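(* Let $S=(S_t)_{t\ge0}$ be a free Brownian motion on a non-commutative probability space $(\mathcal{A},\varphi)$. Let $f\in L^2_s(\mathbb{R}_+^2)$ with $0\leq \mathrm{rank}(f)<\infty$, let $\mu_0\in\mathbb{R}$ and let $A\sim\mathcal{S}(0,\mu_0^2)$ be freely independent of $S$. Assume that $|\mu_0|+\|f\|_{L^2(\mathbb{R}_+^2)}>0$ and set $$Q(x)=x^{2(1+\mathbf{1}_{\{\mu_0\neq 0\}})}\prod_{\lambda\in E(f)}(x-\lambda)^2 .$$ Let $\{F_n\}_{n\geq 1}$ be a sequence of double Wigner integrals with respect to $S$ (i.e. $F_n=I_2^S(f_n)$ with $f_n\in L^2_s(\mathbb{R}_+^2)$). Then, as $n\to\infty$, we have (i) $F_n\overset{\rm law}{\to} A+I_2^S(f)$ if and only if all the following are satisfied: (ii-a) $\widehat{\kappa}_2(F_n)\to \widehat{\kappa}_2(A+I_2^S(f))=\mu_0^2+\|f\|^2_{L^2(\mathbb{R}_+^2)}$; (ii-b) $\displaystyle\sum_{r=3}^{\deg Q} \frac{Q^{(r)}(0)}{r!}\,\widehat{\kappa}_r(F_n) \to \sum_{r=3}^{\deg Q} \frac{Q^{(r)}(0)}{r!}\,\widehat{\kappa}_r(I_2^S(f))$; (ii-c) $\widehat{\kappa}_r(F_n)\to \widehat{\kappa}_r(I_2^S(f))$ for $a(f)$ consecutive values of $r$, with $r\geq 2(1+\mathbf{1}_{\{\mu_0\neq 0\}})$ (i.e. for $r=r_0,r_0+1,\dots,r_0+a(f)-1$ for some integer $r_0\ge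 2(1+\mathbf{1}_{\{\mu_0\neq 0\}})$; the condition is void if $a(f)=0$).
   Context: $L^2_s(\mathbb{R}_+^2)$ denotes the set of real-valued square-integrable functions $f$ on $\mathbb{R}_+^2$ with $f(x,y)=f(y,x)$ a.e. For $f\in L^2_s(\mathbb{R}_+^2)$, $T_f:L^2(\mathbb{R}_+)\to L^2(\mathbb{R}_+)$, $g\mapsto\int_0^\infty f(\cdot,y)g(y)\,dy$, is the associated self-adjoint Hilbert–Schmidt operator; $\mathrm{rank}(f)$ is the rank of $T_f$; $E(f)$ is the set of distinct non-zero eigenvalues of $T_f$; and $a(f)$ is the cardinality of $E(f)$. $(\mathcal{A},\varphi)$ is a tracial non-commutative ($W^*$-)probability space. $\mathcal{S}(0,\sigma^2)$ is the centered semicircular law with variance $\sigma^2$ (the Dirac mass at $0$ if $\sigma=0$). A free Brownian motion $S=(S_t)_{t\ge0}$ is a process of self-adjoint elements starting from $0$, with freely independent increments and $S_t-S_s\sim\mathcal{S}(0,t-s)$ for $t\ge s$. For $f\in L^2_s(\mathbb{R}_+^2)$, $I_2^S(f)$ is the double Wigner integral (in the sense of Biane and Speicher): the unique continuous linear map $L^2_s(\mathbb{R}_+^2)\to L^2(\varphi)$ with $I_2^S(h\otimes h)=\left(\int_0^\infty h(t)\,dS_t\right)^2-\int_0^\infty h^2(t)\,dt$ for $h\in L^2(\mathbb{R}_+)$, where $(h\otimes h)(x,y)=h(x)h(y)$; it satisfies $\varphi(I_2^S(f)^2)=\|f\|^2_{L^2(\mathbb{R}_+^2)}$. $\widehat{\kappa}_r(X)$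 denotes the $r$th free cumulant of a self-adjoint non-commutative random variable $X$. Convergence in law of self-adjoint non-commutative random variables means convergence of all moments. An empty product equals $1$. $A$ may live on an enlargement of $(\mathcal{A},\varphi)$. *)

theory Defs
  imports "HOL-Probability.Probability" "HOL-Computational_Algebra.Polynomial"
begin

section \<open>Bounded operators on a complex Hilbert space\<close>

class scaleC =
  fixes scaleC :: "complex \<Rightarrow> 'a \<Rightarrow> 'a"  (infixr \<open>*\<^sub>C\<close> 75)

text \<open>The inner product is antilinear in its first argument.\<close>

class chilbert_space = banach + scaleC +
  fixes cinner :: "'a \<Rightarrow> 'a \<Rightarrow> complex"
  assumes scaleC_add_right: "c *\<^sub>C (x + y) = c *\<^sub>C x + c *\<^sub>C y"
    and scaleC_add_left: "(c + d) *\<^sub>C x = c *\<^sub>C x + d *\<^sub>C x"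
    and scaleC_scaleC: "c *\<^sub>C d *\<^sub>C x = (c * d) *\<^sub>C x"
    and scaleC_of_real: "complex_of_real r *\<^sub>C x = r *\<^sub>R x"
    and cinner_commute: "cinner x y = cnj (cinner y x)"
    and cinner_add_right: "cinner x (y + z) = cinner x y + cinner x z"
    and cinner_scaleC_right: "cinner x (c *\<^sub>C y) = c * cinner x y"
    and norm_eq_sqrt_cinner: "norm x = sqrt (Re (cinner x x))"

typedef (overloaded) 'h bop =
  "{f :: 'h::chilbert_space \<Rightarrow> 'h. bounded_linear f \<and> (\<forall>c x. f (c *\<^sub>C x) = c *\<^sub>C f x)}"
  morphisms app Bop
  by (rule exI[of _ "\<lambda>x. x"]) (simp add: bounded_linear_ident)

setup_lifting type_definition_bop

lemma bounded_linear_scaleC: "bounded_linear (\<lambda>x::'h::chilbert_space. c *\<^sub>C x)"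
proof (rule bounded_linear_intro[where K = "cmod c"])
  fix x y :: 'h and r :: real
  show "c *\<^sub>C (x + y) = c *\<^sub>C x + c *\<^sub>C y" by (rule scaleC_add_right)
  show "c *\<^sub>C r *\<^sub>R x = r *\<^sub>R c *\<^sub>C x"
    by (metis scaleC_of_real scaleC_scaleC mult.commute)
  have "cinner (c *\<^sub>C x) (c *\<^sub>C x) = (c * cnj c) * cinner x x"
    by (metis cinner_commute cinner_scaleC_right complex_cnj_mult mult.assoc)
  also have "c * cnj c = complex_of_real ((cmod c)\<^sup>2)"
    using complex_norm_square[of c] by simp
  finally have "Re (cinner (c *\<^sub>C x) (c *\<^sub>C x)) = (cmod c)\<^sup>2 * Re (cinner x x)"
    by simp
  then show "norm (c *\<^sub>C x) \<le> norm x * cmod c"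
    by (simp add: norm_eq_sqrt_cinner real_sqrt_mult)
qed

text \<open>Multiplication of operators is composition, so \<open>X ^ k\<close> and \<open>prod_list\<close> have their usual
  meaning.\<close>

instantiation bop :: (chilbert_space) "{ring, monoid_mult, real_vector, scaleC}"
begin

lift_definition zero_bop :: "'a bop" is "\<lambda>_. 0"
  by (metis add_cancel_right_right bounded_linear_zero scaleC_add_right)
lift_definition one_bop :: "'a bop" is "\<lambda>x. x"
  by (simp add: bounded_linear_ident)
lift_definition plus_bop :: "'a bop \<Rightarrow> 'a bop \<Rightarrow> 'a bop" is "\<lambda>f g x. f x + g x"
  by (simp add: bounded_linear_add scaleC_add_right)
lift_definition scaleC_bop :: "complex \<Rightarrow> 'a bop \<Rightarrow> 'a bop" is "\<lambda>c f x. c *\<^sub>C f x"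
  by (auto intro: bounded_linear_compose[OF bounded_linear_scaleC]
      simp: scaleC_scaleC mult.commute)
lift_definition scaleR_bop :: "real \<Rightarrow> 'a bop \<Rightarrow> 'a bop" is "\<lambda>r f x. r *\<^sub>R f x"
  by (auto intro: bounded_linear_const_scaleR)
     (simp flip: scaleC_of_real add: scaleC_scaleC mult.commute)
definition uminus_bop :: "'a bop \<Rightarrow> 'a bop" where "uminus_bop X = (-1) *\<^sub>R X"
definition minus_bop :: "'a bop \<Rightarrow> 'a bop \<Rightarrow> 'a bop" where "minus_bop X Y = X + - Y"
lift_definition times_bop :: "'a bop \<Rightarrow> 'a bop \<Rightarrow> 'a bop" is "\<lambda>f g x. f (g x)"
  by (simp add: bounded_linear_compose)

instance
proof
  fix X Y Z :: "'a bop" and a b :: real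
  show "X + Y + Z = X + (Y + Z)" by transfer (simp add: add.assoc)
  show "X + Y = Y + X" by transfer (simp add: add.commute)
  show "0 + X = X" by transfer simp
  show "- X + X = 0" unfolding uminus_bop_def by transfer simp
  show "X - Y = X + - Y" by (rule minus_bop_def)
  show "X * Y * Z = X * (Y * Z)" by transfer simp
  show "(X + Y) * Z = X * Z + Y * Z" by transfer simp
  show "X * (Y + Z) = X * Y + X * Z"
    by transfer (simp add: linear_simps)
  show "1 * X = X" by transfer simp
  show "X * 1 = X" by transfer simp
  show "a *\<^sub>R (X + Y) = a *\<^sub>R X + a *\<^sub>R Y" by transfer (simp add: scaleR_add_right)
  show "(a + b) *\<^sub>R X = a *\<^sub>R X + b *\<^sub>R X" by transfer (simp add: scaleR_add_left)
  show "a *\<^sub>R b *\<^sub>R X = (a * b) *\<^sub>R X" by transfer simp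
  show "1 *\<^sub>R X = X" by transfer simp
qed

end

definition adj :: "'h::chilbert_space bop \<Rightarrow> 'h bop" where
  "adj X = (THE Y. \<forall>x y. cinner (app Y x) y = cinner x (app X y))"


section \<open>Tracial W*-probability spaces\<close>

text \<open>A von Neumann algebra is a unital *-subalgebra of the bounded operators that is closed in
  the weak operator topology; the last conjunct is this closedness.\<close>

definition von_neumann_algebra :: "'h::chilbert_space bop set \<Rightarrow> bool" where
  "von_neumann_algebra M \<longleftrightarrow>
     1 \<in> M \<and>
     (\<forall>X\<in>M. \<forall>Y\<in>M. X + Y \<in> M \<and> X * Y \<in> M) \<and>
     (\<forall>c. \<forall>X\<in>M. c *\<^sub>C X \<in> M) \<and>
     (\<forall>X\<in>M. adj X \<in> M) \<and>
     (\<forall>T. (\<forall>V. finite V \<longrightarrow> (\<forall>\<epsilon>>0. \<exists>X\<in>M. \<forall>(x, y)\<in>V. cmod (cinner x (app (X - T) y)) < \<epsilon>))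
        \<longrightarrow> T \<in> M)"

text \<open>\<open>\<phi>\<close> is only relevant on \<open>M\<close>. The last conjunct says that it is normal, i.e. ultraweakly
  continuous.\<close>

definition tracial_W_probability_space ::
    "'h::chilbert_space bop set \<Rightarrow> ('h bop \<Rightarrow> complex) \<Rightarrow> bool" where
  "tracial_W_probability_space M \<phi> \<longleftrightarrow>
     von_neumann_algebra M \<and>
     (\<forall>X\<in>M. \<forall>Y\<in>M. \<phi> (X + Y) = \<phi> X + \<phi> Y) \<and>
     (\<forall>c. \<forall>X\<in>M. \<phi> (c *\<^sub>C X) = c * \<phi> X) \<and>
     \<phi> 1 = 1 \<and>
     (\<forall>X\<in>M. \<phi> (adj X * X) \<in> \<real> \<and> 0 \<le> Re (\<phi> (adj X * X))) \<and>
     (\<forall>X\<in>M. \<phi> (adj X * X) = 0 \<longrightarrow> X = 0) \<and>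
     (\<forall>X\<in>M. \<forall>Y\<in>M. \<phi> (X * Y) = \<phi> (Y * X)) \<and>
     (\<exists>\<xi> \<eta> :: nat \<Rightarrow> 'h. summable (\<lambda>k. (norm (\<xi> k))\<^sup>2) \<and> summable (\<lambda>k. (norm (\<eta> k))\<^sup>2) \<and>
        (\<forall>X\<in>M. (\<lambda>k. cinner (\<xi> k) (app X (\<eta> k))) sums \<phi> X))"

text \<open>\<open>(N, \<psi>)\<close> enlarges \<open>(M, \<phi>)\<close> by means of a trace-preserving unital *-homomorphism \<open>\<iota>\<close>
  (automatically injective, as \<open>\<phi>\<close> is faithful).\<close>

definition enlargement ::
    "'h::chilbert_space bop set \<Rightarrow> ('h bop \<Rightarrow> complex) \<Rightarrow>
     'k::chilbert_space bop set \<Rightarrow> ('k bop \<Rightarrow> complex) \<Rightarrow> ('h bop \<Rightarrow> 'k bop) \<Rightarrow> bool" where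
  "enlargement M \<phi> N \<psi> \<iota> \<longleftrightarrow>
     tracial_W_probability_space N \<psi> \<and>
     \<iota> ` M \<subseteq> N \<and> \<iota> 1 = 1 \<and>
     (\<forall>X\<in>M. \<forall>Y\<in>M. \<iota> (X + Y) = \<iota> X + \<iota> Y \<and> \<iota> (X * Y) = \<iota> X * \<iota> Y) \<and>
     (\<forall>c. \<forall>X\<in>M. \<iota> (c *\<^sub>C X) = c *\<^sub>C \<iota> X) \<and>
     (\<forall>X\<in>M. \<iota> (adj X) = adj (\<iota> X)) \<and>
     (\<forall>X\<in>M. \<psi> (\<iota> X) = \<phi> X)"

definition L2_norm_state :: "('h::chilbert_space bop \<Rightarrow> complex) \<Rightarrow> 'h bop \<Rightarrow> real" where
  "L2_norm_state \<phi> X = sqrt (Re (\<phi> (adj X * X)))"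

inductive_set star_algebra_generated :: "'h::chilbert_space bop set \<Rightarrow> 'h bop set"
  for G :: "'h bop set" where
  one: "1 \<in> star_algebra_generated G"
| generator: "X \<in> G \<Longrightarrow> X \<in> star_algebra_generated G"
| adj: "X \<in> star_algebra_generated G \<Longrightarrow> adj X \<in> star_algebra_generated G"
| scaleC: "X \<in> star_algebra_generated G \<Longrightarrow> c *\<^sub>C X \<in> star_algebra_generated G"
| add: "X \<in> star_algebra_generated G \<Longrightarrow> Y \<in> star_algebra_generated G \<Longrightarrow>
    X + Y \<in> star_algebra_generated G"
| mult: "X \<in> star_algebra_generated G \<Longrightarrow> Y \<in> star_algebra_generated G \<Longrightarrow>
    X * Y \<in> star_algebra_generated G"

text \<open>Free independence of the families \<open>G j\<close>, \<open>j \<in> J\<close>: every alternating product of centred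
  elements of the generated unital *-algebras is centred.\<close>

definition freely_independent ::
    "('h::chilbert_space bop \<Rightarrow> complex) \<Rightarrow> 'j set \<Rightarrow> ('j \<Rightarrow> 'h bop set) \<Rightarrow> bool" where
  "freely_independent \<phi> J G \<longleftrightarrow>
     (\<forall>js Xs. Xs \<noteq> [] \<and> length js = length Xs \<and> set js \<subseteq> J \<and>
        (\<forall>i<length Xs. Xs ! i \<in> star_algebra_generated (G (js ! i)) \<and> \<phi> (Xs ! i) = 0) \<and>
        (\<forall>i. Suc i < length Xs \<longrightarrow> js ! i \<noteq> js ! Suc i)
        \<longrightarrow> \<phi> (prod_list Xs) = 0)"

definition converges_in_law ::
    "('h::chilbert_space bop \<Rightarrow> complex) \<Rightarrow> (nat \<Rightarrow> 'h bop) \<Rightarrow>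
     ('k::chilbert_space bop \<Rightarrow> complex) \<Rightarrow> 'k bop \<Rightarrow> bool" where
  "converges_in_law \<phi> F \<psi> X \<longleftrightarrow> (\<forall>k. (\<lambda>n. \<phi> (F n ^ k)) \<longlonglongrightarrow> \<psi> (X ^ k))"


section \<open>Free cumulants\<close>

definition noncrossing_partitions :: "nat \<Rightarrow> nat set set set" where
  "noncrossing_partitions n =
     {\<pi>. partition_on {..<n} \<pi> \<and>
       (\<forall>V\<in>\<pi>. \<forall>W\<in>\<pi>. \<forall>a b c d. a < b \<and> b < c \<and> c < d \<and> a \<in> V \<and> c \<in> V \<and> b \<in> W \<and> d \<in> W
          \<longrightarrow> V = W)}"

text \<open>The moment-cumulant formula, solved for the cumulant of the one-block partition. All other
  partitions only have blocks with fewer than \<open>n\<close> elements, so the conditional merely serves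
  termination.\<close>

function free_cumulant_of_moments :: "(nat \<Rightarrow> 'c::comm_ring_1) \<Rightarrow> nat \<Rightarrow> 'c" where
  "free_cumulant_of_moments m n =
     m n - (\<Sum>\<pi>\<in>noncrossing_partitions n - {{{..<n}}}.
              \<Prod>V\<in>\<pi>. if card V < n then free_cumulant_of_moments m (card V) else 0)"
  by pat_completeness auto
termination by (relation "Wellfounded.measure snd") auto

declare free_cumulant_of_moments.simps [simp del]

lemma moment_cumulant_formula:
  assumes "0 < n"
  shows "m n = (\<Sum>\<pi>\<in>noncrossing_partitions n. \<Prod>V\<in>\<pi>. free_cumulant_of_moments m (card V))"
proof -
  let ?NC = "noncrossing_partitions n"
  have fin: "finite ?NC"
    by (rule finite_subset[of _ "Pow (Pow {..<n})"])
       (auto simp: noncrossing_partitions_def partition_on_def)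
  have top: "{{..<n}} \<in> ?NC"
    using assms by (auto simp: noncrossing_partitions_def partition_on_def disjoint_def)
  have small: "card V < n" if "\<pi> \<in> ?NC - {{{..<n}}}" "V \<in> \<pi>" for \<pi> V
  proof -
    have p: "partition_on {..<n} \<pi>" using that by (simp add: noncrossing_partitions_def)
    have sub: "V \<subseteq> {..<n}" using p that(2) by (auto simp: partition_on_def)
    have "V \<noteq> {..<n}"
    proof
      assume V: "V = {..<n}"
      have "W = V" if "W \<in> \<pi>" for W
      proof (rule ccontr)
        assume "W \<noteq> V"
        then have "W \<inter> V = {}"
          using p \<open>V \<in> \<pi>\<close> that by (auto simp: partition_on_def disjoint_def)
        moreover have "W \<subseteq> V" "W \<noteq> {}" using p that V by (auto simp: partition_on_def)
        ultimately show False by blast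
      qed
      then have "\<pi> = {{..<n}}" using V \<open>V \<in> \<pi>\<close> by blast
      with that show False by simp
    qed
    with sub have "V \<subset> {..<n}" by blast
    from psubset_card_mono[OF _ this] show ?thesis by simp
  qed
  have "(\<Sum>\<pi>\<in>?NC. \<Prod>V\<in>\<pi>. free_cumulant_of_moments m (card V)) =
      free_cumulant_of_moments m n +
      (\<Sum>\<pi>\<in>?NC - {{{..<n}}}. \<Prod>V\<in>\<pi>. free_cumulant_of_moments m (card V))"
    by (subst sum.remove[OF fin top]) simp
  also have "(\<Sum>\<pi>\<in>?NC - {{{..<n}}}. \<Prod>V\<in>\<pi>. free_cumulant_of_moments m (card V)) =
      (\<Sum>\<pi>\<in>?NC - {{{..<n}}}.
         \<Prod>V\<in>\<pi>. if card V < n then free_cumulant_of_moments m (card V) else 0)"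
    by (intro sum.cong prod.cong refl) (simp add: small)
  finally show ?thesis
    by (simp add: free_cumulant_of_moments.simps[of m n])
qed

definition free_cumulant ::
    "('h::chilbert_space bop \<Rightarrow> complex) \<Rightarrow> nat \<Rightarrow> 'h bop \<Rightarrow> complex" where
  "free_cumulant \<phi> r X = free_cumulant_of_moments (\<lambda>k. \<phi> (X ^ k)) r"


section \<open>Square-integrable kernels\<close>

text \<open>Elements of \<open>L\<^sup>2\<close> are represented by square-integrable functions; values outside
  \<open>\<real>\<^sub>+\<close> are irrelevant.\<close>

definition half_line :: "real measure" where
  "half_line = restrict_space lborel {0..}"

definition square_integrable :: "'a measure \<Rightarrow> ('a \<Rightarrow> real) set" where
  "square_integrable \<mu> = {f \<in> borel_measurable \<mu>. integrable \<mu> (\<lambda>x. (f x)\<^sup>2)}"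

definition L2_norm_measure :: "'a measure \<Rightarrow> ('a \<Rightarrow> real) \<Rightarrow> real" where
  "L2_norm_measure \<mu> f = sqrt (\<integral>x. (f x)\<^sup>2 \<partial>\<mu>)"

definition symmetric_kernels :: "(real \<times> real \<Rightarrow> real) set" where
  "symmetric_kernels = {f \<in> square_integrable (half_line \<Otimes>\<^sub>M half_line).
     AE (x, y) in half_line \<Otimes>\<^sub>M half_line. f (x, y) = f (y, x)}"

definition kernel_operator :: "(real \<times> real \<Rightarrow> real) \<Rightarrow> (real \<Rightarrow> real) \<Rightarrow> real \<Rightarrow> real" where
  "kernel_operator f g = (\<lambda>x. \<integral>y. f (x, y) * g y \<partial>half_line)"

text \<open>The dimension of the range of the kernel operator (modulo null functions), as the least
  cardinality of a finite family spanning it; \<open>\<infinity>\<close> if there is none.\<close>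

definition kernel_rank :: "(real \<times> real \<Rightarrow> real) \<Rightarrow> enat" where
  "kernel_rank f =
     (INF B\<in>{B. finite B \<and> B \<subseteq> square_integrable half_line \<and>
                (\<forall>g\<in>square_integrable half_line. \<exists>c.
                   AE x in half_line. kernel_operator f g x = (\<Sum>b\<in>B. c b * b x))}.
        enat (card B))"

definition nonzero_eigenvalues :: "(real \<times> real \<Rightarrow> real) \<Rightarrow> real set" where
  "nonzero_eigenvalues f =
     {l. l \<noteq> 0 \<and>
        (\<exists>g\<in>square_integrable half_line.
           \<not> (AE x in half_line. g x = 0) \<and>
           (AE x in half_line. kernel_operator f g x = l * g x))}"


section \<open>Free Brownian motion and Wigner integrals\<close>

definition semicircle_law :: "real \<Rightarrow> real measure" where
  "semicircle_law v =
     (if v = 0 then return borel 0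
      else density lborel
        (\<lambda>x. ennreal (indicator {- 2 * sqrt v..2 * sqrt v} x * sqrt (4 * v - x\<^sup>2) / (2 * pi * v))))"

definition semicircular ::
    "'h::chilbert_space bop set \<Rightarrow> ('h bop \<Rightarrow> complex) \<Rightarrow> real \<Rightarrow> 'h bop \<Rightarrow> bool" where
  "semicircular M \<phi> v X \<longleftrightarrow> X \<in> M \<and> adj X = X \<and>
     (\<forall>k. \<phi> (X ^ k) = complex_of_real (\<integral>x. x ^ k \<partial>semicircle_law v))"

definition free_Brownian_motion ::
    "'h::chilbert_space bop set \<Rightarrow> ('h bop \<Rightarrow> complex) \<Rightarrow> (real \<Rightarrow> 'h bop) \<Rightarrow> bool" where
  "free_Brownian_motion M \<phi> S \<longleftrightarrow>
     (\<forall>t\<ge>0. S t \<in> M \<and> adj (S t) = S t) \<and>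
     S 0 = 0 \<and>
     (\<forall>s t. 0 \<le> s \<and> s \<le> t \<longrightarrow> semicircular M \<phi> (t - s) (S t - S s)) \<and>
     (\<forall>ts. sorted_wrt (<) ts \<and> set ts \<subseteq> {0..} \<longrightarrow>
        freely_independent \<phi> {..<length ts - 1} (\<lambda>i. {S (ts ! Suc i) - S (ts ! i)}))"

text \<open>Continuous linear maps from a space \<open>D\<close> of square-integrable functions to \<open>L\<^sup>2(\<phi>)\<close>. Only maps
  with values in \<open>M\<close> are considered, so that no completion of \<open>M\<close> is needed and products of values
  make sense: by the Haagerup-type inequality of Biane and Speicher,
  \<open>\<parallel>I\<^sub>n(f)\<parallel> \<le> (n + 1) \<parallel>f\<parallel>\<close> in operator norm, Wigner integrals are bounded operators.\<close>

definition continuous_linear_L2 ::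
    "'h::chilbert_space bop set \<Rightarrow> ('h bop \<Rightarrow> complex) \<Rightarrow>
     'a measure \<Rightarrow> ('a \<Rightarrow> real) set \<Rightarrow> (('a \<Rightarrow> real) \<Rightarrow> 'h bop) \<Rightarrow> bool" where
  "continuous_linear_L2 M \<phi> \<mu> D L \<longleftrightarrow>
     (\<forall>f\<in>D. L f \<in> M) \<and>
     (\<forall>f\<in>D. \<forall>g\<in>D. L (\<lambda>x. f x + g x) = L f + L g) \<and>
     (\<forall>c. \<forall>f\<in>D. L (\<lambda>x. c * f x) = c *\<^sub>R L f) \<and>
     (\<exists>C. \<forall>f\<in>D. L2_norm_state \<phi> (L f) \<le> C * L2_norm_measure \<mu> f)"

definition wigner_integral ::
    "'h::chilbert_space bop set \<Rightarrow> ('h bop \<Rightarrow> complex) \<Rightarrow> (real \<Rightarrow> 'h bop) \<Rightarrow>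
     ((real \<Rightarrow> real) \<Rightarrow> 'h bop) \<Rightarrow> bool" where
  "wigner_integral M \<phi> S W \<longleftrightarrow>
     continuous_linear_L2 M \<phi> half_line (square_integrable half_line) W \<and>
     (\<forall>s t. 0 \<le> s \<and> s \<le> t \<longrightarrow> W (indicator {s..<t}) = S t - S s)"

definition double_wigner_integral ::
    "'h::chilbert_space bop set \<Rightarrow> ('h bop \<Rightarrow> complex) \<Rightarrow> (real \<Rightarrow> 'h bop) \<Rightarrow>
     ((real \<times> real \<Rightarrow> real) \<Rightarrow> 'h bop) \<Rightarrow> bool" where
  "double_wigner_integral M \<phi> S I \<longleftrightarrow>
     continuous_linear_L2 M \<phi> (half_line \<Otimes>\<^sub>M half_line) symmetric_kernels I \<and>
     (\<exists>W. wigner_integral M \<phi> S W \<and>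
        (\<forall>h\<in>square_integrable half_line.
           I (\<lambda>(x, y). h x * h y) = (W h)\<^sup>2 - (\<integral>t. (h t)\<^sup>2 \<partial>half_line) *\<^sub>R 1))"


section \<open>The polynomial associated with the limit\<close>

definition limit_polynomial :: "real \<Rightarrow> (real \<times> real \<Rightarrow> real) \<Rightarrow> real poly" where
  "limit_polynomial \<mu>\<^sub>0 f =
     [:0, 1:] ^ (2 * (1 + of_bool (\<mu>\<^sub>0 \<noteq> 0))) * (\<Prod>l\<in>nonzero_eigenvalues f. [:- l, 1:]\<^sup>2)"

end

theory Submission
  imports Defs "HOL-Computational_Algebra.Formal_Power_Series"
    "HOL-Computational_Algebra.Fundamental_Theorem_Algebra"
begin

text \<open>For \<open>r \<ge> 2\<close> the free cumulant of order \<open>r\<close> of a double Wigner integral is the trace of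
  \<open>T\<^sub>f ^ r\<close>: for a step kernel the integral is a quadratic form in free semicircular elements, whose
  moments are computed by Wick products, and step kernels are dense. Adding \<open>A\<close> only
  changes the second cumulant.

  Let \<open>P(x) = x ^ m \<Prod> (x - \<lambda>)\<close> with \<open>\<lambda>\<close> ranging over the nonzero eigenvalues of \<open>T\<^sub>f\<close>
  and \<open>m \<in> {1, 2}\<close>, so that \<open>Q = P ^ 2\<close>, and let \<open>L\<^sub>n\<close> be the functional mapping \<open>x ^ r\<close>
  to the trace of the \<open>r\<close>th power of the operator of \<open>f\<^sub>n\<close>. As \<open>P\<close> annihilates \<open>T\<^sub>f\<close>, the first two
  conditions amount to \<open>L\<^sub>n(P ^ 2) \<rightarrow> 0\<close>, and the Cauchy-Schwarz inequality for the Hilbert-Schmidt inner product gives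
  \<open>L\<^sub>n(x ^ s P) ^ 2 \<le> L\<^sub>n(x ^ (2 s)) L\<^sub>n(P ^ 2) \<rightarrow> 0\<close>. Thus the differences of the cumulants of \<open>F\<^sub>n\<close> and
  those of the limit satisfy asymptotically a linear recurrence of order \<open>a(f)\<close> with nonzero extreme
  coefficients, and convergence at \<open>a(f)\<close> consecutive indices spreads to all indices in both
  directions.\<close>

section \<open>Non-crossing partitions and moments\<close>

text \<open>The orders 0 and 1 are out of reach: a Hilbert-Schmidt operator need not have a trace,
  and the first cumulant is 0. Hence every polynomial to which the trace functional of a kernel is
  applied is kept divisible by x ^ 2. The choice of m reflects the only discrepancy between the two
  sides: for nonzero \<open>\<mu>\<^sub>0\<close> the second cumulants do not tend to the trace of
  the square but exceed it by \<open>\<mu>\<^sub>0\<^sup>2\<close>, so Q must start at x ^ 4; for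
  \<open>\<mu>\<^sub>0 = 0\<close> the first condition supplies the quadratic term.

  No spectral theory of operators on L2 is developed. Positivity and Cauchy-Schwarz are those of
  symmetric matrices and pass to the limit along step kernels; only \<open>f\<close>, of finite
  rank, is itself turned into a matrix, and annihilating polynomials replace diagonalisation.

  The obstacle is to extract cumulants from moments. Noncrossing partitions satisfy a triangular
  system of power series that determines the cumulants; the Schwinger-Dyson equations of the Wick
  calculus produce a solution of the same system whose entries are traces.\<close>

definition noncrossing :: "nat set set \<Rightarrow> bool" where
  "noncrossing \<pi> \<longleftrightarrow> (\<forall>V\<in>\<pi>. \<forall>W\<in>\<pi>. \<forall>a b c d.
     a < b \<and> b < c \<and> c < d \<and> a \<in> V \<and> c \<in> V \<and> b \<in> W \<and> d \<in> W \<longrightarrow> V = W)"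

lemma noncrossingD:
  "noncrossing \<pi> \<Longrightarrow> V \<in> \<pi> \<Longrightarrow> W \<in> \<pi> \<Longrightarrow> a < b \<Longrightarrow> b < c \<Longrightarrow> c < d \<Longrightarrow>
    a \<in> V \<Longrightarrow> c \<in> V \<Longrightarrow> b \<in> W \<Longrightarrow> d \<in> W \<Longrightarrow> V = W"
  unfolding noncrossing_def by blast

text \<open>Both end points are free because the recursion below cuts a partition into pieces, one
  of which starts in the middle of the original interval.\<close>

definition interval_nc :: "nat \<Rightarrow> nat \<Rightarrow> nat set set set" where
  "interval_nc a b = {\<pi>. partition_on {a..<b} \<pi> \<and> noncrossing \<pi>}"

lemma noncrossing_partitions_eq: "noncrossing_partitions n = interval_nc 0 n"
  by (simp add: noncrossing_partitions_def interval_nc_def noncrossing_def atLeast0LessThan)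

lemma finite_interval_nc [simp]: "finite (interval_nc a b)"
  by (rule finite_subset[of _ "Pow (Pow {a..<b})"])
     (auto simp: interval_nc_def partition_on_def)

lemma interval_nc_finite: "\<pi> \<in> interval_nc a b \<Longrightarrow> finite \<pi>"
  by (rule finite_subset[of _ "Pow {a..<b}"])
     (auto simp: interval_nc_def partition_on_def)

lemma interval_nc_block:
  assumes "\<pi> \<in> interval_nc a b" "V \<in> \<pi>"
  shows "V \<subseteq> {a..<b}" "V \<noteq> {}" "finite V"
  using assms by (auto simp: interval_nc_def partition_on_def intro: finite_subset[of _ "{a..<b}"])

lemma interval_nc_unique:
  assumes "\<pi> \<in> interval_nc a b" "V \<in> \<pi>" "W \<in> \<pi>" "x \<in> V" "x \<in> W"
  shows "V = W"
  using assms by (auto simp: interval_nc_def partition_on_def disjoint_def)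

lemma interval_nc_ex:
  assumes "\<pi> \<in> interval_nc a b" "a \<le> x" "x < b"
  obtains V where "V \<in> \<pi>" "x \<in> V"
proof -
  have "x \<in> \<Union>\<pi>" using assms by (auto simp: interval_nc_def partition_on_def)
  then show ?thesis using that by auto
qed

lemma interval_ncI:
  assumes "\<And>V. V \<in> \<pi> \<Longrightarrow> V \<subseteq> {a..<b}" "\<And>V. V \<in> \<pi> \<Longrightarrow> V \<noteq> {}"
    "\<And>x. a \<le> x \<Longrightarrow> x < b \<Longrightarrow> \<exists>V\<in>\<pi>. x \<in> V"
    "\<And>V W x. V \<in> \<pi> \<Longrightarrow> W \<in> \<pi> \<Longrightarrow> x \<in> V \<Longrightarrow> x \<in> W \<Longrightarrow> V = W"
    "\<And>V W x y z w. V \<in> \<pi> \<Longrightarrow> W \<in> \<pi> \<Longrightarrow> x < y \<Longrightarrow> y < z \<Longrightarrow> z < w \<Longrightarrow>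
      x \<in> V \<Longrightarrow> z \<in> V \<Longrightarrow> y \<in> W \<Longrightarrow> w \<in> W \<Longrightarrow> V = W"
  shows "\<pi> \<in> interval_nc a b"
proof -
  have "\<Union>\<pi> = {a..<b}" using assms(1,3) by fastforce
  moreover have "disjoint \<pi>" using assms(4) unfolding disjoint_def by blast
  moreover have "noncrossing \<pi>" unfolding noncrossing_def using assms(5) by blast
  ultimately show ?thesis using assms(2) by (auto simp: interval_nc_def partition_on_def)
qed

text \<open>The block of the first element \<open>a\<close> is weighted as if it had \<open>s\<close> additional elements.\<close>

definition nc_sum :: "(nat \<Rightarrow> 'c::comm_ring_1) \<Rightarrow> nat \<Rightarrow> nat \<Rightarrow> nat \<Rightarrow> 'c" where
  "nc_sum k s a b =
     (\<Sum>\<pi>\<in>interval_nc a b. \<Prod>V\<in>\<pi>. k (card V + (if a \<in> V then s else 0)))"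

text \<open>If the block of \<open>a\<close> continues at \<open>i\<close>, noncrossing forbids any
  block from linking the gap between them with the rest. The partition then decouples into one of
  the gap and one starting at \<open>i\<close>, to which \<open>a\<close> is added.\<close>

definition glue :: "nat \<Rightarrow> nat \<Rightarrow> nat set set \<times> nat set set \<Rightarrow> nat set set" where
  "glue a i = (\<lambda>(\<sigma>, \<rho>). \<sigma> \<union> (\<lambda>V. if i \<in> V then insert a V else V) ` \<rho>)"

definition second_is :: "nat \<Rightarrow> nat \<Rightarrow> nat set set \<Rightarrow> bool" where
  "second_is a i \<pi> \<longleftrightarrow> (\<exists>V\<in>\<pi>. a \<in> V \<and> i \<in> V \<and> (\<forall>j. a < j \<and> j < i \<longrightarrow> j \<notin> V))"

text \<open>Only the new point \<open>a\<close> could cause a crossing. As the minimum it can only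
  be the first of the four points, and then \<open>i\<close>, which lies in the same block, may take
  its place: the remaining points are at least \<open>i\<close>, and if the second one equals
  \<open>i\<close> the two blocks meet anyway.\<close>

lemma glue_in:
  assumes "a < i" "i < b" and \<sigma>: "\<sigma> \<in> interval_nc (Suc a) i" and \<rho>: "\<rho> \<in> interval_nc i b"
  shows "glue a i (\<sigma>, \<rho>) \<in> interval_nc a b" "second_is a i (glue a i (\<sigma>, \<rho>))"
proof -
  define h where "h V = (if i \<in> V then insert a V else V)" for V :: "nat set"
  have g: "glue a i (\<sigma>, \<rho>) = \<sigma> \<union> h ` \<rho>" by (auto simp: glue_def h_def)
  have s: "x \<in> V \<Longrightarrow> a < x \<and> x < i" if "V \<in> \<sigma>" for V x
    using interval_nc_block[OF \<sigma> that] by auto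
  have r: "x \<in> V \<Longrightarrow> i \<le> x \<and> x < b" if "V \<in> \<rho>" for V x
    using interval_nc_block[OF \<rho> that] by auto
  have hm: "x \<in> h V \<longleftrightarrow> x \<in> V \<or> (x = a \<and> i \<in> V)" for x V by (auto simp: h_def)
  have ncs: "noncrossing \<sigma>" and ncr: "noncrossing \<rho>" using \<sigma> \<rho> by (auto simp: interval_nc_def)
  show "glue a i (\<sigma>, \<rho>) \<in> interval_nc a b"
    unfolding g
  proof (rule interval_ncI)
    fix V assume "V \<in> \<sigma> \<union> h ` \<rho>"
    then show "V \<subseteq> {a..<b}"
      using s r assms(1,2) by (fastforce simp: hm)
  next
    fix V assume "V \<in> \<sigma> \<union> h ` \<rho>"
    then show "V \<noteq> {}"
      using interval_nc_block(2)[OF \<sigma>] interval_nc_block(2)[OF \<rho>] by (auto simp: h_def)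
  next
    fix x assume x: "a \<le> x" "x < b"
    consider "x = a" | "a < x" "x < i" | "i \<le> x" using x by linarith
    then show "\<exists>V\<in>\<sigma> \<union> h ` \<rho>. x \<in> V"
    proof cases
      case 1
      obtain V where "V \<in> \<rho>" "i \<in> V" by (rule interval_nc_ex[OF \<rho>, of i]) (use assms in auto)
      then have "h V \<in> \<sigma> \<union> h ` \<rho>" "x \<in> h V" using 1 by (auto simp: hm)
      then show ?thesis by blast
    next
      case 2
      obtain V where "V \<in> \<sigma>" "x \<in> V" by (rule interval_nc_ex[OF \<sigma>, of x]) (use 2 in auto)
      then show ?thesis by auto
    next
      case 3
      obtain V where "V \<in> \<rho>" "x \<in> V" by (rule interval_nc_ex[OF \<rho>, of x]) (use 3 x in auto)
      then have "h V \<in> \<sigma> \<union> h ` \<rho>" "x \<in> h V" by (auto simp: hm)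
      then show ?thesis by blast
    qed
  next
    fix V W x assume VW: "V \<in> \<sigma> \<union> h ` \<rho>" "W \<in> \<sigma> \<union> h ` \<rho>" "x \<in> V" "x \<in> W"
    show "V = W"
    proof (cases "V \<in> \<sigma>")
      case True
      then have "a < x" "x < i" using s VW by auto
      then have "W \<in> \<sigma>" using VW r by (fastforce simp: hm)
      then show ?thesis using True VW interval_nc_unique[OF \<sigma>] by auto
    next
      case False
      then obtain V' where V': "V' \<in> \<rho>" "V = h V'" using VW by auto
      then have "x = a \<and> i \<in> V' \<or> x \<in> V'" "\<not> (a < x \<and> x < i)"
        using VW V' r[OF V'(1), of x] by (auto simp: hm)
      then have "W \<notin> \<sigma>" using s[of W x] VW V' r[of V' x] by fastforce
      then obtain W' where W': "W' \<in> \<rho>" "W = h W'" using VW by auto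
      have "\<exists>y. y \<in> V' \<and> y \<in> W'"
      proof (cases "x = a")
        case True
        then show ?thesis using V' W' VW r assms(1) by (force simp: hm)
      next
        case False
        then show ?thesis using V' W' VW by (auto simp: hm)
      qed
      then show ?thesis using interval_nc_unique[OF \<rho> V'(1) W'(1)] V' W' by auto
    qed
  next
    fix V W x y z w
    assume VW: "V \<in> \<sigma> \<union> h ` \<rho>" "W \<in> \<sigma> \<union> h ` \<rho>" and o: "x < y" "y < z" "z < w"
      and m: "x \<in> V" "z \<in> V" "y \<in> W" "w \<in> W"
    have lb: "a \<le> u" if "U \<in> \<sigma> \<union> h ` \<rho>" "u \<in> U" for u U
      using that s r assms(1) by (fastforce simp: hm)
    have ya: "a < y" using lb[OF VW(1) m(1)] o by simp
    show "V = W"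
    proof (cases "V \<in> \<sigma>")
      case True
      then have "z < i" using s m by auto
      then have "y < i" using o by simp
      then have "W \<in> \<sigma>" using VW(2) m(3) r ya by (fastforce simp: hm)
      then show ?thesis using noncrossingD[OF ncs True _ o m] by auto
    next
      case False
      then obtain V' where V': "V' \<in> \<rho>" "V = h V'" using VW by auto
      have z: "z \<in> V'" "i \<le> z" using m(2) V' ya o r by (auto simp: hm)
      then have "W \<notin> \<sigma>" using m(4) o s by fastforce
      then obtain W' where W': "W' \<in> \<rho>" "W = h W'" using VW by auto
      have yw: "y \<in> W'" "w \<in> W'" using m W' ya o by (auto simp: hm)
      have "V' = W'"
      proof (cases "x = a")
        case True
        then have i: "i \<in> V'" using m(1) V' r assms(1) by (force simp: hm)
        show ?thesis
        proof (cases "y = i")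
          case True
          then show ?thesis using i yw interval_nc_unique[OF \<rho> V'(1) W'(1)] by auto
        next
          case False
          then have "i < y" using r[OF W'(1) yw(1)] by auto
          then show ?thesis using noncrossingD[OF ncr V'(1) W'(1) _ o(2,3) i z(1) yw] by auto
        qed
      next
        case False
        then have "x \<in> V'" using m V' by (auto simp: hm)
        then show ?thesis using noncrossingD[OF ncr V'(1) W'(1) o _ z(1) yw] by auto
      qed
      then show ?thesis using V' W' by simp
    qed
  qed
  obtain V where V: "V \<in> \<rho>" "i \<in> V" by (rule interval_nc_ex[OF \<rho>, of i]) (use assms in auto)
  then have "h V \<in> glue a i (\<sigma>, \<rho>)" "a \<in> h V" "i \<in> h V" "\<forall>j. a < j \<and> j < i \<longrightarrow> j \<notin> h V"
    using r[OF V(1)] by (fastforce simp: g hm)+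
  then show "second_is a i (glue a i (\<sigma>, \<rho>))" unfolding second_is_def by blast
qed

lemma glue_bij:
  assumes ai: "a < i" "i < b"
  shows "bij_betw (glue a i) (interval_nc (Suc a) i \<times> interval_nc i b)
    {\<pi>\<in>interval_nc a b. second_is a i \<pi>}"
proof (rule bij_betw_byWitness[where
      f' = "\<lambda>\<pi>. ({V\<in>\<pi>. V \<subseteq> {Suc a..<i}}, (\<lambda>V. V - {a}) ` {V\<in>\<pi>. \<not> V \<subseteq> {Suc a..<i}})"])
  show "\<forall>p\<in>interval_nc (Suc a) i \<times> interval_nc i b.
      (\<lambda>\<pi>. ({V\<in>\<pi>. V \<subseteq> {Suc a..<i}}, (\<lambda>V. V - {a}) ` {V\<in>\<pi>. \<not> V \<subseteq> {Suc a..<i}})) (glue a i p) = p"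
  proof
    fix p assume p: "p \<in> interval_nc (Suc a) i \<times> interval_nc i b"
    obtain \<sigma> \<rho> where ps: "p = (\<sigma>, \<rho>)" by (cases p)
    have 1: "\<sigma> \<in> interval_nc (Suc a) i" "\<rho> \<in> interval_nc i b" using p ps by auto
    define h where "h V = (if i \<in> V then insert a V else V)" for V :: "nat set"
    have g: "glue a i (\<sigma>, \<rho>) = \<sigma> \<union> h ` \<rho>" by (auto simp: glue_def h_def)
    have s: "V \<subseteq> {Suc a..<i}" if "V \<in> \<sigma>" for V
      using interval_nc_block[OF 1(1) that] by auto
    have nr: "\<not> h V \<subseteq> {Suc a..<i}" "h V - {a} = V" if "V \<in> \<rho>" for V
    proof -
      have "V \<noteq> {}" "V \<subseteq> {i..<b}" using interval_nc_block[OF 1(2) that] by auto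
      then obtain x where "x \<in> V" "i \<le> x" by fastforce
      moreover have "x \<in> h V" using \<open>x \<in> V\<close> by (auto simp: h_def)
      ultimately show "\<not> h V \<subseteq> {Suc a..<i}" by fastforce
      show "h V - {a} = V" using \<open>V \<subseteq> {i..<b}\<close> ai by (auto simp: h_def)
    qed
    have A: "{V \<in> \<sigma> \<union> h ` \<rho>. V \<subseteq> {Suc a..<i}} = \<sigma>" using s nr by auto
    have "{V \<in> \<sigma> \<union> h ` \<rho>. \<not> V \<subseteq> {Suc a..<i}} = h ` \<rho>" using s nr by auto
    then have B: "(\<lambda>V. V - {a}) ` {V \<in> \<sigma> \<union> h ` \<rho>. \<not> V \<subseteq> {Suc a..<i}} = \<rho>"
      using nr(2) by (simp add: image_image)
    show "({V \<in> glue a i p. V \<subseteq> {Suc a..<i}}, (\<lambda>V. V - {a}) ` {V \<in> glue a i p. \<not> V \<subseteq> {Suc a..<i}}) = p"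
      unfolding ps g A B by simp
  qed
  show "glue a i ` (interval_nc (Suc a) i \<times> interval_nc i b)
      \<subseteq> {\<pi>\<in>interval_nc a b. second_is a i \<pi>}"
    using glue_in[OF ai] by auto
  have *: "glue a i ({V\<in>\<pi>. V \<subseteq> {Suc a..<i}}, (\<lambda>V. V - {a}) ` {V\<in>\<pi>. \<not> V \<subseteq> {Suc a..<i}}) = \<pi> \<and>
     {V\<in>\<pi>. V \<subseteq> {Suc a..<i}} \<in> interval_nc (Suc a) i \<and>
     (\<lambda>V. V - {a}) ` {V\<in>\<pi>. \<not> V \<subseteq> {Suc a..<i}} \<in> interval_nc i b"
    if \<pi>: "\<pi> \<in> interval_nc a b" and sec: "second_is a i \<pi>" for \<pi>
  proof -
    obtain V0 where V0: "V0 \<in> \<pi>" "a \<in> V0" "i \<in> V0" and gap: "\<And>j. a < j \<Longrightarrow> j < i \<Longrightarrow> j \<notin> V0"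
      using sec unfolding second_is_def by blast
    have nc: "noncrossing \<pi>" using \<pi> by (simp add: interval_nc_def)
    have av: "V = V0" if "V \<in> \<pi>" "a \<in> V" for V using interval_nc_unique[OF \<pi> that(1) V0(1)] that V0 by auto
    have iv: "V = V0" if "V \<in> \<pi>" "i \<in> V" for V using interval_nc_unique[OF \<pi> that(1) V0(1)] that V0 by auto
    have rng: "a \<le> x \<and> x < b" if "V \<in> \<pi>" "x \<in> V" for x V
      using interval_nc_block(1)[OF \<pi> that(1)] that(2) by auto
    \<comment> \<open>A block with one element in the gap and another one beyond \<open>i\<close>
      would cross \<open>V0\<close>, which contains \<open>a\<close> and \<open>i\<close> but
      nothing between them.\<close>
    have big: "i \<le> x" if V: "V \<in> \<pi>" "\<not> V \<subseteq> {Suc a..<i}" and x: "x \<in> V" "x \<noteq> a" for V x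
    proof (rule ccontr)
      assume "\<not> i \<le> x"
      then have xi: "a < x" "x < i" using rng[OF V(1) x(1)] x(2) by auto
      then have "V \<noteq> V0" using gap x by auto
      then have aV: "a \<notin> V" "i \<notin> V" using av iv V by auto
      obtain y where y: "y \<in> V" "\<not> (Suc a \<le> y \<and> y < i)" using V(2) by (meson atLeastLessThan_iff subsetI)
      then have "i < y" using rng[OF V(1) y(1)] aV by (metis Suc_leI antisym_conv2 not_less_iff_gr_or_eq)
      then have "V0 = V" using noncrossingD[OF nc V0(1) V(1) xi(1) xi(2) _ V0(2,3) x(1) y(1)] by auto
      then show False using \<open>V \<noteq> V0\<close> by simp
    qed
    have n0: "\<not> V0 \<subseteq> {Suc a..<i}" using V0 by auto
    let ?A = "{V\<in>\<pi>. V \<subseteq> {Suc a..<i}}" and ?B = "{V\<in>\<pi>. \<not> V \<subseteq> {Suc a..<i}}"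
    have hb: "(if i \<in> V - {a} then insert a (V - {a}) else V - {a}) = V" if "V \<in> \<pi>" for V
      using av[OF that] iv[OF that] V0 ai by (auto split: if_splits)
    have G: "glue a i (?A, (\<lambda>V. V - {a}) ` ?B) = \<pi>"
    proof -
      have "(\<lambda>V. if i \<in> V then insert a V else V) ` (\<lambda>V. V - {a}) ` ?B = ?B"
        unfolding image_image using hb by (simp cong: image_cong_simp)
      then show ?thesis by (auto simp: glue_def)
    qed
    have SI: "?A \<in> interval_nc (Suc a) i"
    proof (rule interval_ncI)
      fix x assume x: "Suc a \<le> x" "x < i"
      obtain V where V: "V \<in> \<pi>" "x \<in> V" by (rule interval_nc_ex[OF \<pi>, of x]) (use x ai in auto)
      have "V \<subseteq> {Suc a..<i}" using big[OF V(1) _ V(2)] x by fastforce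
      then show "\<exists>V\<in>?A. x \<in> V" using V by auto
    qed (use interval_nc_block(2)[OF \<pi>] interval_nc_unique[OF \<pi>] noncrossingD[OF nc] in auto)
    have RI: "(\<lambda>V. V - {a}) ` ?B \<in> interval_nc i b"
    proof (rule interval_ncI)
      fix V assume "V \<in> (\<lambda>V. V - {a}) ` ?B"
      then obtain V' where V': "V' \<in> \<pi>" "\<not> V' \<subseteq> {Suc a..<i}" "V = V' - {a}" by blast
      show "V \<subseteq> {i..<b}"
      proof
        fix x assume "x \<in> V"
        then show "x \<in> {i..<b}" using big[OF V'(1,2), of x] rng[OF V'(1), of x] V'(3) by auto
      qed
    next
      fix V assume "V \<in> (\<lambda>V. V - {a}) ` ?B"
      then obtain V' where V': "V' \<in> \<pi>" "\<not> V' \<subseteq> {Suc a..<i}" "V = V' - {a}" by blast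
      show "V \<noteq> {}"
      proof
        assume "V = {}"
        then have "V' = {a}" using V' interval_nc_block(2)[OF \<pi> V'(1)] by auto
        then show False using av[OF V'(1)] V0 ai by auto
      qed
    next
      fix x assume x: "i \<le> x" "x < b"
      obtain V where V: "V \<in> \<pi>" "x \<in> V" by (rule interval_nc_ex[OF \<pi>, of x]) (use x ai in auto)
      have "\<not> V \<subseteq> {Suc a..<i}" using V x by auto
      then show "\<exists>V\<in>(\<lambda>V. V - {a}) ` ?B. x \<in> V" using V x ai by (auto intro!: bexI[of _ V])
    next
      fix V W x assume "V \<in> (\<lambda>V. V - {a}) ` ?B" "W \<in> (\<lambda>V. V - {a}) ` ?B" "x \<in> V" "x \<in> W"
      then show "V = W" using interval_nc_unique[OF \<pi>] by blast
    next
      fix V W x y z w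
      assume "V \<in> (\<lambda>V. V - {a}) ` ?B" "W \<in> (\<lambda>V. V - {a}) ` ?B" and o: "x < y" "y < z" "z < w"
        and m: "x \<in> V" "z \<in> V" "y \<in> W" "w \<in> W"
      then obtain V' W' where "V' \<in> \<pi>" "W' \<in> \<pi>" "V = V' - {a}" "W = W' - {a}" by blast
      with m noncrossingD[OF nc this(1,2) o] show "V = W" by auto
    qed
    show ?thesis using G SI RI by blast
  qed
  show "\<forall>\<pi>\<in>{\<pi> \<in> interval_nc a b. second_is a i \<pi>}.
       glue a i ({V\<in>\<pi>. V \<subseteq> {Suc a..<i}}, (\<lambda>V. V - {a}) ` {V\<in>\<pi>. \<not> V \<subseteq> {Suc a..<i}}) = \<pi>"
    using * by blast
  show "(\<lambda>\<pi>. ({V\<in>\<pi>. V \<subseteq> {Suc a..<i}}, (\<lambda>V. V - {a}) ` {V\<in>\<pi>. \<not> V \<subseteq> {Suc a..<i}})) `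
      {\<pi> \<in> interval_nc a b. second_is a i \<pi>} \<subseteq> interval_nc (Suc a) i \<times> interval_nc i b"
    using * by blast
qed

lemma singleton_bij:
  assumes ab: "a < b"
  shows "bij_betw (insert {a}) (interval_nc (Suc a) b) {\<pi>\<in>interval_nc a b. {a} \<in> \<pi>}"
proof (rule bij_betw_byWitness[where f' = "\<lambda>\<pi>. \<pi> - {{a}}"])
  show "\<forall>\<pi>\<in>interval_nc (Suc a) b. insert {a} \<pi> - {{a}} = \<pi>"
    using interval_nc_block(1) by fastforce
  show "\<forall>\<pi>\<in>{\<pi> \<in> interval_nc a b. {a} \<in> \<pi>}. insert {a} (\<pi> - {{a}}) = \<pi>" by auto
  show "insert {a} ` interval_nc (Suc a) b \<subseteq> {\<pi> \<in> interval_nc a b. {a} \<in> \<pi>}"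
  proof (rule image_subsetI, rule CollectI, rule conjI)
    fix \<pi> assume 1: "\<pi> \<in> interval_nc (Suc a) b"
    have s: "x \<in> V \<Longrightarrow> a < x \<and> x < b" if "V \<in> \<pi>" for V x
      using interval_nc_block[OF 1 that] by auto
    have nc: "noncrossing \<pi>" using 1 by (simp add: interval_nc_def)
    show "insert {a} \<pi> \<in> interval_nc a b"
    proof (rule interval_ncI)
      fix V assume "V \<in> insert {a} \<pi>" then show "V \<subseteq> {a..<b}" using s ab by fastforce
    next
      fix V assume "V \<in> insert {a} \<pi>" then show "V \<noteq> {}" using interval_nc_block(2)[OF 1] by auto
    next
      fix x assume x: "a \<le> x" "x < b"
      show "\<exists>V\<in>insert {a} \<pi>. x \<in> V"
      proof (cases "x = a")
        case False
        obtain V where V: "V \<in> \<pi>" "x \<in> V" by (rule interval_nc_ex[OF 1, of x]) (use x False in auto)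
        then show ?thesis by auto
      qed auto
    next
      fix V W x assume "V \<in> insert {a} \<pi>" "W \<in> insert {a} \<pi>" "x \<in> V" "x \<in> W"
      then show "V = W" using s interval_nc_unique[OF 1] by blast
    next
      fix V W x y z w
      assume VW: "V \<in> insert {a} \<pi>" "W \<in> insert {a} \<pi>" and o: "x < y" "y < z" "z < w"
        and m: "x \<in> V" "z \<in> V" "y \<in> W" "w \<in> W"
      then have "V \<in> \<pi>" "W \<in> \<pi>" by auto
      then show "V = W" using noncrossingD[OF nc _ _ o m] by auto
    qed
  qed auto
  show "(\<lambda>\<pi>. \<pi> - {{a}}) ` {\<pi> \<in> interval_nc a b. {a} \<in> \<pi>} \<subseteq> interval_nc (Suc a) b"
  proof (rule image_subsetI)
    fix \<pi> assume "\<pi> \<in> {\<pi> \<in> interval_nc a b. {a} \<in> \<pi>}"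
    then have 1: "\<pi> \<in> interval_nc a b" "{a} \<in> \<pi>" by auto
    have nc: "noncrossing \<pi>" using 1 by (simp add: interval_nc_def)
    have na: "a \<notin> V" if "V \<in> \<pi>" "V \<noteq> {a}" for V
      using interval_nc_unique[OF 1(1) that(1) 1(2)] that by auto
    show "\<pi> - {{a}} \<in> interval_nc (Suc a) b"
    proof (rule interval_ncI)
      fix V assume "V \<in> \<pi> - {{a}}"
      then have "V \<subseteq> {a..<b}" "a \<notin> V" using interval_nc_block(1)[OF 1(1)] na by auto
      show "V \<subseteq> {Suc a..<b}"
      proof
        fix x assume "x \<in> V"
        then have "x \<in> {a..<b}" "x \<noteq> a" using \<open>V \<subseteq> {a..<b}\<close> \<open>a \<notin> V\<close> by blast+
        then show "x \<in> {Suc a..<b}" by simp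
      qed
    next
      fix x assume x: "Suc a \<le> x" "x < b"
      obtain V where V: "V \<in> \<pi>" "x \<in> V" by (rule interval_nc_ex[OF 1(1), of x]) (use x in auto)
      then show "\<exists>V\<in>\<pi> - {{a}}. x \<in> V" using x by (auto intro!: bexI[of _ V])
    qed (use interval_nc_block(2)[OF 1(1)] interval_nc_unique[OF 1(1)] noncrossingD[OF nc] in auto)
  qed
qed

lemma interval_nc_second:
  assumes "a < b"
  shows "interval_nc a b = {\<pi>\<in>interval_nc a b. {a} \<in> \<pi>} \<union>
    (\<Union>i\<in>{Suc a..<b}. {\<pi>\<in>interval_nc a b. second_is a i \<pi>})"
proof -
  have "{a} \<in> \<pi> \<or> (\<exists>i\<in>{Suc a..<b}. second_is a i \<pi>)" if \<pi>: "\<pi> \<in> interval_nc a b" for \<pi>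
  proof -
    obtain V where V: "V \<in> \<pi>" "a \<in> V" by (rule interval_nc_ex[OF \<pi>, of a]) (use assms in auto)
    have sub: "V \<subseteq> {a..<b}" using interval_nc_block[OF \<pi> V(1)] by auto
    show ?thesis
    proof (cases "V = {a}")
      case False
      then have ne: "V - {a} \<noteq> {}" "finite (V - {a})" using V interval_nc_block[OF \<pi> V(1)] by auto
      obtain i where i: "i \<in> V" "i \<noteq> a" and le: "\<And>j. j \<in> V \<Longrightarrow> j \<noteq> a \<Longrightarrow> i \<le> j"
        using Min_in[OF ne(2,1)] Min_le[OF ne(2)] by blast
      have "a \<le> i" "i < b" using i(1) sub by (meson atLeastLessThan_iff subsetD)+
      then have "i \<in> {Suc a..<b}" using i(2) by simp
      moreover have "\<forall>j. a < j \<and> j < i \<longrightarrow> j \<notin> V" using le by (metis leD less_irrefl)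
      then have "second_is a i \<pi>" unfolding second_is_def using V i by blast
      ultimately show ?thesis by blast
    qed (use V in auto)
  qed
  then show ?thesis by blast
qed

text \<open>Case distinction on the second element of the block of \<open>a\<close>. Once
  \<open>a\<close> is removed, \<open>i\<close> is the first element of its block, and the lost
  element is remembered by raising the surplus from \<open>s\<close> to \<open>Suc s\<close>; the
  gap contributes an ordinary sum without surplus.\<close>

lemma nc_sum_rec:
  assumes ab: "a < b"
  shows "nc_sum k s a b = k (Suc s) * nc_sum k 0 (Suc a) b +
     (\<Sum>i\<in>{Suc a..<b}. nc_sum k 0 (Suc a) i * nc_sum k (Suc s) i b)"
proof -
  let ?w = "\<lambda>\<pi>. \<Prod>V\<in>\<pi>. k (card V + (if a \<in> V then s else 0))"
  have uniq: "i = j" if \<pi>: "\<pi> \<in> interval_nc a b" and ui: "second_is a i \<pi>" and uj: "second_is a j \<pi>" and aij: "a < i" "a < j"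
    for i j \<pi>
  proof -
    obtain V where V: "V \<in> \<pi>" "a \<in> V" "i \<in> V" "\<forall>x. a < x \<and> x < i \<longrightarrow> x \<notin> V"
      using ui unfolding second_is_def by blast
    obtain W where W: "W \<in> \<pi>" "a \<in> W" "j \<in> W" "\<forall>x. a < x \<and> x < j \<longrightarrow> x \<notin> W"
      using uj unfolding second_is_def by blast
    have "V = W" using interval_nc_unique[OF \<pi> V(1) W(1) V(2) W(2)] .
    then have "\<not> i < j" "\<not> j < i" using V(3,4) W(3,4) aij by auto
    then show ?thesis by simp
  qed
  have sing: "\<not> second_is a i \<pi>" if \<pi>: "\<pi> \<in> interval_nc a b" and "{a} \<in> \<pi>" "a < i" for i \<pi>
  proof
    assume "second_is a i \<pi>"
    then obtain V where "V \<in> \<pi>" "a \<in> V" "i \<in> V" unfolding second_is_def by blast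
    with interval_nc_unique[OF \<pi> this(1) that(2)] show False using that by auto
  qed
  have "nc_sum k s a b = sum ?w {\<pi>\<in>interval_nc a b. {a} \<in> \<pi>} +
      sum ?w (\<Union>i\<in>{Suc a..<b}. {\<pi>\<in>interval_nc a b. second_is a i \<pi>})"
    unfolding nc_sum_def
    by (subst interval_nc_second[OF ab], rule sum.union_disjoint) (use sing in auto)
  also have "sum ?w (\<Union>i\<in>{Suc a..<b}. {\<pi>\<in>interval_nc a b. second_is a i \<pi>}) =
      (\<Sum>i\<in>{Suc a..<b}. sum ?w {\<pi>\<in>interval_nc a b. second_is a i \<pi>})"
    by (rule sum.UNION_disjoint) (use uniq in \<open>auto simp: Suc_le_eq\<close>)
  also have "\<dots> = (\<Sum>i\<in>{Suc a..<b}. nc_sum k 0 (Suc a) i * nc_sum k (Suc s) i b)"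
  proof (rule sum.cong[OF refl])
    fix i assume "i \<in> {Suc a..<b}"
    then have i: "a < i" "i < b" by auto
    have "sum ?w {\<pi>\<in>interval_nc a b. second_is a i \<pi>} =
        (\<Sum>p\<in>interval_nc (Suc a) i \<times> interval_nc i b. ?w (glue a i p))"
      by (rule sum.reindex_bij_betw[OF glue_bij[OF i], symmetric])
    also have "\<dots> = (\<Sum>(\<sigma>, \<rho>)\<in>interval_nc (Suc a) i \<times> interval_nc i b.
        (\<Prod>V\<in>\<sigma>. k (card V)) * (\<Prod>V\<in>\<rho>. k (card V + (if i \<in> V then Suc s else 0))))"
    proof (rule sum.cong[OF refl], safe, goal_cases)
      case (1 \<sigma> \<rho>)
      define h where "h V = (if i \<in> V then insert a V else V)" for V :: "nat set"
      have g: "glue a i (\<sigma>, \<rho>) = \<sigma> \<union> h ` \<rho>" by (auto simp: glue_def h_def)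
      have s: "x \<in> V \<Longrightarrow> a < x \<and> x < i" if "V \<in> \<sigma>" for V x
        using interval_nc_block[OF 1(1) that] by auto
      have r: "a \<notin> V" "finite V" "\<exists>x\<in>V. i \<le> x" if "V \<in> \<rho>" for V
        using interval_nc_block[OF 1(2) that] i by auto
      have inj: "inj_on h \<rho>"
      proof (rule inj_onI)
        fix V W assume VW: "V \<in> \<rho>" "W \<in> \<rho>" "h V = h W"
        have "h U - {a} = U" if "U \<in> \<rho>" for U using r(1)[OF that] by (auto simp: h_def)
        from this[of V] this[of W] have "V = h V - {a}" "W = h W - {a}" using VW(1,2) by auto
        then show "V = W" using VW(3) by simp
      qed
      have "?w (\<sigma> \<union> h ` \<rho>) = ?w \<sigma> * ?w (h ` \<rho>)"
      proof (rule prod.union_disjoint)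
        show "\<sigma> \<inter> h ` \<rho> = {}"
        proof (safe, goal_cases)
          case (1 _ V)
          with r(3) obtain x where "x \<in> V" "i \<le> x" by auto
          then have "x \<in> h V" by (simp add: h_def)
          then show ?case using s[OF 1(1), of x] \<open>i \<le> x\<close> by simp
        qed
      qed (use interval_nc_finite 1 in auto)
      also have "?w \<sigma> = (\<Prod>V\<in>\<sigma>. k (card V))"
        by (rule prod.cong[OF refl]) (use s in auto)
      also have "?w (h ` \<rho>) = (\<Prod>V\<in>\<rho>. k (card V + (if i \<in> V then Suc s else 0)))"
        by (subst prod.reindex[OF inj], rule prod.cong[OF refl]) (use r in \<open>auto simp: h_def\<close>)
      finally show ?case unfolding g .
    qed
    also have "\<dots> = nc_sum k 0 (Suc a) i * nc_sum k (Suc s) i b"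
      by (simp add: nc_sum_def sum_product sum.cartesian_product)
    finally show "sum ?w {\<pi>\<in>interval_nc a b. second_is a i \<pi>} =
        nc_sum k 0 (Suc a) i * nc_sum k (Suc s) i b" .
  qed
  also have "sum ?w {\<pi>\<in>interval_nc a b. {a} \<in> \<pi>} = k (Suc s) * nc_sum k 0 (Suc a) b"
  proof -
    have "sum ?w {\<pi>\<in>interval_nc a b. {a} \<in> \<pi>} = (\<Sum>\<pi>\<in>interval_nc (Suc a) b. ?w (insert {a} \<pi>))"
      by (rule sum.reindex_bij_betw[OF singleton_bij[OF ab], symmetric])
    also have "\<dots> = (\<Sum>\<pi>\<in>interval_nc (Suc a) b. k (Suc s) * (\<Prod>V\<in>\<pi>. k (card V)))"
    proof (rule sum.cong[OF refl])
      fix \<pi> assume \<pi>: "\<pi> \<in> interval_nc (Suc a) b"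
      have na: "a \<notin> V" if "V \<in> \<pi>" for V using interval_nc_block(1)[OF \<pi> that] by auto
      then have "{a} \<notin> \<pi>" by auto
      then have "?w (insert {a} \<pi>) = k (Suc s) * ?w \<pi>"
        using interval_nc_finite[OF \<pi>] by simp
      also have "?w \<pi> = (\<Prod>V\<in>\<pi>. k (card V))" by (rule prod.cong[OF refl]) (use na in auto)
      finally show "?w (insert {a} \<pi>) = k (Suc s) * (\<Prod>V\<in>\<pi>. k (card V))" .
    qed
    finally show ?thesis by (simp add: nc_sum_def sum_distrib_left)
  qed
  finally show ?thesis .
qed

lemma nc_sum_empty [simp]: "nc_sum k s a a = 1"
proof -
  have "interval_nc a a = {{}}" by (auto simp: interval_nc_def partition_on_def noncrossing_def)
  then show ?thesis by (simp add: nc_sum_def)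
qed

text \<open>Translation invariance follows from the recursion by induction on the length, without a
  bijection between partitions of the two intervals.\<close>

lemma nc_sum_shift: "nc_sum k s (a + c) (a + c + n) = nc_sum k s a (a + n)"
proof (induction n arbitrary: s a rule: less_induct)
  case (less n)
  show ?case
  proof (cases "n = 0")
    case False
    then obtain n' where n: "n = Suc n'" by (cases n) auto
    have m: "nc_sum k 0 (Suc (a + c)) (a + c + n) = nc_sum k 0 (Suc a) (a + n)"
      using less[of n' 0 "Suc a"] n by simp
    have "(\<Sum>i\<in>{Suc (a+c)..<a+c+n}. nc_sum k 0 (Suc (a+c)) i * nc_sum k (Suc s) i (a+c+n)) =
        (\<Sum>i\<in>{Suc a..<a+n}. nc_sum k 0 (Suc a) i * nc_sum k (Suc s) i (a+n))"
    proof (rule sum.reindex_bij_witness[where i = "\<lambda>i. i + c" and j = "\<lambda>i. i - c"])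
      fix i assume i: "i \<in> {Suc (a+c)..<a+c+n}"
      define j where "j = i - Suc (a + c)"
      have i2: "i = Suc a + c + j" "j < n" using i by (auto simp: j_def)
      have "nc_sum k 0 (Suc a + c) (Suc a + c + j) = nc_sum k 0 (Suc a) (Suc a + j)"
        by (rule less) (use i2 in auto)
      moreover have "nc_sum k (Suc s) (Suc a + j + c) (Suc a + j + c + (n' - j)) =
          nc_sum k (Suc s) (Suc a + j) (Suc a + j + (n' - j))"
        by (rule less) (use i2 n in auto)
      moreover have "i - c = Suc a + j" "Suc a + j + (n' - j) = a + n"
        "Suc a + j + c + (n' - j) = a + c + n" "Suc a + j + c = i"
        using i2 n i by auto
      moreover have "Suc a + c + j = i" "Suc a + c = Suc (a + c)" using i2 by auto
      moreover have "Suc a + c + j = i" "Suc a + c = Suc (a + c)" using i2 by auto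
      ultimately show "nc_sum k 0 (Suc a) (i - c) * nc_sum k (Suc s) (i - c) (a+n) =
          nc_sum k 0 (Suc (a+c)) i * nc_sum k (Suc s) i (a+c+n)"
        by metis
    qed auto
    moreover have "a + c < a + c + n" "a < a + n" using n by auto
    ultimately show ?thesis using m
      by (simp only: nc_sum_rec[of "a+c" "a+c+n"] nc_sum_rec[of a "a+n"])
  qed simp
qed

lemma moment_eq_nc_sum:
  assumes "m 0 = 1"
  shows "m n = nc_sum (free_cumulant_of_moments m) 0 0 n"
proof (cases "n = 0")
  case False
  then show ?thesis
    by (simp add: moment_cumulant_formula[of n m] nc_sum_def noncrossing_partitions_eq)
qed (simp add: assms)

section \<open>Cumulants determined by a recursion of power series\<close>

unbundle fps_syntax

text \<open>The system is triangular: if two solutions agree at \<open>s\<close> as series, their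
  constant coefficients give equality of the numbers at \<open>s\<close>, and cancelling X times the
  moment series gives agreement at \<open>Suc s\<close>. The generating series of the noncrossing
  sums solve the system with the true cumulants, so any other solution reveals them.\<close>

lemma free_cumulant_of_moments_unique:
  fixes m :: "nat \<Rightarrow> 'c::field" and t :: "nat \<Rightarrow> 'c fps"
  assumes m0: "m 0 = 1"
    and M1: "Abs_fps m = 1 + fps_X * t 1"
    and rec: "\<And>s. s \<ge> 1 \<Longrightarrow> t s = fps_const (k s) * Abs_fps m + fps_X * Abs_fps m * t (Suc s)"
    and s: "s \<ge> 1"
  shows "free_cumulant_of_moments m s = k s"
proof -
  define \<kappa> where "\<kappa> = free_cumulant_of_moments m"
  define M where "M = Abs_fps m"
  \<comment> \<open>With surplus \<open>s - 1\<close> the constant coefficient of \<open>G s\<close>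
    is the cumulant of order \<open>s\<close>, for \<open>s\<close> at least 1.\<close>
  define G where "G s = Abs_fps (\<lambda>n. nc_sum \<kappa> (s - 1) 0 (Suc n))" for s
  have mn: "m n = nc_sum \<kappa> 0 c (c + n)" for n c
    using moment_eq_nc_sum[of m, OF m0] nc_sum_shift[of \<kappa> 0 0 c n] by (simp add: \<kappa>_def)
  have Grec: "G (Suc s) = fps_const (\<kappa> (Suc s)) * M + fps_X * M * G (Suc (Suc s))" for s
  proof (rule fps_ext)
    fix n
    have "fps_nth (G (Suc s)) n = \<kappa> (Suc s) * m n +
        (\<Sum>i\<in>{1..<Suc n}. m (i - 1) * nc_sum \<kappa> (Suc s) i (Suc n))"
    proof -
      have "nc_sum \<kappa> 0 1 i = m (i - 1)" if "i \<ge> 1" for i using mn[of "i - 1" 1] that by simp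
      moreover have "nc_sum \<kappa> 0 1 (Suc n) = m n" using mn[of n 1] by simp
      ultimately show ?thesis by (simp add: G_def nc_sum_rec[of 0 "Suc n"])
    qed
    also have "(\<Sum>i\<in>{1..<Suc n}. m (i - 1) * nc_sum \<kappa> (Suc s) i (Suc n)) =
        (\<Sum>i<n. m i * nc_sum \<kappa> (Suc s) 0 (n - i))"
    proof (rule sum.reindex_bij_witness[where i = Suc and j = "\<lambda>i. i - 1"])
      fix i assume "i \<in> {1..<Suc n}"
      then show "m (i - 1) * nc_sum \<kappa> (Suc s) 0 (n - (i - 1)) = m (i - 1) * nc_sum \<kappa> (Suc s) i (Suc n)"
        using nc_sum_shift[of \<kappa> "Suc s" 0 i "Suc n - i"] by (simp add: Suc_diff_le)
    qed auto
    also have "\<dots> = fps_nth (fps_X * (M * G (Suc (Suc s)))) n"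
    proof (cases n)
      case (Suc n')
      have "(\<Sum>i<n. m i * nc_sum \<kappa> (Suc s) 0 (n - i)) =
          (\<Sum>i=0..n'. m i * nc_sum \<kappa> (Suc s) 0 (Suc (n' - i)))"
        by (rule sum.cong) (auto simp: Suc Suc_diff_le)
      also have "\<dots> = fps_nth (M * G (Suc (Suc s))) n'"
        unfolding fps_mult_nth by (simp add: M_def G_def)
      finally show ?thesis by (simp add: Suc)
    qed simp
    finally show "fps_nth (G (Suc s)) n =
        fps_nth (fps_const (\<kappa> (Suc s)) * M + fps_X * M * G (Suc (Suc s))) n"
      by (simp add: M_def mult.assoc)
  qed
  have MG: "M = 1 + fps_X * G 1"
  proof (rule fps_ext)
    fix n
    show "fps_nth M n = fps_nth (1 + fps_X * G 1) n"
      using m0 mn[of n 0] by (cases n) (simp_all add: M_def G_def)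
  qed
  have M0: "fps_nth M 0 = 1" using m0 by (simp add: M_def)
  have M_nz: "M \<noteq> 0" using M0 by force
  have "G (Suc s) = t (Suc s) \<and> \<kappa> (Suc s) = k (Suc s)" for s
  proof (induction s)
    case 0
    have "fps_X * G 1 = fps_X * t 1" using MG M1 by (simp add: M_def)
    then have e: "G 1 = t 1" by simp
    have "fps_nth (G 1) 0 = fps_nth (t 1) 0" using e by simp
    then have "\<kappa> 1 = k 1" using Grec[of 0] rec[of 1] M0 by (simp add: M_def)
    then show ?case using e by simp
  next
    case (Suc s)
    have "fps_X * M * G (Suc (Suc s)) = fps_X * M * t (Suc (Suc s))"
      using Grec[of s, unfolded conjunct1[OF Suc] conjunct2[OF Suc]] rec[of "Suc s", folded M_def]
      by (metis add_left_cancel le_add1 plus_1_eq_Suc)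
    then have e: "G (Suc (Suc s)) = t (Suc (Suc s))" using M_nz by simp
    then have "fps_nth (G (Suc (Suc s))) 0 = fps_nth (t (Suc (Suc s))) 0" by simp
    then have "\<kappa> (Suc (Suc s)) = k (Suc (Suc s))"
      using Grec[of "Suc s"] rec[of "Suc (Suc s)"] M0 by (simp add: M_def)
    then show ?case using e by simp
  qed
  from this[of "s - 1"] show ?thesis using s by (simp add: \<kappa>_def)
qed

section \<open>Bounded operators and tracial states\<close>

lemma cinner_add_left: "cinner (x + y) z = cinner x z + cinner (y::'h::chilbert_space) z"
  by (metis cinner_add_right cinner_commute complex_cnj_add)

lemma cinner_scaleC_left: "cinner (c *\<^sub>C x) (y::'h::chilbert_space) = cnj c * cinner x y"
  by (metis cinner_commute cinner_scaleC_right complex_cnj_mult)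

lemma cinner_zero_right [simp]: "cinner x (0::'h::chilbert_space) = 0"
  by (metis add_cancel_right_right cinner_add_right)

lemma cinner_zero_left [simp]: "cinner (0::'h::chilbert_space) x = 0"
  by (metis cinner_commute cinner_zero_right complex_cnj_zero)

lemma scaleC_zero_right [simp]: "c *\<^sub>C (0::'h::chilbert_space) = 0"
  by (metis add_cancel_right_right scaleC_add_right)

lemma scaleC_one [simp]: "1 *\<^sub>C (x::'h::chilbert_space) = x"
  by (metis of_real_1 scaleC_of_real scaleR_one)

lemma scaleC_minus_one: "(-1) *\<^sub>C (x::'h::chilbert_space) = - x"
  using scaleC_of_real[of "-1" x] by simp

lemma cinner_minus_right: "cinner x (- (y::'h::chilbert_space)) = - cinner x y"
  by (metis cinner_scaleC_right scaleC_minus_one mult_minus1)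

lemma cinner_diff_right: "cinner x (y - (z::'h::chilbert_space)) = cinner x y - cinner x z"
  by (metis cinner_add_right cinner_minus_right uminus_add_conv_diff add.commute)

lemma cinner_diff_left: "cinner (x - (y::'h::chilbert_space)) z = cinner x z - cinner y z"
  by (metis cinner_diff_right cinner_commute complex_cnj_diff)

lemma cinner_self: "cinner x x = complex_of_real ((norm (x::'h::chilbert_space))\<^sup>2)"
proof -
  have "Im (cinner x x) = 0"
    using cinner_commute[of x x] by (metis cnj.sel(2) neg_equal_zero)
  moreover have "Re (cinner x x) = (norm x)\<^sup>2"
    using norm_eq_sqrt_cinner[of x] norm_ge_zero[of x]
    by (metis real_sqrt_ge_0_iff real_sqrt_pow2)
  ultimately show ?thesis by (simp add: complex_eq_iff)
qed

lemma norm_add_scaleC: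
  "(norm (x + c *\<^sub>C y))\<^sup>2 = (norm x)\<^sup>2 + 2 * Re (c * cinner x y) + (cmod c)\<^sup>2 * (norm (y::'h::chilbert_space))\<^sup>2"
proof -
  have "complex_of_real ((norm (x + c *\<^sub>C y))\<^sup>2) =
      cinner x x + c * cinner x y + cnj c * cinner y x + cnj c * c * cinner y y"
    unfolding cinner_self[symmetric]
    by (simp add: cinner_add_left cinner_add_right cinner_scaleC_left cinner_scaleC_right algebra_simps)
  also have "cnj c * cinner y x = cnj (c * cinner x y)" by (metis cinner_commute complex_cnj_mult)
  also have "cnj c * c = complex_of_real ((cmod c)\<^sup>2)" by (simp add: complex_norm_square mult.commute del: of_real_power)
  finally have "Re (complex_of_real ((norm (x + c *\<^sub>C y))\<^sup>2)) =
      Re (cinner x x + c * cinner x y + cnj (c * cinner x y) + complex_of_real ((cmod c)\<^sup>2) * cinner y y)"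
    by simp
  then show ?thesis unfolding cinner_self by (simp del: of_real_power)
qed

text \<open>Common core of the Cauchy-Schwarz inequalities below and of the orthogonality in the
  Riesz theorem. For positive \<open>b\<close> the expression is smallest at c = - cnj s / b; for
  \<open>b = 0\<close> a large negative multiple of \<open>cnj s\<close> would make it negative
  unless \<open>s\<close> is 0.\<close>

lemma quadratic_orthogonal:
  fixes s :: complex and a b :: real
  assumes "b \<ge> 0" and nn: "\<And>c. 0 \<le> a + 2 * Re (c * s) + (cmod c)\<^sup>2 * b"
  shows "b = 0 \<Longrightarrow> s = 0" and "(cmod s)\<^sup>2 \<le> a * b"
proof -
  have cs: "Re (complex_of_real t * cnj s * s) = t * (cmod s)\<^sup>2" for t
    by (simp add: mult.assoc cmod_power2) (simp add: power2_eq_square)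
  show z: "s = 0" if "b = 0"
  proof (rule ccontr)
    assume "s \<noteq> 0"
    then have p: "(cmod s)\<^sup>2 > 0" by simp
    define t where "t = - (\<bar>a\<bar> + 1) / (cmod s)\<^sup>2"
    have "0 \<le> a + 2 * (t * (cmod s)\<^sup>2)"
      using nn[of "complex_of_real t * cnj s"] that unfolding cs by simp
    moreover have "t * (cmod s)\<^sup>2 = - (\<bar>a\<bar> + 1)" using p unfolding t_def by (simp only: nonzero_eq_divide_eq times_divide_eq_left) simp
    ultimately show False by linarith
  qed
  show "(cmod s)\<^sup>2 \<le> a * b"
  proof (cases "b = 0")
    case False
    then have b: "b > 0" using assms(1) by simp
    let ?c = "complex_of_real (- 1 / b) * cnj s"
    have "(cmod ?c)\<^sup>2 * b = (cmod s)\<^sup>2 / b"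
      using b by (simp add: norm_mult power_mult_distrib norm_divide power_divide) (simp add: power2_eq_square)
    then have "0 \<le> a + 2 * (- 1 / b * (cmod s)\<^sup>2) + (cmod s)\<^sup>2 / b"
      using nn[of ?c] unfolding cs by simp
    then have "(cmod s)\<^sup>2 / b \<le> a" by simp
    then show ?thesis using b by (simp add: divide_le_eq)
  qed (use z in simp)
qed

lemma cinner_cauchy_schwarz: "cmod (cinner x y) \<le> norm x * norm (y::'h::chilbert_space)"
proof -
  have "(cmod (cinner x y))\<^sup>2 \<le> (norm x)\<^sup>2 * (norm y)\<^sup>2"
    by (rule quadratic_orthogonal(2)) (simp_all only: norm_add_scaleC[symmetric] zero_le_power2)
  then show ?thesis by (metis abs_norm_cancel abs_mult norm_mult power2_le_iff_abs_le power_mult_distrib abs_ge_zero abs_le_square_iff)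
qed

lemma cinner_right_unique:
  assumes "\<And>y. cinner x y = cinner x' (y::'h::chilbert_space)"
  shows "x = x'"
proof -
  have "cinner (x - x') (x - x') = 0" using assms[of "x - x'"] by (simp add: cinner_diff_left)
  then show ?thesis by (simp add: cinner_self)
qed

lemma parallelogram:
  "(norm (x - y))\<^sup>2 = 2 * (norm x)\<^sup>2 + 2 * (norm y)\<^sup>2 - (norm (x + (y::'h::chilbert_space)))\<^sup>2"
  using norm_add_scaleC[of x 1 y] norm_add_scaleC[of x "-1" y] by (simp add: scaleC_minus_one)

text \<open>The representing vector is a multiple of the point of least norm in the hyperplane g =
  1. A minimising sequence is Cauchy by the parallelogram law, and minimality makes its limit
  orthogonal to the kernel of \<open>g\<close>.\<close>

lemma riesz_representation:
  fixes g :: "'h::chilbert_space \<Rightarrow> complex"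
  assumes bl: "bounded_linear g" and C: "\<And>c x. g (c *\<^sub>C x) = c * g x"
  shows "\<exists>z. \<forall>x. g x = cinner z x"
proof (cases "\<forall>x. g x = 0")
  case True
  then show ?thesis by (intro exI[of _ 0]) simp
next
  case False
  then obtain x0 where x0: "g x0 \<noteq> 0" by blast
  have gd: "g (x - y) = g x - g y" and ga: "g (x + y) = g x + g y" for x y
    by (rule linear_diff[OF bounded_linear.linear[OF bl]], rule linear_add[OF bounded_linear.linear[OF bl]])
  define A where "A = {x. g x = 1}"
  have A: "(1 / g x0) *\<^sub>C x0 \<in> A" using x0 by (simp add: A_def C)
  define d where "d = Inf (norm ` A)"
  have bdd: "bdd_below (norm ` A)" by (rule bdd_belowI[of _ 0]) auto
  have dle: "d \<le> norm x" if "x \<in> A" for x unfolding d_def using bdd that by (intro cInf_lower) auto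
  have d0: "d \<ge> 0" unfolding d_def by (rule cInf_greatest) (use A in auto)
  have "\<exists>x\<in>A. norm x < d + 1 / real (Suc n)" for n
  proof -
    have "Inf (norm ` A) < d + 1 / real (Suc n)" by (simp add: d_def)
    then show ?thesis using cInf_lessD[of "norm ` A"] A by fastforce
  qed
  then obtain x where xA: "\<And>n. x n \<in> A" and xd: "\<And>n. norm (x n) < d + 1 / real (Suc n)" by metis
  \<comment> \<open>Midpoints lie in \<open>A\<close>, so \<open>x m + x n\<close> has norm at least
    \<open>2 * d\<close>; the parallelogram law then bounds the distance by the excess of the two
    squared norms over the square of \<open>d\<close>.\<close>
  have close: "(norm (x m - x n))\<^sup>2 \<le> 8 * (d + 1) / real (Suc k)" if "m \<ge> k" "n \<ge> k" for m n k
  proof -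
    have "(1/2) *\<^sub>C (x m + x n) \<in> A" using xA[of m] xA[of n] by (simp add: A_def C ga)
    then have "d \<le> norm ((1/2) *\<^sub>C (x m + x n))" by (rule dle)
    also have "\<dots> = norm (x m + x n) / 2"
      using scaleC_of_real[of "1/2" "x m + x n"] by simp
    finally have "2 * d \<le> norm (x m + x n)" by simp
    then have p: "4 * d\<^sup>2 \<le> (norm (x m + x n))\<^sup>2"
      using power_mono[of "2*d" "norm (x m + x n)" 2] d0 by (simp add: power_mult_distrib)
    have le: "norm (x l) \<le> d + 1 / real (Suc k)" if "l \<ge> k" for l
      using xd[of l] that by (smt (verit) frac_le of_nat_0_less_iff of_nat_le_iff Suc_le_mono zero_less_Suc)
    have sq: "(norm (x l))\<^sup>2 \<le> d\<^sup>2 + 2 * (d + 1) / real (Suc k)" if "l \<ge> k" for l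
    proof -
      have "(norm (x l))\<^sup>2 \<le> (d + 1 / real (Suc k))\<^sup>2" using le[OF that] by (intro power_mono) auto
      also have "\<dots> = d\<^sup>2 + (2 * d + 1 / real (Suc k)) / real (Suc k)"
        by (simp only: power2_sum add_divide_distrib) (simp add: power2_eq_square)
      also have "\<dots> \<le> d\<^sup>2 + 2 * (d + 1) / real (Suc k)"
      proof -
        have "1 / real (Suc k) \<le> 2" by (simp add: divide_le_eq)
        then have "(2 * d + 1 / real (Suc k)) / real (Suc k) \<le> 2 * (d + 1) / real (Suc k)"
          by (intro divide_right_mono) auto
        then show ?thesis by simp
      qed
      finally show ?thesis .
    qed
    show ?thesis using parallelogram[of "x m" "x n"] p sq[OF that(1)] sq[OF that(2)] by linarith
  qed
  have "Cauchy x"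
  proof (rule metric_CauchyI)
    fix e :: real assume e: "e > 0"
    obtain k where k: "8 * (d + 1) / e\<^sup>2 < real (Suc k)"
      using reals_Archimedean2 by (metis less_Suc_eq less_trans of_nat_less_iff)
    have "dist (x m) (x n) < e" if "m \<ge> k" "n \<ge> k" for m n
    proof -
      have "(norm (x m - x n))\<^sup>2 \<le> 8 * (d + 1) / real (Suc k)" using close that by blast
      also have "\<dots> < e\<^sup>2" using k e by (simp add: divide_less_eq mult.commute del: of_nat_Suc)
      finally show ?thesis using e by (simp add: dist_norm power_less_imp_less_base)
    qed
    then show "\<exists>M. \<forall>m\<ge>M. \<forall>n\<ge>M. dist (x m) (x n) < e" by blast
  qed
  then obtain z where z: "x \<longlonglongrightarrow> z" using Cauchy_convergent_iff convergent_def by blast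
  have "(\<lambda>n. g (x n)) \<longlonglongrightarrow> g z" using bounded_linear.tendsto[OF bl z] .
  moreover have "(\<lambda>n. g (x n)) = (\<lambda>n. 1)" using xA by (auto simp: A_def)
  ultimately have gz: "g z = 1" using LIMSEQ_unique tendsto_const by metis
  have "norm z \<le> d"
  proof (rule LIMSEQ_le[OF tendsto_norm[OF z]])
    have "(\<lambda>n. d + 1 / real (Suc n)) \<longlonglongrightarrow> d + 0"
      by (intro tendsto_intros LIMSEQ_Suc[OF lim_1_over_n])
    then show "(\<lambda>n. d + 1 / real (Suc n)) \<longlonglongrightarrow> d" by simp
    show "\<exists>N. \<forall>n\<ge>N. norm (x n) \<le> d + 1 / real (Suc n)" using xd less_imp_le by blast
  qed
  have orth: "cinner z w = 0" if w: "g w = 0" for w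
  proof -
    have "0 \<le> 0 + 2 * Re (c * cinner z w) + (cmod c)\<^sup>2 * (norm w)\<^sup>2" for c
    proof -
      have "z + c *\<^sub>C w \<in> A" using gz w by (simp add: A_def ga C)
      then have "norm z \<le> norm (z + c *\<^sub>C w)" using dle \<open>norm z \<le> d\<close> by force
      then have "(norm z)\<^sup>2 \<le> (norm (z + c *\<^sub>C w))\<^sup>2" by (intro power_mono) auto
      then show ?thesis unfolding norm_add_scaleC by simp
    qed
    from quadratic_orthogonal(2)[OF _ this] show ?thesis by simp
  qed
  have nz: "norm z \<noteq> 0"
    using gz linear_0[OF bounded_linear.linear[OF bl]] by auto
  have "g x = cinner (complex_of_real (1 / (norm z)\<^sup>2) *\<^sub>C z) x" for x
  proof -
    have "g (x - g x *\<^sub>C z) = 0" by (simp add: gd C gz)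
    then have "cinner z x = g x * cinner z z"
      using orth[of "x - g x *\<^sub>C z"] by (simp add: cinner_diff_right cinner_scaleC_right)
    then show ?thesis using nz by (simp add: cinner_scaleC_left cinner_self)
  qed
  then show ?thesis by blast
qed

section \<open>Adjoints and the algebra of bounded operators\<close>

lemma app_simps [simp]:
  "app (X + Y) x = app X x + app Y x" "app (X * Y) x = app X (app Y x)"
  "app (c *\<^sub>C X) x = c *\<^sub>C app X x" "app (r *\<^sub>R X) x = r *\<^sub>R app X x"
  "app 1 x = x" "app 0 x = 0"
  by (simp_all add: plus_bop.rep_eq times_bop.rep_eq scaleC_bop.rep_eq scaleR_bop.rep_eq
      one_bop.rep_eq zero_bop.rep_eq)

lemma app_bounded_linear: "bounded_linear (app X)" and app_scaleC: "app X (c *\<^sub>C x) = c *\<^sub>C app X x"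
  using app[of X] by auto

lemma app_uminus [simp]: "app (- X) x = - app X x"
  by (simp only: uminus_bop_def app_simps) simp

lemma app_diff [simp]: "app (X - Y) x = app X x - app Y x"
  by (simp only: minus_bop_def app_simps app_uminus) simp

lemma bop_eqI: "(\<And>x. app X x = app Y x) \<Longrightarrow> X = Y"
  by (metis app_inject ext)

text \<open>Existence behind the definite description in \<open>adj\<close>. The Riesz vectors
  depend linearly on \<open>x\<close> by uniqueness, and testing the vector \<open>Y x\<close>
  against itself bounds its norm.\<close>

lemma ex_adjoint: "\<exists>Y. \<forall>x y. cinner (app Y x) y = cinner x (app X (y::'h::chilbert_space))"
proof -
  have "\<exists>z. \<forall>y. cinner x (app X y) = cinner z y" for x
  proof (rule riesz_representation)
    show "bounded_linear (\<lambda>y. cinner x (app X y))"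
    proof (rule bounded_linear_intro)
      fix y z :: 'h and r :: real
      show "cinner x (app X (y + z)) = cinner x (app X y) + cinner x (app X z)"
        by (simp add: linear_add[OF bounded_linear.linear[OF app_bounded_linear]] cinner_add_right)
      show "cinner x (app X (r *\<^sub>R y)) = r *\<^sub>R cinner x (app X y)"
        by (simp only: app_scaleC cinner_scaleC_right scaleR_conv_of_real scaleC_of_real[symmetric])
      have "cmod (cinner x (app X y)) \<le> norm x * norm (app X y)" by (rule cinner_cauchy_schwarz)
      also have "\<dots> \<le> norm x * (onorm (app X) * norm y)"
        by (intro mult_left_mono onorm[OF app_bounded_linear]) auto
      finally show "cmod (cinner x (app X y)) \<le> norm y * (norm x * onorm (app X))"
        by (simp add: mult_ac)
    qed
  qed (simp add: app_scaleC cinner_scaleC_right)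
  then obtain Y where "\<forall>x y. cinner x (app X y) = cinner (Y x) y"
    using choice[of "\<lambda>x z. \<forall>y. cinner x (app X y) = cinner z y"] by blast
  then have Y: "cinner x (app X y) = cinner (Y x) y" for x y by blast
  have add: "Y (x + y) = Y x + Y y" for x y
    by (rule cinner_right_unique) (simp add: cinner_add_left flip: Y)
  have scal: "Y (c *\<^sub>C x) = c *\<^sub>C Y x" for c x
    by (rule cinner_right_unique) (simp add: cinner_scaleC_left flip: Y)
  have "bounded_linear Y"
  proof (rule bounded_linear_intro)
    fix x :: 'h and r :: real
    show "Y (r *\<^sub>R x) = r *\<^sub>R Y x" by (simp only: scaleC_of_real[symmetric] scal)
    have "complex_of_real ((norm (Y x))\<^sup>2) = cinner x (app X (Y x))" by (simp only: Y cinner_self)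
    then have "(norm (Y x))\<^sup>2 \<le> cmod (cinner x (app X (Y x)))"
      using norm_of_real[of "(norm (Y x))\<^sup>2", where 'a = complex] by simp
    also have "\<dots> \<le> norm x * norm (app X (Y x))" by (rule cinner_cauchy_schwarz)
    also have "\<dots> \<le> norm x * (onorm (app X) * norm (Y x))"
      by (intro mult_left_mono onorm[OF app_bounded_linear]) auto
    finally have le: "norm (Y x) * norm (Y x) \<le> (norm x * onorm (app X)) * norm (Y x)"
      by (simp add: power2_eq_square mult_ac)
    then show "norm (Y x) \<le> norm x * onorm (app X)"
    proof (cases "Y x = 0")
      case True
      then show ?thesis using onorm_pos_le[OF app_bounded_linear[of X]] by simp
    next
      case False
      then have "0 < norm (Y x)" by simp
      then show ?thesis using le by (rule mult_right_le_imp_le[rotated])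
    qed
  qed (rule add)
  then have "app (Bop Y) = Y" using scal by (simp add: Bop_inverse)
  then show ?thesis using Y by (intro exI[of _ "Bop Y"]) simp
qed

lemma adj_eqI:
  assumes "\<And>x y. cinner (app Y x) y = cinner x (app X (y::'h::chilbert_space))"
  shows "adj X = Y"
  unfolding adj_def
proof (rule the_equality)
  fix Z assume "\<forall>x y. cinner (app Z x) y = cinner x (app X y)"
  then show "Z = Y" by (intro bop_eqI cinner_right_unique) (simp add: assms)
qed (use assms in blast)

lemma cinner_adj: "cinner (app (adj X) x) y = cinner x (app X (y::'h::chilbert_space))"
proof -
  obtain Y where Y: "\<And>x y. cinner (app Y x) y = cinner x (app X y)" using ex_adjoint by metis
  then show ?thesis using adj_eqI[OF Y] by simp
qed

lemma adj_adj [simp]: "adj (adj X) = X"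
proof (rule adj_eqI)
  fix x y
  show "cinner (app X x) y = cinner x (app (adj X) y)"
    using cinner_adj[of X y x] cinner_commute[of "app X x" y] cinner_commute[of x "app (adj X) y"] by simp
qed

lemma adj_add [simp]: "adj (X + Y) = adj X + adj Y"
  by (rule adj_eqI) (simp add: cinner_add_left cinner_add_right cinner_adj)

lemma adj_mult [simp]: "adj (X * Y) = adj Y * adj X"
  by (rule adj_eqI) (simp add: cinner_adj)

lemma adj_scaleC [simp]: "adj (c *\<^sub>C X) = cnj c *\<^sub>C adj X"
  by (rule adj_eqI) (simp add: cinner_scaleC_left cinner_scaleC_right cinner_adj)

lemma adj_one [simp]: "adj 1 = 1"
  by (rule adj_eqI) simp

lemma bop_scaleR_scaleC: "r *\<^sub>R (X::'h::chilbert_space bop) = complex_of_real r *\<^sub>C X"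
  by (rule bop_eqI) (simp add: scaleC_of_real)

lemma adj_scaleR [simp]: "adj (r *\<^sub>R X) = r *\<^sub>R adj X"
  by (simp add: bop_scaleR_scaleC)

lemma adj_uminus [simp]: "adj (- X) = - adj X"
  by (simp only: uminus_bop_def adj_scaleR)

lemma adj_diff [simp]: "adj (X - Y) = adj X - adj Y"
  by (simp only: minus_bop_def adj_add adj_uminus)

lemma adj_power [simp]: "adj (X ^ n) = adj X ^ n"
  by (induction n) (simp_all add: power_commutes)

lemma bop_algebra:
  fixes X Y :: "'h::chilbert_space bop"
  shows "(c *\<^sub>C X) * Y = c *\<^sub>C (X * Y)" "X * (c *\<^sub>C Y) = c *\<^sub>C (X * Y)"
    "c *\<^sub>C (X + Y) = c *\<^sub>C X + c *\<^sub>C Y" "(c + d) *\<^sub>C X = c *\<^sub>C X + d *\<^sub>C X"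
    "c *\<^sub>C d *\<^sub>C X = (c * d) *\<^sub>C X" "1 *\<^sub>C X = X" "- X = (-1) *\<^sub>C X"
  by (rule bop_eqI; simp add: app_scaleC scaleC_add_right scaleC_add_left scaleC_scaleC scaleC_minus_one)+

lemma bop_algebra_real:
  fixes X Y :: "'h::chilbert_space bop"
  shows "(r *\<^sub>R X) * Y = r *\<^sub>R (X * Y)" "X * (r *\<^sub>R Y) = r *\<^sub>R (X * Y)"
  by (simp_all add: bop_scaleR_scaleC bop_algebra)

section \<open>L2 geometry of a faithful tracial state\<close>

locale tracial_space =
  fixes M :: "'h::chilbert_space bop set" and \<phi> :: "'h bop \<Rightarrow> complex"
  assumes tracial: "tracial_W_probability_space M \<phi>"
begin

lemma M_one [simp, intro]: "1 \<in> M"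
  and M_add [simp, intro]: "X \<in> M \<Longrightarrow> Y \<in> M \<Longrightarrow> X + Y \<in> M"
  and M_mult [simp, intro]: "X \<in> M \<Longrightarrow> Y \<in> M \<Longrightarrow> X * Y \<in> M"
  and M_scaleC [simp, intro]: "X \<in> M \<Longrightarrow> c *\<^sub>C X \<in> M"
  and M_adj [simp, intro]: "X \<in> M \<Longrightarrow> adj X \<in> M"
proof -
  have "von_neumann_algebra M" using tracial by (simp only: tracial_W_probability_space_def)
  note vN = this[unfolded von_neumann_algebra_def]
  show "1 \<in> M" using vN by (elim conjE)
  show "X \<in> M \<Longrightarrow> Y \<in> M \<Longrightarrow> X + Y \<in> M" "X \<in> M \<Longrightarrow> Y \<in> M \<Longrightarrow> X * Y \<in> M"
    using vN by (elim conjE, simp)+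
  show "X \<in> M \<Longrightarrow> c *\<^sub>C X \<in> M" "X \<in> M \<Longrightarrow> adj X \<in> M"
    using vN by (elim conjE, simp)+
qed

lemma M_scaleR [simp, intro]: "X \<in> M \<Longrightarrow> r *\<^sub>R X \<in> M"
  by (simp add: bop_scaleR_scaleC)

lemma M_uminus [simp, intro]: "X \<in> M \<Longrightarrow> - X \<in> M"
  by (simp add: bop_algebra(7))

lemma M_diff [simp, intro]: "X \<in> M \<Longrightarrow> Y \<in> M \<Longrightarrow> X - Y \<in> M"
  using M_add[of X "- Y"] by simp

lemma M_zero [simp, intro]: "0 \<in> M"
  using M_diff[OF M_one M_one] by simp

lemma M_power [simp, intro]: "X \<in> M \<Longrightarrow> X ^ n \<in> M"
  by (induction n) auto

lemma M_sum [intro]: "(\<And>i. i \<in> I \<Longrightarrow> X i \<in> M) \<Longrightarrow> sum X I \<in> M"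
  by (induction I rule: infinite_finite_induct) auto

lemma \<phi>_add: "X \<in> M \<Longrightarrow> Y \<in> M \<Longrightarrow> \<phi> (X + Y) = \<phi> X + \<phi> Y"
  and \<phi>_scaleC: "X \<in> M \<Longrightarrow> \<phi> (c *\<^sub>C X) = c * \<phi> X"
  and \<phi>_one [simp]: "\<phi> 1 = 1"
  and \<phi>_commute: "X \<in> M \<Longrightarrow> Y \<in> M \<Longrightarrow> \<phi> (X * Y) = \<phi> (Y * X)"
  and \<phi>_pos: "X \<in> M \<Longrightarrow> \<phi> (adj X * X) \<in> \<real>" "X \<in> M \<Longrightarrow> 0 \<le> Re (\<phi> (adj X * X))"
  and \<phi>_faithful: "X \<in> M \<Longrightarrow> \<phi> (adj X * X) = 0 \<Longrightarrow> X = 0"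
  using tracial unfolding tracial_W_probability_space_def by (elim conjE; simp)+

lemma \<phi>_uminus: "X \<in> M \<Longrightarrow> \<phi> (- X) = - \<phi> X"
  by (simp add: bop_algebra(7) \<phi>_scaleC)

lemma \<phi>_diff: "X \<in> M \<Longrightarrow> Y \<in> M \<Longrightarrow> \<phi> (X - Y) = \<phi> X - \<phi> Y"
  using \<phi>_add[of X "- Y"] by (simp add: \<phi>_uminus)

lemma \<phi>_real: "X \<in> M \<Longrightarrow> \<phi> (adj X * X) = complex_of_real (Re (\<phi> (adj X * X)))"
  using \<phi>_pos(1) by (metis complex_is_Real_iff of_real_Re)

abbreviation "nrm \<equiv> L2_norm_state \<phi>"

lemma nrm_nonneg [simp]: "X \<in> M \<Longrightarrow> 0 \<le> nrm X"
  by (simp add: L2_norm_state_def \<phi>_pos)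

lemma nrm_sq: "X \<in> M \<Longrightarrow> complex_of_real ((nrm X)\<^sup>2) = \<phi> (adj X * X)"
  using \<phi>_real[of X] \<phi>_pos(2)[of X] by (simp add: L2_norm_state_def del: of_real_power)

lemma nrm_eq_0: "X \<in> M \<Longrightarrow> nrm X = 0 \<Longrightarrow> X = 0"
  using nrm_sq[of X] \<phi>_faithful[of X] by simp

text \<open>Traciality makes the adjoint an isometry for the L2 norm; this is what gives
  Cauchy-Schwarz for \<open>X * Y\<close> in place of \<open>adj X * Y\<close>.\<close>

lemma nrm_adj: "X \<in> M \<Longrightarrow> nrm (adj X) = nrm X"
  by (simp add: L2_norm_state_def \<phi>_commute[of X "adj X"])

lemma \<phi>_expand:
  assumes X: "X \<in> M" and Y: "Y \<in> M"
  shows "\<phi> (adj (X + c *\<^sub>C Y) * (X + c *\<^sub>C Y)) =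
    \<phi> (adj X * X) + c * \<phi> (adj X * Y) + cnj c * \<phi> (adj Y * X) + (cnj c * c) * \<phi> (adj Y * Y)"
proof -
  have "adj (X + c *\<^sub>C Y) * (X + c *\<^sub>C Y) =
      adj X * X + c *\<^sub>C (adj X * Y) + (cnj c *\<^sub>C (adj Y * X) + (cnj c * c) *\<^sub>C (adj Y * Y))"
    by (simp add: distrib_left distrib_right bop_algebra mult.commute[of c])
  then show ?thesis using X Y by (simp add: \<phi>_add \<phi>_scaleC)
qed

text \<open>Positivity makes \<open>\<phi>\<close> real on elements \<open>adj Z * Z\<close>.
  Expanding at c = 1 compares the imaginary parts of the two cross terms, at c = \<i> their real
  parts.\<close>

lemma \<phi>_hermitian:
  assumes X: "X \<in> M" and Y: "Y \<in> M"
  shows "\<phi> (adj Y * X) = cnj (\<phi> (adj X * Y))"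
proof -
  have im: "Im (\<phi> (adj Z * Z)) = 0" if "Z \<in> M" for Z
    using \<phi>_pos(1)[OF that] by (simp add: complex_is_Real_iff)
  have *: "Im (c * \<phi> (adj X * Y) + cnj c * \<phi> (adj Y * X)) = 0" if "cnj c * c = 1" for c
    using im[of "X + c *\<^sub>C Y"] im[OF X] im[OF Y] X Y that unfolding \<phi>_expand[OF X Y] by simp
  show ?thesis using *[of 1] *[of \<i>] by (simp add: complex_eq_iff)
qed

lemma \<phi>_cauchy_schwarz_adj:
  assumes X: "X \<in> M" and Y: "Y \<in> M"
  shows "cmod (\<phi> (adj X * Y)) \<le> nrm X * nrm Y"
proof -
  have "(cmod (\<phi> (adj X * Y)))\<^sup>2 \<le> Re (\<phi> (adj X * X)) * Re (\<phi> (adj Y * Y))"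
  proof (rule quadratic_orthogonal(2))
    fix c
    have "0 \<le> Re (\<phi> (adj (X + c *\<^sub>C Y) * (X + c *\<^sub>C Y)))" using X Y by (intro \<phi>_pos(2)) auto
    also have "\<dots> = Re (\<phi> (adj X * X)) + 2 * Re (c * \<phi> (adj X * Y)) + (cmod c)\<^sup>2 * Re (\<phi> (adj Y * Y))"
    proof -
      have "cnj c * c = complex_of_real ((cmod c)\<^sup>2)"
        by (simp add: complex_norm_square mult.commute del: of_real_power)
      then show ?thesis unfolding \<phi>_expand[OF X Y] \<phi>_hermitian[OF X Y] by (simp del: of_real_power)
    qed
    finally show "0 \<le> \<dots>" .
  qed (use \<phi>_pos Y in auto)
  also have "\<dots> = (nrm X * nrm Y)\<^sup>2"
    using X Y by (simp add: L2_norm_state_def power_mult_distrib \<phi>_pos)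
  finally show ?thesis by (rule power2_le_imp_le) (use X Y in simp)
qed

lemma \<phi>_cauchy_schwarz:
  assumes X: "X \<in> M" and Y: "Y \<in> M"
  shows "cmod (\<phi> (X * Y)) \<le> nrm X * nrm Y"
  using \<phi>_cauchy_schwarz_adj[of "adj X" Y] X Y by (simp add: nrm_adj)

lemma nrm_triangle:
  assumes X: "X \<in> M" and Y: "Y \<in> M"
  shows "nrm (X + Y) \<le> nrm X + nrm Y"
proof -
  have "complex_of_real ((nrm (X + Y))\<^sup>2) = of_real ((nrm X)\<^sup>2) + \<phi> (adj X * Y) + cnj (\<phi> (adj X * Y)) + of_real ((nrm Y)\<^sup>2)"
    using \<phi>_expand[OF X Y, of 1] X Y \<phi>_hermitian[OF X Y] by (simp add: nrm_sq bop_algebra del: of_real_power)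
  then have "(nrm (X + Y))\<^sup>2 = (nrm X)\<^sup>2 + 2 * Re (\<phi> (adj X * Y)) + (nrm Y)\<^sup>2"
    by (simp add: complex_eq_iff del: of_real_power)
  also have "\<dots> \<le> (nrm X)\<^sup>2 + 2 * (nrm X * nrm Y) + (nrm Y)\<^sup>2"
    using \<phi>_cauchy_schwarz_adj[OF X Y] complex_Re_le_cmod[of "\<phi> (adj X * Y)"] by linarith
  also have "\<dots> = (nrm X + nrm Y)\<^sup>2" by (simp add: power2_sum)
  finally show ?thesis by (rule power2_le_imp_le) (use X Y in simp)
qed

lemma nrm_uminus: "X \<in> M \<Longrightarrow> nrm (- X) = nrm X"
  by (simp add: L2_norm_state_def)

text \<open>As the adjoint is isometric, \<open>adj X - X\<close> has norm at most twice the
  distance from \<open>X\<close> to any \<open>Y m\<close>; faithfulness turns norm 0 into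
  equality.\<close>

lemma limit_self_adjoint:
  assumes X: "X \<in> M" and Y: "\<And>m. Y m \<in> M" "\<And>m. adj (Y m) = Y m"
    and lim: "(\<lambda>m. nrm (Y m - X)) \<longlonglongrightarrow> 0"
  shows "adj X = X"
proof -
  have "nrm (adj X - X) \<le> 2 * nrm (Y m - X)" for m
  proof -
    have "nrm (adj X - X) = nrm ((Y m - X) + - adj (Y m - X))" using Y(2) by simp
    also have "\<dots> \<le> nrm (Y m - X) + nrm (- adj (Y m - X))" using X Y by (intro nrm_triangle) auto
    also have "\<dots> = 2 * nrm (Y m - X)" using X Y(1) nrm_adj[of "Y m - X"] nrm_uminus by (simp del: adj_diff)
    finally show ?thesis .
  qed
  moreover have "(\<lambda>m. 2 * nrm (Y m - X)) \<longlonglongrightarrow> 0" using tendsto_mult_left[OF lim, of 2] by simp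
  ultimately have "nrm (adj X - X) \<le> 0" by (meson LIMSEQ_le_const)
  then have "nrm (adj X - X) = 0" using X by (simp add: antisym)
  then show ?thesis using nrm_eq_0[of "adj X - X"] X by simp
qed

text \<open>L2 convergence alone does not control higher moments, since products are not continuous
  for the L2 norm. Bounded moments of \<open>Y m\<close> bound the L2 norms of mixed words, and the
  factors \<open>Y m\<close> are then exchanged for \<open>X\<close> one at a time.\<close>

lemma moments_tendsto:
  assumes X: "X \<in> M" "adj X = X" and Y: "\<And>m. Y m \<in> M" "\<And>m. adj (Y m) = Y m"
    and lim: "(\<lambda>m. nrm (Y m - X)) \<longlonglongrightarrow> 0"
    and bdd: "\<And>k. \<exists>B. \<forall>m. cmod (\<phi> (Y m ^ k)) \<le> B"
  shows "(\<lambda>m. \<phi> (Y m ^ k)) \<longlonglongrightarrow> \<phi> (X ^ k)"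
proof -
  \<comment> \<open>Cycling the trace writes the squared norm as the trace of
    \<open>X ^ (2 * j) * Y m ^ (2 * k)\<close>. Cauchy-Schwarz separates the factors, and the
    squared norm of the second one is a moment of order \<open>4 * k\<close>.\<close>
  have nb: "\<exists>B. \<forall>m. nrm (X ^ j * Y m ^ k) \<le> B" for j k
  proof -
    obtain B where B: "\<And>m. cmod (\<phi> (Y m ^ (4 * k))) \<le> B" using bdd by blast
    have "nrm (X ^ j * Y m ^ k) \<le> sqrt (nrm (X ^ (2 * j)) * sqrt B)" for m
    proof -
      have "complex_of_real ((nrm (X ^ j * Y m ^ k))\<^sup>2) = \<phi> (Y m ^ k * (X ^ j * X ^ j * Y m ^ k))"
        using X Y by (subst nrm_sq) (auto simp: mult.assoc)
      also have "\<dots> = \<phi> (X ^ (2 * j) * Y m ^ (2 * k))"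
        using X Y by (subst \<phi>_commute) (auto simp: mult.assoc mult_2 power_add)
      finally have "(nrm (X ^ j * Y m ^ k))\<^sup>2 \<le> cmod (\<phi> (X ^ (2 * j) * Y m ^ (2 * k)))"
        by (metis complex_Re_le_cmod Re_complex_of_real)
      also have "\<dots> \<le> nrm (X ^ (2 * j)) * nrm (Y m ^ (2 * k))"
        using X Y by (intro \<phi>_cauchy_schwarz) auto
      also have "nrm (Y m ^ (2 * k)) \<le> sqrt B"
      proof -
        have "complex_of_real ((nrm (Y m ^ (2 * k)))\<^sup>2) = \<phi> (Y m ^ (4 * k))"
          using Y by (subst nrm_sq) (auto simp flip: power_add)
        then have "(nrm (Y m ^ (2 * k)))\<^sup>2 \<le> B"
          using B[of m] by (metis complex_Re_le_cmod Re_complex_of_real order_trans)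
        then show ?thesis by (simp add: real_le_rsqrt)
      qed
      finally have "(nrm (X ^ j * Y m ^ k))\<^sup>2 \<le> nrm (X ^ (2 * j)) * sqrt B"
        using X by (simp add: mult_left_mono)
      then show ?thesis by (rule real_le_rsqrt)
    qed
    then show ?thesis by blast
  qed
  have "(\<lambda>m. \<phi> (Y m ^ k * X ^ j)) \<longlonglongrightarrow> \<phi> (X ^ (k + j))" for j
  proof (induction k arbitrary: j)
    case (Suc k)
    obtain B where B: "\<And>m. nrm (X ^ j * Y m ^ k) \<le> B" using nb by blast
    have eq: "\<phi> (Y m ^ Suc k * X ^ j) = \<phi> (Y m ^ k * X ^ Suc j) + \<phi> ((Y m - X) * (X ^ j * Y m ^ k))" for m
    proof -
      have "Y m ^ Suc k * X ^ j = Y m ^ k * X ^ Suc j + Y m ^ k * ((Y m - X) * X ^ j)"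
        by (simp add: power_Suc2 mult.assoc distrib_left right_diff_distrib left_diff_distrib del: power_Suc)
          (simp add: power_Suc2[symmetric])
      moreover have "\<phi> (Y m ^ k * ((Y m - X) * X ^ j)) = \<phi> ((Y m - X) * (X ^ j * Y m ^ k))"
        using X Y by (subst \<phi>_commute) (auto simp: mult.assoc)
      ultimately show ?thesis using X Y by (simp add: \<phi>_add)
    qed
    have "(\<lambda>m. \<phi> ((Y m - X) * (X ^ j * Y m ^ k))) \<longlonglongrightarrow> 0"
    proof (rule Lim_null_comparison)
      show "\<forall>\<^sub>F m in sequentially. cmod (\<phi> ((Y m - X) * (X ^ j * Y m ^ k))) \<le> nrm (Y m - X) * B"
      proof (intro always_eventually allI)
        fix m
        have "cmod (\<phi> ((Y m - X) * (X ^ j * Y m ^ k))) \<le> nrm (Y m - X) * nrm (X ^ j * Y m ^ k)"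
          using X Y by (intro \<phi>_cauchy_schwarz) auto
        also have "\<dots> \<le> nrm (Y m - X) * B" using X Y B by (intro mult_left_mono) auto
        finally show "cmod (\<phi> ((Y m - X) * (X ^ j * Y m ^ k))) \<le> nrm (Y m - X) * B" .
      qed
      show "(\<lambda>m. nrm (Y m - X) * B) \<longlonglongrightarrow> 0" using tendsto_mult_right[OF lim, of B] by simp
    qed
    with Suc[of "Suc j"] show ?case unfolding eq using tendsto_add by fastforce
  qed simp
  from this[of 0] show ?thesis by simp
qed

end

section \<open>Wick families and quadratic forms\<close>

text \<open>Only the inner dimension is recorded. Rectangular products are thus included, and
  associativity holds as an equation between functions even for two different inner
  dimensions.\<close>

definition mat_mult :: "nat \<Rightarrow> (nat \<Rightarrow> nat \<Rightarrow> real) \<Rightarrow> (nat \<Rightarrow> nat \<Rightarrow> real) \<Rightarrow> nat \<Rightarrow> nat \<Rightarrow> real" where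
  "mat_mult n a b = (\<lambda>i j. \<Sum>k<n. a i k * b k j)"

fun mat_power :: "nat \<Rightarrow> (nat \<Rightarrow> nat \<Rightarrow> real) \<Rightarrow> nat \<Rightarrow> nat \<Rightarrow> nat \<Rightarrow> real" where
  "mat_power n a 0 = (\<lambda>i j. if i = j then 1 else 0)"
| "mat_power n a (Suc r) = mat_mult n (mat_power n a r) a"

definition mat_trace :: "nat \<Rightarrow> (nat \<Rightarrow> nat \<Rightarrow> real) \<Rightarrow> real" where
  "mat_trace n a = (\<Sum>i<n. a i i)"

text \<open>On a constant word this is the recursion of the Chebyshev polynomials of the second
  kind, orthogonal for the semicircle law of variance \<open>v i\<close>. Only equal neighbours are
  contracted, in accordance with the freeness of distinct letters.\<close>

fun wick :: "('i \<Rightarrow> 'h::chilbert_space bop) \<Rightarrow> ('i \<Rightarrow> real) \<Rightarrow> 'i list \<Rightarrow> 'h bop" where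
  "wick x v [] = 1"
| "wick x v [i] = x i"
| "wick x v (i # j # w) = x i * wick x v (j # w) - (if i = j then v i *\<^sub>R wick x v w else 0)"

abbreviation word :: "('i \<Rightarrow> 'h::chilbert_space bop) \<Rightarrow> 'i list \<Rightarrow> 'h bop" where
  "word x u \<equiv> prod_list (map x u)"

text \<open>Centredness of the Wick words is all that the moment computations retain of freeness and
  semicircularity.\<close>

locale wick_family = tracial_space M \<phi>
  for M :: "'h::chilbert_space bop set" and \<phi> :: "'h bop \<Rightarrow> complex" +
  fixes J :: "'i set" and x :: "'i \<Rightarrow> 'h bop" and v :: "'i \<Rightarrow> real"
  assumes x_in [simp]: "i \<in> J \<Longrightarrow> x i \<in> M"
    and wick_centred: "w \<in> lists J \<Longrightarrow> w \<noteq> [] \<Longrightarrow> \<phi> (wick x v w) = 0"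
begin

lemma \<phi>_scaleR: "X \<in> M \<Longrightarrow> \<phi> (r *\<^sub>R X) = complex_of_real r * \<phi> X"
  by (simp add: bop_scaleR_scaleC \<phi>_scaleC)

lemma \<phi>_zero [simp]: "\<phi> 0 = 0"
  using \<phi>_scaleR[of 0 0] by simp

lemma wick_in [simp, intro]: "w \<in> lists J \<Longrightarrow> wick x v w \<in> M"
  by (induction w rule: induct_list012) auto

lemma word_in [simp, intro]: "u \<in> lists J \<Longrightarrow> word x u \<in> M"
  by (induction u) auto

lemma butlast_in_lists: "w \<in> lists J \<Longrightarrow> butlast w \<in> lists J"
  by (auto dest: in_set_butlastD)

lemma mult_wick:
  "x i * wick x v w =
    wick x v (i # w) + (if w \<noteq> [] \<and> hd w = i then v i *\<^sub>R wick x v (tl w) else 0)"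
  by (cases w) auto

text \<open>The sum over all factorisations \<open>w = w1 k w2\<close> of \<open>\<phi> (L w1) \<phi> (w2 R)\<close>.\<close>

fun split_sum :: "'i \<Rightarrow> 'h bop \<Rightarrow> 'h bop \<Rightarrow> 'i list \<Rightarrow> complex" where
  "split_sum k L R [] = 0"
| "split_sum k L R (j # w) =
    (if j = k then \<phi> L * \<phi> (word x w * R) else 0) + split_sum k (L * x j) R w"

lemma split_sum_append:
  "split_sum k L R (u @ w) = split_sum k L (word x w * R) u + split_sum k (L * word x u) R w"
  by (induction u arbitrary: L) (auto simp: mult.assoc)

lemma split_sum_add:
  "u \<in> lists J \<Longrightarrow> R \<in> M \<Longrightarrow> R' \<in> M \<Longrightarrow>
    split_sum k L (R + R') u = split_sum k L R u + split_sum k L R' u"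
  by (induction u arbitrary: L) (auto simp: \<phi>_add distrib_left)

lemma split_sum_scaleR:
  "u \<in> lists J \<Longrightarrow> R \<in> M \<Longrightarrow> split_sum k L (r *\<^sub>R R) u = complex_of_real r * split_sum k L R u"
  by (induction u arbitrary: L) (auto simp: \<phi>_scaleR distrib_left bop_algebra_real)

text \<open>The leading letter is contracted either with a letter of \<open>u\<close> or with the last letter of the
  Wick product.\<close>

lemma mult_word_wick:
  assumes "u \<in> lists J" "w \<in> lists J" "i \<in> J"
  shows "\<phi> (x i * word x u * wick x v w) = complex_of_real (v i) *
    (split_sum i 1 (wick x v w) u +
     (if w \<noteq> [] \<and> last w = i then \<phi> (word x u * wick x v (butlast w)) else 0))"
  using assms
proof (induction u arbitrary: w rule: rev_induct)
  case Nil
  show ?case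
  proof (cases w)
    case Nil
    have "\<phi> (x i) = 0" using wick_centred[of "[i]"] assms by simp
    then show ?thesis using Nil by simp
  next
    case (Cons j w')
    have c: "\<phi> (wick x v (i # w)) = 0" using wick_centred[of "i # w"] Nil by simp
    have "\<phi> (x i * wick x v w) = \<phi> (wick x v (i # w)) + (if j = i then complex_of_real (v i) * \<phi> (wick x v w') else 0)"
      unfolding mult_wick using Nil Cons by (auto simp: \<phi>_add \<phi>_scaleR simp del: wick.simps)
    moreover have "\<phi> (wick x v w') = (if w' = [] then 1 else 0)"
      using wick_centred[of w'] Nil Cons by auto
    moreover have "\<phi> (wick x v (butlast w)) = (if w' = [] then 1 else 0)"
      using wick_centred[of "butlast w"] butlast_in_lists[of w] Nil Cons by (cases "w' = []") simp_all
    ultimately show ?thesis using c Cons by (cases "w' = []") (simp_all del: wick.simps(2,3))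
  qed
next
  case (snoc j u)
  then have J: "u \<in> lists J" "j \<in> J" "w \<in> lists J" "i \<in> J" by auto
  have tl: "tl w \<in> lists J" using J(3) by (cases w) auto

  \<comment> \<open>The last letter of \<open>u\<close> is absorbed into the Wick product, at the
    price of a contraction with the head of \<open>w\<close>. The induction hypothesis then applies
    to \<open>j # w\<close> and to \<open>tl w\<close>.\<close>
  let ?c = "if w \<noteq> [] \<and> hd w = j then v j else 0"
  have dec: "x j * wick x v w = wick x v (j # w) + ?c *\<^sub>R wick x v (tl w)" by (simp add: mult_wick)
  have split: "\<phi> (X * (x j * wick x v w)) = \<phi> (X * wick x v (j # w)) + complex_of_real ?c * \<phi> (X * wick x v (tl w))"
    if "X \<in> M" for X
    unfolding dec using that J tl by (simp add: distrib_left \<phi>_add \<phi>_scaleR bop_algebra_real)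
  have "\<phi> (x i * word x (u @ [j]) * wick x v w) =
      \<phi> (x i * word x u * wick x v (j # w)) + complex_of_real ?c * \<phi> (x i * word x u * wick x v (tl w))"
    using split[of "x i * word x u"] J by (simp add: mult.assoc)
  also have "\<phi> (x i * word x u * wick x v (j # w)) = complex_of_real (v i) *
    (split_sum i 1 (wick x v (j # w)) u +
     (if last (j # w) = i then \<phi> (word x u * wick x v (butlast (j # w))) else 0))"
    using snoc.IH[of "j # w"] J by simp
  also have "\<phi> (x i * word x u * wick x v (tl w)) = complex_of_real (v i) *
    (split_sum i 1 (wick x v (tl w)) u +
     (if tl w \<noteq> [] \<and> last (tl w) = i then \<phi> (word x u * wick x v (butlast (tl w))) else 0))"
    using snoc.IH[of "tl w"] J tl by simp
  finally have eq: "\<phi> (x i * word x (u @ [j]) * wick x v w) = complex_of_real (v i) *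
     (split_sum i 1 (wick x v (j # w)) u + complex_of_real ?c * split_sum i 1 (wick x v (tl w)) u +
      ((if last (j # w) = i then \<phi> (word x u * wick x v (butlast (j # w))) else 0) +
       complex_of_real ?c * (if tl w \<noteq> [] \<and> last (tl w) = i then \<phi> (word x u * wick x v (butlast (tl w))) else 0)))"
    by (simp add: algebra_simps)
  have s1: "split_sum i 1 (wick x v w) (u @ [j]) =
      split_sum i 1 (wick x v (j # w)) u + complex_of_real ?c * split_sum i 1 (wick x v (tl w)) u +
      (if j = i then \<phi> (word x u) * \<phi> (wick x v w) else 0)"
    using J tl by (simp add: split_sum_append dec split_sum_add split_sum_scaleR)
  \<comment> \<open>For empty \<open>w\<close> the absorbed letter is itself the last letter of the
    Wick product, and its contraction is the new term of \<open>split_sum\<close>; for nonempty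
    \<open>w\<close> that term vanishes because Wick words are centred.\<close>
  have s2: "(if last (j # w) = i then \<phi> (word x u * wick x v (butlast (j # w))) else 0) +
       complex_of_real ?c * (if tl w \<noteq> [] \<and> last (tl w) = i then \<phi> (word x u * wick x v (butlast (tl w))) else 0) =
     (if j = i then \<phi> (word x u) * \<phi> (wick x v w) else 0) +
     (if w \<noteq> [] \<and> last w = i then \<phi> (word x (u @ [j]) * wick x v (butlast w)) else 0)"
  proof (cases w)
    case Nil
    then show ?thesis by simp
  next
    case (Cons k w')
    have c0: "\<phi> (wick x v w) = 0" using wick_centred[of w] J Cons by simp
    show ?thesis
    proof (cases "w' = []")
      case True
      then show ?thesis using Cons c0 J by simp
    next
      case False
      have d: "x j * wick x v (k # butlast w') =
          wick x v (j # k # butlast w') + ?c *\<^sub>R wick x v (butlast w')"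
        using Cons by (simp add: mult_wick del: wick.simps)
      have "\<phi> (word x (u @ [j]) * wick x v (butlast w)) =
          \<phi> (word x u * wick x v (j # k # butlast w')) + complex_of_real ?c * \<phi> (word x u * wick x v (butlast w'))"
        using Cons False J butlast_in_lists[of w']
        by (simp add: mult.assoc d distrib_left \<phi>_add \<phi>_scaleR bop_algebra_real del: wick.simps)
      then show ?thesis using Cons False c0 by (simp del: wick.simps)
    qed
  qed
  show ?case unfolding eq s1 s2 by (simp add: algebra_simps)
qed

text \<open>The Schwinger-Dyson equation of free semicircular letters: multiplication by a letter
  acts as integration by parts, and \<open>split_sum\<close> is the free difference quotient with
  the state applied to both legs.\<close>

lemma schwinger_dyson_word:
  assumes "u \<in> lists J" "i \<in> J"
  shows "\<phi> (x i * word x u) = complex_of_real (v i) * split_sum i 1 1 u"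
  using mult_word_wick[of u "[]" i] assms by simp

text \<open>Noncommutative polynomials in the letters are represented by lists of monomials.\<close>

definition nc_eval :: "(complex \<times> 'i list) list \<Rightarrow> 'h bop" where
  "nc_eval p = (\<Sum>(c, w)\<leftarrow>p. c *\<^sub>C word x w)"

definition nc_mult :: "(complex \<times> 'i list) list \<Rightarrow> (complex \<times> 'i list) list \<Rightarrow> (complex \<times> 'i list) list" where
  "nc_mult p q = concat (map (\<lambda>(c, w). map (\<lambda>(d, u). (c * d, w @ u)) q) p)"

definition nc_split :: "'i \<Rightarrow> 'h bop \<Rightarrow> 'h bop \<Rightarrow> (complex \<times> 'i list) list \<Rightarrow> complex" where
  "nc_split k L R p = (\<Sum>(c, w)\<leftarrow>p. c * split_sum k L R w)"

definition nc_polys :: "(complex \<times> 'i list) list set" where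
  "nc_polys = lists (UNIV \<times> lists J)"

lemma nc_simps [simp]:
  "nc_eval [] = 0" "nc_eval ((c, w) # p) = c *\<^sub>C word x w + nc_eval p"
  "nc_eval (p @ q) = nc_eval p + nc_eval q"
  "nc_split k L R [] = 0" "nc_split k L R ((c, w) # p) = c * split_sum k L R w + nc_split k L R p"
  "nc_split k L R (p @ q) = nc_split k L R p + nc_split k L R q"
  "nc_mult [] q = []" "nc_mult ((c, w) # p) q = map (\<lambda>(d, u). (c * d, w @ u)) q @ nc_mult p q"
  by (simp_all add: nc_eval_def nc_split_def nc_mult_def)

lemma nc_polys_simps [simp]:
  "[] \<in> nc_polys" "(c, w) # p \<in> nc_polys \<longleftrightarrow> w \<in> lists J \<and> p \<in> nc_polys"
  "p @ q \<in> nc_polys \<longleftrightarrow> p \<in> nc_polys \<and> q \<in> nc_polys"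
  by (auto simp: nc_polys_def)

lemma nc_polys_induct [consumes 1, case_names Nil Cons]:
  assumes "p \<in> nc_polys" "P []"
    and "\<And>c w p. w \<in> lists J \<Longrightarrow> p \<in> nc_polys \<Longrightarrow> P p \<Longrightarrow> P ((c, w) # p)"
  shows "P p"
  using assms(1)
proof (induction p)
  case (Cons cw p)
  then show ?case using assms(3) by (cases cw) auto
qed (rule assms(2))

lemma nc_eval_in [simp, intro]: "p \<in> nc_polys \<Longrightarrow> nc_eval p \<in> M"
  by (induction rule: nc_polys_induct) auto

lemma scaleC_bop_zero [simp]: "c *\<^sub>C (0::'h bop) = 0"
  by (rule bop_eqI) simp

lemma nc_eval_monom_mult:
  "nc_eval (map (\<lambda>(d, u). (c * d, w @ u)) q) = c *\<^sub>C (word x w * nc_eval q)"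
  by (induction q) (auto simp: bop_algebra distrib_left)

lemma nc_eval_mult: "nc_eval (nc_mult p q) = nc_eval p * nc_eval q"
  by (induction p) (auto simp: nc_eval_monom_mult bop_algebra distrib_right)

lemma nc_polys_monom_mult:
  "q \<in> nc_polys \<Longrightarrow> w \<in> lists J \<Longrightarrow> map (\<lambda>(d, u). (c * d, w @ u)) q \<in> nc_polys"
  by (induction rule: nc_polys_induct) auto

lemma nc_mult_in [simp, intro]: "p \<in> nc_polys \<Longrightarrow> q \<in> nc_polys \<Longrightarrow> nc_mult p q \<in> nc_polys"
  by (induction rule: nc_polys_induct) (auto simp: nc_polys_monom_mult)

lemma split_sum_scaleC_right:
  "u \<in> lists J \<Longrightarrow> R \<in> M \<Longrightarrow> split_sum k L (c *\<^sub>C R) u = c * split_sum k L R u"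
  by (induction u arbitrary: L) (auto simp: \<phi>_scaleC distrib_left bop_algebra)

lemma split_sum_zero_right: "u \<in> lists J \<Longrightarrow> split_sum k L 0 u = 0"
  using split_sum_scaleC_right[of u 0 k L 0] by simp

lemma split_sum_scaleC_left:
  "u \<in> lists J \<Longrightarrow> L \<in> M \<Longrightarrow> split_sum k (c *\<^sub>C L) R u = c * split_sum k L R u"
  by (induction u arbitrary: L) (auto simp: \<phi>_scaleC distrib_left bop_algebra)

lemma split_sum_add_left:
  "u \<in> lists J \<Longrightarrow> L \<in> M \<Longrightarrow> L' \<in> M \<Longrightarrow>
    split_sum k (L + L') R u = split_sum k L R u + split_sum k L' R u"
  by (induction u arbitrary: L L') (auto simp: \<phi>_add algebra_simps)

lemma nc_split_scaleC_left:
  "p \<in> nc_polys \<Longrightarrow> L \<in> M \<Longrightarrow> nc_split k (c *\<^sub>C L) R p = c * nc_split k L R p"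
  by (induction rule: nc_polys_induct) (auto simp: split_sum_scaleC_left algebra_simps)

lemma nc_split_add_left:
  "p \<in> nc_polys \<Longrightarrow> L \<in> M \<Longrightarrow> L' \<in> M \<Longrightarrow> nc_split k (L + L') R p = nc_split k L R p + nc_split k L' R p"
  by (induction rule: nc_polys_induct) (auto simp: split_sum_add_left algebra_simps)

lemma nc_split_zero_left: "p \<in> nc_polys \<Longrightarrow> nc_split k 0 R p = 0"
  using nc_split_scaleC_left[of p 0 k 0 R] by simp

lemma nc_split_monom_mult:
  assumes "q \<in> nc_polys" "w \<in> lists J" "L \<in> M" "R \<in> M"
  shows "nc_split k L R (map (\<lambda>(d, u). (c * d, w @ u)) q) =
    c * (split_sum k L (nc_eval q * R) w + nc_split k (L * word x w) R q)"
  using assms(1)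
proof (induction rule: nc_polys_induct)
  case Nil
  then show ?case using assms by (simp add: split_sum_zero_right)
next
  case (Cons d u q)
  then show ?case using assms
    by (simp add: split_sum_append distrib_right split_sum_add bop_algebra split_sum_scaleC_right)
      (simp add: algebra_simps)
qed

text \<open>Leibniz rule of the free difference quotient: the distinguished letter is taken from the
  first or from the second factor.\<close>

lemma nc_split_mult:
  assumes "p \<in> nc_polys" "q \<in> nc_polys" "L \<in> M" "R \<in> M"
  shows "nc_split k L R (nc_mult p q) = nc_split k L (nc_eval q * R) p + nc_split k (L * nc_eval p) R q"
  using assms(1)
proof (induction rule: nc_polys_induct)
  case Nil
  then show ?case using assms by (simp add: nc_split_zero_left)
next
  case (Cons c w p)
  then show ?case using assms
    by (simp add: nc_split_monom_mult distrib_left nc_split_add_left bop_algebra nc_split_scaleC_left)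
qed

lemma schwinger_dyson:
  assumes "p \<in> nc_polys" "i \<in> J"
  shows "\<phi> (x i * nc_eval p) = complex_of_real (v i) * nc_split i 1 1 p"
  using assms(1)
proof (induction rule: nc_polys_induct)
  case Nil
  then show ?case using \<phi>_scaleC[of 0 0] by simp
next
  case (Cons c w p)
  then show ?case using assms(2)
    by (simp add: distrib_left \<phi>_add \<phi>_scaleC bop_algebra schwinger_dyson_word algebra_simps)
qed

fun nc_power :: "(complex \<times> 'i list) list \<Rightarrow> nat \<Rightarrow> (complex \<times> 'i list) list" where
  "nc_power p 0 = [(1, [])]"
| "nc_power p (Suc n) = nc_mult p (nc_power p n)"

lemma nc_power_in [simp, intro]: "p \<in> nc_polys \<Longrightarrow> nc_power p n \<in> nc_polys"
  by (induction n) auto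

lemma nc_eval_power [simp]: "nc_eval (nc_power p n) = nc_eval p ^ n"
  by (induction n) (auto simp: nc_eval_mult bop_algebra)

text \<open>Iterated Leibniz rule: the distinguished letter sits in one of the factors, with
  \<open>i\<close> factors to its left.\<close>

lemma nc_split_power:
  assumes "p \<in> nc_polys" "L \<in> M" "R \<in> M"
  shows "nc_split k L R (nc_power p n) =
    (\<Sum>i<n. nc_split k (L * nc_eval p ^ i) (nc_eval p ^ (n - Suc i) * R) p)"
  using assms(2)
proof (induction n arbitrary: L)
  case (Suc n)
  have "nc_split k L R (nc_power p (Suc n)) =
      nc_split k L (nc_eval p ^ n * R) p + nc_split k (L * nc_eval p) R (nc_power p n)"
    using assms Suc by (simp add: nc_split_mult)
  also have "nc_split k (L * nc_eval p) R (nc_power p n) =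
      (\<Sum>i<n. nc_split k (L * nc_eval p ^ Suc i) (nc_eval p ^ (n - Suc i) * R) p)"
    using Suc assms by (simp add: mult.assoc)
  finally show ?case by (simp add: sum.lessThan_Suc_shift del: sum.lessThan_Suc)
qed simp

end

section \<open>Free cumulants of a quadratic form in semicircular letters\<close>

lemma sum_list_upt: "(\<Sum>k\<leftarrow>[0..<n]. f k) = (\<Sum>k<n. (f k :: 'b::comm_monoid_add))"
  by (induction n) (auto simp: add.commute)

lemma sum_delta_lt:
  fixes n :: nat
  shows
  "(\<Sum>p<n. (if p = k then f p else 0)) = (if k < n then f k else (0::'b::comm_monoid_add))"
  "(\<Sum>p<n. (if k = p then f p else 0)) = (if k < n then f k else (0::'b::comm_monoid_add))"
  by (simp_all add: sum.delta sum.delta')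

lemma mat_power_1: "k < n \<Longrightarrow> mat_power n a (Suc 0) k l = a k l"
  by (simp add: mat_mult_def mult_delta_left sum_delta_lt)

text \<open>\<open>None\<close> is the letter reserved for \<open>A\<close>; the letters
  \<open>Some k\<close> stand for normalised increments of the Brownian motion. One Wick family for
  both lets a single computation treat \<open>A\<close> together with the integral.\<close>

locale quadratic_form = wick_family M \<phi> "insert None (Some ` {..<n})" x v
  for M :: "'h::chilbert_space bop set" and \<phi> :: "'h bop \<Rightarrow> complex"
    and n :: nat and x :: "nat option \<Rightarrow> 'h bop" and v :: "nat option \<Rightarrow> real" +
  fixes c :: real and a :: "nat \<Rightarrow> nat \<Rightarrow> real"
  assumes v_Some [simp]: "v (Some k) = 1"
    and a_sym: "a k l = a l k"
begin

definition Y :: "'h bop" where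
  "Y = c *\<^sub>R x None + (\<Sum>k<n. \<Sum>l<n. a k l *\<^sub>R (x (Some k) * x (Some l))) - (\<Sum>k<n. a k k) *\<^sub>R 1"

text \<open>The presentation of \<open>Y\<close> by monomials to which the Schwinger-Dyson equation
  for polynomials applies.\<close>

definition poly_Y :: "(complex \<times> nat option list) list" where
  "poly_Y = (complex_of_real c, [None]) # (complex_of_real (- (\<Sum>k<n. a k k)), []) #
     concat (map (\<lambda>k. map (\<lambda>l. (complex_of_real (a k l), [Some k, Some l])) [0..<n]) [0..<n])"

lemma nc_eval_concat: "nc_eval (concat ps) = (\<Sum>p\<leftarrow>ps. nc_eval p)"
  by (induction ps) auto

lemma nc_split_concat: "nc_split k L R (concat ps) = (\<Sum>p\<leftarrow>ps. nc_split k L R p)"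
  by (induction ps) auto

lemma nc_eval_map: "nc_eval (map (\<lambda>i. (f i, g i)) is) = (\<Sum>i\<leftarrow>is. f i *\<^sub>C word x (g i))"
  by (induction "is") auto

lemma nc_split_map: "nc_split k L R (map (\<lambda>i. (f i, g i)) is) = (\<Sum>i\<leftarrow>is. f i * split_sum k L R (g i))"
  by (induction "is") auto

lemma poly_Y_in [simp]: "poly_Y \<in> nc_polys"
  by (auto simp: poly_Y_def nc_polys_def)

lemma nc_eval_poly_Y [simp]: "nc_eval poly_Y = Y"
  by (simp add: poly_Y_def Y_def nc_eval_concat nc_eval_map comp_def sum_list_upt bop_scaleR_scaleC)
    (simp add: bop_algebra)

lemma Y_in [simp]: "Y \<in> M"
  using nc_eval_in[OF poly_Y_in] by simp

lemma nc_split_poly_Y_None: "nc_split None L R poly_Y = complex_of_real c * (\<phi> L * \<phi> R)"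
  by (simp add: poly_Y_def nc_split_concat nc_split_map comp_def sum_list_upt)

text \<open>The letter occurs in the first or in the second place of a quadratic monomial; symmetry
  of \<open>a\<close> brings both cases to the same row \<open>p\<close>.\<close>

lemma nc_split_poly_Y_Some:
  assumes "p < n"
  shows "nc_split (Some p) L R poly_Y =
    (\<Sum>l<n. complex_of_real (a p l) * (\<phi> L * \<phi> (x (Some l) * R) + \<phi> (L * x (Some l)) * \<phi> R))"
proof -
  have "nc_split (Some p) L R poly_Y = (\<Sum>k<n. \<Sum>l<n.
      (if k = p then complex_of_real (a k l) * (\<phi> L * \<phi> (x (Some l) * R)) else 0) +
      (if l = p then complex_of_real (a k l) * (\<phi> (L * x (Some k)) * \<phi> R) else 0))"
    by (simp add: poly_Y_def nc_split_concat nc_split_map comp_def sum_list_upt)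
      (intro sum.cong refl, simp add: distrib_left)
  also have "\<dots> = (\<Sum>k<n. \<Sum>l<n. if k = p then complex_of_real (a k l) * (\<phi> L * \<phi> (x (Some l) * R)) else 0) +
      (\<Sum>k<n. \<Sum>l<n. if l = p then complex_of_real (a k l) * (\<phi> (L * x (Some k)) * \<phi> R) else 0)"
    by (simp only: sum.distrib)
  also have "(\<Sum>k<n. \<Sum>l<n. if k = p then complex_of_real (a k l) * (\<phi> L * \<phi> (x (Some l) * R)) else 0) =
      (\<Sum>l<n. complex_of_real (a p l) * (\<phi> L * \<phi> (x (Some l) * R)))"
    by (subst sum.swap) (simp add: sum_delta_lt assms)
  also have "(\<Sum>k<n. \<Sum>l<n. if l = p then complex_of_real (a k l) * (\<phi> (L * x (Some k)) * \<phi> R) else 0) =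
      (\<Sum>k<n. complex_of_real (a p k) * (\<phi> (L * x (Some k)) * \<phi> R))"
    by (simp add: sum_delta_lt assms a_sym[of p])
  finally show ?thesis by (simp add: sum.distrib distrib_left)
qed

definition m where "m r = \<phi> (Y ^ r)"

text \<open>These two-point functions close the system: the next moment of \<open>Y\<close> is
  expressed by them and by earlier moments, and their own equation involves only moments and
  two-point functions with fewer factors \<open>Y\<close>.\<close>

definition b where "b r k l = \<phi> (x (Some k) * (x (Some l) * Y ^ r))"

lemma sd_power:
  assumes "i \<in> insert None (Some ` {..<n})"
  shows "\<phi> (x i * Y ^ r) = complex_of_real (v i) * (\<Sum>j<r. nc_split i (Y ^ j) (Y ^ (r - Suc j)) poly_Y)"
  using schwinger_dyson[of "nc_power poly_Y r" i] assms by (simp add: nc_split_power)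

lemma None_moment: "\<phi> (x None * Y ^ r) = complex_of_real (v None * c) * (\<Sum>j<r. m j * m (r - Suc j))"
  by (simp add: sd_power nc_split_poly_Y_None m_def sum_distrib_left mult.assoc)

text \<open>A parity statement, since \<open>Y\<close> has even degree in the letters
  \<open>Some k\<close>. The Schwinger-Dyson equation reduces it to the same statement with fewer
  factors \<open>Y\<close>.\<close>

lemma Some_moment: "l < n \<Longrightarrow> \<phi> (x (Some l) * Y ^ r) = 0"
proof (induction r arbitrary: l rule: less_induct)
  case (less r)
  have "nc_split (Some l) (Y ^ j) (Y ^ (r - Suc j)) poly_Y = 0" if "j < r" for j
  proof -
    have "\<phi> (Y ^ j * x (Some p)) = \<phi> (x (Some p) * Y ^ j)" if "p < n" for p
      using that by (intro \<phi>_commute) auto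
    then show ?thesis using less that by (simp add: nc_split_poly_Y_Some)
  qed
  then show ?case using less.prems by (simp add: sd_power)
qed

text \<open>The letter \<open>Some k\<close> pairs either with \<open>x (Some l)\<close> or with a
  letter inside one of the factors \<open>Y\<close>. Of the two places in a quadratic monomial, one
  leaves unpaired letters on both sides and vanishes by parity.\<close>

lemma b_rec:
  assumes "k < n" "l < n"
  shows "b r k l = (if k = l then m r else 0) +
    (\<Sum>j<r. \<Sum>p<n. complex_of_real (a k p) * b j p l * m (r - Suc j))"
proof -
  let ?q = "nc_mult [(1, [Some l])] (nc_power poly_Y r)"
  have "nc_eval ?q = x (Some l) * Y ^ r" by (subst nc_eval_mult) (simp add: bop_algebra)
  then have "b r k l = \<phi> (x (Some k) * nc_eval ?q)" by (simp only: b_def)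
  also have "\<dots> = nc_split (Some k) 1 1 ?q"
  proof -
    have "?q \<in> nc_polys" by (rule nc_mult_in) (use assms in auto)
    then show ?thesis using schwinger_dyson[of ?q "Some k"] assms by simp
  qed
  also have "\<dots> = (if k = l then m r else 0) +
      (\<Sum>j<r. nc_split (Some k) (x (Some l) * Y ^ j) (Y ^ (r - Suc j)) poly_Y)"
    using assms by (subst nc_split_mult) (auto simp: nc_split_power m_def bop_algebra)
  also have "(\<Sum>j<r. nc_split (Some k) (x (Some l) * Y ^ j) (Y ^ (r - Suc j)) poly_Y) =
      (\<Sum>j<r. \<Sum>p<n. complex_of_real (a k p) * b j p l * m (r - Suc j))"
  proof (intro sum.cong refl)
    fix j
    have "\<phi> (x (Some l) * Y ^ j * x (Some p)) = b j p l" if "p < n" for p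
      unfolding b_def using that assms by (subst \<phi>_commute) auto
    then show "nc_split (Some k) (x (Some l) * Y ^ j) (Y ^ (r - Suc j)) poly_Y =
        (\<Sum>p<n. complex_of_real (a k p) * b j p l * m (r - Suc j))"
      using assms by (simp add: nc_split_poly_Y_Some Some_moment m_def mult.assoc)
  qed
  finally show ?thesis .
qed

lemma \<phi>_sum: "(\<And>i. i \<in> I \<Longrightarrow> f i \<in> M) \<Longrightarrow> \<phi> (sum f I) = (\<Sum>i\<in>I. \<phi> (f i))"
  by (induction I rule: infinite_finite_induct) (auto simp: \<phi>_add M_sum)

lemma m_Suc:
  "m (Suc r) = complex_of_real c * \<phi> (x None * Y ^ r) +
     (\<Sum>k<n. \<Sum>l<n. complex_of_real (a k l) * b r k l) - complex_of_real (\<Sum>k<n. a k k) * m r"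
proof -
  have sm: "sum f I * Z = (\<Sum>i\<in>I. f i * Z)" for f :: "nat \<Rightarrow> 'h bop" and I Z
    by (rule sum_distrib_right)
  have "Y * Y ^ r = c *\<^sub>R (x None * Y ^ r) +
      (\<Sum>k<n. \<Sum>l<n. a k l *\<^sub>R (x (Some k) * (x (Some l) * Y ^ r))) - (\<Sum>k<n. a k k) *\<^sub>R Y ^ r"
    by (subst Y_def) (simp add: left_diff_distrib distrib_right bop_algebra_real sm mult.assoc)
  moreover have "c *\<^sub>R (x None * Y ^ r) \<in> M" "(\<Sum>k<n. a k k) *\<^sub>R Y ^ r \<in> M" by auto
  moreover have "(\<Sum>k<n. \<Sum>l<n. a k l *\<^sub>R (x (Some k) * (x (Some l) * Y ^ r))) \<in> M"
    by (intro M_sum) auto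
  moreover have "\<phi> (\<Sum>k<n. \<Sum>l<n. a k l *\<^sub>R (x (Some k) * (x (Some l) * Y ^ r))) =
      (\<Sum>k<n. \<Sum>l<n. complex_of_real (a k l) * b r k l)"
    by (subst \<phi>_sum; (intro M_sum)?; (intro sum.cong refl)?; (subst \<phi>_sum)?; auto simp: \<phi>_scaleR b_def)
  ultimately show ?thesis by (simp add: m_def \<phi>_add \<phi>_diff \<phi>_scaleR)
qed

text \<open>The trace of the \<open>r\<close>th power of \<open>a\<close> times the matrix of
  generating series of \<open>b\<close>. Contracting the equation of \<open>b\<close> with that
  power gives the triangular system of the cumulants, with the traces of powers as the numbers to be
  read off.\<close>

definition T :: "nat \<Rightarrow> complex fps" where
  "T r = (\<Sum>k<n. \<Sum>l<n. fps_const (complex_of_real (mat_power n a r k l)) * Abs_fps (\<lambda>j. b j l k))"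

lemma fps_mult_nth_lessThan:
  "(fps_X * (f * g :: 'c::comm_ring_1 fps)) $ r = (\<Sum>j<r. f $ j * g $ (r - Suc j))"
proof (cases r)
  case (Suc r')
  have "(\<Sum>j<Suc r'. f $ j * g $ (r' - j)) = (\<Sum>j=0..r'. f $ j * g $ (r' - j))"
    by (rule sum.cong) auto
  also have "\<dots> = (f * g) $ r'" by (simp only: fps_mult_nth)
  finally show ?thesis by (simp add: Suc)
qed simp

lemma B_rec:
  assumes "k < n" "l < n"
  shows "Abs_fps (\<lambda>j. b j k l) = (if k = l then Abs_fps m else 0) +
    fps_X * (\<Sum>p<n. fps_const (complex_of_real (a k p)) * (Abs_fps (\<lambda>j. b j p l) * Abs_fps m))"
proof (rule fps_ext)
  fix r
  have "(\<Sum>j<r. \<Sum>p<n. complex_of_real (a k p) * b j p l * m (r - Suc j)) =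
      (\<Sum>p<n. complex_of_real (a k p) * (\<Sum>j<r. b j p l * m (r - Suc j)))"
    by (subst sum.swap) (simp add: sum_distrib_left mult.assoc)
  also have "\<dots> = (fps_X * (\<Sum>p<n. fps_const (complex_of_real (a k p)) * (Abs_fps (\<lambda>j. b j p l) * Abs_fps m))) $ r"
  proof -
    have "fps_X * (\<Sum>p<n. fps_const (complex_of_real (a k p)) * (Abs_fps (\<lambda>j. b j p l) * Abs_fps m)) =
      (\<Sum>p<n. fps_const (complex_of_real (a k p)) * (fps_X * (Abs_fps (\<lambda>j. b j p l) * Abs_fps m)))"
      by (simp add: sum_distrib_left mult_ac)
    then show ?thesis by (simp only: fps_sum_nth fps_mult_left_const_nth fps_mult_nth_lessThan) simp
  qed
  finally show "Abs_fps (\<lambda>j. b j k l) $ r = ((if k = l then Abs_fps m else 0) +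
    fps_X * (\<Sum>p<n. fps_const (complex_of_real (a k p)) * (Abs_fps (\<lambda>j. b j p l) * Abs_fps m))) $ r"
    using assms by (simp add: b_rec)
qed

lemma fps_const_sum: "fps_const (sum f I) = (\<Sum>i\<in>I. fps_const (f i :: complex))"
  by (induction I rule: infinite_finite_induct) (auto simp flip: fps_const_add)

lemma T_rec:
  "T r = fps_const (complex_of_real (mat_trace n (mat_power n a r))) * Abs_fps m + fps_X * Abs_fps m * T (Suc r)"
proof -
  let ?c = "\<lambda>t. fps_const (complex_of_real t)" and ?P = "mat_power n a r"
  have "T r = (\<Sum>k<n. \<Sum>l<n. ?c (?P k l) * (if l = k then Abs_fps m else 0)) +
     (\<Sum>k<n. \<Sum>l<n. ?c (?P k l) * (fps_X * (\<Sum>p<n. ?c (a l p) * (Abs_fps (\<lambda>j. b j p k) * Abs_fps m))))"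
    unfolding T_def by (simp add: B_rec distrib_left sum.distrib)
  also have "(\<Sum>k<n. \<Sum>l<n. ?c (?P k l) * (if l = k then Abs_fps m else 0)) =
      ?c (mat_trace n ?P) * Abs_fps m"
    by (simp add: mat_trace_def if_distrib sum_delta_lt fps_const_sum sum_distrib_right cong: if_cong)
  also have "(\<Sum>k<n. \<Sum>l<n. ?c (?P k l) * (fps_X * (\<Sum>p<n. ?c (a l p) * (Abs_fps (\<lambda>j. b j p k) * Abs_fps m)))) =
      fps_X * Abs_fps m * T (Suc r)"
  proof -
    have "(\<Sum>l<n. ?c (?P k l) * (fps_X * (\<Sum>p<n. ?c (a l p) * (Abs_fps (\<lambda>j. b j p k) * Abs_fps m)))) =
        fps_X * Abs_fps m * (\<Sum>p<n. ?c (mat_mult n ?P a k p) * Abs_fps (\<lambda>j. b j p k))" for k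
    proof -
      have "(\<Sum>l<n. ?c (?P k l) * (fps_X * (\<Sum>p<n. ?c (a l p) * (Abs_fps (\<lambda>j. b j p k) * Abs_fps m)))) =
          (\<Sum>l<n. \<Sum>p<n. fps_X * Abs_fps m * (?c (?P k l * a l p) * Abs_fps (\<lambda>j. b j p k)))"
        by (simp add: sum_distrib_left mult_ac flip: fps_const_mult)
      also have "\<dots> = (\<Sum>p<n. \<Sum>l<n. fps_X * Abs_fps m * (?c (?P k l * a l p) * Abs_fps (\<lambda>j. b j p k)))"
        by (rule sum.swap)
      also have "\<dots> = fps_X * Abs_fps m * (\<Sum>p<n. ?c (mat_mult n ?P a k p) * Abs_fps (\<lambda>j. b j p k))"
        unfolding mat_mult_def of_real_sum fps_const_sum sum_distrib_left sum_distrib_right ..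
      finally show ?thesis .
    qed
    then show ?thesis by (simp add: T_def sum_distrib_left)
  qed
  finally show ?thesis .
qed

text \<open>\<open>T\<close> solves the triangular system except at the two lowest orders:
  subtracting the trace in \<open>Y\<close> removes the first cumulant, and the letter
  \<open>None\<close> contributes its variance to the second.\<close>

theorem free_cumulant_Y:
  assumes "s \<ge> 1"
  shows "free_cumulant \<phi> s Y =
    complex_of_real (if s = 1 then 0 else mat_trace n (mat_power n a s) + (if s = 2 then c\<^sup>2 * v None else 0))"
proof -
  let ?M = "Abs_fps m"
  define \<kappa> where "\<kappa> s = complex_of_real (if s = 1 then 0 else mat_trace n (mat_power n a s) + (if s = 2 then c\<^sup>2 * v None else 0))" for s
  \<comment> \<open>\<open>t 2\<close> absorbs the contribution of \<open>x None\<close>;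
    \<open>t 1\<close> is then forced by the system with first cumulant 0.\<close>
  define t where "t s = (if s = 1 then fps_X * ?M * (fps_const (complex_of_real (c\<^sup>2 * v None)) * ?M + T 2)
      else if s = 2 then fps_const (complex_of_real (c\<^sup>2 * v None)) * ?M + T 2 else T s)" for s
  have "free_cumulant_of_moments m s = \<kappa> s"
  proof (rule free_cumulant_of_moments_unique[where t = t])
    show "m 0 = 1" by (simp add: m_def)
    show "Abs_fps m = 1 + fps_X * t 1"
    proof (rule fps_ext)
      fix r
      show "Abs_fps m $ r = (1 + fps_X * t 1) $ r"
      proof (cases r)
        case 0
        then show ?thesis by (simp add: m_def)
      next
        case (Suc r')
        have T1: "T 1 $ r' = (\<Sum>k<n. \<Sum>l<n. complex_of_real (a k l) * b r' k l)"
        proof -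
          have "mat_power n a 1 k l = a k l" if "k < n" for k l
            using mat_power_1[OF that] by simp
          then have "T 1 $ r' = (\<Sum>k<n. \<Sum>l<n. complex_of_real (a k l) * b r' l k)"
            by (simp add: T_def fps_sum_nth del: mat_power.simps One_nat_def)
          also have "\<dots> = (\<Sum>l<n. \<Sum>k<n. complex_of_real (a k l) * b r' l k)" by (rule sum.swap)
          finally show ?thesis by (simp add: a_sym)
        qed
        have tr1: "mat_trace n (mat_power n a 1) = (\<Sum>k<n. a k k)"
          by (simp add: mat_trace_def mat_power_1 del: mat_power.simps)
        have "(fps_X * ?M * T 2) $ r' = T 1 $ r' - complex_of_real (\<Sum>k<n. a k k) * m r'"
          using arg_cong[OF T_rec[of 1], of "\<lambda>f. f $ r'"] unfolding tr1 by (simp add: numeral_2_eq_2)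
        moreover have "(fps_X * ?M * (fps_const (complex_of_real (c\<^sup>2 * v None)) * ?M)) $ r' =
            complex_of_real c * \<phi> (x None * Y ^ r')"
        proof -
          have "fps_X * ?M * (fps_const (complex_of_real (c\<^sup>2 * v None)) * ?M) =
              fps_const (complex_of_real (c\<^sup>2 * v None)) * (fps_X * (?M * ?M))" by (simp add: mult_ac)
          then show ?thesis
            by (simp only: fps_mult_left_const_nth fps_mult_nth_lessThan None_moment)
              (simp add: power2_eq_square mult_ac)
        qed
        moreover have "t 1 = fps_X * ?M * (fps_const (complex_of_real (c\<^sup>2 * v None)) * ?M) + fps_X * ?M * T 2"
          by (simp add: t_def distrib_left)
        ultimately show ?thesis using T1 by (simp add: Suc m_Suc)
      qed
    qed
    show "t s = fps_const (\<kappa> s) * Abs_fps m + fps_X * Abs_fps m * t (Suc s)" if s1: "s \<ge> 1" for s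
    proof -
      consider "s = 1" | "s = 2" | "s \<ge> 3" using s1 by linarith
      then show ?thesis
      proof cases
        case 1
        then show ?thesis by (simp add: t_def \<kappa>_def numeral_2_eq_2)
      next
        case 2
        then show ?thesis using T_rec[of 2]
          by (simp add: t_def \<kappa>_def distrib_right add_ac flip: fps_const_add del: mat_power.simps)
      next
        case 3
        then show ?thesis using T_rec[of s] by (simp add: t_def \<kappa>_def del: mat_power.simps)
      qed
    qed
  qed fact
  moreover have "m = (\<lambda>k. \<phi> (Y ^ k))" by (auto simp: m_def)
  ultimately show ?thesis by (simp add: free_cumulant_def \<kappa>_def)
qed

end

section \<open>Semicircular elements\<close>

text \<open>Second kind, rescaled to variance \<open>v\<close>: for positive \<open>v\<close> this
  is sqrt v ^ n times U_n at t / (2 sqrt v). The recursive form remains meaningful for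
  \<open>v = 0\<close> and matches \<open>wick\<close> on constant words.\<close>

fun chebyshev :: "real \<Rightarrow> nat \<Rightarrow> real \<Rightarrow> real" where
  "chebyshev v 0 t = 1"
| "chebyshev v (Suc 0) t = t"
| "chebyshev v (Suc (Suc n)) t = t * chebyshev v (Suc n) t - v * chebyshev v n t"

lemma continuous_on_chebyshev [continuous_intros]: "continuous_on A (chebyshev v n)"
  by (induction v n "undefined :: real" rule: chebyshev.induct)
    (auto intro!: continuous_intros simp: fun_eq_iff)

lemma chebyshev_cos:
  assumes "v \<ge> 0"
  shows "chebyshev v n (2 * sqrt v * cos \<theta>) * sin \<theta> = sqrt v ^ n * sin (real (Suc n) * \<theta>)"
proof (induction n rule: induct_nat_012)
  case (ge2 n)
  have v: "v = sqrt v * sqrt v" using assms by simp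
  have "sin (real (Suc (Suc (Suc n))) * \<theta>) + sin (real (Suc n) * \<theta>) = 2 * (cos \<theta> * sin (real (Suc (Suc n)) * \<theta>))"
    using sin_add[of "real (Suc (Suc n)) * \<theta>" \<theta>] sin_diff[of "real (Suc (Suc n)) * \<theta>" \<theta>]
    by (simp add: algebra_simps)
  then have e: "sin (real (Suc (Suc (Suc n))) * \<theta>) = 2 * (cos \<theta> * sin (real (Suc (Suc n)) * \<theta>)) - sin (real (Suc n) * \<theta>)"
    by simp
  have "chebyshev v (Suc (Suc n)) (2 * sqrt v * cos \<theta>) * sin \<theta> =
      2 * sqrt v * cos \<theta> * (chebyshev v (Suc n) (2 * sqrt v * cos \<theta>) * sin \<theta>) -
      v * (chebyshev v n (2 * sqrt v * cos \<theta>) * sin \<theta>)"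
    by (simp add: algebra_simps)
  also have "\<dots> = 2 * sqrt v * cos \<theta> * (sqrt v ^ Suc n * sin (real (Suc (Suc n)) * \<theta>)) -
      sqrt v * sqrt v * (sqrt v ^ n * sin (real (Suc n) * \<theta>))"
    using ge2 v by simp
  also have "\<dots> = sqrt v ^ Suc (Suc n) * sin (real (Suc (Suc (Suc n))) * \<theta>)"
    unfolding e by (simp add: algebra_simps)
  finally show ?case .
qed (simp_all add: sin_double)

lemma semicircle_integral:
  fixes h :: "real \<Rightarrow> real"
  assumes v: "v > 0" and h: "continuous_on UNIV h"
  shows "integrable (semicircle_law v) h"
    and "(\<integral>t. h t \<partial>semicircle_law v) =
      integral {- 2 * sqrt v..2 * sqrt v} (\<lambda>t. h t * sqrt (4 * v - t\<^sup>2)) / (2 * pi * v)"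
proof -
  let ?I = "{- 2 * sqrt v..2 * sqrt v}"
  let ?g = "\<lambda>t. indicator ?I t * sqrt (4 * v - t\<^sup>2) / (2 * pi * v)"
  have hm: "h \<in> borel_measurable borel" using h by (rule borel_measurable_continuous_onI)
  have gm: "?g \<in> borel_measurable borel" by measurable
  have g0: "0 \<le> ?g t" for t
  proof (cases "t \<in> ?I")
    case True
    then have "t\<^sup>2 \<le> (2 * sqrt v)\<^sup>2" by (intro power2_le_iff_abs_le[THEN iffD2]) (use v in auto)
    then show ?thesis using v by (simp add: power_mult_distrib)
  qed simp
  have law: "semicircle_law v = density lborel (\<lambda>t. ennreal (?g t))"
    using v by (simp add: semicircle_law_def)
  have eq: "?g t *\<^sub>R h t = indicator ?I t *\<^sub>R (h t * sqrt (4 * v - t\<^sup>2) / (2 * pi * v))" for t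
    by simp
  have c: "continuous_on ?I (\<lambda>t. h t * sqrt (4 * v - t\<^sup>2) / (2 * pi * v))"
    using v by (intro continuous_intros continuous_on_subset[OF h]) auto
  have si: "set_integrable lborel ?I (\<lambda>t. h t * sqrt (4 * v - t\<^sup>2) / (2 * pi * v))"
    by (rule borel_integrable_atLeastAtMost'[OF c])
  show "integrable (semicircle_law v) h"
    unfolding law using si hm gm g0
    by (subst integrable_density) (auto simp: set_integrable_def mult_ac)
  have "(\<integral>t. h t \<partial>semicircle_law v) = (\<integral>t. ?g t *\<^sub>R h t \<partial>lborel)"
    unfolding law by (rule integral_density) (use hm gm g0 in auto)
  also have "\<dots> = (LINT t:?I|lborel. h t * sqrt (4 * v - t\<^sup>2) / (2 * pi * v))"
    unfolding eq set_lebesgue_integral_def ..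
  also have "\<dots> = integral ?I (\<lambda>t. h t * sqrt (4 * v - t\<^sup>2) / (2 * pi * v))"
    by (rule set_borel_integral_eq_integral(2)[OF si])
  also have "\<dots> = integral ?I (\<lambda>t. h t * sqrt (4 * v - t\<^sup>2)) / (2 * pi * v)"
    by (rule integral_divide)
  finally show "(\<integral>t. h t \<partial>semicircle_law v) =
      integral ?I (\<lambda>t. h t * sqrt (4 * v - t\<^sup>2)) / (2 * pi * v)" .
qed

text \<open>Substituting t = 2 sqrt v cos \<theta> leads, up to a constant, to the integral of sin
  ((n + 1) \<theta>) sin \<theta>, half a difference of two cosines with an explicit primitive that
  vanishes at 0 and \<pi>. Derivatives are taken in the open interval only, as arccos has infinite
  slope at the end points.\<close>

lemma integral_chebyshev:
  assumes v: "v > 0" and n: "n \<ge> 1"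
  shows "integral {- 2 * sqrt v..2 * sqrt v} (\<lambda>t. chebyshev v n t * sqrt (4 * v - t\<^sup>2)) = 0"
proof -
  define s where "s = 2 * sqrt v"
  have s: "s > 0" using v by (simp add: s_def)
  define g where "g \<theta> = sin (real n * \<theta>) / (2 * real n) - sin (real (n + 2) * \<theta>) / (2 * real (n + 2))" for \<theta>
  have d: "((\<lambda>\<theta>. sin (k * \<theta>) / (2 * k)) has_real_derivative cos (k * \<theta>) / 2) (at \<theta>)"
    if "k > 0" for k \<theta> :: real
    using that by (auto intro!: derivative_eq_intros)
  have g': "(g has_real_derivative sin (real (Suc n) * \<theta>) * sin \<theta>) (at \<theta>)" for \<theta>
  proof -
    have "(g has_real_derivative cos (real n * \<theta>) / 2 - cos (real (n + 2) * \<theta>) / 2) (at \<theta>)"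
      unfolding g_def by (intro DERIV_diff d) (use n in auto)
    moreover have "cos (real n * \<theta>) / 2 - cos (real (n + 2) * \<theta>) / 2 = sin (real (Suc n) * \<theta>) * sin \<theta>"
      using cos_add[of "real (Suc n) * \<theta>" \<theta>] cos_diff[of "real (Suc n) * \<theta>" \<theta>]
      by (simp add: algebra_simps)
    ultimately show ?thesis by simp
  qed
  have gc: "continuous_on A g" for A
    using g' by (meson DERIV_continuous continuous_at_imp_continuous_on)
  \<comment> \<open>The factor is - s ^ 2 times sqrt v ^ n: one s comes from the square root in the
    density, the other from dt, and the sign from the decrease of arccos.\<close>
  define F where "F t = - 4 * v * sqrt v ^ n * g (arccos (t / s))" for t
  have "((\<lambda>t. chebyshev v n t * sqrt (4 * v - t\<^sup>2)) has_integral (F s - F (- s))) {- s..s}"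
  proof (rule fundamental_theorem_of_calculus_interior)
    show "- s \<le> s" using s by simp
    show "continuous_on {- s..s} F" unfolding F_def
      by (intro continuous_intros continuous_on_compose2[OF gc[of UNIV]] continuous_on_arccos')
        (use s in \<open>auto simp: field_simps\<close>)
    fix t assume t: "t \<in> {- s<..<s}"
    define \<theta> where "\<theta> = arccos (t / s)"
    have ts: "- 1 < t / s" "t / s < 1" using t s by (auto simp: field_simps)
    have cos: "t = s * cos \<theta>" using ts s by (simp add: \<theta>_def)
    have sn: "sin \<theta> = sqrt (1 - (t / s)\<^sup>2)" using ts by (simp add: \<theta>_def sin_arccos)
    have sp: "sin \<theta> > 0"
      unfolding sn using ts by (simp add: abs_square_less_1 abs_if)
    have d: "((\<lambda>t. g (arccos (t / s))) has_real_derivative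
        sin (real (Suc n) * \<theta>) * sin \<theta> * (inverse (- sin \<theta>) * (1 / s))) (at t)"
    proof (rule DERIV_chain2[where f = g and g = "\<lambda>t. arccos (t / s)"])
      show "(g has_real_derivative sin (real (Suc n) * \<theta>) * sin \<theta>) (at (arccos (t / s)))"
        using g'[of \<theta>] by (simp add: \<theta>_def)
      show "((\<lambda>t. arccos (t / s)) has_real_derivative inverse (- sin \<theta>) * (1 / s)) (at t)"
      proof (rule DERIV_chain2[where f = arccos and g = "\<lambda>t. t / s"])
        show "(arccos has_real_derivative inverse (- sin \<theta>)) (at (t / s))"
          unfolding sn using ts by (rule DERIV_arccos)
        show "((\<lambda>t. t / s) has_real_derivative 1 / s) (at t)"
          using s by (auto intro!: derivative_eq_intros)
      qed
    qed
    have root: "sqrt (4 * v - t\<^sup>2) = s * sin \<theta>"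
    proof -
      have "4 * v - t\<^sup>2 = (s * sin \<theta>)\<^sup>2"
        using v unfolding cos by (simp add: power_mult_distrib sin_squared_eq s_def algebra_simps)
      then show ?thesis using s sp by simp
    qed
    have "chebyshev v n t * sqrt (4 * v - t\<^sup>2) = s * (chebyshev v n (2 * sqrt v * cos \<theta>) * sin \<theta>)"
      unfolding root using cos by (simp add: s_def)
    also have "\<dots> = s * (sqrt v ^ n * sin (real (Suc n) * \<theta>))"
      using v by (simp only: chebyshev_cos)
    finally have e: "chebyshev v n t * sqrt (4 * v - t\<^sup>2) = s * sqrt v ^ n * sin (real (Suc n) * \<theta>)" by simp
    have "(F has_real_derivative - 4 * v * sqrt v ^ n * (sin (real (Suc n) * \<theta>) * sin \<theta> * (inverse (- sin \<theta>) * (1 / s)))) (at t)"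
      unfolding F_def by (rule DERIV_cmult[OF d])
    moreover have "- 4 * v * sqrt v ^ n * (sin (real (Suc n) * \<theta>) * sin \<theta> * (inverse (- sin \<theta>) * (1 / s))) =
        chebyshev v n t * sqrt (4 * v - t\<^sup>2)"
    proof -
      have "4 * v = s * s" using v by (simp add: s_def)
      then show ?thesis unfolding e using sp s by (simp add: field_simps)
    qed
    ultimately show "(F has_vector_derivative chebyshev v n t * sqrt (4 * v - t\<^sup>2)) (at t)"
      by (simp add: has_real_derivative_iff_has_vector_derivative)
  qed
  moreover have "F s = 0" using s by (simp add: F_def g_def)
  moreover have "F (- s) = 0"
  proof -
    have "sin (real k * pi) = 0" for k by (rule sin_npi)
    from this[of n] this[of "n + 2"] have "g pi = 0" by (simp only: g_def)
    then show ?thesis using s by (simp add: F_def)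
  qed
  ultimately show ?thesis by (simp add: s_def integral_unique)
qed

text \<open>Includes the Dirac mass at \<open>v = 0\<close>, which is the law of \<open>A\<close>
  when \<open>\<mu>\<^sub>0\<close> is 0.\<close>

lemma semicircle_expectation:
  fixes h :: "real \<Rightarrow> real"
  assumes "v \<ge> 0" "continuous_on UNIV h"
  shows "integrable (semicircle_law v) h"
    and "n \<ge> 1 \<Longrightarrow> (\<integral>t. chebyshev v n t \<partial>semicircle_law v) = 0"
proof -
  have hm: "h \<in> borel_measurable borel" "chebyshev v n \<in> borel_measurable borel"
    using assms(2) by (auto intro!: borel_measurable_continuous_onI continuous_intros)
  show "integrable (semicircle_law v) h"
  proof (cases "v = 0")
    case True
    interpret prob_space "return borel (0 :: real)" by (rule prob_space_return) simp
    have "integrable (return borel 0) h"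
      by (rule integrable_const_bound[where B = "\<bar>h 0\<bar>"]) (use hm in \<open>auto simp: AE_return\<close>)
    then show ?thesis using True by (simp add: semicircle_law_def)
  next
    case False
    then show ?thesis using semicircle_integral(1)[of v h] assms by simp
  qed
  show "(\<integral>t. chebyshev v n t \<partial>semicircle_law v) = 0" if n: "n \<ge> 1"
  proof (cases "v = 0")
    case True
    have "chebyshev 0 (Suc k) 0 = 0" for k by (cases k) auto
    from this[of "n - 1"] show ?thesis using True hm n by (simp add: semicircle_law_def integral_return)
  next
    case False
    then show ?thesis
      using semicircle_integral(2)[of v "chebyshev v n"] integral_chebyshev[of v n] assms n
      by (simp add: continuous_on_chebyshev)
  qed
qed

context tracial_space
begin

lemma semicircular_wick:
  assumes sc: "semicircular M \<phi> (v i) (x i)" and v: "v i \<ge> 0" and n: "n \<ge> 1"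
  shows "\<phi> (wick x v (replicate n i)) = 0"
proof -
  have X: "x i \<in> M" "\<And>k. \<phi> (x i ^ k) = complex_of_real (\<integral>t. t ^ k \<partial>semicircle_law (v i))"
    using sc by (auto simp: semicircular_def)
  have in_M: "wick x v (replicate n i) \<in> M" for n
    by (induction n rule: induct_nat_012) (use X in auto)
  have int: "integrable (semicircle_law (v i)) (\<lambda>t. t ^ j * chebyshev (v i) n t)" for j n
    by (rule semicircle_expectation(1)[OF v]) (intro continuous_intros)
  \<comment> \<open>The power \<open>x i ^ j\<close> makes the claim stable under the recursion,
    which trades Chebyshev degree for an additional factor \<open>x i\<close>.\<close>
  have "\<phi> (x i ^ j * wick x v (replicate n i)) =
      complex_of_real (\<integral>t. t ^ j * chebyshev (v i) n t \<partial>semicircle_law (v i))" for j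
  proof (induction n arbitrary: j rule: induct_nat_012)
    case 0
    then show ?case using X by simp
  next
    case 1
    then show ?case using X(2)[of "Suc j"] by (simp add: power_commutes mult.commute)
  next
    case (ge2 n)
    have "x i ^ j * wick x v (replicate (Suc (Suc n)) i) =
        x i ^ Suc j * wick x v (replicate (Suc n) i) - v i *\<^sub>R (x i ^ j * wick x v (replicate n i))"
      by (simp add: right_diff_distrib bop_algebra_real mult.assoc[symmetric] power_commutes)
    then have "\<phi> (x i ^ j * wick x v (replicate (Suc (Suc n)) i)) =
        \<phi> (x i ^ Suc j * wick x v (replicate (Suc n) i)) - complex_of_real (v i) * \<phi> (x i ^ j * wick x v (replicate n i))"
      using X in_M[of n] in_M[of "Suc n"]
      by (simp add: \<phi>_diff bop_scaleR_scaleC \<phi>_scaleC del: replicate_Suc power_Suc)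
    also have "\<dots> = complex_of_real ((\<integral>t. t ^ Suc j * chebyshev (v i) (Suc n) t \<partial>semicircle_law (v i)) -
        v i * (\<integral>t. t ^ j * chebyshev (v i) n t \<partial>semicircle_law (v i)))"
      using ge2 by (simp del: replicate_Suc power_Suc)
    also have "(\<integral>t. t ^ Suc j * chebyshev (v i) (Suc n) t \<partial>semicircle_law (v i)) -
        v i * (\<integral>t. t ^ j * chebyshev (v i) n t \<partial>semicircle_law (v i)) =
       (\<integral>t. t ^ Suc j * chebyshev (v i) (Suc n) t - v i * (t ^ j * chebyshev (v i) n t) \<partial>semicircle_law (v i))"
      using int[of "Suc j" "Suc n"] int[of j n]
      by (subst Bochner_Integration.integral_diff) (simp_all del: power_Suc)
    also have "(\<lambda>t. t ^ Suc j * chebyshev (v i) (Suc n) t - v i * (t ^ j * chebyshev (v i) n t)) =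
        (\<lambda>t. t ^ j * chebyshev (v i) (Suc (Suc n)) t)"
      by (auto simp: algebra_simps)
    finally show ?case .
  qed
  from this[of 0] show ?thesis using semicircle_expectation(2)[of "v i" "\<lambda>_. 0" n] v n by simp
qed

end

text \<open>Homogeneity of Wick powers, for passing from increments of variance t - s to normalised
  letters of variance 1.\<close>

lemma wick_replicate_scaleR:
  fixes x y :: "_ \<Rightarrow> 'h::chilbert_space bop"
  assumes "y i = r *\<^sub>R x j" "w i = r\<^sup>2 * v j"
  shows "wick y w (replicate n i) = r ^ n *\<^sub>R wick x v (replicate n j)"
proof (induction n rule: induct_nat_012)
  case (ge2 n)
  then show ?case using assms
    by (simp add: bop_algebra_real scaleR_right_diff_distrib power2_eq_square mult_ac)
qed (use assms in simp_all)

section \<open>Free Brownian motion\<close>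

text \<open>Contractions join equal neighbours only, so a Wick word factorises wherever the letter
  changes.\<close>

lemma wick_append:
  assumes "u \<noteq> []" "w \<noteq> []" "last u \<noteq> hd w"
  shows "wick x v (u @ w) = wick x v u * wick x v w"
  using assms
proof (induction u rule: induct_list012)
  case (2 i)
  then show ?case by (cases w) auto
next
  case (3 i j u)
  have "wick x v (u @ w) = wick x v u * wick x v w" if "i = j"
    using 3 by (cases "u = []") auto
  then show ?case using 3
    by (auto simp: left_diff_distrib mult.assoc bop_algebra_real)
qed auto

lemma star_algebra_scaleR: "X \<in> star_algebra_generated G \<Longrightarrow> r *\<^sub>R X \<in> star_algebra_generated G"
  by (simp add: bop_scaleR_scaleC star_algebra_generated.scaleC)

lemma star_algebra_diff:
  assumes "X \<in> star_algebra_generated G" "Y \<in> star_algebra_generated G"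
  shows "X - Y \<in> star_algebra_generated G"
  using star_algebra_generated.add[OF assms(1) star_algebra_scaleR[OF assms(2), of "-1"]] by simp

lemma star_algebra_wick:
  "(\<And>i. i \<in> set w \<Longrightarrow> x i \<in> star_algebra_generated G) \<Longrightarrow> wick x v w \<in> star_algebra_generated G"
  by (induction w rule: induct_list012)
    (auto intro!: star_algebra_generated.intros(1,6) star_algebra_diff star_algebra_scaleR)

definition monochrome :: "('i \<Rightarrow> 'j) \<Rightarrow> 'i list \<Rightarrow> bool" where
  "monochrome col u \<longleftrightarrow> u \<noteq> [] \<and> (\<forall>i\<in>set u. col i = col (hd u))"

lemma monochromeD: "monochrome col u \<Longrightarrow> i \<in> set u \<Longrightarrow> col i = col (hd u)"
  and monochrome_nonempty: "monochrome col u \<Longrightarrow> u \<noteq> []"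
  unfolding monochrome_def by blast+

lemma monochrome_single: "monochrome col [i]"
  by (simp add: monochrome_def)

lemma monochrome_Cons:
  assumes u: "monochrome col u" and i: "col i = col (hd u)"
  shows "monochrome col (i # u)"
proof -
  have *: "col j = col i" if "j \<in> set (i # u)" for j
    using that monochromeD[OF u, of j] i[symmetric] by (cases "j = i") simp_all
  show ?thesis unfolding monochrome_def list.sel(1) using * by blast
qed

lemma monochrome_blocks:
  assumes "w \<noteq> []"
  shows "\<exists>us. w = concat us \<and> us \<noteq> [] \<and> (\<forall>u\<in>set us. monochrome col u) \<and>
    successively (\<lambda>u u'. col (hd u) \<noteq> col (hd u')) us"
  using assms
proof (induction w)
  case (Cons i w)
  show ?case
  proof (cases "w = []")
    case True
    then show ?thesis by (intro exI[of _ "[[i]]"]) (auto simp: monochrome_single)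
  next
    case False
    then obtain us where us: "w = concat us" "us \<noteq> []"
      "\<forall>u\<in>set us. monochrome col u"
      "successively (\<lambda>u u'. col (hd u) \<noteq> col (hd u')) us"
      using Cons by blast
    from us(2) obtain u us' where u: "us = u # us'" by (metis list.exhaust)
    show ?thesis
    proof (cases "col i = col (hd u)")
      case True
      then show ?thesis using us u
        by (intro exI[of _ "(i # u) # us'"]) (auto simp: successively_Cons monochrome_Cons)
    next
      case False
      then show ?thesis using us u
        by (intro exI[of _ "[i] # us"]) (auto simp: successively_Cons monochrome_single)
    qed
  qed
qed simp

lemma wick_concat:
  assumes "\<forall>u\<in>set us. monochrome col u"
    and "successively (\<lambda>u u'. col (hd u) \<noteq> col (hd u')) us"
  shows "wick x v (concat us) = prod_list (map (wick x v) us)"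
  using assms
proof (induction us)
  case (Cons u us)
  show ?case
  proof (cases us)
    case (Cons u' us')
    have "u \<noteq> []" "u' \<noteq> []" using Cons.prems(1) Cons monochrome_nonempty by auto
    moreover have "col (last u) = col (hd u)" by (rule monochromeD) (use Cons.prems \<open>u \<noteq> []\<close> in auto)
    moreover have "col (hd u) \<noteq> col (hd u')" using Cons.prems(2) Cons by (simp add: successively_Cons)
    ultimately have nn: "u \<noteq> []" and "col (last u) \<noteq> col (hd u')" "u' \<noteq> []" by auto
    then have h: "last u \<noteq> hd (concat us)" "concat us \<noteq> []" using Cons by auto
    then have "wick x v (concat (u # us)) = wick x v u * wick x v (concat us)"
      using wick_append[OF nn h(2,1)] by (simp only: concat.simps)
    moreover have "wick x v (concat us) = prod_list (map (wick x v) us)"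
    proof (rule Cons.IH)
      show "\<forall>u\<in>set us. monochrome col u" using Cons.prems(1) by simp
      show "successively (\<lambda>u u'. col (hd u) \<noteq> col (hd u')) us"
        using Cons.prems(2) \<open>us = u' # us'\<close> by (simp add: successively_Cons)
    qed
    ultimately show ?thesis by simp
  qed simp
qed simp

text \<open>Letters of the same colour belong to the same algebra of a free family; a Wick word is the
  alternating product of its monochrome blocks.\<close>

lemma wick_free:
  fixes col :: "'i \<Rightarrow> 'j"
  assumes free: "freely_independent \<phi> C G"
    and col: "\<And>i. i \<in> J \<Longrightarrow> col i \<in> C" "\<And>i. i \<in> J \<Longrightarrow> x i \<in> star_algebra_generated (G (col i))"
    and mono: "\<And>u. u \<in> lists J \<Longrightarrow> monochrome col u \<Longrightarrow> \<phi> (wick x v u) = 0"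
    and w: "w \<in> lists J" "w \<noteq> []"
  shows "\<phi> (wick x v w) = 0"
proof -
  obtain us where us: "w = concat us" "us \<noteq> []"
    "\<forall>u\<in>set us. monochrome col u"
    "successively (\<lambda>u u'. col (hd u) \<noteq> col (hd u')) us"
    using monochrome_blocks[OF w(2)] by blast
  have J: "u \<in> lists J" if "u \<in> set us" for u using that w(1) us(1) by auto
  have hdJ: "hd u \<in> J" if "u \<in> set us" for u
    using J[OF that] monochrome_nonempty us(3) that by (cases u) auto
  let ?js = "map (\<lambda>u. col (hd u)) us" and ?Xs = "map (wick x v) us"
  have "\<phi> (prod_list ?Xs) = 0"
  proof (rule free[unfolded freely_independent_def, rule_format, of ?Xs ?js], intro conjI allI impI)
    show "?Xs \<noteq> []" "length ?js = length ?Xs" using us by auto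
    show "set ?js \<subseteq> C" using col(1) hdJ by auto
  next
    fix l assume "l < length ?Xs"
    then have u: "us ! l \<in> set us" "l < length us" by auto
    have "x i \<in> star_algebra_generated (G (col (hd (us ! l))))" if "i \<in> set (us ! l)" for i
    proof -
      have "i \<in> J" using that J[OF u(1)] by auto
      moreover have "col i = col (hd (us ! l))" by (rule monochromeD) (use us(3) u that in auto)
      ultimately show ?thesis using col(2)[of i] by simp
    qed
    then show "?Xs ! l \<in> star_algebra_generated (G (?js ! l))"
      using u by (auto intro!: star_algebra_wick)
    show "\<phi> (?Xs ! l) = 0" using mono[OF J[OF u(1)]] us(3) u by auto
  next
    fix l assume "Suc l < length ?Xs"
    then show "?js ! l \<noteq> ?js ! Suc l"
      using us(4) by (auto simp: successively_conv_nth)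
  qed
  then show ?thesis using wick_concat[OF us(3,4), of x v] us(1) by simp
qed

text \<open>Each letter is its own colour, so a monochrome word is a constant word, and the claim
  reduces to the Chebyshev integrals of a single increment.\<close>

lemma (in tracial_space) brownian_increments_wick:
  assumes bm: "free_Brownian_motion M \<phi> S" and ts: "sorted_wrt (<) ts" "set ts \<subseteq> {0..}"
    and x: "\<And>i. i < length ts - 1 \<Longrightarrow>
      x i = (1 / sqrt (ts ! Suc i - ts ! i)) *\<^sub>R (S (ts ! Suc i) - S (ts ! i))"
    and w: "w \<in> lists {..<length ts - 1}" "w \<noteq> []"
  shows "\<phi> (wick x (\<lambda>_. 1) w) = 0"
proof (rule wick_free[where col = "\<lambda>i. i", OF _ _ _ _ w])
  show "freely_independent \<phi> {..<length ts - 1} (\<lambda>i. {S (ts ! Suc i) - S (ts ! i)})"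
    using bm ts by (simp add: free_Brownian_motion_def)
next
  fix i assume "i \<in> {..<length ts - 1}"
  then show "x i \<in> star_algebra_generated {S (ts ! Suc i) - S (ts ! i)}"
    by (simp add: x star_algebra_scaleR star_algebra_generated.generator)
next
  fix u assume u: "u \<in> lists {..<length ts - 1}" and mono: "monochrome (\<lambda>i. i) u"
  note ne = monochrome_nonempty[OF mono]
  define i where "i = hd u"
  have i: "i < length ts - 1" using u ne by (cases u) (auto simp: i_def)
  have rep: "u = replicate (length u) i"
    using monochromeD[OF mono] by (metis i_def replicate_length_same)
  have lt: "ts ! i < ts ! Suc i" and ge: "0 \<le> ts ! i"
    using i ts by (auto simp: sorted_wrt_nth_less subset_iff)
  let ?d = "ts ! Suc i - ts ! i"
  have sc: "semicircular M \<phi> ?d (S (ts ! Suc i) - S (ts ! i))"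
    using bm lt ge by (simp add: free_Brownian_motion_def)
  have z: "\<phi> (wick (\<lambda>_. S (ts ! Suc i) - S (ts ! i)) (\<lambda>_. ?d) (replicate (length u) i)) = 0"
    by (rule semicircular_wick) (use sc lt ne in \<open>auto simp: Suc_le_eq\<close>)
  have X: "S (ts ! Suc i) - S (ts ! i) \<in> M" using sc by (simp add: semicircular_def)
  have inM: "wick (\<lambda>_. S (ts ! Suc i) - S (ts ! i)) (\<lambda>_. ?d) (replicate n i) \<in> M" for n
    by (induction n rule: induct_nat_012) (use X in auto)
  have "wick x (\<lambda>_. 1) (replicate (length u) i) = (1 / sqrt ?d) ^ length u *\<^sub>R
      wick (\<lambda>_. S (ts ! Suc i) - S (ts ! i)) (\<lambda>_. ?d) (replicate (length u) i)"
    by (rule wick_replicate_scaleR) (use lt in \<open>auto simp: x[OF i] power_divide\<close>)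
  then have "\<phi> (wick x (\<lambda>_. 1) (replicate (length u) i)) = 0"
    using z inM by (simp add: bop_scaleR_scaleC \<phi>_scaleC)
  then show "\<phi> (wick x (\<lambda>_. 1) u) = 0" using rep by simp
qed auto

section \<open>Brownian motion and the free element \<open>A\<close> in a common enlargement\<close>

locale wigner_setting = M: tracial_space M \<phi> + N: tracial_space N \<psi>
  for M :: "'h::chilbert_space bop set" and \<phi> :: "'h bop \<Rightarrow> complex"
    and N :: "'k::chilbert_space bop set" and \<psi> :: "'k bop \<Rightarrow> complex" +
  fixes \<iota> :: "'h bop \<Rightarrow> 'k bop" and S :: "real \<Rightarrow> 'h bop" and W :: "(real \<Rightarrow> real) \<Rightarrow> 'h bop"
    and I\<^sub>2 :: "(real \<times> real \<Rightarrow> real) \<Rightarrow> 'h bop" and \<mu>\<^sub>0 :: real and A :: "'k bop"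
  assumes bm: "free_Brownian_motion M \<phi> S"
    and wigner: "wigner_integral M \<phi> S W"
    and I2: "continuous_linear_L2 M \<phi> (half_line \<Otimes>\<^sub>M half_line) symmetric_kernels I\<^sub>2"
    and I2_tensor: "h \<in> square_integrable half_line \<Longrightarrow>
      I\<^sub>2 (\<lambda>(x, y). h x * h y) = (W h)\<^sup>2 - (\<integral>t. (h t)\<^sup>2 \<partial>half_line) *\<^sub>R 1"
    and enl: "enlargement M \<phi> N \<psi> \<iota>"
    and A: "semicircular N \<psi> (\<mu>\<^sub>0\<^sup>2) A"
    and A_free: "freely_independent \<psi> UNIV (\<lambda>b. if b then {A} else \<iota> ` S ` {0..})"
begin

lemma \<iota>_in [simp]: "X \<in> M \<Longrightarrow> \<iota> X \<in> N"
  and \<iota>_one [simp]: "\<iota> 1 = 1"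
  and \<iota>_add: "X \<in> M \<Longrightarrow> Y \<in> M \<Longrightarrow> \<iota> (X + Y) = \<iota> X + \<iota> Y"
  and \<iota>_mult: "X \<in> M \<Longrightarrow> Y \<in> M \<Longrightarrow> \<iota> (X * Y) = \<iota> X * \<iota> Y"
  and \<iota>_scaleC: "X \<in> M \<Longrightarrow> \<iota> (c *\<^sub>C X) = c *\<^sub>C \<iota> X"
  and \<iota>_adj: "X \<in> M \<Longrightarrow> \<iota> (adj X) = adj (\<iota> X)"
  and \<psi>_\<iota>: "X \<in> M \<Longrightarrow> \<psi> (\<iota> X) = \<phi> X"
  using enl unfolding enlargement_def by (elim conjE; auto)+

lemma \<iota>_scaleR: "X \<in> M \<Longrightarrow> \<iota> (r *\<^sub>R X) = r *\<^sub>R \<iota> X"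
  by (simp add: bop_scaleR_scaleC \<iota>_scaleC)

lemma \<iota>_zero [simp]: "\<iota> 0 = 0"
  using \<iota>_scaleR[of 0 0] by simp

lemma \<iota>_diff: "X \<in> M \<Longrightarrow> Y \<in> M \<Longrightarrow> \<iota> (X - Y) = \<iota> X - \<iota> Y"
  using \<iota>_add[of X "(-1) *\<^sub>R Y"] \<iota>_scaleR[of Y "-1"] by simp

lemma \<iota>_power: "X \<in> M \<Longrightarrow> \<iota> (X ^ k) = \<iota> X ^ k"
  by (induction k) (auto simp: \<iota>_mult)

lemma \<iota>_sum: "(\<And>i. i \<in> I \<Longrightarrow> f i \<in> M) \<Longrightarrow> \<iota> (sum f I) = (\<Sum>i\<in>I. \<iota> (f i))"
proof (induction I rule: infinite_finite_induct)
  case (insert i I)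
  then show ?case by (simp add: \<iota>_add M.M_sum)
qed (use \<iota>_scaleR[of 0 0] in auto)

text \<open>Injectivity of the relabelling \<open>g\<close> preserves which neighbours are equal, so
  the same contractions occur on both sides.\<close>

lemma \<iota>_wick:
  assumes "\<And>i. i \<in> set w \<Longrightarrow> x i \<in> M \<and> y (g i) = \<iota> (x i) \<and> v (g i) = v' i" and "inj g"
  shows "wick x v' w \<in> M \<and> \<iota> (wick x v' w) = wick y v (map g w)"
  using assms(1)
proof (induction w rule: induct_list012)
  case (3 i j w)
  then show ?case using inj_eq[OF assms(2)]
    by (auto simp: \<iota>_diff \<iota>_mult \<iota>_scaleR)
qed auto

lemma S_in: "t \<ge> 0 \<Longrightarrow> S t \<in> M"
  and S_adj: "t \<ge> 0 \<Longrightarrow> adj (S t) = S t"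
  using bm by (auto simp: free_Brownian_motion_def)

text \<open>Freeness enters at two levels. Two colours separate \<open>A\<close> from the image of
  the Brownian motion; a word in the second colour is the image of a word in \<open>M\<close>, where
  the increments are free among themselves.\<close>

lemma joint_wick_family:
  fixes ts :: "real list"
  assumes ts: "sorted_wrt (<) ts" "set ts \<subseteq> {0..}"
    and y: "y None = A" "\<And>i. i < length ts - 1 \<Longrightarrow>
      y (Some i) = (1 / sqrt (ts ! Suc i - ts ! i)) *\<^sub>R (\<iota> (S (ts ! Suc i)) - \<iota> (S (ts ! i)))"
    and v: "v None = \<mu>\<^sub>0\<^sup>2" "\<And>i. v (Some i) = 1"
  shows "wick_family N \<psi> (insert None (Some ` {..<length ts - 1})) y v"
proof
  let ?n = "length ts - 1"
  define x where "x i = (1 / sqrt (ts ! Suc i - ts ! i)) *\<^sub>R (S (ts ! Suc i) - S (ts ! i))" for i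
  have ge: "0 \<le> ts ! i" if "i < length ts" for i using that ts(2) by (auto simp: subset_iff)
  have xM: "x i \<in> M" and yx: "y (Some i) = \<iota> (x i)" if "i < ?n" for i
    using that ge[of i] ge[of "Suc i"] by (auto simp: x_def y \<iota>_scaleR \<iota>_diff S_in)
  have yalg: "y (Some i) \<in> star_algebra_generated (\<iota> ` S ` {0..})" if "i < ?n" for i
    unfolding y(2)[OF that] using that ge[of i] ge[of "Suc i"]
    by (intro star_algebra_scaleR star_algebra_diff star_algebra_generated.generator) auto
  have AN: "A \<in> N" using A by (simp add: semicircular_def)
  show "y i \<in> N" if "i \<in> insert None (Some ` {..<?n})" for i
    using that xM yx y(1) AN by auto
  show "\<psi> (wick y v w) = 0" if w: "w \<in> lists (insert None (Some ` {..<?n}))" "w \<noteq> []" for w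
  proof (rule wick_free[where col = "\<lambda>i. i = None", OF A_free _ _ _ w])
    fix i assume "i \<in> insert None (Some ` {..<?n})"
    then show "y i \<in> star_algebra_generated (if i = None then {A} else \<iota> ` S ` {0..})"
      using yalg y(1) by (auto intro: star_algebra_generated.generator)
  next
    fix u assume u: "u \<in> lists (insert None (Some ` {..<?n}))" "monochrome (\<lambda>i. i = None) u"
    note ne = monochrome_nonempty[OF u(2)] and mono = monochromeD[OF u(2)]
    show "\<psi> (wick y v u) = 0"
    proof (cases "hd u = None")
      case True
      then have "u = replicate (length u) None" using mono by (metis replicate_length_same)
      moreover have "\<psi> (wick y v (replicate (length u) None)) = 0"
        by (rule N.semicircular_wick) (use A y v ne in \<open>auto simp: Suc_le_eq\<close>)
      ultimately show ?thesis by simp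
    next
      case False
      define u' where "u' = map the u"
      have "\<forall>i\<in>set u. \<exists>k. i = Some k" using mono False by auto
      then have uu: "u = map Some u'" unfolding u'_def by (auto simp: map_idI)
      have u'J: "u' \<in> lists {..<?n}" using u(1) uu by auto
      have w: "wick x (\<lambda>_. 1) u' \<in> M \<and> \<iota> (wick x (\<lambda>_. 1) u') = wick y v (map Some u')"
        by (rule \<iota>_wick) (use u'J xM yx v in auto)
      then have "\<psi> (wick y v u) = \<phi> (wick x (\<lambda>_. 1) u')" using uu \<psi>_\<iota> by metis
      also have "\<dots> = 0"
        by (rule M.brownian_increments_wick[OF bm ts _ u'J]) (use x_def ne uu in auto)
      finally show ?thesis .
    qed
  qed auto
qed

end

section \<open>Square-integrable functions\<close>

lemma square_integrableI:
  "f \<in> borel_measurable \<mu> \<Longrightarrow> integrable \<mu> (\<lambda>x. (f x)\<^sup>2) \<Longrightarrow> f \<in> square_integrable \<mu>"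
  by (simp add: square_integrable_def)

lemma square_integrableD:
  assumes "f \<in> square_integrable \<mu>"
  shows "f \<in> borel_measurable \<mu>" "integrable \<mu> (\<lambda>x. (f x)\<^sup>2)"
  using assms by (auto simp: square_integrable_def)

lemma square_integrable_mult:
  assumes "f \<in> square_integrable \<mu>" "g \<in> square_integrable \<mu>"
  shows "integrable \<mu> (\<lambda>x. f x * g x)"
proof (rule Bochner_Integration.integrable_bound)
  note [measurable] = square_integrableD(1)[OF assms(1)] square_integrableD(1)[OF assms(2)]
  show "integrable \<mu> (\<lambda>x. (f x)\<^sup>2 + (g x)\<^sup>2)"
    using assms by (intro Bochner_Integration.integrable_add square_integrableD)
  show "(\<lambda>x. f x * g x) \<in> borel_measurable \<mu>" by measurable
  have "\<bar>a * b\<bar> \<le> a\<^sup>2 + b\<^sup>2" for a b :: real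
  proof -
    have "2 * (\<bar>a\<bar> * \<bar>b\<bar>) \<le> a\<^sup>2 + b\<^sup>2" using sum_squares_bound[of "\<bar>a\<bar>" "\<bar>b\<bar>"] by (simp add: mult.assoc)
    moreover have "0 \<le> \<bar>a\<bar> * \<bar>b\<bar>" by simp
    ultimately show ?thesis unfolding abs_mult by linarith
  qed
  then show "AE x in \<mu>. norm (f x * g x) \<le> norm ((f x)\<^sup>2 + (g x)\<^sup>2)" by simp
qed

lemma square_integrable_add [intro]:
  assumes "f \<in> square_integrable \<mu>" "g \<in> square_integrable \<mu>"
  shows "(\<lambda>x. f x + g x) \<in> square_integrable \<mu>"
proof (rule square_integrableI)
  show "(\<lambda>x. f x + g x) \<in> borel_measurable \<mu>"
    using assms by (intro borel_measurable_add square_integrableD)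
  have "(\<lambda>x. (f x + g x)\<^sup>2) = (\<lambda>x. (f x)\<^sup>2 + (g x)\<^sup>2 + 2 * (f x * g x))"
    by (auto simp: power2_sum)
  then show "integrable \<mu> (\<lambda>x. (f x + g x)\<^sup>2)"
    using assms square_integrable_mult[OF assms] by (simp add: square_integrableD)
qed

lemma square_integrable_scale [intro]:
  "f \<in> square_integrable \<mu> \<Longrightarrow> (\<lambda>x. c * f x) \<in> square_integrable \<mu>"
  by (auto simp: square_integrable_def power_mult_distrib)

lemma square_integrable_diff [intro]:
  "f \<in> square_integrable \<mu> \<Longrightarrow> g \<in> square_integrable \<mu> \<Longrightarrow> (\<lambda>x. f x - g x) \<in> square_integrable \<mu>"
  using square_integrable_add[of f \<mu> "\<lambda>x. (-1) * g x"] square_integrable_scale[of g \<mu> "-1"] by simp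

lemma square_integrable_zero [intro]: "(\<lambda>x. 0) \<in> square_integrable \<mu>"
  by (simp add: square_integrable_def)

lemma square_integrable_sum [intro]:
  "(\<And>i. i \<in> I \<Longrightarrow> f i \<in> square_integrable \<mu>) \<Longrightarrow> (\<lambda>x. \<Sum>i\<in>I. f i x) \<in> square_integrable \<mu>"
  by (induction I rule: infinite_finite_induct) auto

lemma square_integrable_cong_AE:
  assumes "f \<in> square_integrable \<mu>" "g \<in> borel_measurable \<mu>" "AE x in \<mu>. f x = g x"
  shows "g \<in> square_integrable \<mu>"
proof (rule square_integrableI[OF assms(2)])
  have "AE x in \<mu>. (f x)\<^sup>2 = (g x)\<^sup>2" using assms(3) by auto
  then show "integrable \<mu> (\<lambda>x. (g x)\<^sup>2)"
    using square_integrableD[OF assms(1)] assms(2) by (subst integrable_cong_AE[symmetric]) auto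
qed

lemma indicator_square_integrable:
  assumes "A \<in> sets \<mu>" "emeasure \<mu> A < \<infinity>"
  shows "(indicator A :: _ \<Rightarrow> real) \<in> square_integrable \<mu>"
proof (rule square_integrableI)
  have "(\<lambda>x. (indicator A x)\<^sup>2) = (indicator A :: _ \<Rightarrow> real)" by (auto simp: indicator_def)
  then show "integrable \<mu> (\<lambda>x. (indicator A x :: real)\<^sup>2)" using assms by simp
qed (use assms in auto)

lemma L2_norm_measure_sq:
  "(L2_norm_measure \<mu> f)\<^sup>2 = (\<integral>x. (f x)\<^sup>2 \<partial>\<mu>)" "0 \<le> L2_norm_measure \<mu> f"
  by (simp_all add: L2_norm_measure_def)

lemma L2_cauchy_schwarz:
  assumes f: "f \<in> square_integrable \<mu>" and g: "g \<in> square_integrable \<mu>"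
  shows "\<bar>\<integral>x. f x * g x \<partial>\<mu>\<bar> \<le> L2_norm_measure \<mu> f * L2_norm_measure \<mu> g"
proof -
  let ?a = "\<integral>x. (f x)\<^sup>2 \<partial>\<mu>" and ?b = "\<integral>x. (g x)\<^sup>2 \<partial>\<mu>" and ?s = "\<integral>x. f x * g x \<partial>\<mu>"
  have nn: "0 \<le> ?a + 2 * (t * ?s) + t\<^sup>2 * ?b" for t
  proof -
    have "0 \<le> (\<integral>x. (f x + t * g x)\<^sup>2 \<partial>\<mu>)" by simp
    also have "(\<lambda>x. (f x + t * g x)\<^sup>2) = (\<lambda>x. (f x)\<^sup>2 + 2 * t * (f x * g x) + t\<^sup>2 * (g x)\<^sup>2)"
      by (auto simp: power2_sum power_mult_distrib mult_ac)
    also have "(\<integral>x. (f x)\<^sup>2 + 2 * t * (f x * g x) + t\<^sup>2 * (g x)\<^sup>2 \<partial>\<mu>) = ?a + 2 * t * ?s + t\<^sup>2 * ?b"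
      using f g square_integrable_mult[OF f g] by (simp add: square_integrableD)
    finally show ?thesis by (simp add: mult_ac)
  qed
  have "(cmod (complex_of_real ?s))\<^sup>2 \<le> ?a * ?b"
  proof (rule quadratic_orthogonal(2))
    fix c :: complex
    have "(Re c)\<^sup>2 * ?b \<le> (cmod c)\<^sup>2 * ?b" by (intro mult_right_mono) (auto simp: cmod_power2)
    then show "0 \<le> ?a + 2 * Re (c * complex_of_real ?s) + (cmod c)\<^sup>2 * ?b"
      using nn[of "Re c"] by simp
  qed simp
  then have "?s\<^sup>2 \<le> (L2_norm_measure \<mu> f * L2_norm_measure \<mu> g)\<^sup>2"
    by (simp add: power_mult_distrib L2_norm_measure_sq)
  then show ?thesis
    using abs_le_square_iff[of ?s "L2_norm_measure \<mu> f * L2_norm_measure \<mu> g"] L2_norm_measure_sq(2)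
    by (metis abs_of_nonneg mult_nonneg_nonneg)
qed

lemma L2_norm_triangle:
  assumes f: "f \<in> square_integrable \<mu>" and g: "g \<in> square_integrable \<mu>"
  shows "L2_norm_measure \<mu> (\<lambda>x. f x + g x) \<le> L2_norm_measure \<mu> f + L2_norm_measure \<mu> g"
proof (rule power2_le_imp_le)
  have "(L2_norm_measure \<mu> (\<lambda>x. f x + g x))\<^sup>2 = (\<integral>x. (f x)\<^sup>2 + 2 * (f x * g x) + (g x)\<^sup>2 \<partial>\<mu>)"
    by (simp add: L2_norm_measure_sq power2_sum algebra_simps)
  also have "\<dots> = (L2_norm_measure \<mu> f)\<^sup>2 + 2 * (\<integral>x. f x * g x \<partial>\<mu>) + (L2_norm_measure \<mu> g)\<^sup>2"
    using f g square_integrable_mult[OF f g] by (simp add: square_integrableD L2_norm_measure_sq)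
  also have "\<dots> \<le> (L2_norm_measure \<mu> f + L2_norm_measure \<mu> g)\<^sup>2"
    using L2_cauchy_schwarz[OF f g] by (simp add: power2_sum)
  finally show "(L2_norm_measure \<mu> (\<lambda>x. f x + g x))\<^sup>2 \<le> (L2_norm_measure \<mu> f + L2_norm_measure \<mu> g)\<^sup>2" .
qed (simp add: L2_norm_measure_sq)

lemma L2_norm_scale: "L2_norm_measure \<mu> (\<lambda>x. c * f x) = \<bar>c\<bar> * L2_norm_measure \<mu> f"
  by (simp add: L2_norm_measure_def power_mult_distrib real_sqrt_mult)

lemma L2_norm_commute: "L2_norm_measure \<mu> (\<lambda>x. f x - g x) = L2_norm_measure \<mu> (\<lambda>x. g x - f x)"
  by (simp add: L2_norm_measure_def power2_commute)

lemma L2_norm_sum: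
  assumes "\<And>i. i \<in> I \<Longrightarrow> f i \<in> square_integrable \<mu>"
  shows "L2_norm_measure \<mu> (\<lambda>x. \<Sum>i\<in>I. f i x) \<le> (\<Sum>i\<in>I. L2_norm_measure \<mu> (f i))"
  using assms
proof (induction I rule: infinite_finite_induct)
  case (insert i I)
  then have "L2_norm_measure \<mu> (\<lambda>x. f i x + (\<Sum>i\<in>I. f i x)) \<le>
      L2_norm_measure \<mu> (f i) + L2_norm_measure \<mu> (\<lambda>x. \<Sum>i\<in>I. f i x)"
    by (intro L2_norm_triangle) auto
  then show ?case using insert by simp
qed (simp_all add: L2_norm_measure_def)

lemma L2_norm_eq_0_AE:
  assumes "f \<in> square_integrable \<mu>" "L2_norm_measure \<mu> f = 0"
  shows "AE x in \<mu>. f x = 0"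
proof -
  have "(\<integral>x. (f x)\<^sup>2 \<partial>\<mu>) = 0" using assms(2) L2_norm_measure_sq(1)[of \<mu> f] by simp
  then show ?thesis using integral_nonneg_eq_0_iff_AE[OF square_integrableD(2)[OF assms(1)]] by simp
qed

lemma L2_dominated:
  assumes f: "f \<in> square_integrable \<mu>" and g: "\<And>n. g n \<in> borel_measurable \<mu>"
    and bd: "\<And>n x. x \<in> space \<mu> \<Longrightarrow> 0 \<le> g n x \<and> g n x \<le> f x"
    and lim: "\<And>x. x \<in> space \<mu> \<Longrightarrow> (\<lambda>n. g n x) \<longlonglongrightarrow> f x"
  shows "g n \<in> square_integrable \<mu>" and "(\<lambda>n. L2_norm_measure \<mu> (\<lambda>x. f x - g n x)) \<longlonglongrightarrow> 0"
proof -
  note [measurable] = square_integrableD(1)[OF f] g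
  show "g n \<in> square_integrable \<mu>" for n
  proof (rule square_integrableI[OF g Bochner_Integration.integrable_bound[OF square_integrableD(2)[OF f]]])
    show "AE x in \<mu>. norm ((g n x)\<^sup>2) \<le> norm ((f x)\<^sup>2)"
      using bd by (intro AE_I2) (auto intro: power_mono)
  qed measurable
  have "(\<lambda>n. \<integral>x. (f x - g n x)\<^sup>2 \<partial>\<mu>) \<longlonglongrightarrow> (\<integral>x. 0 \<partial>\<mu>)"
  proof (rule integral_dominated_convergence[where w = "\<lambda>x. (f x)\<^sup>2"])
    show "AE x in \<mu>. (\<lambda>n. (f x - g n x)\<^sup>2) \<longlonglongrightarrow> 0"
    proof (rule AE_I2)
      fix x assume "x \<in> space \<mu>"
      from tendsto_power[OF tendsto_diff[OF tendsto_const lim[OF this]], of "f x" 2]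
      show "(\<lambda>n. (f x - g n x)\<^sup>2) \<longlonglongrightarrow> 0" by simp
    qed
    show "AE x in \<mu>. norm ((f x - g n x)\<^sup>2) \<le> (f x)\<^sup>2" for n
      using bd by (intro AE_I2) (auto intro!: power_mono)
  qed (use square_integrableD[OF f] in auto)
  then show "(\<lambda>n. L2_norm_measure \<mu> (\<lambda>x. f x - g n x)) \<longlonglongrightarrow> 0"
    using tendsto_real_sqrt by (force simp: L2_norm_measure_def)
qed

text \<open>Takes the place of density theorems: whatever holds for indicators of a generating
  intersection-stable class of sets of finite measure and survives linear combinations and L2 limits
  holds on all of L2. All later approximation and orthogonality statements on the half-line and its
  square are instances.\<close>

lemma L2_induct:
  fixes f :: "'a \<Rightarrow> real"
  assumes gen: "sets \<mu> = sigma_sets (space \<mu>) G" "Int_stable G" "G \<subseteq> Pow (space \<mu>)"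
    and fin: "\<And>A. A \<in> G \<Longrightarrow> emeasure \<mu> A < \<infinity>"
    and exh: "\<And>n::nat. B n \<in> G" "incseq B" "(\<Union>n. B n) = space \<mu>"
    and base: "\<And>A. A \<in> G \<Longrightarrow> P (indicator A)"
    and add: "\<And>f g. f \<in> square_integrable \<mu> \<Longrightarrow> g \<in> square_integrable \<mu> \<Longrightarrow> P f \<Longrightarrow> P g \<Longrightarrow> P (\<lambda>x. f x + g x)"
    and scale: "\<And>c f. f \<in> square_integrable \<mu> \<Longrightarrow> P f \<Longrightarrow> P (\<lambda>x. c * f x)"
    and lim: "\<And>f. f \<in> square_integrable \<mu> \<Longrightarrow>
      (\<And>e. e > 0 \<Longrightarrow> \<exists>g\<in>square_integrable \<mu>. P g \<and> L2_norm_measure \<mu> (\<lambda>x. f x - g x) < e) \<Longrightarrow> P f"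
    and f: "f \<in> square_integrable \<mu>"
  shows "P f"
proof -
  \<comment> \<open>Pointwise approximation from below is approximation in L2, because the limit
    dominates the whole sequence.\<close>
  have mono_lim: "P f" if f: "f \<in> square_integrable \<mu>" and g: "\<And>n. g n \<in> borel_measurable \<mu>"
    and bd: "\<And>n x. x \<in> space \<mu> \<Longrightarrow> 0 \<le> g n x \<and> g n x \<le> f x"
    and l: "\<And>x. x \<in> space \<mu> \<Longrightarrow> (\<lambda>n. g n x) \<longlonglongrightarrow> f x" and P: "\<And>n. P (g n)"
    for f and g :: "nat \<Rightarrow> 'a \<Rightarrow> real"
  proof (rule lim[OF f])
    fix e :: real assume "e > 0"
    then obtain n where "\<bar>L2_norm_measure \<mu> (\<lambda>x. f x - g n x) - 0\<bar> < e"
      using LIMSEQ_D[OF L2_dominated(2)[OF f g bd l], of e] by auto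
    then show "\<exists>g\<in>square_integrable \<mu>. P g \<and> L2_norm_measure \<mu> (\<lambda>x. f x - g x) < e"
      using L2_dominated(1)[OF f g bd l, of n] P[of n] by (intro bexI[of _ "g n"]) auto
  qed
  have Gs: "A \<in> sets \<mu>" if "A \<in> G" for A using that gen(1) by auto
  have sub: "emeasure \<mu> (E \<inter> B i) < \<infinity>" if "E \<in> sets \<mu>" for E i
    using le_less_trans[OF emeasure_mono[of "E \<inter> B i" "B i" \<mu>] fin[OF exh(1)]] Gs[OF exh(1)] by auto
  have L2: "(indicator (E \<inter> B i) :: _ \<Rightarrow> real) \<in> square_integrable \<mu>" if "E \<in> sets \<mu>" for E i
    using that sub Gs[OF exh(1)] by (intro indicator_square_integrable) auto
  have P0: "P (\<lambda>x. 0)"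
  proof -
    have "(indicator (B 0) :: _ \<Rightarrow> real) \<in> square_integrable \<mu>"
      by (rule indicator_square_integrable[OF Gs[OF exh(1)] fin[OF exh(1)]])
    from scale[OF this base[OF exh(1)], of 0] show ?thesis by simp
  qed
  have diff: "P (\<lambda>x. f x - g x)" if "f \<in> square_integrable \<mu>" "g \<in> square_integrable \<mu>" "P f" "P g" for f g
    using add[OF that(1) square_integrable_scale[OF that(2), of "-1"] that(3) scale[OF that(2,4), of "-1"]]
    by simp
  \<comment> \<open>The Dynkin argument runs inside \<open>B i\<close>: complements of sets of
    finite measure may have infinite measure, and their indicators would leave L2.\<close>
  have ind_B: "P (indicator (E \<inter> B i))" if E: "E \<in> sets \<mu>" for E i
  proof -
    have "E \<in> sigma_sets (space \<mu>) G" using E gen(1) by simp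
    from gen(2,3) this show ?thesis
    proof (induction rule: sigma_sets_induct_disjoint)
      case (basic A)
      then show ?case using base[OF Int_stableD[OF gen(2) basic exh(1)]] by simp
    next
      case empty
      show ?case using P0 by (simp add: indicator_def[abs_def])
    next
      case (compl A)
      then have A: "A \<in> sets \<mu>" using gen(1) by simp
      have "(\<lambda>x. indicator (space \<mu> \<inter> B i) x - indicator (A \<inter> B i) x) = (indicator ((space \<mu> - A) \<inter> B i) :: _ \<Rightarrow> real)"
        using sets.sets_into_space[OF A] by (auto simp: indicator_def fun_eq_iff)
      moreover have "P (indicator (space \<mu> \<inter> B i))"
        using base[OF exh(1)[of i]] gen(3) exh(1)[of i] by (metis PowD Int_absorb1 subsetD)
      ultimately show ?case
        using diff[OF L2[of "space \<mu>" i] L2[OF A, of i]] compl by simp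
    next
      case (union A)
      then have A: "A n \<in> sets \<mu>" for n using gen(1) by auto
      have fin_sum: "P (indicator ((\<Union>k<n. A k) \<inter> B i)) " for n
      proof (induction n)
        case 0
        show ?case using P0 by (simp add: indicator_def[abs_def])
      next
        case (Suc n)
        have "(\<lambda>x. indicator ((\<Union>k<n. A k) \<inter> B i) x + indicator (A n \<inter> B i) x) =
            (indicator ((\<Union>k<Suc n. A k) \<inter> B i) :: _ \<Rightarrow> real)"
        proof
          fix x
          have "x \<notin> A n \<or> x \<notin> A k" if "k < n" for k
            using union(1) that unfolding disjoint_family_on_def by (metis disjoint_iff less_irrefl UNIV_I)
          then show "indicator ((\<Union>k<n. A k) \<inter> B i) x + indicator (A n \<inter> B i) x =
            (indicator ((\<Union>k<Suc n. A k) \<inter> B i) x :: real)"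
            by (auto simp: indicator_def less_Suc_eq)
        qed
        then show ?case using add[OF L2 L2 Suc union(3)[of n]] A by auto
      qed
      have "P (indicator ((\<Union>n. A n) \<inter> B i))"
      proof (rule mono_lim)
        show "(\<lambda>n. indicator ((\<Union>k<n. A k) \<inter> B i) x :: real) \<longlonglongrightarrow> indicator ((\<Union>n. A n) \<inter> B i) x" for x
        proof (cases "x \<in> (\<Union>n. A n) \<inter> B i")
          case True
          then obtain m where "x \<in> A m" by auto
          then have "\<forall>n\<ge>Suc m. indicator ((\<Union>k<n. A k) \<inter> B i) x = (indicator ((\<Union>n. A n) \<inter> B i) x :: real)"
            using True by (auto simp: indicator_def Suc_le_eq)
          then show ?thesis by (intro tendsto_eventually) (auto simp: eventually_sequentially)
        next
          case False
          then have "indicator ((\<Union>k<n. A k) \<inter> B i) x = (0 :: real)" for n by (auto simp: indicator_def)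
          then show ?thesis using False by simp
        qed
        show "0 \<le> (indicator ((\<Union>k<n. A k) \<inter> B i) x :: real) \<and>
            (indicator ((\<Union>k<n. A k) \<inter> B i) x :: real) \<le> indicator ((\<Union>n. A n) \<inter> B i) x" for n x
          by (auto simp: indicator_def)
      qed (use L2 fin_sum A Gs[OF exh(1)] in auto)
      then show ?case by simp
    qed
  qed
  have ind: "P (indicator E)" if E: "E \<in> sets \<mu>" and i: "(indicator E :: _ \<Rightarrow> real) \<in> square_integrable \<mu>" for E
  proof (rule mono_lim[OF i])
    fix x assume x: "x \<in> space \<mu>"
    obtain m where m: "x \<in> B m" using x exh(3) by auto
    have "\<forall>n\<ge>m. indicator (E \<inter> B n) x = (indicator E x :: real)"
      using m incseqD[OF exh(2)] by (auto simp: indicator_def)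
    then show "(\<lambda>n. indicator (E \<inter> B n) x :: real) \<longlonglongrightarrow> indicator E x"
      by (intro tendsto_eventually) (auto simp: eventually_sequentially)
  next
    show "P (indicator (E \<inter> B n))" for n using ind_B[OF E] .
  qed (use E Gs[OF exh(1)] in \<open>auto simp: indicator_def\<close>)
  have nonneg: "f \<in> square_integrable \<mu> \<longrightarrow> P f" if "f \<in> borel_measurable \<mu>" "\<And>x. 0 \<le> f x" for f
    using that
  proof (induction rule: borel_measurable_induct_real)
    case (set A)
    then show ?case using ind by simp
  next
    case (mult u c)
    show ?case
    proof
      assume c: "(\<lambda>x. c * u x) \<in> square_integrable \<mu>"
      show "P (\<lambda>x. c * u x)"
      proof (cases "c = 0")
        case False
        then have "u \<in> square_integrable \<mu>" using square_integrable_scale[OF c, of "1 / c"] by simp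
        then show ?thesis using mult scale by blast
      qed (use P0 in simp)
    qed
  next
    case (add u v)
    show ?case
    proof
      assume uv: "(\<lambda>x. v x + u x) \<in> square_integrable \<mu>"
      have "w \<in> square_integrable \<mu>" if "w \<in> borel_measurable \<mu>" "\<And>x. 0 \<le> w x \<and> w x \<le> v x + u x" for w
      proof (rule square_integrableI[OF that(1) Bochner_Integration.integrable_bound[OF square_integrableD(2)[OF uv]]])
        show "(\<lambda>x. (w x)\<^sup>2) \<in> borel_measurable \<mu>" using that(1) by measurable
        show "AE x in \<mu>. norm ((w x)\<^sup>2) \<le> norm ((v x + u x)\<^sup>2)"
          using that(2) by (auto intro!: power_mono)
      qed
      from this[of u] this[of v] show "P (\<lambda>x. v x + u x)"
        using add assms(9)[of v u] by simp
    qed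
  next
    case (seq U)
    show ?case
    proof
      assume u: "f \<in> square_integrable \<mu>"
      have le: "U i x \<le> f x" if "x \<in> space \<mu>" for i x
        using seq.hyps that by (intro incseq_le) (auto simp: incseq_def le_fun_def)
      show "P f"
      proof (rule mono_lim[OF u])
        show "P (U n)" for n
          using seq.IH[of n] L2_dominated(1)[OF u, of U n] seq.hyps le by blast
      qed (use seq.hyps le in auto)
    qed
  qed
  have part: "(\<lambda>x. max 0 (s * f x)) \<in> square_integrable \<mu>" if "\<bar>s\<bar> = 1" for s
  proof (rule square_integrableI)
    note [measurable] = square_integrableD(1)[OF f]
    show "(\<lambda>x. max 0 (s * f x)) \<in> borel_measurable \<mu>" by measurable
    have "(max 0 (s * f x))\<^sup>2 \<le> (f x)\<^sup>2" for x
    proof -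
      have "\<bar>max 0 (s * f x)\<bar> \<le> \<bar>s * f x\<bar>" by (simp add: max_def)
      then show ?thesis using that by (simp add: abs_le_square_iff[symmetric] abs_mult)
    qed
    then show "integrable \<mu> (\<lambda>x. (max 0 (s * f x))\<^sup>2)"
      by (intro Bochner_Integration.integrable_bound[OF square_integrableD(2)[OF f]]) auto
  qed
  have "P (\<lambda>x. max 0 (1 * f x) - max 0 ((-1) * f x))"
  proof (intro diff)
    show p: "(\<lambda>x. max 0 (1 * f x)) \<in> square_integrable \<mu>" "(\<lambda>x. max 0 ((-1) * f x)) \<in> square_integrable \<mu>"
      using part[of 1] part[of "-1"] by auto
    show "P (\<lambda>x. max 0 (1 * f x))" "P (\<lambda>x. max 0 ((-1) * f x))"
      using nonneg[OF square_integrableD(1)[OF p(1)]] nonneg[OF square_integrableD(1)[OF p(2)]] p by auto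
  qed
  moreover have "(\<lambda>x. max 0 (1 * f x) - max 0 ((-1) * f x)) = f" by (auto simp: max_def)
  ultimately show ?thesis by simp
qed

section \<open>Step functions on the half-line\<close>

abbreviation (input) half_line2 :: "(real \<times> real) measure" where
  "half_line2 \<equiv> half_line \<Otimes>\<^sub>M half_line"

lemma space_half_line [simp]: "space half_line = {0..}"
  by (simp add: half_line_def space_restrict_space)

interpretation half_line: sigma_finite_measure half_line
  unfolding half_line_def by (intro sigma_finite_measure_restrict_space sigma_finite_lborel) auto

interpretation half_line2: pair_sigma_finite half_line half_line ..

text \<open>The sets on whose indicators \<open>wigner_integral\<close> prescribes the values; they
  are stable under intersection, as \<open>L2_induct\<close> demands of a generator.\<close>

definition half_open_intervals :: "real set set" where
  "half_open_intervals = {{s..<t} | s t. 0 \<le> s \<and> s \<le> t}"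

lemma sets_half_line: "sets half_line = sigma_sets {0..} half_open_intervals"
proof -
  have "sets half_line = (\<inter>) {0..} ` sets borel"
    by (simp add: half_line_def sets_restrict_space)
  also have "sets (borel :: real measure) = sigma_sets UNIV (range (\<lambda>(a, b). {a..<b}))"
    by (subst borel_eq_atLeastLessThan) simp
  also have "(\<inter>) {0..} ` sigma_sets UNIV (range (\<lambda>(a, b). {a..<b})) =
      sigma_sets {0..} ((\<inter>) {0..} ` range (\<lambda>(a :: real, b). {a..<b}))"
  proof (rule sigma_sets_Int)
    have "{0::real..} \<in> sets borel" by simp
    also have "sets (borel :: real measure) = sigma_sets UNIV (range (\<lambda>(a, b). {a..<b}))"
      by (subst borel_eq_atLeastLessThan) simp
    finally show "{0::real..} \<in> sigma_sets UNIV (range (\<lambda>(a, b). {a..<b}))" .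
  qed simp
  also have "(\<inter>) {0..} ` range (\<lambda>(a :: real, b). {a..<b}) = half_open_intervals"
  proof (intro equalityI subsetI)
    fix A assume "A \<in> (\<inter>) {0..} ` range (\<lambda>(a :: real, b). {a..<b})"
    then obtain a b :: real where "A = {0..} \<inter> {a..<b}" by auto
    then have "A = {max 0 a..<max (max 0 a) b}" by auto
    then show "A \<in> half_open_intervals" unfolding half_open_intervals_def by force
  next
    fix A assume "A \<in> half_open_intervals"
    then obtain s t where "A = {s..<t}" "0 \<le> s" unfolding half_open_intervals_def by blast
    then have "A = {0..} \<inter> {s..<t}" by auto
    then show "A \<in> (\<inter>) {0..} ` range (\<lambda>(a :: real, b). {a..<b})" by force
  qed
  finally show ?thesis .
qed

lemma Int_half_open_intervals:
  "A \<in> half_open_intervals \<Longrightarrow> B \<in> half_open_intervals \<Longrightarrow> A \<inter> B \<in> half_open_intervals"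
proof -
  assume "A \<in> half_open_intervals" "B \<in> half_open_intervals"
  then obtain s t u v where AB: "A = {s..<t}" "B = {u..<v}" "0 \<le> s" "0 \<le> u"
    unfolding half_open_intervals_def by blast
  then have "A \<inter> B = {max s u..<max (max s u) (min t v)}" by auto
  moreover have "0 \<le> max s u" using AB by auto
  ultimately show ?thesis unfolding half_open_intervals_def by force
qed

lemma half_open_interval_0 [simp]: "0 \<le> t \<Longrightarrow> {0..<t} \<in> half_open_intervals"
  unfolding half_open_intervals_def by force

lemma emeasure_half_line: "0 \<le> s \<Longrightarrow> s \<le> t \<Longrightarrow> emeasure half_line {s..<t} = ennreal (t - s)"
  unfolding half_line_def by (subst emeasure_restrict_space) auto

lemma half_open_interval_sets:
  assumes "A \<in> half_open_intervals"
  shows "A \<in> sets half_line" "emeasure half_line A < \<infinity>"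
  using assms by (auto simp: sets_half_line half_open_intervals_def emeasure_half_line
      intro!: sigma_sets.Basic)

lemma UN_initial_intervals: "(\<Union>n::nat. {0..<real n}) = {0..}"
  by (auto intro: reals_Archimedean2)

lemma half_line_induct [consumes 1, case_names interval add scale lim]:
  assumes "f \<in> square_integrable half_line"
    and "\<And>s t. 0 \<le> s \<Longrightarrow> s \<le> t \<Longrightarrow> P (indicator {s..<t})"
    and "\<And>f g. f \<in> square_integrable half_line \<Longrightarrow> g \<in> square_integrable half_line \<Longrightarrow> P f \<Longrightarrow> P g \<Longrightarrow> P (\<lambda>x. f x + g x)"
    and "\<And>c f. f \<in> square_integrable half_line \<Longrightarrow> P f \<Longrightarrow> P (\<lambda>x. c * f x)"
    and "\<And>f. f \<in> square_integrable half_line \<Longrightarrow>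
      (\<And>e. e > 0 \<Longrightarrow> \<exists>g\<in>square_integrable half_line. P g \<and> L2_norm_measure half_line (\<lambda>x. f x - g x) < e) \<Longrightarrow> P f"
  shows "P f"
proof (rule L2_induct[where \<mu> = half_line and G = half_open_intervals and B = "\<lambda>n. {0..<real n}" and P = P and f = f])
  show "Int_stable half_open_intervals" by (auto simp: Int_stable_def Int_half_open_intervals)
  show "half_open_intervals \<subseteq> Pow (space half_line)" by (auto simp: half_open_intervals_def)
  show "incseq (\<lambda>n. {0..<real n})" by (auto simp: incseq_def)
  show "P (indicator A)" if "A \<in> half_open_intervals" for A
    using that assms(2) by (auto simp: half_open_intervals_def)
  show "(\<Union>n. {0..<real n}) = space half_line" by (simp add: UN_initial_intervals)
  show "emeasure half_line A < \<infinity>" if "A \<in> half_open_intervals" for A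
    using that by (rule half_open_interval_sets)
qed (fact assms | simp add: sets_half_line)+

lemma tensor_integral:
  assumes u: "integrable half_line u" and v: "integrable half_line v"
  shows "integrable half_line2 (\<lambda>(x, y). u x * v y :: real)"
    and "(\<integral>(x, y). u x * v y \<partial>half_line2) = (\<integral>x. u x \<partial>half_line) * (\<integral>y. v y \<partial>half_line)"
proof -
  note [measurable] = borel_measurable_integrable[OF u] borel_measurable_integrable[OF v]
  have m: "(\<lambda>(x, y). u x * v y) \<in> borel_measurable half_line2" by measurable
  show i: "integrable half_line2 (\<lambda>(x, y). u x * v y)"
    by (rule half_line2.Fubini_integrable[OF m]) (use u v in \<open>auto simp: abs_mult\<close>)
  show "(\<integral>(x, y). u x * v y \<partial>half_line2) = (\<integral>x. u x \<partial>half_line) * (\<integral>y. v y \<partial>half_line)"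
    using half_line2.integral_fst'[OF i] by simp
qed

lemma tensor_square_integrable:
  assumes "h \<in> square_integrable half_line" "k \<in> square_integrable half_line"
  shows "(\<lambda>(x, y). h x * k y) \<in> square_integrable half_line2"
proof (rule square_integrableI)
  note [measurable] = assms[THEN square_integrableD(1)]
  show "(\<lambda>(x, y). h x * k y) \<in> borel_measurable half_line2" by measurable
  show "integrable half_line2 (\<lambda>z. (case z of (x, y) \<Rightarrow> h x * k y)\<^sup>2)"
    using tensor_integral(1)[OF assms[THEN square_integrableD(2)]]
    by (simp add: case_prod_beta' power_mult_distrib)
qed

lemma tensor_inner:
  assumes "h \<in> square_integrable half_line" "k \<in> square_integrable half_line"
    "h' \<in> square_integrable half_line" "k' \<in> square_integrable half_line"
  shows "(\<integral>z. (case z of (x, y) \<Rightarrow> h x * k y) * (case z of (x, y) \<Rightarrow> h' x * k' y) \<partial>half_line2) =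
    (\<integral>x. h x * h' x \<partial>half_line) * (\<integral>x. k x * k' x \<partial>half_line)"
  using tensor_integral(2)[OF square_integrable_mult[OF assms(1,3)] square_integrable_mult[OF assms(2,4)]]
  by (simp add: case_prod_beta' mult_ac)

lemma indicator_times_split:
  "indicator (A \<times> B) = (\<lambda>(x, y). indicator A x * indicator B y :: real)"
  by (auto simp: indicator_def fun_eq_iff)

lemma half_line2_induct [consumes 1, case_names rectangle add scale lim]:
  assumes "f \<in> square_integrable half_line2"
    and "\<And>s t s' t'. 0 \<le> s \<Longrightarrow> s \<le> t \<Longrightarrow> 0 \<le> s' \<Longrightarrow> s' \<le> t' \<Longrightarrow>
      P (\<lambda>(x, y). indicator {s..<t} x * indicator {s'..<t'} y)"
    and "\<And>f g. f \<in> square_integrable half_line2 \<Longrightarrow> g \<in> square_integrable half_line2 \<Longrightarrow> P f \<Longrightarrow> P g \<Longrightarrow> P (\<lambda>x. f x + g x)"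
    and "\<And>c f. f \<in> square_integrable half_line2 \<Longrightarrow> P f \<Longrightarrow> P (\<lambda>x. c * f x)"
    and "\<And>f. f \<in> square_integrable half_line2 \<Longrightarrow>
      (\<And>e. e > 0 \<Longrightarrow> \<exists>g\<in>square_integrable half_line2. P g \<and> L2_norm_measure half_line2 (\<lambda>x. f x - g x) < e) \<Longrightarrow> P f"
  shows "P f"
proof -
  let ?G = "{a \<times> b | a b. a \<in> half_open_intervals \<and> b \<in> half_open_intervals}"
  have sub: "half_open_intervals \<subseteq> Pow {0..}" by (auto simp: half_open_intervals_def)
  show ?thesis
  proof (rule L2_induct[where \<mu> = half_line2 and G = ?G and B = "\<lambda>n. {0..<real n} \<times> {0..<real n}" and P = P and f = f])
    have "sets half_line2 = sets (sigma (space half_line \<times> space half_line) ?G)"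
      by (rule sets_pair_eq[where Ca = "range (\<lambda>n. {0..<real n})" and Cb = "range (\<lambda>n. {0..<real n})"])
        (use sub in \<open>auto simp: sets_half_line UN_initial_intervals\<close>)
    then show "sets half_line2 = sigma_sets (space half_line2) ?G"
      using sub by (subst (asm) sets_measure_of) (auto simp: space_pair_measure)
    show "Int_stable ?G"
    proof (rule Int_stableI)
      fix X Y assume "X \<in> ?G" "Y \<in> ?G"
      then obtain a b c d where "X = a \<times> b" "Y = c \<times> d" "a \<in> half_open_intervals"
        "b \<in> half_open_intervals" "c \<in> half_open_intervals" "d \<in> half_open_intervals" by blast
      moreover from this have "X \<inter> Y = (a \<inter> c) \<times> (b \<inter> d)" by auto
      ultimately show "X \<inter> Y \<in> ?G" using Int_half_open_intervals by blast
    qed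
    show "?G \<subseteq> Pow (space half_line2)" using sub by (auto simp: space_pair_measure)
    show "emeasure half_line2 A < \<infinity>" if "A \<in> ?G" for A
      using that half_open_interval_sets
      by (auto simp: half_line.emeasure_pair_measure_Times ennreal_mult_less_top)
    show "{0..<real n} \<times> {0..<real n} \<in> ?G" for n by force
    show "incseq (\<lambda>n. {0..<real n} \<times> {0..<real n})" by (auto simp: incseq_def)
    show "(\<Union>n. {0..<real n} \<times> {0..<real n}) = space half_line2"
    proof (intro equalityI subsetI)
      fix z assume "z \<in> space half_line2"
      then obtain x y where z: "z = (x, y)" "0 \<le> x" "0 \<le> y" by (auto simp: space_pair_measure)
      obtain n where "max x y < real n" using reals_Archimedean2 by blast
      then show "z \<in> (\<Union>n. {0..<real n} \<times> {0..<real n})" using z by auto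
    qed (auto simp: space_pair_measure)
    show "P (indicator A)" if A: "A \<in> ?G" for A
    proof -
      obtain s t s' t' where st: "A = {s..<t} \<times> {s'..<t'}" "0 \<le> s" "s \<le> t" "0 \<le> s'" "s' \<le> t'"
        using A unfolding half_open_intervals_def by blast
      show ?thesis unfolding st(1) indicator_times_split by (rule assms(2)) (use st in auto)
    qed
  qed (fact assms)+
qed

section \<open>Step functions and step kernels on a partition\<close>

definition increments :: "real list \<Rightarrow> bool" where
  "increments ts \<longleftrightarrow> sorted_wrt (<) ts \<and> set ts \<subseteq> {0..}"

text \<open>Normalised in L2, so that its Wigner integral is a semicircular element of variance 1,
  as required of the letters \<open>Some k\<close>.\<close>

definition incr_fun :: "real list \<Rightarrow> nat \<Rightarrow> real \<Rightarrow> real" where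
  "incr_fun ts i = (\<lambda>x. (1 / sqrt (ts ! Suc i - ts ! i)) * indicator {ts ! i..<ts ! Suc i} x)"

lemma interval_square_integrable:
  "0 \<le> s \<Longrightarrow> s \<le> t \<Longrightarrow> (indicator {s..<t} :: real \<Rightarrow> real) \<in> square_integrable half_line"
  by (rule indicator_square_integrable) (use half_open_interval_sets[of "{s..<t}"] in \<open>auto simp: half_open_intervals_def\<close>)

lemma increments_nth:
  assumes "increments ts" "i < length ts - 1"
  shows "0 \<le> ts ! i" "ts ! i < ts ! Suc i" "0 \<le> ts ! Suc i"
  using assms by (auto simp: increments_def sorted_wrt_nth_less subset_iff)

lemma incr_fun_square_integrable:
  "increments ts \<Longrightarrow> i < length ts - 1 \<Longrightarrow> incr_fun ts i \<in> square_integrable half_line"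
  unfolding incr_fun_def using increments_nth[of ts i]
  by (intro square_integrable_scale interval_square_integrable) auto

lemma incr_fun_orthonormal:
  assumes ts: "increments ts" and ij: "i < length ts - 1" "j < length ts - 1"
  shows "(\<integral>x. incr_fun ts i x * incr_fun ts j x \<partial>half_line) = (if i = j then 1 else 0)"
proof (cases "i = j")
  case True
  note n = increments_nth[OF ts ij(1)]
  let ?d = "ts ! Suc i - ts ! i"
  have "(\<lambda>x. incr_fun ts i x * incr_fun ts i x) = (\<lambda>x. (1 / ?d) * indicator {ts ! i..<ts ! Suc i} x)"
    using n by (auto simp: incr_fun_def indicator_def fun_eq_iff)
  moreover have "(\<integral>x. indicator {ts ! i..<ts ! Suc i} x \<partial>half_line) = ?d"
  proof -
    have "{ts ! i..<ts ! Suc i} \<inter> {0..} = {ts ! i..<ts ! Suc i}" using n by auto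
    then show ?thesis using n emeasure_half_line[of "ts ! i" "ts ! Suc i"] by (simp add: measure_def)
  qed
  ultimately show ?thesis using True n by simp
next
  case False
  have "incr_fun ts i x * incr_fun ts j x = 0" for x
  proof -
    have "ts ! Suc p \<le> ts ! q" if pq: "p < q" "q < length ts - 1" for p q
    proof (cases "Suc p = q")
      case False
      have "q < length ts" using pq by linarith
      then show ?thesis
        using pq False ts sorted_wrt_nth_less[of "(<)" ts "Suc p" q] by (auto simp: increments_def)
    qed simp
    from this[of i j] this[of j i] show ?thesis
      using False ij by (cases "i < j") (auto simp: incr_fun_def indicator_def)
  qed
  then have "(\<integral>x. incr_fun ts i x * incr_fun ts j x \<partial>half_line) = (\<integral>x. 0 \<partial>half_line)"
    by (simp only:)
  then show ?thesis using False by simp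
qed

text \<open>Telescoping over the partition; the square roots undo the normalisation of
  \<open>incr_fun\<close>.\<close>

lemma interval_eq_step:
  assumes ts: "increments ts" and pq: "p \<le> q" "q < length ts"
  shows "indicator {ts ! p..<ts ! q} x =
    (\<Sum>i<length ts - 1. (if p \<le> i \<and> i < q then sqrt (ts ! Suc i - ts ! i) else 0) * incr_fun ts i x)"
proof -
  have le: "ts ! i \<le> ts ! j" if "i \<le> j" "j < length ts" for i j
    using that ts sorted_wrt_nth_less[of "(<)" ts i j] by (cases "i = j") (auto simp: increments_def)
  have "indicator {ts ! p..<ts ! q} x = (\<Sum>i=p..<q. indicator {ts ! i..<ts ! Suc i} x :: real)"
    using pq
  proof (induction q rule: dec_induct)
    case (step r)
    have "indicator {ts ! p..<ts ! Suc r} x = (indicator {ts ! p..<ts ! r} x + indicator {ts ! r..<ts ! Suc r} x :: real)"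
    proof -
      have "ts ! p \<le> ts ! r" "ts ! r \<le> ts ! Suc r" using le[of p r] le[of r "Suc r"] step by auto
      then show ?thesis by (auto simp: indicator_def)
    qed
    then show ?case using step by simp
  qed simp
  also have "\<dots> = (\<Sum>i=p..<q. sqrt (ts ! Suc i - ts ! i) * incr_fun ts i x)"
    using increments_nth(2)[OF ts] pq by (intro sum.cong) (force simp: incr_fun_def)+
  also have "\<dots> = (\<Sum>i<length ts - 1. (if p \<le> i \<and> i < q then sqrt (ts ! Suc i - ts ! i) * incr_fun ts i x else 0))"
    using pq by (intro sum.mono_neutral_cong_left) auto
  also have "\<dots> = (\<Sum>i<length ts - 1. (if p \<le> i \<and> i < q then sqrt (ts ! Suc i - ts ! i) else 0) * incr_fun ts i x)"
    by (intro sum.cong) auto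
  finally show ?thesis .
qed

definition step_fun :: "real list \<Rightarrow> (nat \<Rightarrow> real) \<Rightarrow> real \<Rightarrow> real" where
  "step_fun ts c = (\<lambda>x. \<Sum>i<length ts - 1. c i * incr_fun ts i x)"

definition step_kernel :: "real list \<Rightarrow> (nat \<Rightarrow> nat \<Rightarrow> real) \<Rightarrow> real \<times> real \<Rightarrow> real" where
  "step_kernel ts a = (\<lambda>z. \<Sum>i<length ts - 1. \<Sum>j<length ts - 1.
     a i j * (case z of (x, y) \<Rightarrow> incr_fun ts i x * incr_fun ts j y))"

lemma step_fun_square_integrable: "increments ts \<Longrightarrow> step_fun ts c \<in> square_integrable half_line"
  unfolding step_fun_def by (intro square_integrable_sum square_integrable_scale incr_fun_square_integrable) auto

lemma step_kernel_square_integrable: "increments ts \<Longrightarrow> step_kernel ts a \<in> square_integrable half_line2"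
  unfolding step_kernel_def
  by (intro square_integrable_sum square_integrable_scale tensor_square_integrable incr_fun_square_integrable) auto

lemma increments_sorted_list:
  "finite T \<Longrightarrow> T \<subseteq> {0..} \<Longrightarrow> increments (sorted_list_of_set T)"
  by (simp add: increments_def)

lemma interval_is_step:
  assumes "finite T" "T \<subseteq> {0..}" "s \<in> T" "t \<in> T" "s \<le> t"
  shows "\<exists>c. indicator {s..<t} = step_fun (sorted_list_of_set T) c"
proof -
  let ?ts = "sorted_list_of_set T"
  have ts: "increments ?ts" using assms by (simp add: increments_sorted_list)
  obtain p q where pq: "p < length ?ts" "q < length ?ts" "?ts ! p = s" "?ts ! q = t"
    using assms by (metis in_set_conv_nth set_sorted_list_of_set)
  have "p \<le> q"
    using ts pq assms(5) sorted_wrt_nth_less[of "(<)" ?ts q p] by (force simp: increments_def not_le[symmetric])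
  have "indicator {s..<t} = step_fun ?ts (\<lambda>i. if p \<le> i \<and> i < q then sqrt (?ts ! Suc i - ?ts ! i) else 0)"
    using interval_eq_step[OF ts \<open>p \<le> q\<close> pq(2)] unfolding step_fun_def pq(3,4) by blast
  then show ?thesis by blast
qed

text \<open>Approximation along all sufficiently fine partitions, so that finitely many functions can be
  approximated on a common partition.\<close>

definition refinable :: "'a measure \<Rightarrow> (real list \<Rightarrow> ('a \<Rightarrow> real) set) \<Rightarrow> ('a \<Rightarrow> real) \<Rightarrow> bool" where
  "refinable \<mu> D f \<longleftrightarrow> (\<forall>e>0. \<exists>T\<^sub>0. finite T\<^sub>0 \<and> T\<^sub>0 \<subseteq> {0..} \<and>
     (\<forall>T. finite T \<longrightarrow> T \<subseteq> {0..} \<longrightarrow> T\<^sub>0 \<subseteq> T \<longrightarrow>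
       (\<exists>g\<in>D (sorted_list_of_set T). L2_norm_measure \<mu> (\<lambda>x. f x - g x) < e)))"

lemma refinableE:
  assumes "refinable \<mu> D f" "e > 0"
  obtains T\<^sub>0 where "finite T\<^sub>0" "T\<^sub>0 \<subseteq> {0..}"
    "\<And>T. finite T \<Longrightarrow> T \<subseteq> {0..} \<Longrightarrow> T\<^sub>0 \<subseteq> T \<Longrightarrow>
      \<exists>g\<in>D (sorted_list_of_set T). L2_norm_measure \<mu> (\<lambda>x. f x - g x) < e"
proof -
  note * = assms(1)[unfolded refinable_def, rule_format, OF assms(2)]
  from * obtain T\<^sub>0 where T: "finite T\<^sub>0" "T\<^sub>0 \<subseteq> {0..}"
    and h: "\<forall>T. finite T \<longrightarrow> T \<subseteq> {0..} \<longrightarrow> T\<^sub>0 \<subseteq> T \<longrightarrow>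
       (\<exists>g\<in>D (sorted_list_of_set T). L2_norm_measure \<mu> (\<lambda>x. f x - g x) < e)"
    by (elim exE conjE)
  show ?thesis by (rule that[OF T h[rule_format]])
qed

lemma refinableI:
  assumes "\<And>e. e > 0 \<Longrightarrow> \<exists>T\<^sub>0. finite T\<^sub>0 \<and> T\<^sub>0 \<subseteq> {0..} \<and>
     (\<forall>T. finite T \<longrightarrow> T \<subseteq> {0..} \<longrightarrow> T\<^sub>0 \<subseteq> T \<longrightarrow>
       (\<exists>g\<in>D (sorted_list_of_set T). L2_norm_measure \<mu> (\<lambda>x. f x - g x) < e))"
  shows "refinable \<mu> D f"
  unfolding refinable_def by (intro allI impI assms)

lemma refinable_add:
  assumes D: "\<And>ts. increments ts \<Longrightarrow> D ts \<subseteq> square_integrable \<mu>"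
    "\<And>ts g h. g \<in> D ts \<Longrightarrow> h \<in> D ts \<Longrightarrow> (\<lambda>x. g x + h x) \<in> D ts"
    and fg: "f \<in> square_integrable \<mu>" "g \<in> square_integrable \<mu>" "refinable \<mu> D f" "refinable \<mu> D g"
  shows "refinable \<mu> D (\<lambda>x. f x + g x)"
proof (rule refinableI)
  fix e :: real assume "e > 0"
  then have e: "e / 2 > 0" by simp
  obtain T1 where T1: "finite T1" "T1 \<subseteq> {0..}" "\<And>T. finite T \<Longrightarrow> T \<subseteq> {0..} \<Longrightarrow> T1 \<subseteq> T \<Longrightarrow>
    \<exists>u\<in>D (sorted_list_of_set T). L2_norm_measure \<mu> (\<lambda>x. f x - u x) < e / 2"
    by (rule refinableE[OF fg(3) e], rule that)
  obtain T2 where T2: "finite T2" "T2 \<subseteq> {0..}" "\<And>T. finite T \<Longrightarrow> T \<subseteq> {0..} \<Longrightarrow> T2 \<subseteq> T \<Longrightarrow>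
    \<exists>u\<in>D (sorted_list_of_set T). L2_norm_measure \<mu> (\<lambda>x. g x - u x) < e / 2"
    by (rule refinableE[OF fg(4) e], rule that)
  have "\<exists>u\<in>D (sorted_list_of_set T). L2_norm_measure \<mu> (\<lambda>x. f x + g x - u x) < e"
    if T: "finite T" "T \<subseteq> {0..}" "T1 \<union> T2 \<subseteq> T" for T
  proof -
    have ts: "increments (sorted_list_of_set T)" using T by (simp add: increments_sorted_list)
    obtain u where u: "u \<in> D (sorted_list_of_set T)" "L2_norm_measure \<mu> (\<lambda>x. f x - u x) < e / 2"
      using T1(3)[of T] T by auto
    obtain w where w: "w \<in> D (sorted_list_of_set T)" "L2_norm_measure \<mu> (\<lambda>x. g x - w x) < e / 2"
      using T2(3)[of T] T by auto
    have "L2_norm_measure \<mu> (\<lambda>x. (f x - u x) + (g x - w x)) \<le>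
        L2_norm_measure \<mu> (\<lambda>x. f x - u x) + L2_norm_measure \<mu> (\<lambda>x. g x - w x)"
      by (rule L2_norm_triangle) (use fg u w D(1)[OF ts] in auto)
    moreover have "(\<lambda>x. (f x - u x) + (g x - w x)) = (\<lambda>x. f x + g x - (u x + w x))" by auto
    ultimately show ?thesis using D(2)[OF u(1) w(1)] u(2) w(2)
      by (intro bexI[of _ "\<lambda>x. u x + w x"]) auto
  qed
  then show "\<exists>T\<^sub>0. finite T\<^sub>0 \<and> T\<^sub>0 \<subseteq> {0..} \<and> (\<forall>T. finite T \<longrightarrow> T \<subseteq> {0..} \<longrightarrow> T\<^sub>0 \<subseteq> T \<longrightarrow>
       (\<exists>u\<in>D (sorted_list_of_set T). L2_norm_measure \<mu> (\<lambda>x. f x + g x - u x) < e))"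
    using T1(1,2) T2(1,2) by (intro exI[of _ "T1 \<union> T2"]) auto
qed

lemma refinable_scale:
  assumes D: "\<And>ts g. g \<in> D ts \<Longrightarrow> (\<lambda>x. b * g x) \<in> D ts" and f: "refinable \<mu> D f"
  shows "refinable \<mu> D (\<lambda>x. b * f x)"
proof (rule refinableI)
  fix e :: real assume "e > 0"
  then have e: "e / (\<bar>b\<bar> + 1) > 0" by simp
  obtain T1 where T1: "finite T1" "T1 \<subseteq> {0..}" "\<And>T. finite T \<Longrightarrow> T \<subseteq> {0..} \<Longrightarrow> T1 \<subseteq> T \<Longrightarrow>
    \<exists>u\<in>D (sorted_list_of_set T). L2_norm_measure \<mu> (\<lambda>x. f x - u x) < e / (\<bar>b\<bar> + 1)"
    by (rule refinableE[OF f e], rule that)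
  have "\<exists>u\<in>D (sorted_list_of_set T). L2_norm_measure \<mu> (\<lambda>x. b * f x - u x) < e"
    if T: "finite T" "T \<subseteq> {0..}" "T1 \<subseteq> T" for T
  proof -
    obtain u where u: "u \<in> D (sorted_list_of_set T)" "L2_norm_measure \<mu> (\<lambda>x. f x - u x) < e / (\<bar>b\<bar> + 1)"
      using T1(3)[of T] T by auto
    have "L2_norm_measure \<mu> (\<lambda>x. b * f x - b * u x) = \<bar>b\<bar> * L2_norm_measure \<mu> (\<lambda>x. f x - u x)"
      by (simp add: L2_norm_scale flip: right_diff_distrib)
    also have "\<dots> \<le> (\<bar>b\<bar> + 1) * L2_norm_measure \<mu> (\<lambda>x. f x - u x)"
      by (intro mult_right_mono) (auto simp: L2_norm_measure_sq)
    also have "\<dots> < e" using u(2) by (simp add: pos_less_divide_eq mult.commute)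
    finally show ?thesis using D[OF u(1)] by (intro bexI[of _ "\<lambda>x. b * u x"]) auto
  qed
  then show "\<exists>T\<^sub>0. finite T\<^sub>0 \<and> T\<^sub>0 \<subseteq> {0..} \<and> (\<forall>T. finite T \<longrightarrow> T \<subseteq> {0..} \<longrightarrow> T\<^sub>0 \<subseteq> T \<longrightarrow>
       (\<exists>u\<in>D (sorted_list_of_set T). L2_norm_measure \<mu> (\<lambda>x. b * f x - u x) < e))"
    using T1(1,2) by (intro exI[of _ T1]) auto
qed

lemma refinable_lim:
  assumes D: "\<And>ts. increments ts \<Longrightarrow> D ts \<subseteq> square_integrable \<mu>"
    and f: "f \<in> square_integrable \<mu>"
    and lim: "\<And>e. e > 0 \<Longrightarrow> \<exists>g\<in>square_integrable \<mu>. refinable \<mu> D g \<and> L2_norm_measure \<mu> (\<lambda>x. f x - g x) < e"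
  shows "refinable \<mu> D f"
proof (rule refinableI)
  fix e :: real assume "e > 0"
  then have e: "e / 2 > 0" by simp
  obtain g where g: "g \<in> square_integrable \<mu>" "refinable \<mu> D g" "L2_norm_measure \<mu> (\<lambda>x. f x - g x) < e / 2"
    using lim[OF e] by blast
  obtain T1 where T1: "finite T1" "T1 \<subseteq> {0..}" "\<And>T. finite T \<Longrightarrow> T \<subseteq> {0..} \<Longrightarrow> T1 \<subseteq> T \<Longrightarrow>
    \<exists>u\<in>D (sorted_list_of_set T). L2_norm_measure \<mu> (\<lambda>x. g x - u x) < e / 2"
    by (rule refinableE[OF g(2) e], rule that)
  have "\<exists>u\<in>D (sorted_list_of_set T). L2_norm_measure \<mu> (\<lambda>x. f x - u x) < e"
    if T: "finite T" "T \<subseteq> {0..}" "T1 \<subseteq> T" for T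
  proof -
    have ts: "increments (sorted_list_of_set T)" using T by (simp add: increments_sorted_list)
    obtain u where u: "u \<in> D (sorted_list_of_set T)" "L2_norm_measure \<mu> (\<lambda>x. g x - u x) < e / 2"
      using T1(3)[of T] T by auto
    have "L2_norm_measure \<mu> (\<lambda>x. (f x - g x) + (g x - u x)) \<le>
        L2_norm_measure \<mu> (\<lambda>x. f x - g x) + L2_norm_measure \<mu> (\<lambda>x. g x - u x)"
      by (rule L2_norm_triangle) (use f g u D(1)[OF ts] in auto)
    then show ?thesis using u g(3) by (intro bexI[of _ u]) auto
  qed
  then show "\<exists>T\<^sub>0. finite T\<^sub>0 \<and> T\<^sub>0 \<subseteq> {0..} \<and> (\<forall>T. finite T \<longrightarrow> T \<subseteq> {0..} \<longrightarrow> T\<^sub>0 \<subseteq> T \<longrightarrow>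
       (\<exists>u\<in>D (sorted_list_of_set T). L2_norm_measure \<mu> (\<lambda>x. f x - u x) < e))"
    using T1(1,2) by (intro exI[of _ T1]) auto
qed

lemma range_step_fun:
  "g \<in> range (step_fun ts) \<Longrightarrow> h \<in> range (step_fun ts) \<Longrightarrow> (\<lambda>x. g x + h x) \<in> range (step_fun ts)"
  "g \<in> range (step_fun ts) \<Longrightarrow> (\<lambda>x. b * g x) \<in> range (step_fun ts)"
proof -
  have eq: "step_fun ts (\<lambda>i. c i + d i) = (\<lambda>x. step_fun ts c x + step_fun ts d x)" for c d
    by (auto simp: step_fun_def distrib_right sum.distrib)
  have sum: "(\<lambda>x. step_fun ts c x + step_fun ts d x) \<in> range (step_fun ts)" for c d
    unfolding eq[symmetric] by (rule rangeI)
  show "(\<lambda>x. g x + h x) \<in> range (step_fun ts)" if "g \<in> range (step_fun ts)" "h \<in> range (step_fun ts)"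
    using that by (elim imageE) (simp only: sum)
  have eq: "step_fun ts (\<lambda>i. b * c i) = (\<lambda>x. b * step_fun ts c x)" for c
    by (auto simp: step_fun_def sum_distrib_left mult.assoc)
  have scale: "(\<lambda>x. b * step_fun ts c x) \<in> range (step_fun ts)" for c
    unfolding eq[symmetric] by (rule rangeI)
  show "(\<lambda>x. b * g x) \<in> range (step_fun ts)" if "g \<in> range (step_fun ts)"
    using that by (elim imageE) (simp only: scale)
qed

lemma range_step_kernel:
  "g \<in> range (step_kernel ts) \<Longrightarrow> h \<in> range (step_kernel ts) \<Longrightarrow> (\<lambda>x. g x + h x) \<in> range (step_kernel ts)"
  "g \<in> range (step_kernel ts) \<Longrightarrow> (\<lambda>x. b * g x) \<in> range (step_kernel ts)"
proof -
  have eq: "step_kernel ts (\<lambda>i j. c i j + d i j) = (\<lambda>x. step_kernel ts c x + step_kernel ts d x)" for c d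
    by (auto simp: step_kernel_def distrib_right sum.distrib)
  have sum: "(\<lambda>x. step_kernel ts c x + step_kernel ts d x) \<in> range (step_kernel ts)" for c d
    unfolding eq[symmetric] by (rule rangeI)
  show "(\<lambda>x. g x + h x) \<in> range (step_kernel ts)" if "g \<in> range (step_kernel ts)" "h \<in> range (step_kernel ts)"
    using that by (elim imageE) (simp only: sum)
  have eq: "step_kernel ts (\<lambda>i j. b * c i j) = (\<lambda>x. b * step_kernel ts c x)" for c
    by (auto simp: step_kernel_def sum_distrib_left mult.assoc)
  have scale: "(\<lambda>x. b * step_kernel ts c x) \<in> range (step_kernel ts)" for c
    unfolding eq[symmetric] by (rule rangeI)
  show "(\<lambda>x. b * g x) \<in> range (step_kernel ts)" if "g \<in> range (step_kernel ts)"
    using that by (elim imageE) (simp only: scale)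
qed

lemma step_fun_dense:
  assumes "h \<in> square_integrable half_line"
  shows "refinable half_line (\<lambda>ts. range (step_fun ts)) h"
  using assms
proof (induction rule: half_line_induct)
  case (interval s t)
  show ?case
  proof (rule refinableI, intro exI[of _ "{s, t}"] conjI allI impI)
    fix e :: real and T assume e: "e > 0" and T: "finite T" "T \<subseteq> {0..}" "{s, t} \<subseteq> T"
    then obtain c where "indicator {s..<t} = step_fun (sorted_list_of_set T) c"
      using interval_is_step[of T s t] interval by auto
    then show "\<exists>g\<in>range (step_fun (sorted_list_of_set T)). L2_norm_measure half_line (\<lambda>x. indicator {s..<t} x - g x) < e"
      using e by (intro bexI[of _ "step_fun (sorted_list_of_set T) c"]) (auto simp: L2_norm_measure_def)
  qed (use interval in auto)
next
  case (add f g)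
  then show ?case
    by (intro refinable_add) (auto simp: step_fun_square_integrable range_step_fun)
next
  case (scale b f)
  show ?case by (rule refinable_scale[OF range_step_fun(2) scale.IH])
next
  case (lim f)
  show ?case by (rule refinable_lim[OF _ lim.hyps lim.IH]) (auto simp: step_fun_square_integrable)
qed

lemma step_kernel_dense:
  assumes "f \<in> square_integrable half_line2"
  shows "refinable half_line2 (\<lambda>ts. range (step_kernel ts)) f"
  using assms
proof (induction rule: half_line2_induct)
  case (rectangle s t s' t')
  show ?case
  proof (rule refinableI, intro exI[of _ "{s, t, s', t'}"] conjI allI impI)
    fix e :: real and T assume e: "e > 0" and T: "finite T" "T \<subseteq> {0..}" "{s, t, s', t'} \<subseteq> T"
    let ?ts = "sorted_list_of_set T"
    obtain c d where cd: "indicator {s..<t} = step_fun ?ts c" "indicator {s'..<t'} = step_fun ?ts d"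
      using interval_is_step[of T s t] interval_is_step[of T s' t'] rectangle T by auto
    have "(\<lambda>(x, y). indicator {s..<t} x * indicator {s'..<t'} y) = step_kernel ?ts (\<lambda>i j. c i * d j)"
      unfolding cd by (auto simp: step_fun_def step_kernel_def sum_product mult_ac intro!: sum.cong)
    then show "\<exists>g\<in>range (step_kernel ?ts).
        L2_norm_measure half_line2 (\<lambda>x. (case x of (x, y) \<Rightarrow> indicator {s..<t} x * indicator {s'..<t'} y) - g x) < e"
      using e by (intro bexI[of _ "step_kernel ?ts (\<lambda>i j. c i * d j)"]) (auto simp: L2_norm_measure_def)
  qed (use rectangle in auto)
next
  case (add f g)
  then show ?case
    by (intro refinable_add) (auto simp: step_kernel_square_integrable range_step_kernel)
next
  case (scale b f)
  show ?case by (rule refinable_scale[OF range_step_kernel(2) scale.IH])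
next
  case (lim f)
  show ?case by (rule refinable_lim[OF _ lim.hyps lim.IH]) (auto simp: step_kernel_square_integrable)
qed

section \<open>Moments of symmetric matrices\<close>

lemma mat_mult_assoc: "mat_mult m (mat_mult n a b) c = mat_mult n a (mat_mult m b c)"
proof (intro ext)
  fix i j
  have "mat_mult m (mat_mult n a b) c i j = (\<Sum>k<m. \<Sum>l<n. a i l * b l k * c k j)"
    by (simp add: mat_mult_def sum_distrib_right)
  also have "\<dots> = (\<Sum>l<n. \<Sum>k<m. a i l * b l k * c k j)" by (rule sum.swap)
  also have "\<dots> = mat_mult n a (mat_mult m b c) i j"
    by (simp add: mat_mult_def sum_distrib_left mult.assoc)
  finally show "mat_mult m (mat_mult n a b) c i j = mat_mult n a (mat_mult m b c) i j" .
qed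

lemma mat_power_0_mult: "i < n \<Longrightarrow> mat_mult n (mat_power n a 0) b i j = b i j"
  by (simp add: mat_mult_def mult_delta_left sum_delta_lt)

lemma mat_mult_power_0: "j < n \<Longrightarrow> mat_mult n b (mat_power n a 0) i j = b i j"
  by (simp add: mat_mult_def mult_delta_right sum_delta_lt)

lemma mat_power_commutes:
  "i < n \<Longrightarrow> j < n \<Longrightarrow> mat_mult n a (mat_power n a r) i j = mat_power n a (Suc r) i j"
proof (induction r arbitrary: j)
  case 0
  then show ?case using mat_mult_power_0[of j n a a i] mat_power_1[of i n a j] by simp
next
  case (Suc r)
  have "mat_mult n a (mat_power n a (Suc r)) i j = mat_mult n (mat_mult n a (mat_power n a r)) a i j"
    by (simp add: mat_mult_assoc)
  also have "\<dots> = mat_mult n (mat_power n a (Suc r)) a i j"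
    using Suc by (simp add: mat_mult_def[of n "mat_mult n a (mat_power n a r)"] mat_mult_def[of n "mat_power n a (Suc r)"] del: mat_power.simps)
  finally show ?case by simp
qed

lemma mat_power_sym:
  assumes "\<And>i j. a i j = a j i" "i < n" "j < n"
  shows "mat_power n a r i j = mat_power n a r j i"
  using assms(2,3)
proof (induction r arbitrary: i j)
  case (Suc r)
  have "mat_power n a (Suc r) i j = (\<Sum>k<n. mat_power n a r k i * a j k)"
    using Suc assms(1) by (simp add: mat_mult_def)
  also have "\<dots> = mat_mult n a (mat_power n a r) j i"
    by (simp add: mat_mult_def mult.commute)
  finally show ?case using mat_power_commutes Suc.prems by simp
qed auto

section \<open>Polynomials of a symmetric matrix and their traces\<close>

definition poly_sum :: "(nat \<Rightarrow> real) \<Rightarrow> real poly \<Rightarrow> real" where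
  "poly_sum \<tau> p = (\<Sum>k\<le>degree p. coeff p k * \<tau> k)"

lemma poly_sum_upto: "degree p \<le> N \<Longrightarrow> poly_sum \<tau> p = (\<Sum>k\<le>N. coeff p k * \<tau> k)"
  unfolding poly_sum_def by (intro sum.mono_neutral_left) (auto simp: coeff_eq_0)

lemma poly_sum_0 [simp]: "poly_sum \<tau> 0 = 0"
  by (simp add: poly_sum_def)

lemma poly_sum_add: "poly_sum \<tau> (p + q) = poly_sum \<tau> p + poly_sum \<tau> q"
proof -
  let ?N = "max (degree p) (degree q)"
  have "degree (p + q) \<le> ?N" by (rule degree_add_le_max)
  then show ?thesis
    by (simp add: poly_sum_upto[of _ ?N] distrib_right sum.distrib)
qed

lemma poly_sum_smult: "poly_sum \<tau> (smult c p) = c * poly_sum \<tau> p"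
proof -
  have "degree (smult c p) \<le> degree p" by (rule degree_smult_le)
  then show ?thesis by (simp add: poly_sum_upto[of _ "degree p"] sum_distrib_left mult.assoc)
qed

lemma poly_sum_diff: "poly_sum \<tau> (p - q) = poly_sum \<tau> p - poly_sum \<tau> q"
  using poly_sum_add[of \<tau> p "smult (- 1) q"] poly_sum_smult[of \<tau> "- 1" q] by simp

lemma poly_sum_pCons: "poly_sum \<tau> (pCons c p) = c * \<tau> 0 + poly_sum (\<lambda>k. \<tau> (Suc k)) p"
proof -
  have "degree (pCons c p) \<le> Suc (degree p)" by (rule degree_pCons_le)
  then have "poly_sum \<tau> (pCons c p) = (\<Sum>k\<le>Suc (degree p). coeff (pCons c p) k * \<tau> k)"
    by (rule poly_sum_upto)
  also have "\<dots> = c * \<tau> 0 + (\<Sum>k\<le>degree p. coeff p k * \<tau> (Suc k))"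
    by (subst sum.atMost_Suc_shift) simp
  finally show ?thesis by (simp add: poly_sum_def)
qed

lemma poly_sum_cong: "(\<And>k. \<tau> k = \<tau>' k) \<Longrightarrow> poly_sum \<tau> p = poly_sum \<tau>' p"
  by (simp add: poly_sum_def)

lemma poly_sum_sum: "(\<Sum>i\<in>I. poly_sum (\<tau> i) p) = poly_sum (\<lambda>k. \<Sum>i\<in>I. \<tau> i k) p"
  unfolding poly_sum_def by (subst sum.swap) (simp add: sum_distrib_left)

lemma poly_sum_mult_right: "poly_sum \<tau> p * c = poly_sum (\<lambda>k. \<tau> k * c) p"
  by (simp add: poly_sum_def sum_distrib_right mult.assoc)

text \<open>The functional \<open>poly_sum\<close> applied entrywise, so that its algebraic rules
  serve matrix entries, traces and cumulants alike.\<close>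

definition mat_poly :: "nat \<Rightarrow> (nat \<Rightarrow> nat \<Rightarrow> real) \<Rightarrow> real poly \<Rightarrow> nat \<Rightarrow> nat \<Rightarrow> real" where
  "mat_poly n a p i j = poly_sum (\<lambda>k. mat_power n a k i j) p"

lemma mat_poly_pCons:
  "mat_poly n a (pCons c p) i j = (if i = j then c else 0) + mat_mult n (mat_poly n a p) a i j"
  by (simp add: mat_poly_def poly_sum_pCons mat_mult_def poly_sum_mult_right poly_sum_sum)

lemma mat_poly_commutes:
  assumes "i < n" "j < n"
  shows "mat_mult n (mat_poly n a p) a i j = mat_mult n a (mat_poly n a p) i j"
proof -
  have "mat_mult n (mat_poly n a p) a i j = poly_sum (\<lambda>k. mat_power n a (Suc k) i j) p"
    by (simp add: mat_poly_def mat_mult_def poly_sum_mult_right poly_sum_sum)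
  also have "\<dots> = poly_sum (\<lambda>k. mat_mult n a (mat_power n a k) i j) p"
    using mat_power_commutes[OF assms] by (intro poly_sum_cong) simp
  also have "\<dots> = mat_mult n a (mat_poly n a p) i j"
    by (simp add: mat_mult_def mat_poly_def mult.commute[of "a i _"] poly_sum_mult_right poly_sum_sum)
  finally show ?thesis .
qed

text \<open>Induction on \<open>p\<close>, moving one factor \<open>a\<close> past a polynomial in
  \<open>a\<close>. The indices stay in the range in which the zeroth power acts as an
  identity.\<close>

lemma mat_poly_mult:
  assumes "i < n" "j < n"
  shows "mat_poly n a (p * q) i j = mat_mult n (mat_poly n a p) (mat_poly n a q) i j"
  using assms(2)
proof (induction p arbitrary: j)
  case 0
  then show ?case by (simp add: mat_poly_def mat_mult_def)
next
  case (pCons c p)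
  have "mat_poly n a (pCons c p * q) i j = c * mat_poly n a q i j + mat_poly n a (pCons 0 (p * q)) i j"
    by (simp add: mat_poly_def poly_sum_add poly_sum_smult)
  also have "mat_poly n a (pCons 0 (p * q)) i j = mat_mult n (mat_poly n a (p * q)) a i j"
    by (simp add: mat_poly_pCons)
  also have "\<dots> = mat_mult n (mat_mult n (mat_poly n a p) (mat_poly n a q)) a i j"
    using pCons by (simp add: mat_mult_def[of n "mat_poly n a (p * q)"] mat_mult_def[of n "mat_mult n _ _"])
  also have "\<dots> = mat_mult n (mat_poly n a p) (mat_mult n (mat_poly n a q) a) i j"
    by (simp add: mat_mult_assoc)
  also have "\<dots> = mat_mult n (mat_poly n a p) (mat_mult n a (mat_poly n a q)) i j"
    using mat_poly_commutes pCons.prems by (simp add: mat_mult_def[of n "mat_poly n a p"])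
  also have "\<dots> = mat_mult n (mat_mult n (mat_poly n a p) a) (mat_poly n a q) i j"
    by (simp add: mat_mult_assoc)
  also have "c * mat_poly n a q i j + \<dots> = mat_mult n (mat_poly n a (pCons c p)) (mat_poly n a q) i j"
    using assms(1) by (simp add: mat_poly_pCons mat_mult_def[of n "mat_poly n a (pCons c p)"]
        mat_mult_def[of n "mat_mult n (mat_poly n a p) a"] distrib_right sum.distrib mult_delta_left sum_delta_lt)
  finally show ?case .
qed

lemma mat_poly_sym:
  assumes "\<And>i j. a i j = a j i" "i < n" "j < n"
  shows "mat_poly n a p i j = mat_poly n a p j i"
  unfolding mat_poly_def using mat_power_sym[OF assms] by (intro poly_sum_cong)

definition trace_moment :: "nat \<Rightarrow> (nat \<Rightarrow> nat \<Rightarrow> real) \<Rightarrow> nat \<Rightarrow> real" where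
  "trace_moment n a r = mat_trace n (mat_power n a r)"

lemma poly_sum_trace: "poly_sum (trace_moment n a) p = mat_trace n (mat_poly n a p)"
  unfolding mat_trace_def mat_poly_def poly_sum_sum
  by (rule poly_sum_cong) (simp add: trace_moment_def mat_trace_def)

definition frobenius :: "nat \<Rightarrow> (nat \<Rightarrow> nat \<Rightarrow> real) \<Rightarrow> real" where
  "frobenius n b = (\<Sum>i<n. \<Sum>j<n. (b i j)\<^sup>2)"

lemma frobenius_nonneg: "0 \<le> frobenius n b"
  by (simp add: frobenius_def sum_nonneg)

lemma frobenius_eq_0D: "frobenius n b = 0 \<Longrightarrow> i < n \<Longrightarrow> j < n \<Longrightarrow> b i j = 0"
  by (simp add: frobenius_def sum_nonneg_eq_0_iff sum_nonneg)

text \<open>Symmetry turns the trace of a product into the entrywise inner product. Positivity and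
  Cauchy-Schwarz for the trace functional are thereby those of finite sums of reals.\<close>

lemma trace_mult_sym:
  assumes "\<And>i j. a i j = a j i"
  shows "poly_sum (trace_moment n a) (p * q) = (\<Sum>i<n. \<Sum>j<n. mat_poly n a p i j * mat_poly n a q i j)"
  unfolding poly_sum_trace mat_trace_def
  using mat_poly_sym[of a _ n _ q, OF assms]
  by (intro sum.cong refl) (simp add: mat_poly_mult mat_mult_def)

lemma trace_square:
  assumes "\<And>i j. a i j = a j i"
  shows "poly_sum (trace_moment n a) (p\<^sup>2) = frobenius n (mat_poly n a p)"
  using trace_mult_sym[of a n p p, OF assms] by (simp add: frobenius_def power2_eq_square)

lemma trace_cauchy_schwarz:
  assumes "\<And>i j. a i j = a j i"
  shows "(poly_sum (trace_moment n a) (p * q))\<^sup>2 \<le>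
    poly_sum (trace_moment n a) (p\<^sup>2) * poly_sum (trace_moment n a) (q\<^sup>2)"
proof -
  let ?I = "{..<n} \<times> {..<n}"
  let ?P = "\<lambda>z. mat_poly n a p (fst z) (snd z)" and ?Q = "\<lambda>z. mat_poly n a q (fst z) (snd z)"
  have "(\<Sum>z\<in>?I. ?P z * ?Q z)\<^sup>2 \<le> (\<Sum>z\<in>?I. (?P z)\<^sup>2) * (\<Sum>z\<in>?I. (?Q z)\<^sup>2)"
    by (rule Cauchy_Schwarz_ineq_sum)
  then show ?thesis
    unfolding trace_square[OF assms] trace_mult_sym[OF assms] frobenius_def
    by (simp add: sum.cartesian_product case_prod_beta')
qed

lemma poly_sum_monom: "poly_sum \<tau> (monom 1 r) = \<tau> r"
  by (simp add: poly_sum_def degree_monom_eq if_distrib[of "\<lambda>x. x * _"] sum.delta cong: if_cong)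

lemma mat_poly_monom: "mat_poly n a (monom 1 r) i j = mat_power n a r i j"
  by (simp add: mat_poly_def poly_sum_monom)

lemma trace_moment_even:
  assumes "\<And>i j. a i j = a j i"
  shows "trace_moment n a (2 * s) = frobenius n (mat_power n a s)"
  using trace_square[of a n "monom 1 s", OF assms]
  by (simp add: monom_power mult.commute poly_sum_monom mat_poly_monom[abs_def] frobenius_def)

lemma frobenius_mult: "frobenius n (mat_mult n a b) \<le> frobenius n a * frobenius n b"
proof -
  have "frobenius n (mat_mult n a b) \<le> (\<Sum>i<n. \<Sum>j<n. (\<Sum>k<n. (a i k)\<^sup>2) * (\<Sum>k<n. (b k j)\<^sup>2))"
    unfolding frobenius_def mat_mult_def by (intro sum_mono Cauchy_Schwarz_ineq_sum)
  also have "\<dots> = (\<Sum>i<n. \<Sum>k<n. (a i k)\<^sup>2) * (\<Sum>j<n. \<Sum>k<n. (b k j)\<^sup>2)"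
    by (simp add: sum_product)
  also have "(\<Sum>j<n. \<Sum>k<n. (b k j)\<^sup>2) = frobenius n b"
    unfolding frobenius_def by (rule sum.swap)
  finally show ?thesis by (simp add: frobenius_def)
qed

lemma frobenius_power: "s \<ge> 1 \<Longrightarrow> frobenius n (mat_power n a s) \<le> frobenius n a ^ s"
proof (induction s rule: dec_induct)
  case base
  show ?case using mat_power_1[of _ n a] by (simp add: frobenius_def)
next
  case (step s)
  have "frobenius n (mat_power n a (Suc s)) \<le> frobenius n (mat_power n a s) * frobenius n a"
    by (simp add: frobenius_mult)
  also have "\<dots> \<le> frobenius n a ^ s * frobenius n a"
    using step by (intro mult_right_mono frobenius_nonneg)
  finally show ?case by (simp add: mult.commute)
qed

lemma trace_moment_2:
  assumes "\<And>i j. a i j = a j i"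
  shows "trace_moment n a 2 = frobenius n a"
  using trace_moment_even[of a n 1, OF assms] mat_power_1[of _ n a] by (simp add: frobenius_def)

lemma trace_moment_bound_even:
  assumes "\<And>i j. a i j = a j i" "s \<ge> 1"
  shows "trace_moment n a (2 * s) \<le> trace_moment n a 2 ^ s"
  using frobenius_power[OF assms(2)] by (simp only: trace_moment_even[OF assms(1)] trace_moment_2[OF assms(1)])

text \<open>Splitting x ^ r into x ^ (r - 1) and x reduces any order to even ones, where the trace
  is a squared Frobenius norm. The squares avoid the sign of odd traces and half-integer
  exponents.\<close>

lemma trace_moment_bound:
  assumes sym: "\<And>i j. a i j = a j i" and r: "r \<ge> 2"
  shows "(trace_moment n a r)\<^sup>2 \<le> trace_moment n a 2 ^ r"
proof -
  have "trace_moment n a r = poly_sum (trace_moment n a) (monom 1 (r - 1) * monom 1 1)"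
    using r by (simp add: mult_monom poly_sum_monom)
  then have "(trace_moment n a r)\<^sup>2 \<le> trace_moment n a (2 * (r - 1)) * trace_moment n a 2"
    using trace_cauchy_schwarz[of a n "monom 1 (r - 1)" "monom 1 1", OF sym]
    by (simp add: monom_power poly_sum_monom mult.commute)
  also have "\<dots> \<le> trace_moment n a 2 ^ (r - 1) * trace_moment n a 2"
    using trace_moment_bound_even[of a "r - 1" n, OF sym] r
    by (intro mult_right_mono) (auto simp: trace_moment_2[OF sym] frobenius_nonneg)
  also have "\<dots> = trace_moment n a 2 ^ r"
    using r power_Suc[of "trace_moment n a 2" "r - 1"] by (simp add: mult.commute)
  finally show ?thesis .
qed

section \<open>Annihilating polynomials and eigenvalues\<close>

lemma linear_dependence:
  fixes f :: "'i \<Rightarrow> 'b \<Rightarrow> real"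
  assumes "finite B" "finite I" "card B < card I"
  shows "\<exists>c. (\<exists>i\<in>I. c i \<noteq> 0) \<and> (\<forall>b\<in>B. (\<Sum>i\<in>I. c i * f i b) = 0)"
  using assms
proof (induction B arbitrary: I f rule: finite_induct)
  case empty
  then show ?case by (intro exI[of _ "\<lambda>_. 1"]) (auto simp: card_gt_0_iff)
next
  case (insert b B)
  show ?case
  proof (cases "\<forall>i\<in>I. f i b = 0")
    case True
    obtain c where "\<exists>i\<in>I. c i \<noteq> 0" "\<forall>b\<in>B. (\<Sum>i\<in>I. c i * f i b) = 0"
    proof -
      have "card B < card I" using insert by simp
      from insert.IH[OF insert.prems(1) this, of f] show ?thesis using that by blast
    qed
    then show ?thesis using True by (intro exI[of _ c]) auto
  next
    case False
    then obtain p where p: "p \<in> I" "f p b \<noteq> 0" by auto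
    let ?I = "I - {p}"
    \<comment> \<open>Elimination with pivot \<open>p\<close>: the vectors \<open>g i\<close> vanish
      in coordinate \<open>b\<close>, so the induction hypothesis finds a relation among them, and
      the coefficient of \<open>p\<close> is chosen to transfer it back to \<open>f\<close>.\<close>
    define g where "g i x = f i x - f i b / f p b * f p x" for i x
    have "card B < card ?I" using insert p by simp
    then obtain c where c: "\<exists>i\<in>?I. c i \<noteq> 0" "\<forall>x\<in>B. (\<Sum>i\<in>?I. c i * g i x) = 0"
    proof -
      have "finite ?I" using insert.prems by simp
      from insert.IH[OF this \<open>card B < card ?I\<close>, of g] show ?thesis using that by blast
    qed
    define d where "d i = (if i = p then - (\<Sum>i\<in>?I. c i * f i b) / f p b else c i)" for i
    have "(\<Sum>i\<in>I. d i * f i x) = (\<Sum>i\<in>?I. c i * g i x)" for x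
    proof -
      have "(\<Sum>i\<in>I. d i * f i x) = d p * f p x + (\<Sum>i\<in>?I. d i * f i x)"
        using insert.prems p by (simp add: sum.remove)
      also have "(\<Sum>i\<in>?I. d i * f i x) = (\<Sum>i\<in>?I. c i * f i x)"
        by (intro sum.cong) (auto simp: d_def)
      also have "d p * f p x = - (\<Sum>i\<in>?I. c i * (f i b / f p b * f p x))"
        by (simp add: d_def sum_distrib_right sum_divide_distrib mult.assoc)
      finally show ?thesis
        by (simp add: g_def right_diff_distrib sum_subtractf)
    qed
    moreover have "g i b = 0" for i using p by (simp add: g_def)
    ultimately have "\<forall>x\<in>insert b B. (\<Sum>i\<in>I. d i * f i x) = 0" using c by auto
    moreover have "\<exists>i\<in>I. d i \<noteq> 0" using c(1) by (auto simp: d_def)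
    ultimately show ?thesis by blast
  qed
qed

definition mat_eigenvalues :: "nat \<Rightarrow> (nat \<Rightarrow> nat \<Rightarrow> real) \<Rightarrow> real set" where
  "mat_eigenvalues n a = {l. l \<noteq> 0 \<and> (\<exists>u. (\<exists>i<n. u i \<noteq> 0) \<and> (\<forall>i<n. (\<Sum>j<n. a i j * u j) = l * u i))}"

text \<open>The powers of order 0 to \<open>n * n\<close> are one more than the entries of a matrix,
  hence linearly dependent. Existence suffices, as the degree is minimised afterwards.\<close>

lemma ex_annihilator: "\<exists>q. q \<noteq> 0 \<and> (\<forall>i<n. \<forall>j<n. mat_poly n a q i j = 0)"
proof -
  let ?B = "{..<n} \<times> {..<n}" and ?I = "{..n * n}"
  obtain c where c: "\<exists>k\<in>?I. c k \<noteq> 0"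
    "\<forall>z\<in>?B. (\<Sum>k\<in>?I. c k * mat_power n a k (fst z) (snd z)) = 0"
    using linear_dependence[of ?B ?I "\<lambda>k z. mat_power n a k (fst z) (snd z)"] by auto
  define q where "q = (\<Sum>k\<le>n * n. monom (c k) k)"
  have cq: "coeff q k = (if k \<le> n * n then c k else 0)" for k
    by (simp add: q_def coeff_sum)
  have "degree q \<le> n * n" by (rule degree_le) (simp add: cq)
  then have "mat_poly n a q i j = (\<Sum>k\<le>n * n. c k * mat_power n a k i j)" for i j
    by (simp add: mat_poly_def poly_sum_upto cq)
  moreover have "q \<noteq> 0" using c(1) cq by (metis atMost_iff coeff_0)
  ultimately show ?thesis using c(2) by (intro exI[of _ q]) auto
qed

lemma mat_poly_eigen:
  assumes u: "\<And>i. i < n \<Longrightarrow> (\<Sum>j<n. a i j * u j) = l * u i" and i: "i < n"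
  shows "(\<Sum>j<n. mat_poly n a q i j * u j) = poly q l * u i"
proof (induction q)
  case 0
  then show ?case by (simp add: mat_poly_def)
next
  case (pCons c q)
  have "(\<Sum>j<n. mat_mult n (mat_poly n a q) a i j * u j) = (\<Sum>j<n. \<Sum>k<n. mat_poly n a q i k * (a k j * u j))"
    by (simp add: mat_mult_def sum_distrib_right mult.assoc)
  also have "\<dots> = (\<Sum>k<n. mat_poly n a q i k * (\<Sum>j<n. a k j * u j))"
    by (subst sum.swap) (simp add: sum_distrib_left)
  also have "\<dots> = l * (\<Sum>k<n. mat_poly n a q i k * u k)"
    using u by (simp add: sum_distrib_left mult_ac)
  finally show ?case using pCons i
    by (simp add: mat_poly_pCons distrib_right sum.distrib mult_delta_left sum_delta_lt)
qed

lemma finite_mat_eigenvalues: "finite (mat_eigenvalues n a)"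
proof -
  obtain q where q: "q \<noteq> 0" "\<And>i j. i < n \<Longrightarrow> j < n \<Longrightarrow> mat_poly n a q i j = 0"
    using ex_annihilator[of n a] by blast
  have "mat_eigenvalues n a \<subseteq> {l. poly q l = 0}"
  proof
    fix l assume "l \<in> mat_eigenvalues n a"
    then obtain u i where u: "\<And>i. i < n \<Longrightarrow> (\<Sum>j<n. a i j * u j) = l * u i" "i < n" "u i \<noteq> 0"
      unfolding mat_eigenvalues_def by blast
    then show "l \<in> {l. poly q l = 0}" using mat_poly_eigen[of n a u l i q] q(2) by simp
  qed
  then show ?thesis using poly_roots_finite[OF q(1)] finite_subset by blast
qed

lemma prod_roots_dvd:
  fixes q :: "'a::idom poly"
  assumes "finite R" "\<And>r. r \<in> R \<Longrightarrow> poly q r = 0"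
  shows "(\<Prod>r\<in>R. [:- r, 1:]) dvd q"
  using assms
proof (induction R rule: finite_induct)
  case (insert r R)
  then obtain s where s: "q = (\<Prod>r\<in>R. [:- r, 1:]) * s" by (auto elim: dvdE)
  have "poly (\<Prod>r\<in>R. [:- r, 1:]) r \<noteq> 0" using insert by (auto simp: poly_prod)
  then have "poly s r = 0" using insert.prems[of r] by (simp add: s)
  then obtain s' where "s = [:- r, 1:] * s'" by (rule poly_eq_0_iff_dvd[THEN iffD1, THEN dvdE])
  then have "q = (\<Prod>r\<in>insert r R. [:- r, 1:]) * s'"
    by (simp only: prod.insert[OF insert.hyps] s mult_ac)
  then show ?case by (rule dvdI)
qed simp

text \<open>The divisor is the real quadratic with roots z and cnj z. The remainder has degree at
  most 1 and real coefficients, so a nonreal root forces it to be 0.\<close>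

lemma quadratic_dvd:
  fixes q :: "real poly"
  assumes root: "poly (map_poly complex_of_real q) z = 0" and z: "Im z \<noteq> 0"
  shows "[:(Re z)\<^sup>2 + (Im z)\<^sup>2, - 2 * Re z, 1:] dvd q"
proof -
  let ?r = "[:(Re z)\<^sup>2 + (Im z)\<^sup>2, - 2 * Re z, 1:]" and ?c = "map_poly complex_of_real"
  have hom: "?c (p * p') = ?c p * ?c p'" "?c (p + p') = ?c p + ?c p'" for p p'
    by (auto simp: poly_eq_iff coeff_map_poly coeff_mult)
  have "q = ?r * (q div ?r) + q mod ?r" by (simp only: mult_div_mod_eq)
  then have "?c q = ?c ?r * ?c (q div ?r) + ?c (q mod ?r)" using hom by metis
  moreover have "poly (?c ?r) z = 0"
    by (simp add: complex_eq_iff power2_eq_square algebra_simps map_poly_pCons)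
  ultimately have m: "poly (?c (q mod ?r)) z = 0" using root by simp
  have "degree (q mod ?r) < 2 \<or> q mod ?r = 0" using degree_mod_less[of ?r q] by auto
  then have "degree (q mod ?r) \<le> 1" by auto
  moreover obtain b p where p: "q mod ?r = pCons b p" by (cases "q mod ?r")
  ultimately have "degree p = 0" by (cases "p = 0") auto
  then obtain c where "p = [:c:]" by (rule degree_eq_zeroE)
  then have bc: "q mod ?r = [:b, c:]" using p by simp
  have "complex_of_real b + z * complex_of_real c = 0" using m unfolding bc by (simp add: map_poly_pCons)
  then have "c = 0" "b = 0" using z by (auto simp: complex_eq_iff)
  then show ?thesis using bc by (simp add: mod_eq_0_iff_dvd)
qed

text \<open>An annihilating polynomial of minimal degree of a symmetric matrix has only simple real roots,
  all of them eigenvalues.\<close>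

lemma mat_poly_eigenvalues:
  assumes sym: "\<And>i j. a i j = a j i" and ij: "i < n" "j < n"
  shows "mat_poly n a ([:0, 1:] * (\<Prod>l\<in>mat_eigenvalues n a. [:- l, 1:])) i j = 0"
proof -
  define ann where "ann q \<longleftrightarrow> (\<forall>i<n. \<forall>j<n. mat_poly n a q i j = 0)" for q
  have ann_mult: "ann (p * q)" "ann (q * p)" if "ann p" for p q
    using that by (auto simp: ann_def mult.commute[of q p] mat_poly_mult mat_mult_def)
  \<comment> \<open>This is where symmetry enters: the trace of the square is a squared Frobenius
    norm, so the ideal of annihilating polynomials is radical.\<close>
  have ann_sq: "ann p" if "ann (p\<^sup>2)" for p
  proof -
    have "frobenius n (mat_poly n a p) = 0"
      using trace_square[of a n p, OF sym] that by (simp add: poly_sum_trace mat_trace_def ann_def)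
    then show ?thesis unfolding ann_def using frobenius_eq_0D by blast
  qed
  have "\<exists>q. (q \<noteq> 0 \<and> ann q) \<and> (\<forall>p. p \<noteq> 0 \<and> ann p \<longrightarrow> degree q \<le> degree p)"
    using ex_has_least_nat[of "\<lambda>q. q \<noteq> 0 \<and> ann q" _ degree] ex_annihilator[of n a]
    unfolding ann_def by blast
  then obtain q where q: "q \<noteq> 0" "ann q" and qmin: "\<And>p. p \<noteq> 0 \<Longrightarrow> ann p \<Longrightarrow> degree q \<le> degree p"
    by blast
  have proper: "\<not> ann p" if "q = p * r" "degree r \<ge> 1" for p r
  proof
    assume "ann p"
    moreover have "p \<noteq> 0" "r \<noteq> 0" using q(1) that by auto
    ultimately show False using qmin[of p] that by (simp add: degree_mult_eq)
  qed
  define R where "R = {l. poly q l = 0}"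
  have R: "finite R" unfolding R_def by (rule poly_roots_finite[OF q(1)])
  obtain s where s: "q = (\<Prod>r\<in>R. [:- r, 1:]) * s"
    using prod_roots_dvd[OF R, of q] by (auto simp: R_def elim: dvdE)
  have "degree s = 0"
  proof (rule ccontr)
    assume ds: "degree s \<noteq> 0"
    let ?c = "map_poly complex_of_real"
    have "degree (?c s) \<noteq> 0" using ds by (simp add: degree_map_poly)
    then have "\<not> constant (poly (?c s))" by (simp add: constant_degree)
    then obtain z where z: "poly (?c s) z = 0" using fundamental_theorem_of_algebra by blast
    show False
    proof (cases "Im z = 0")
      \<comment> \<open>A real root of the cofactor \<open>s\<close> is also one of the roots
        collected in \<open>R\<close>, hence a double root of \<open>q\<close>. Then
        \<open>q\<close> divides the square of a proper divisor of itself, and this divisor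
        annihilates as well, against minimality.\<close>
      case True
      have "poly (?c s) (complex_of_real x) = complex_of_real (poly s x)" for x
        by (induction s) (auto simp: map_poly_pCons)
      moreover have "z = complex_of_real (Re z)" using True by (simp add: complex_eq_iff)
      ultimately have "poly s (Re z) = 0" using z by (metis of_real_eq_0_iff)
      then obtain s' where s': "s = [:- Re z, 1:] * s'" by (rule poly_eq_0_iff_dvd[THEN iffD1, THEN dvdE])
      have "poly q (Re z) = 0" by (subst s) (simp add: \<open>poly s (Re z) = 0\<close>)
      then have "Re z \<in> R" by (simp add: R_def)
      then have "(\<Prod>r\<in>R. [:- r, 1:]) = [:- Re z, 1:] * (\<Prod>r\<in>R - {Re z}. [:- r, 1:])"
        using R by (simp add: prod.remove)
      then have q2: "q = ([:- Re z, 1:] * (s' * (\<Prod>r\<in>R - {Re z}. [:- r, 1:]))) * [:- Re z, 1:]"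
        by (simp only: s s' mult_ac)
      let ?p = "[:- Re z, 1:] * (s' * (\<Prod>r\<in>R - {Re z}. [:- r, 1:]))"
      have "?p\<^sup>2 = q * (s' * (\<Prod>r\<in>R - {Re z}. [:- r, 1:]))"
        by (subst q2) (simp only: power2_eq_square mult_ac)
      then have "ann ?p" using ann_mult(1)[OF q(2)] ann_sq by metis
      then show False using proper[OF q2] by simp
    next
      \<comment> \<open>A nonreal root splits off (x - Re z) ^ 2 + (Im z) ^ 2. Multiplying
        \<open>q\<close> by the cofactor \<open>?p\<close> yields a sum of two squares whose trace
        is 0, so both squared norms vanish and the second one shows that \<open>?p\<close>
        annihilates.\<close>
      case False
      let ?r = "[:(Re z)\<^sup>2 + (Im z)\<^sup>2, - 2 * Re z, 1:]"
      obtain s' where s': "s = ?r * s'" using quadratic_dvd[OF z False] by (auto elim: dvdE)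
      let ?p = "s' * (\<Prod>r\<in>R. [:- r, 1:])"
      have q2: "q = ?p * ?r" by (simp only: s s' mult_ac)
      have sq: "(A * p)\<^sup>2 + (smult y p)\<^sup>2 = p * (A\<^sup>2 + [:y\<^sup>2:]) * p" for A p :: "real poly" and y
      proof -
        have "smult y p = [:y:] * p" "[:y\<^sup>2:] = [:y:]\<^sup>2" by (simp_all add: power2_eq_square)
        then show ?thesis by (simp only: power2_eq_square distrib_left distrib_right mult_ac)
      qed
      have "?r = [:- Re z, 1:]\<^sup>2 + [:(Im z)\<^sup>2:]" by (simp add: power2_eq_square)
      then have "([:- Re z, 1:] * ?p)\<^sup>2 + (smult (Im z) ?p)\<^sup>2 = q * ?p"
        unfolding sq by (subst q2) (simp only:)
      moreover have "poly_sum (trace_moment n a) (q * ?p) = 0"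
        using ann_mult(1)[OF q(2), of ?p] by (simp add: poly_sum_trace mat_trace_def ann_def)
      ultimately have "poly_sum (trace_moment n a) (([:- Re z, 1:] * ?p)\<^sup>2) +
          poly_sum (trace_moment n a) ((smult (Im z) ?p)\<^sup>2) = 0"
        by (simp only: poly_sum_add[symmetric])
      then have "frobenius n (mat_poly n a (smult (Im z) ?p)) = 0"
        unfolding trace_square[OF sym]
        using frobenius_nonneg[of n "mat_poly n a ([:- Re z, 1:] * ?p)"]
          frobenius_nonneg[of n "mat_poly n a (smult (Im z) ?p)"] by linarith
      then have "mat_poly n a (smult (Im z) ?p) i j = 0" if "i < n" "j < n" for i j
        using that by (rule frobenius_eq_0D)
      then have "ann ?p" using False by (simp add: ann_def mat_poly_def poly_sum_smult)
      then show False using proper[OF q2] by simp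
    qed
  qed
  then obtain c where c: "s = [:c:]" by (rule degree_eq_zeroE)
  then have cn: "c \<noteq> 0" using q(1) s by auto
  \<comment> \<open>Dividing \<open>q\<close> by the factor of a root \<open>l\<close> leaves a
    polynomial that does not annihilate; any nonzero column of its value at \<open>a\<close> is an
    eigenvector for \<open>l\<close>.\<close>
  have "R \<subseteq> insert 0 (mat_eigenvalues n a)"
  proof
    fix l assume l: "l \<in> R"
    then have "poly q l = 0" by (simp add: R_def)
    then obtain q' where "q = [:- l, 1:] * q'" by (rule poly_eq_0_iff_dvd[THEN iffD1, THEN dvdE])
    then have q': "q = q' * [:- l, 1:]" by (simp only: mult.commute)
    then have "\<not> ann q'" using proper[OF q'] by simp
    then obtain i j where ij: "i < n" "j < n" "mat_poly n a q' i j \<noteq> 0" by (auto simp: ann_def)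
    have eig: "(\<Sum>k<n. a i k * mat_poly n a q' k j) = l * mat_poly n a q' i j" if "i < n" for i
    proof -
      have "mat_poly n a q i j = mat_poly n a (pCons 0 q' + smult (- l) q') i j"
        by (simp add: q' mult.commute[of q'])
      also have "\<dots> = mat_mult n a (mat_poly n a q') i j - l * mat_poly n a q' i j"
        using mat_poly_pCons[of n a 0 q' i j] mat_poly_commutes[of i n j a q'] that ij
        by (simp add: mat_poly_def poly_sum_diff poly_sum_smult)
      finally show ?thesis using q(2) that ij by (simp add: ann_def mat_mult_def)
    qed
    have "l \<in> mat_eigenvalues n a" if "l \<noteq> 0"
      unfolding mat_eigenvalues_def
      by (intro CollectI conjI exI[of _ "\<lambda>k. mat_poly n a q' k j"]) (use that ij eig in auto)
    then show "l \<in> insert 0 (mat_eigenvalues n a)" by blast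
  qed
  then have "(\<Prod>r\<in>R. [:- r, 1:]) dvd (\<Prod>r\<in>insert 0 (mat_eigenvalues n a). [:- r, 1:])"
    by (intro prod_dvd_prod_subset) (auto simp: finite_mat_eigenvalues)
  also have "(\<Prod>r\<in>insert 0 (mat_eigenvalues n a). [:- r, 1:]) =
      [:0, 1:] * (\<Prod>l\<in>mat_eigenvalues n a. [:- l, 1:])"
    by (subst prod.insert[OF finite_mat_eigenvalues]) (simp_all add: mat_eigenvalues_def)
  finally obtain t where t: "[:0, 1:] * (\<Prod>l\<in>mat_eigenvalues n a. [:- l, 1:]) = (\<Prod>r\<in>R. [:- r, 1:]) * t"
    by (auto elim: dvdE)
  have "(\<Prod>r\<in>R. [:- r, 1:]) = q * [:1 / c:]" using s c cn by (simp add: mult.commute)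
  then have "ann ([:0, 1:] * (\<Prod>l\<in>mat_eigenvalues n a. [:- l, 1:]))"
    unfolding t using ann_mult(1)[OF q(2)] by (simp only: mult.assoc)
  then show ?thesis using ij by (simp only: ann_def)
qed

text \<open>Cyclicity of the trace across two dimensions; at order 0 the traces would be
  \<open>N\<close> and \<open>n\<close>. In the application \<open>d\<close> holds the coordinates
  of approximately orthonormal functions on a fine partition, so that the product of
  \<open>d\<close> and \<open>d'\<close> is a Gram matrix close to the identity, while
  \<open>n\<close> stays fixed.\<close>

lemma trace_moment_congruence:
  fixes c d :: "nat \<Rightarrow> nat \<Rightarrow> real" and n N :: nat
  defines "d' \<equiv> \<lambda>i k. d k i"
  assumes r: "r \<ge> 1"
  shows "trace_moment N (mat_mult n d' (mat_mult n c d)) r = trace_moment n (mat_mult n c (mat_mult N d d')) r"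
proof -
  let ?a = "mat_mult n d' (mat_mult n c d)" and ?b = "mat_mult n c (mat_mult N d d')"
  have pow: "mat_power N ?a (Suc r) i j = mat_mult n d' (mat_mult n (mat_power n ?b r) (mat_mult n c d)) i j"
    if "i < N" for r i j
  proof (induction r arbitrary: j)
    case 0
    show ?case
      unfolding mat_power_1[OF that] by (simp add: mat_mult_def[of n d'] mat_power_0_mult del: mat_power.simps)
  next
    case (Suc r)
    have "mat_power N ?a (Suc (Suc r)) i j = mat_mult N (mat_power N ?a (Suc r)) ?a i j"
      by simp
    also have "\<dots> = mat_mult N (mat_mult n d' (mat_mult n (mat_power n ?b r) (mat_mult n c d))) ?a i j"
      unfolding mat_mult_def[of N "mat_power N ?a (Suc r)"] Suc by (simp add: mat_mult_def[of N])
    also have "\<dots> = mat_mult n d' (mat_mult n (mat_power n ?b (Suc r)) (mat_mult n c d)) i j"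
      by (simp add: mat_mult_assoc)
    finally show ?case .
  qed
  obtain s where s: "r = Suc s" using r by (cases r) auto
  let ?Z = "mat_mult n (mat_power n ?b s) (mat_mult n c d)"
  have "trace_moment N ?a r = (\<Sum>i<N. mat_mult n d' ?Z i i)"
    using pow by (simp add: trace_moment_def mat_trace_def s del: mat_power.simps)
  also have "\<dots> = (\<Sum>i<N. \<Sum>k<n. ?Z k i * d' i k)" by (simp add: mat_mult_def[of n d'] mult.commute)
  also have "\<dots> = (\<Sum>k<n. \<Sum>i<N. ?Z k i * d' i k)" by (rule sum.swap)
  also have "\<dots> = (\<Sum>k<n. mat_mult N ?Z d' k k)" by (simp add: mat_mult_def[of N ?Z])
  also have "mat_mult N ?Z d' = mat_power n ?b r" by (simp add: s mat_mult_assoc)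
  finally show ?thesis by (simp add: trace_moment_def mat_trace_def)
qed

lemma trace_moment_tendsto:
  assumes G: "\<And>k l. k < n \<Longrightarrow> l < n \<Longrightarrow> (\<lambda>m. G m k l) \<longlonglongrightarrow> (if k = l then 1 else 0 :: real)"
  shows "(\<lambda>m. trace_moment n (mat_mult n c (G m)) r) \<longlonglongrightarrow> trace_moment n c r"
proof -
  have b: "(\<lambda>m. mat_mult n c (G m) k l) \<longlonglongrightarrow> c k l" if "l < n" for k l
  proof -
    have "(\<lambda>m. \<Sum>p<n. c k p * G m p l) \<longlonglongrightarrow> (\<Sum>p<n. c k p * (if p = l then 1 else 0))"
      using that by (intro tendsto_intros G) auto
    then show ?thesis using that by (simp add: mat_mult_def mult_delta_right sum_delta_lt)
  qed
  have "(\<lambda>m. mat_power n (mat_mult n c (G m)) r k l) \<longlonglongrightarrow> mat_power n c r k l" if "l < n" for k l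
    using that
  proof (induction r arbitrary: l)
    case (Suc r)
    have "(\<lambda>m. \<Sum>p<n. mat_power n (mat_mult n c (G m)) r k p * mat_mult n c (G m) p l) \<longlonglongrightarrow>
        (\<Sum>p<n. mat_power n c r k p * c p l)"
      using Suc b by (intro tendsto_intros) auto
    then show ?case by (simp add: mat_mult_def[of n "mat_power n _ r"])
  qed simp
  then show ?thesis unfolding trace_moment_def mat_trace_def by (intro tendsto_sum) auto
qed

section \<open>Double Wigner integrals\<close>

lemma symmetric_kernelsI:
  "f \<in> square_integrable half_line2 \<Longrightarrow> (\<And>x y. f (x, y) = f (y, x)) \<Longrightarrow> f \<in> symmetric_kernels"
  by (auto simp: symmetric_kernels_def)

lemma symmetric_kernelsD: "f \<in> symmetric_kernels \<Longrightarrow> f \<in> square_integrable half_line2"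
  by (simp add: symmetric_kernels_def)

lemma symmetric_kernels_swap:
  "f \<in> symmetric_kernels \<Longrightarrow> AE z in half_line2. f z = f (case z of (x, y) \<Rightarrow> (y, x))"
  by (auto simp: symmetric_kernels_def case_prod_beta')

lemma symmetric_kernels_add:
  assumes "f \<in> symmetric_kernels" "g \<in> symmetric_kernels"
  shows "(\<lambda>z. f z + g z) \<in> symmetric_kernels"
proof -
  have "AE z in half_line2. f z + g z = f (case z of (x, y) \<Rightarrow> (y, x)) + g (case z of (x, y) \<Rightarrow> (y, x))"
    using assms[THEN symmetric_kernels_swap] by eventually_elim simp
  then show ?thesis
    using assms by (auto simp: symmetric_kernels_def case_prod_beta')
qed

lemma symmetric_kernels_scale:
  assumes "f \<in> symmetric_kernels"
  shows "(\<lambda>z. c * f z) \<in> symmetric_kernels"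
proof -
  have "AE z in half_line2. c * f z = c * f (case z of (x, y) \<Rightarrow> (y, x))"
    using assms[THEN symmetric_kernels_swap] by eventually_elim simp
  then show ?thesis
    using assms by (auto simp: symmetric_kernels_def case_prod_beta')
qed

lemma symmetric_kernels_sum:
  "(\<And>i. i \<in> I \<Longrightarrow> f i \<in> symmetric_kernels) \<Longrightarrow> (\<lambda>z. \<Sum>i\<in>I. f i z) \<in> symmetric_kernels"
proof (induction I rule: infinite_finite_induct)
  case (insert i I)
  then show ?case using symmetric_kernels_add[of "f i" "\<lambda>z. \<Sum>i\<in>I. f i z"] by simp
qed (auto intro!: symmetric_kernelsI)

text \<open>Polarised tensor square: the defining property in \<open>double_wigner_integral\<close>
  prescribes values on tensor squares only.\<close>

definition sym_tensor :: "(real \<Rightarrow> real) \<Rightarrow> (real \<Rightarrow> real) \<Rightarrow> real \<times> real \<Rightarrow> real" where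
  "sym_tensor h k = (\<lambda>(x, y). h x * k y + k x * h y)"

lemma sym_tensor_in:
  assumes "h \<in> square_integrable half_line" "k \<in> square_integrable half_line"
  shows "sym_tensor h k \<in> symmetric_kernels"
proof (rule symmetric_kernelsI)
  have "sym_tensor h k = (\<lambda>z. (case z of (x, y) \<Rightarrow> h x * k y) + (case z of (x, y) \<Rightarrow> k x * h y))"
    by (auto simp: sym_tensor_def)
  then show "sym_tensor h k \<in> square_integrable half_line2"
    using assms by (simp only:) (intro square_integrable_add tensor_square_integrable)
qed (simp add: sym_tensor_def mult.commute)

lemma tensor_square_in:
  "h \<in> square_integrable half_line \<Longrightarrow> (\<lambda>(x, y). h x * h y) \<in> symmetric_kernels"
  by (rule symmetric_kernelsI[OF tensor_square_integrable]) (auto simp: mult.commute)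

lemma step_kernel_sym:
  assumes "\<And>i j. a i j = a j i"
  shows "step_kernel ts a = (\<lambda>z. \<Sum>i<length ts - 1. \<Sum>j<length ts - 1.
    a i j / 2 * sym_tensor (incr_fun ts i) (incr_fun ts j) z)"
proof
  fix z :: "real \<times> real"
  obtain x y where z: "z = (x, y)" by (cases z)
  let ?n = "length ts - 1"
  have "(\<Sum>i<?n. \<Sum>j<?n. a i j * (incr_fun ts j x * incr_fun ts i y)) =
      (\<Sum>i<?n. \<Sum>j<?n. a i j * (incr_fun ts i x * incr_fun ts j y))"
    by (subst sum.swap) (simp add: assms)
  then have "(\<Sum>i<?n. \<Sum>j<?n. a i j / 2 * sym_tensor (incr_fun ts i) (incr_fun ts j) z) =
      (\<Sum>i<?n. \<Sum>j<?n. a i j * (incr_fun ts i x * incr_fun ts j y))"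
    by (simp add: z sym_tensor_def distrib_left sum.distrib flip: sum_divide_distrib)
  then show "step_kernel ts a z = (\<Sum>i<?n. \<Sum>j<?n. a i j / 2 * sym_tensor (incr_fun ts i) (incr_fun ts j) z)"
    by (simp add: step_kernel_def z)
qed

lemma step_kernel_in:
  assumes "increments ts" "\<And>i j. a i j = a j i"
  shows "step_kernel ts a \<in> symmetric_kernels"
  unfolding step_kernel_sym[of a, OF assms(2)] using assms(1)
  by (intro symmetric_kernels_sum symmetric_kernels_scale sym_tensor_in incr_fun_square_integrable) auto

lemma L2_inner_sum:
  assumes E: "\<And>p. p \<in> I \<Longrightarrow> E p \<in> square_integrable \<mu>" and F: "\<And>q. q \<in> K \<Longrightarrow> F q \<in> square_integrable \<mu>"
  shows "(\<integral>x. (\<Sum>p\<in>I. c p * E p x) * (\<Sum>q\<in>K. d q * F q x) \<partial>\<mu>) =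
    (\<Sum>p\<in>I. \<Sum>q\<in>K. c p * d q * (\<integral>x. E p x * F q x \<partial>\<mu>))"
proof -
  have int: "integrable \<mu> (\<lambda>x. c p * d q * (E p x * F q x))" if "p \<in> I" "q \<in> K" for p q
    by (intro integrable_mult_right square_integrable_mult E F that)
  have "(\<integral>x. (\<Sum>p\<in>I. c p * E p x) * (\<Sum>q\<in>K. d q * F q x) \<partial>\<mu>) =
      (\<integral>x. (\<Sum>p\<in>I. \<Sum>q\<in>K. c p * d q * (E p x * F q x)) \<partial>\<mu>)"
    by (simp add: sum_product mult_ac)
  also have "\<dots> = (\<Sum>p\<in>I. \<integral>x. (\<Sum>q\<in>K. c p * d q * (E p x * F q x)) \<partial>\<mu>)"
    by (rule Bochner_Integration.integral_sum) (intro Bochner_Integration.integrable_sum int)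
  also have "\<dots> = (\<Sum>p\<in>I. \<Sum>q\<in>K. \<integral>x. c p * d q * (E p x * F q x) \<partial>\<mu>)"
    by (intro sum.cong refl Bochner_Integration.integral_sum int)
  finally show ?thesis by simp
qed

lemma step_kernel_norm:
  assumes ts: "increments ts"
  shows "(L2_norm_measure half_line2 (step_kernel ts a))\<^sup>2 = frobenius (length ts - 1) a"
proof -
  let ?n = "length ts - 1"
  let ?I = "{..<?n} \<times> {..<?n}"
  let ?e = "\<lambda>p z. case z of (x, y) \<Rightarrow> incr_fun ts (fst p) x * incr_fun ts (snd p) y"
  have L2: "?e p \<in> square_integrable half_line2" if "p \<in> ?I" for p
    using that ts by (intro tensor_square_integrable incr_fun_square_integrable) auto
  have inner: "(\<integral>z. ?e p z * ?e q z \<partial>half_line2) = (if q = p then 1 else 0)"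
    if "p \<in> ?I" "q \<in> ?I" for p q
    using that ts by (subst tensor_inner) (auto simp: incr_fun_orthonormal incr_fun_square_integrable prod_eq_iff)
  have "step_kernel ts a = (\<lambda>z. \<Sum>p\<in>?I. (case_prod a p) * ?e p z)"
    by (auto simp: step_kernel_def sum.cartesian_product case_prod_beta')
  then have "(L2_norm_measure half_line2 (step_kernel ts a))\<^sup>2 =
      (\<integral>z. (\<Sum>p\<in>?I. (case_prod a p) * ?e p z) * (\<Sum>p\<in>?I. (case_prod a p) * ?e p z) \<partial>half_line2)"
    unfolding L2_norm_measure_sq(1) by (simp only: power2_eq_square)
  also have "\<dots> = (\<Sum>p\<in>?I. \<Sum>q\<in>?I. case_prod a p * case_prod a q * (\<integral>z. ?e p z * ?e q z \<partial>half_line2))"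
    by (rule L2_inner_sum) (use L2 in auto)
  also have "\<dots> = (\<Sum>p\<in>?I. \<Sum>q\<in>?I. if q = p then case_prod a p * case_prod a q else 0)"
    by (intro sum.cong refl) (simp only: inner if_distrib[of "\<lambda>x. _ * x"] mult_1_right mult_zero_right)
  also have "\<dots> = (\<Sum>p\<in>?I. (case_prod a p)\<^sup>2)"
    by (intro sum.cong refl) (simp add: sum.delta power2_eq_square)
  also have "\<dots> = frobenius ?n a"
    by (simp add: frobenius_def sum.cartesian_product case_prod_beta')
  finally show ?thesis .
qed

lemma integral_swap_half_line2:
  fixes f :: "real \<times> real \<Rightarrow> real"
  assumes "f \<in> borel_measurable half_line2"
  shows "(\<integral>z. f (case z of (x, y) \<Rightarrow> (y, x)) \<partial>half_line2) = (\<integral>z. f z \<partial>half_line2)"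
  using half_line2.integral_product_swap[OF assms] by (simp add: case_prod_beta')

text \<open>Since \<open>f\<close> is symmetric almost everywhere, transposing the coefficients of a
  step kernel does not change its distance from \<open>f\<close>. The mean of the two is symmetric
  and, by the triangle inequality, at least as close.\<close>

lemma symmetric_step_approx:
  assumes f: "f \<in> symmetric_kernels" and e: "e > 0"
  shows "\<exists>ts a. increments ts \<and> (\<forall>i j. a i j = a j i) \<and> L2_norm_measure half_line2 (\<lambda>z. f z - step_kernel ts a z) < e"
proof -
  let ?sw = "\<lambda>z :: real \<times> real. case z of (x, y) \<Rightarrow> (y, x)"
  obtain T where T: "finite T" "T \<subseteq> {0..}"
    "\<And>T'. finite T' \<Longrightarrow> T' \<subseteq> {0..} \<Longrightarrow> T \<subseteq> T' \<Longrightarrow>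
      \<exists>g\<in>range (step_kernel (sorted_list_of_set T')). L2_norm_measure half_line2 (\<lambda>x. f x - g x) < e"
    by (rule refinableE[OF step_kernel_dense[OF symmetric_kernelsD[OF f]] e], rule that)
  define ts where "ts = sorted_list_of_set T"
  have ts: "increments ts" using T by (simp add: ts_def increments_sorted_list)
  obtain a where a: "L2_norm_measure half_line2 (\<lambda>z. f z - step_kernel ts a z) < e"
    using T(3)[OF T(1,2) subset_refl] by (auto simp: ts_def)
  have sq: "step_kernel ts b \<in> square_integrable half_line2" for b
    by (rule step_kernel_square_integrable[OF ts])
  note fL = symmetric_kernelsD[OF f]
  define b where "b i j = (a i j + a j i) / 2" for i j
  have swap: "step_kernel ts (\<lambda>i j. a j i) z = step_kernel ts a (?sw z)" for z
    by (cases z, simp only: step_kernel_def prod.case, subst sum.swap, simp add: mult_ac)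
  have "L2_norm_measure half_line2 (\<lambda>z. f z - step_kernel ts (\<lambda>i j. a j i) z) =
      L2_norm_measure half_line2 (\<lambda>z. f z - step_kernel ts a z)"
  proof -
    have "(\<integral>z. (f z - step_kernel ts (\<lambda>i j. a j i) z)\<^sup>2 \<partial>half_line2) =
        (\<integral>z. (f (?sw z) - step_kernel ts a (?sw z))\<^sup>2 \<partial>half_line2)"
    proof (rule integral_cong_AE)
      note [measurable] = square_integrableD(1)[OF fL] square_integrableD(1)[OF sq]
      show "(\<lambda>z. (f z - step_kernel ts (\<lambda>i j. a j i) z)\<^sup>2) \<in> borel_measurable half_line2" by measurable
      have [measurable]: "?sw \<in> measurable half_line2 half_line2" by measurable
      show "(\<lambda>z. (f (?sw z) - step_kernel ts a (?sw z))\<^sup>2) \<in> borel_measurable half_line2" by measurable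
      show "AE z in half_line2. (f z - step_kernel ts (\<lambda>i j. a j i) z)\<^sup>2 = (f (?sw z) - step_kernel ts a (?sw z))\<^sup>2"
        using symmetric_kernels_swap[OF f] by eventually_elim (simp add: swap)
    qed
    also have "\<dots> = (\<integral>z. (f z - step_kernel ts a z)\<^sup>2 \<partial>half_line2)"
    proof -
      note [measurable] = square_integrableD(1)[OF fL] square_integrableD(1)[OF sq]
      have "(\<lambda>z. (f z - step_kernel ts a z)\<^sup>2) \<in> borel_measurable half_line2" by measurable
      from integral_swap_half_line2[OF this] show ?thesis .
    qed
    finally show ?thesis by (simp add: L2_norm_measure_def)
  qed
  moreover have "(\<lambda>z. f z - step_kernel ts b z) = (\<lambda>z. (1/2) * (f z - step_kernel ts a z) +
      (1/2) * (f z - step_kernel ts (\<lambda>i j. a j i) z))"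
    by (auto simp: step_kernel_def b_def field_simps sum.distrib simp flip: sum_divide_distrib)
  moreover have "L2_norm_measure half_line2 (\<lambda>z. (1/2) * (f z - step_kernel ts a z) +
      (1/2) * (f z - step_kernel ts (\<lambda>i j. a j i) z)) \<le>
     L2_norm_measure half_line2 (\<lambda>z. (1/2) * (f z - step_kernel ts a z)) +
     L2_norm_measure half_line2 (\<lambda>z. (1/2) * (f z - step_kernel ts (\<lambda>i j. a j i) z))"
    using fL sq by (intro L2_norm_triangle square_integrable_scale square_integrable_diff)
  ultimately have "L2_norm_measure half_line2 (\<lambda>z. f z - step_kernel ts b z) < e"
    using a by (simp only: L2_norm_scale)
  moreover have "b i j = b j i" for i j by (simp add: b_def add.commute)
  ultimately show ?thesis using ts by blast
qed

section \<open>Convergence and bounds transferred between moments and cumulants\<close>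

lemma free_cumulants_tendsto:
  fixes m :: "nat \<Rightarrow> nat \<Rightarrow> complex"
  assumes "\<And>k. (\<lambda>n. m n k) \<longlonglongrightarrow> m' k"
  shows "(\<lambda>n. free_cumulant_of_moments (m n) r) \<longlonglongrightarrow> free_cumulant_of_moments m' r"
proof (induction r rule: less_induct)
  case (less r)
  show ?case
    unfolding free_cumulant_of_moments.simps[of _ r]
  proof (intro tendsto_diff assms tendsto_sum tendsto_prod)
    fix V :: "nat set"
    show "(\<lambda>n. if card V < r then free_cumulant_of_moments (m n) (card V) else 0) \<longlonglongrightarrow>
        (if card V < r then free_cumulant_of_moments m' (card V) else 0)"
      using less by auto
  qed
qed

lemma block_card_pos:
  assumes "\<pi> \<in> noncrossing_partitions k" "V \<in> \<pi>"
  shows "card V \<ge> 1"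
  using interval_nc_block[of \<pi> 0 k V] assms
  by (simp add: noncrossing_partitions_eq Suc_le_eq card_gt_0_iff)

lemma moments_tendsto_of_cumulants:
  fixes m :: "nat \<Rightarrow> nat \<Rightarrow> complex"
  assumes "\<And>r. r \<ge> 1 \<Longrightarrow> (\<lambda>n. free_cumulant_of_moments (m n) r) \<longlonglongrightarrow> free_cumulant_of_moments m' r"
    and "k \<ge> 1"
  shows "(\<lambda>n. m n k) \<longlonglongrightarrow> m' k"
proof -
  have "0 < k" using assms(2) by simp
  show ?thesis
    unfolding moment_cumulant_formula[OF \<open>0 < k\<close>]
    by (intro tendsto_sum tendsto_prod assms(1) block_card_pos)
qed

lemma moments_bounded_of_cumulants:
  fixes m :: "nat \<Rightarrow> nat \<Rightarrow> complex"
  assumes b: "\<And>r. r \<ge> 1 \<Longrightarrow> \<exists>B. \<forall>n. cmod (free_cumulant_of_moments (m n) r) \<le> B"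
    and "k \<ge> 1"
  shows "\<exists>B. \<forall>n. cmod (m n k) \<le> B"
proof -
  have "0 < k" using assms(2) by simp
  obtain B where B: "\<And>r n. r \<ge> 1 \<Longrightarrow> cmod (free_cumulant_of_moments (m n) r) \<le> B r"
    using b by metis
  have "cmod (m n k) \<le> (\<Sum>\<pi>\<in>noncrossing_partitions k. \<Prod>V\<in>\<pi>. B (card V))" for n
    unfolding moment_cumulant_formula[OF \<open>0 < k\<close>, of "m n"]
  proof (intro order_trans[OF norm_sum] sum_mono)
    fix \<pi> assume "\<pi> \<in> noncrossing_partitions k"
    then show "cmod (\<Prod>V\<in>\<pi>. free_cumulant_of_moments (m n) (card V)) \<le> (\<Prod>V\<in>\<pi>. B (card V))"
      unfolding prod_norm[symmetric] by (intro prod_mono) (auto intro: B block_card_pos)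
  qed
  then show ?thesis by blast
qed

section \<open>Cumulants of \<open>A\<close> plus the double integral of a step kernel\<close>

context wigner_setting
begin

lemma I2_in [simp]: "f \<in> symmetric_kernels \<Longrightarrow> I\<^sub>2 f \<in> M"
  and I2_add: "f \<in> symmetric_kernels \<Longrightarrow> g \<in> symmetric_kernels \<Longrightarrow> I\<^sub>2 (\<lambda>z. f z + g z) = I\<^sub>2 f + I\<^sub>2 g"
  and I2_scale: "f \<in> symmetric_kernels \<Longrightarrow> I\<^sub>2 (\<lambda>z. c * f z) = c *\<^sub>R I\<^sub>2 f"
  using I2 unfolding continuous_linear_L2_def by (elim conjE; simp)+

lemma I2_bound: obtains C where "C \<ge> 0"
  "\<And>f. f \<in> symmetric_kernels \<Longrightarrow> M.nrm (I\<^sub>2 f) \<le> C * L2_norm_measure half_line2 f"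
proof -
  obtain C where C: "\<And>f. f \<in> symmetric_kernels \<Longrightarrow> M.nrm (I\<^sub>2 f) \<le> C * L2_norm_measure half_line2 f"
    using I2 unfolding continuous_linear_L2_def by blast
  have *: "M.nrm (I\<^sub>2 f) \<le> \<bar>C\<bar> * L2_norm_measure half_line2 f" if "f \<in> symmetric_kernels" for f
    using C[OF that] mult_right_mono[OF abs_ge_self[of C] L2_norm_measure_sq(2)[of half_line2 f]] by linarith
  show ?thesis by (rule that[of "\<bar>C\<bar>"]) (simp_all add: *)
qed

lemma I2_sum:
  "(\<And>i. i \<in> I \<Longrightarrow> f i \<in> symmetric_kernels) \<Longrightarrow> I\<^sub>2 (\<lambda>z. \<Sum>i\<in>I. f i z) = (\<Sum>i\<in>I. I\<^sub>2 (f i))"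
proof (induction I rule: infinite_finite_induct)
  case (insert i I)
  then show ?case using I2_add[of "f i" "\<lambda>z. \<Sum>i\<in>I. f i z"] by (simp add: symmetric_kernels_sum)
next
  case (infinite I)
  then show ?case using I2_scale[of "\<lambda>z. 0" 0] by (simp add: symmetric_kernelsI square_integrable_zero)
next
  case empty
  then show ?case using I2_scale[of "\<lambda>z. 0" 0] by (simp add: symmetric_kernelsI square_integrable_zero)
qed

lemma W_in [simp]: "h \<in> square_integrable half_line \<Longrightarrow> W h \<in> M"
  and W_add: "h \<in> square_integrable half_line \<Longrightarrow> k \<in> square_integrable half_line \<Longrightarrow> W (\<lambda>x. h x + k x) = W h + W k"
  and W_scale: "h \<in> square_integrable half_line \<Longrightarrow> W (\<lambda>x. c * h x) = c *\<^sub>R W h"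
  and W_interval: "0 \<le> s \<Longrightarrow> s \<le> t \<Longrightarrow> W (indicator {s..<t}) = S t - S s"
  using wigner unfolding wigner_integral_def continuous_linear_L2_def by (elim conjE; simp)+

text \<open>Polarisation of the defining identity. The integrals of \<open>h\<close> and
  \<open>k\<close> need not commute, so both orders of the product remain.\<close>

lemma I2_sym_tensor:
  assumes h: "h \<in> square_integrable half_line" and k: "k \<in> square_integrable half_line"
  shows "I\<^sub>2 (sym_tensor h k) = W h * W k + W k * W h - (2 * (\<integral>x. h x * k x \<partial>half_line)) *\<^sub>R 1"
proof -
  let ?hk = "\<lambda>x. h x + k x"
  have hk: "?hk \<in> square_integrable half_line" using h k by (rule square_integrable_add)
  have eq: "(\<lambda>(x, y). ?hk x * ?hk y) = (\<lambda>z. ((case z of (x, y) \<Rightarrow> h x * h y) + sym_tensor h k z) + (case z of (x, y) \<Rightarrow> k x * k y))"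
    by (auto simp: sym_tensor_def algebra_simps)
  have "I\<^sub>2 (\<lambda>(x, y). ?hk x * ?hk y) =
      I\<^sub>2 (\<lambda>(x, y). h x * h y) + I\<^sub>2 (sym_tensor h k) + I\<^sub>2 (\<lambda>(x, y). k x * k y)"
    unfolding eq using h k
    by (subst I2_add; (subst I2_add)?; (intro symmetric_kernels_add)?; (simp add: sym_tensor_in tensor_square_in)?)
  then have "I\<^sub>2 (sym_tensor h k) = I\<^sub>2 (\<lambda>(x, y). ?hk x * ?hk y) - I\<^sub>2 (\<lambda>(x, y). h x * h y) - I\<^sub>2 (\<lambda>(x, y). k x * k y)"
    by (simp add: algebra_simps)
  also have "\<dots> = (W h + W k)\<^sup>2 - (W h)\<^sup>2 - (W k)\<^sup>2 - ((\<integral>x. (?hk x)\<^sup>2 \<partial>half_line) -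
      (\<integral>x. (h x)\<^sup>2 \<partial>half_line) - (\<integral>x. (k x)\<^sup>2 \<partial>half_line)) *\<^sub>R 1"
    unfolding I2_tensor[OF hk] I2_tensor[OF h] I2_tensor[OF k] W_add[OF h k] by (simp add: scaleR_diff_left)
  also have "(\<integral>x. (?hk x)\<^sup>2 \<partial>half_line) = (\<integral>x. (h x)\<^sup>2 \<partial>half_line) + 2 * (\<integral>x. h x * k x \<partial>half_line) + (\<integral>x. (k x)\<^sup>2 \<partial>half_line)"
  proof -
    have "(\<lambda>x. (?hk x)\<^sup>2) = (\<lambda>x. (h x)\<^sup>2 + 2 * (h x * k x) + (k x)\<^sup>2)" by (auto simp: power2_sum)
    then show ?thesis using h k square_integrable_mult[OF h k] by (simp add: square_integrableD)
  qed
  finally show ?thesis by (simp add: power2_eq_square algebra_simps)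
qed

lemma W_incr_fun:
  assumes "increments ts" "i < length ts - 1"
  shows "W (incr_fun ts i) = (1 / sqrt (ts ! Suc i - ts ! i)) *\<^sub>R (S (ts ! Suc i) - S (ts ! i))"
proof -
  note n = increments_nth[OF assms]
  show ?thesis
    unfolding incr_fun_def using n by (subst W_scale) (auto simp: W_interval intro: interval_square_integrable)
qed

lemma I2_step_kernel:
  assumes ts: "increments ts" and a: "\<And>i j. a i j = a j i"
  shows "I\<^sub>2 (step_kernel ts a) = (\<Sum>i<length ts - 1. \<Sum>j<length ts - 1.
      a i j *\<^sub>R (W (incr_fun ts i) * W (incr_fun ts j))) - (\<Sum>i<length ts - 1. a i i) *\<^sub>R 1"
proof -
  let ?n = "length ts - 1" and ?x = "\<lambda>i. W (incr_fun ts i)"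
  note inc = incr_fun_square_integrable[OF ts]
  have "I\<^sub>2 (step_kernel ts a) = (\<Sum>i<?n. \<Sum>j<?n. (a i j / 2) *\<^sub>R I\<^sub>2 (sym_tensor (incr_fun ts i) (incr_fun ts j)))"
    unfolding step_kernel_sym[of a, OF a]
    by (subst I2_sum, (intro symmetric_kernels_sum symmetric_kernels_scale sym_tensor_in inc; simp),
        intro sum.cong refl, subst I2_sum, (intro symmetric_kernels_scale sym_tensor_in inc; simp),
        intro sum.cong refl I2_scale sym_tensor_in inc) auto
  \<comment> \<open>Orthonormality of the increments leaves only diagonal corrections, which add up
    to the trace of \<open>a\<close>.\<close>
  also have "\<dots> = (\<Sum>i<?n. \<Sum>j<?n. (a i j / 2) *\<^sub>R (?x i * ?x j) + (a i j / 2) *\<^sub>R (?x j * ?x i) -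
      (if j = i then a i j *\<^sub>R 1 else 0))"
    by (intro sum.cong refl)
      (auto simp: I2_sym_tensor inc incr_fun_orthonormal[OF ts] scaleR_add_right scaleR_diff_right)
  also have "\<dots> = (\<Sum>i<?n. \<Sum>j<?n. (a i j / 2) *\<^sub>R (?x i * ?x j)) + (\<Sum>i<?n. \<Sum>j<?n. (a i j / 2) *\<^sub>R (?x j * ?x i)) -
      (\<Sum>i<?n. \<Sum>j<?n. if j = i then a i j *\<^sub>R 1 else 0)"
    by (simp only: sum.distrib sum_subtractf)
  also have "(\<Sum>i<?n. \<Sum>j<?n. (a i j / 2) *\<^sub>R (?x j * ?x i)) = (\<Sum>i<?n. \<Sum>j<?n. (a i j / 2) *\<^sub>R (?x i * ?x j))"
    by (subst sum.swap) (simp add: a)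
  also have "(\<Sum>i<?n. \<Sum>j<?n. (a i j / 2) *\<^sub>R (?x i * ?x j)) + (\<Sum>i<?n. \<Sum>j<?n. (a i j / 2) *\<^sub>R (?x i * ?x j)) =
      (\<Sum>i<?n. \<Sum>j<?n. a i j *\<^sub>R (?x i * ?x j))"
    by (simp flip: sum.distrib scaleR_add_left)
  also have "(\<Sum>i<?n. \<Sum>j<?n. if j = i then a i j *\<^sub>R (1::'h bop) else 0) = (\<Sum>i<?n. a i i) *\<^sub>R 1"
    by (simp add: sum_delta_lt scaleR_sum_left)
  finally show ?thesis .
qed

text \<open>The factor \<open>c\<close> covers both sides of the theorem: \<open>c = 0\<close> gives
  a double integral alone, \<open>c = 1\<close> the limit with \<open>A\<close> added.\<close>

definition Z :: "real \<Rightarrow> (real \<times> real \<Rightarrow> real) \<Rightarrow> 'k bop" where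
  "Z c f = c *\<^sub>R A + \<iota> (I\<^sub>2 f)"

lemma A_in [simp]: "A \<in> N" and A_adj: "adj A = A"
  using A by (auto simp: semicircular_def)

lemma Z_in [simp]: "f \<in> symmetric_kernels \<Longrightarrow> Z c f \<in> N"
  by (simp add: Z_def)

text \<open>For a step kernel \<open>Z\<close> is exactly the quadratic form \<open>Y\<close> in the
  joint Wick family of \<open>A\<close> and the normalised increments.\<close>

lemma free_cumulant_Z_step:
  assumes ts: "increments ts" and a: "\<And>i j. a i j = a j i" and r: "r \<ge> 1"
  shows "free_cumulant \<psi> r (Z c (step_kernel ts a)) = complex_of_real
    (if r = 1 then 0 else trace_moment (length ts - 1) a r + (if r = 2 then c\<^sup>2 * \<mu>\<^sub>0\<^sup>2 else 0))"
proof -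
  let ?n = "length ts - 1"
  define y where "y = case_option A (\<lambda>i. \<iota> (W (incr_fun ts i)))"
  define v where "v = case_option (\<mu>\<^sub>0\<^sup>2) (\<lambda>i :: nat. 1 :: real)"
  have Sin: "S (ts ! i) \<in> M" if "i < length ts" for i
    using that ts by (intro S_in) (auto simp: increments_def subset_iff)
  interpret W: wick_family N \<psi> "insert None (Some ` {..<?n})" y v
  proof (rule joint_wick_family)
    show "sorted_wrt (<) ts" "set ts \<subseteq> {0..}" using ts by (auto simp: increments_def)
    show "y (Some i) = (1 / sqrt (ts ! Suc i - ts ! i)) *\<^sub>R (\<iota> (S (ts ! Suc i)) - \<iota> (S (ts ! i)))"
      if "i < ?n" for i
      using that Sin[of i] Sin[of "Suc i"] by (simp add: y_def W_incr_fun[OF ts] \<iota>_scaleR \<iota>_diff)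
  qed (auto simp: y_def v_def)
  interpret Q: quadratic_form N \<psi> ?n y v c a
    by unfold_locales (use a in \<open>auto simp: v_def\<close>)
  note inc = incr_fun_square_integrable[OF ts]
  have in_M: "(\<Sum>j<?n. a i j *\<^sub>R (W (incr_fun ts i) * W (incr_fun ts j))) \<in> M" if "i < ?n" for i
    using that inc by (intro M.M_sum) auto
  have "\<iota> (\<Sum>i<?n. \<Sum>j<?n. a i j *\<^sub>R (W (incr_fun ts i) * W (incr_fun ts j))) =
      (\<Sum>i<?n. \<Sum>j<?n. a i j *\<^sub>R (y (Some i) * y (Some j)))"
  proof (subst \<iota>_sum)
    show "(\<Sum>i<?n. \<iota> (\<Sum>j<?n. a i j *\<^sub>R (W (incr_fun ts i) * W (incr_fun ts j)))) =
        (\<Sum>i<?n. \<Sum>j<?n. a i j *\<^sub>R (y (Some i) * y (Some j)))"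
    proof (intro sum.cong refl)
      fix i assume "i \<in> {..<?n}"
      then show "\<iota> (\<Sum>j<?n. a i j *\<^sub>R (W (incr_fun ts i) * W (incr_fun ts j))) =
          (\<Sum>j<?n. a i j *\<^sub>R (y (Some i) * y (Some j)))"
        using inc by (subst \<iota>_sum) (auto simp: y_def \<iota>_scaleR \<iota>_mult)
    qed
  qed (use in_M in auto)
  moreover have "(\<Sum>i<?n. \<Sum>j<?n. a i j *\<^sub>R (W (incr_fun ts i) * W (incr_fun ts j))) \<in> M"
    by (rule M.M_sum) (use in_M in auto)
  moreover have "y None = A" by (simp add: y_def)
  ultimately have "Z c (step_kernel ts a) = Q.Y"
    unfolding Z_def Q.Y_def I2_step_kernel[OF ts a] by (simp add: \<iota>_diff \<iota>_scaleR)
  then show ?thesis using Q.free_cumulant_Y[OF r] by (simp add: trace_moment_def v_def)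
qed

end

section \<open>Passage from step kernels to symmetric kernels\<close>

lemma adj_sum: "adj (sum f I) = (\<Sum>i\<in>I. adj (f i))"
proof (induction I rule: infinite_finite_induct)
  case (infinite I)
  then show ?case using adj_scaleR[of 0 0] by simp
next
  case empty
  then show ?case using adj_scaleR[of 0 0] by simp
qed simp

text \<open>The two leading zeros keep out the orders 0 and 1, at which the traces of step
  approximations are the dimension and the sum of the diagonal and need not converge.\<close>

lemma poly_sum_tendsto:
  assumes "\<And>k. k \<ge> 2 \<Longrightarrow> (\<lambda>n. \<tau> n k) \<longlonglongrightarrow> \<tau>' k"
  shows "(\<lambda>n. poly_sum (\<tau> n) (pCons 0 (pCons 0 p))) \<longlonglongrightarrow> poly_sum \<tau>' (pCons 0 (pCons 0 p))"
proof -
  have "poly_sum s (pCons 0 (pCons 0 p)) = (\<Sum>k\<le>degree p. coeff p k * s (Suc (Suc k)))" for s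
    by (simp only: poly_sum_pCons mult_zero_left add_0_left) (simp add: poly_sum_def)
  then show ?thesis by (simp only:) (intro tendsto_sum tendsto_mult tendsto_const assms, simp)
qed

lemma L2_norm_diff_tendsto:
  assumes f: "f \<in> square_integrable \<mu>" and g: "\<And>n. g n \<in> square_integrable \<mu>"
    and lim: "(\<lambda>n. L2_norm_measure \<mu> (\<lambda>x. f x - g n x)) \<longlonglongrightarrow> 0"
  shows "(\<lambda>n. L2_norm_measure \<mu> (g n)) \<longlonglongrightarrow> L2_norm_measure \<mu> f"
proof -
  have "\<bar>L2_norm_measure \<mu> (g n) - L2_norm_measure \<mu> f\<bar> \<le> L2_norm_measure \<mu> (\<lambda>x. f x - g n x)" for n
  proof -
    have "L2_norm_measure \<mu> (\<lambda>x. g n x + (f x - g n x)) \<le> L2_norm_measure \<mu> (g n) + L2_norm_measure \<mu> (\<lambda>x. f x - g n x)"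
      using f g by (intro L2_norm_triangle square_integrable_diff)
    moreover have "L2_norm_measure \<mu> (\<lambda>x. f x + (g n x - f x)) \<le> L2_norm_measure \<mu> f + L2_norm_measure \<mu> (\<lambda>x. g n x - f x)"
      using f g by (intro L2_norm_triangle square_integrable_diff)
    ultimately show ?thesis using L2_norm_commute[of \<mu> f "g n"] by simp
  qed
  then have "(\<lambda>n. L2_norm_measure \<mu> (g n) - L2_norm_measure \<mu> f) \<longlonglongrightarrow> 0"
    by (intro Lim_null_comparison[OF _ lim]) (auto intro: always_eventually)
  then show ?thesis by (simp add: LIM_zero_iff)
qed

definition step_approx :: "(real \<times> real \<Rightarrow> real) \<Rightarrow> (nat \<Rightarrow> real list) \<Rightarrow> (nat \<Rightarrow> nat \<Rightarrow> nat \<Rightarrow> real) \<Rightarrow> bool" where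
  "step_approx f ts a \<longleftrightarrow> (\<forall>m. increments (ts m)) \<and> (\<forall>m i j. a m i j = a m j i) \<and>
     (\<lambda>m. L2_norm_measure half_line2 (\<lambda>z. f z - step_kernel (ts m) (a m) z)) \<longlonglongrightarrow> 0"

lemma ex_step_approx:
  assumes "f \<in> symmetric_kernels"
  obtains ts a where "step_approx f ts a"
proof -
  have "\<forall>m. \<exists>p. increments (fst p) \<and> (\<forall>i j. snd p i j = snd p j i) \<and>
      L2_norm_measure half_line2 (\<lambda>z. f z - step_kernel (fst p) (snd p) z) < 1 / real (Suc m)"
  proof
    fix m
    obtain ts a where "increments ts" "\<forall>i j. a i j = a j i"
      "L2_norm_measure half_line2 (\<lambda>z. f z - step_kernel ts a z) < 1 / real (Suc m)"
      using symmetric_step_approx[OF assms, of "1 / real (Suc m)"] by auto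
    then show "\<exists>p. increments (fst p) \<and> (\<forall>i j. snd p i j = snd p j i) \<and>
      L2_norm_measure half_line2 (\<lambda>z. f z - step_kernel (fst p) (snd p) z) < 1 / real (Suc m)"
      by (intro exI[of _ "(ts, a)"]) simp
  qed
  from choice[OF this] obtain p where p: "\<And>m. increments (fst (p m))" "\<And>m i j. snd (p m) i j = snd (p m) j i"
    "\<And>m. L2_norm_measure half_line2 (\<lambda>z. f z - step_kernel (fst (p m)) (snd (p m)) z) < 1 / real (Suc m)"
    by blast
  have "(\<lambda>m. L2_norm_measure half_line2 (\<lambda>z. f z - step_kernel (fst (p m)) (snd (p m)) z)) \<longlonglongrightarrow> 0"
  proof (rule Lim_null_comparison[OF _ LIMSEQ_Suc[OF lim_1_over_n]])
    show "\<forall>\<^sub>F m in sequentially. norm (L2_norm_measure half_line2 (\<lambda>z. f z - step_kernel (fst (p m)) (snd (p m)) z))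
        \<le> 1 / real (Suc m)"
      using p(3) by (intro always_eventually allI) (simp add: L2_norm_measure_sq less_imp_le)
  qed
  then have "step_approx f (\<lambda>m. fst (p m)) (\<lambda>m. snd (p m))" unfolding step_approx_def using p(1,2) by blast
  then show ?thesis by (rule that)
qed

lemma step_approxD:
  assumes "step_approx f ts a"
  shows "increments (ts m)" "a m i j = a m j i"
    "(\<lambda>m. L2_norm_measure half_line2 (\<lambda>z. f z - step_kernel (ts m) (a m) z)) \<longlonglongrightarrow> 0"
  using assms unfolding step_approx_def by blast+

context wigner_setting
begin

lemma nrm_\<iota>: "X \<in> M \<Longrightarrow> N.nrm (\<iota> X) = M.nrm X"
  by (simp add: L2_norm_state_def \<psi>_\<iota> flip: \<iota>_adj \<iota>_mult)

lemma W_incr_adj: "increments ts \<Longrightarrow> i < length ts - 1 \<Longrightarrow> adj (W (incr_fun ts i)) = W (incr_fun ts i)"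
  using increments_nth[of ts i] by (simp add: W_incr_fun S_adj)

lemma I2_step_adj:
  assumes ts: "increments ts" and a: "\<And>i j. a i j = a j i"
  shows "adj (I\<^sub>2 (step_kernel ts a)) = I\<^sub>2 (step_kernel ts a)"
proof -
  let ?n = "length ts - 1" and ?x = "\<lambda>i. W (incr_fun ts i)"
  have "adj (\<Sum>i<?n. \<Sum>j<?n. a i j *\<^sub>R (?x i * ?x j)) = (\<Sum>i<?n. \<Sum>j<?n. a i j *\<^sub>R (?x j * ?x i))"
    using W_incr_adj[OF ts] by (simp add: adj_sum)
  also have "\<dots> = (\<Sum>i<?n. \<Sum>j<?n. a i j *\<^sub>R (?x i * ?x j))"
    by (subst sum.swap) (simp add: a)
  finally show ?thesis unfolding I2_step_kernel[OF ts a] by simp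
qed

lemma I2_diff:
  "f \<in> symmetric_kernels \<Longrightarrow> g \<in> symmetric_kernels \<Longrightarrow> I\<^sub>2 (\<lambda>z. f z - g z) = I\<^sub>2 f - I\<^sub>2 g"
  using I2_add[of f "\<lambda>z. (- 1) * g z"] I2_scale[of g "- 1"] symmetric_kernels_scale[of g "- 1"] by simp

lemma symmetric_kernels_diff:
  "f \<in> symmetric_kernels \<Longrightarrow> g \<in> symmetric_kernels \<Longrightarrow> (\<lambda>z. f z - g z) \<in> symmetric_kernels"
  using symmetric_kernels_add[of f "\<lambda>z. (- 1) * g z"] symmetric_kernels_scale[of g "- 1"] by simp

lemma I2_tendsto:
  assumes f: "f \<in> symmetric_kernels" and ap: "step_approx f ts a"
  shows "(\<lambda>m. M.nrm (I\<^sub>2 (step_kernel (ts m) (a m)) - I\<^sub>2 f)) \<longlonglongrightarrow> 0"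
proof -
  note D = step_approxD[OF ap]
  obtain C where C: "C \<ge> 0" "\<And>f. f \<in> symmetric_kernels \<Longrightarrow> M.nrm (I\<^sub>2 f) \<le> C * L2_norm_measure half_line2 f"
    by (rule I2_bound, rule that)
  have s: "step_kernel (ts m) (a m) \<in> symmetric_kernels" for m by (rule step_kernel_in[OF D(1,2)])
  have "M.nrm (I\<^sub>2 (step_kernel (ts m) (a m)) - I\<^sub>2 f) \<le> C * L2_norm_measure half_line2 (\<lambda>z. f z - step_kernel (ts m) (a m) z)" for m
    using C(2)[OF symmetric_kernels_diff[OF s[of m] f]] I2_diff[OF s[of m] f]
      L2_norm_commute[of half_line2 f "step_kernel (ts m) (a m)"] by simp
  then have "norm (M.nrm (I\<^sub>2 (step_kernel (ts m) (a m)) - I\<^sub>2 f)) \<le> C * L2_norm_measure half_line2 (\<lambda>z. f z - step_kernel (ts m) (a m) z)" for m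
    using M.nrm_nonneg[OF M.M_diff[OF I2_in[OF s[of m]] I2_in[OF f]]] by simp
  then show ?thesis
    by (intro Lim_null_comparison[OF always_eventually[OF allI] tendsto_mult_right_zero[OF D(3), of C]])
qed

text \<open>Self-adjointness is not part of the definition of the integral. It holds for step
  kernels because the increments are self-adjoint, and it passes to L2 limits.\<close>

lemma I2_adj:
  assumes f: "f \<in> symmetric_kernels"
  shows "adj (I\<^sub>2 f) = I\<^sub>2 f"
proof -
  obtain ts a where ap: "step_approx f ts a" by (rule ex_step_approx[OF f])
  note D = step_approxD[OF ap]
  show ?thesis
    by (rule M.limit_self_adjoint[OF _ _ _ I2_tendsto[OF f ap]])
      (use f in \<open>auto simp: step_kernel_in[OF D(1,2)] I2_step_adj[OF D(1,2)]\<close>)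
qed

lemma Z_adj: "f \<in> symmetric_kernels \<Longrightarrow> adj (Z c f) = Z c f"
  by (simp add: Z_def A_adj I2_adj flip: \<iota>_adj)

lemma step_trace_2:
  "step_approx f ts a \<Longrightarrow> trace_moment (length (ts m) - 1) (a m) 2 = (L2_norm_measure half_line2 (step_kernel (ts m) (a m)))\<^sup>2"
  using step_approxD by (simp add: trace_moment_2 step_kernel_norm)

lemma step_norm_tendsto:
  assumes f: "f \<in> symmetric_kernels" and ap: "step_approx f ts a"
  shows "(\<lambda>m. L2_norm_measure half_line2 (step_kernel (ts m) (a m))) \<longlonglongrightarrow> L2_norm_measure half_line2 f"
  using step_approxD[OF ap] f
  by (intro L2_norm_diff_tendsto) (auto intro: step_kernel_square_integrable symmetric_kernelsD)

text \<open>Continuity of the integral gives only L2 convergence. The uniform moment bounds that are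
  needed in addition come from the cumulants, which are explicit for step kernels and controlled by
  the norm of the kernel.\<close>

lemma free_cumulant_Z_tendsto:
  assumes f: "f \<in> symmetric_kernels" and ap: "step_approx f ts a"
  shows "(\<lambda>m. free_cumulant \<psi> r (Z c (step_kernel (ts m) (a m)))) \<longlonglongrightarrow> free_cumulant \<psi> r (Z c f)"
proof -
  note D = step_approxD[OF ap]
  let ?Y = "\<lambda>m. Z c (step_kernel (ts m) (a m))"
  have s: "step_kernel (ts m) (a m) \<in> symmetric_kernels" for m by (rule step_kernel_in[OF D(1,2)])
  \<comment> \<open>The norms of the approximants converge and are thus bounded; by the trace
    inequality the same \<open>K\<close> then controls the cumulants of every order.\<close>
  obtain K where K: "\<And>m. L2_norm_measure half_line2 (step_kernel (ts m) (a m)) \<le> K"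
    using Bseq_bdd_above[OF convergent_imp_Bseq[OF convergentI[OF step_norm_tendsto[OF f ap]]]]
    by (auto simp: bdd_above_def)
  have bdd: "\<exists>B. \<forall>m. cmod (free_cumulant \<psi> r (?Y m)) \<le> B" if "r \<ge> 1" for r
  proof -
    have "cmod (free_cumulant \<psi> r (?Y m)) \<le> K ^ r + c\<^sup>2 * \<mu>\<^sub>0\<^sup>2" for m
    proof (cases "r = 1")
      case True
      have "K \<ge> 0" using K[of m] L2_norm_measure_sq(2) order_trans by blast
      then show ?thesis using True by (simp add: free_cumulant_Z_step[OF D(1,2)])
    next
      case False
      let ?t = "trace_moment (length (ts m) - 1) (a m)"
      let ?L = "L2_norm_measure half_line2 (step_kernel (ts m) (a m))"
      have L: "0 \<le> ?L" by (simp add: L2_norm_measure_sq)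
      have "(?t r)\<^sup>2 \<le> (?L ^ r)\<^sup>2"
        using trace_moment_bound[of "a m" r "length (ts m) - 1", OF D(2)] False that
        unfolding step_trace_2[OF ap] by (simp add: power_mult[symmetric] mult.commute)
      then have "\<bar>?t r\<bar> \<le> ?L ^ r" using L by (simp add: power2_le_iff_abs_le)
      also have "\<dots> \<le> K ^ r" using L K by (intro power_mono)
      finally have t: "\<bar>?t r\<bar> \<le> K ^ r" .
      have "cmod (free_cumulant \<psi> r (?Y m)) = \<bar>?t r + (if r = 2 then c\<^sup>2 * \<mu>\<^sub>0\<^sup>2 else 0)\<bar>"
        using False that by (simp only: free_cumulant_Z_step[OF D(1,2)] norm_of_real) simp
      also have "\<dots> \<le> \<bar>?t r\<bar> + c\<^sup>2 * \<mu>\<^sub>0\<^sup>2" by (auto simp: abs_if)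
      finally show ?thesis using t by linarith
    qed
    then show ?thesis by blast
  qed
  have "(\<lambda>m. \<psi> (?Y m ^ k)) \<longlonglongrightarrow> \<psi> (Z c f ^ k)" for k
  proof (rule N.moments_tendsto)
    show "(\<lambda>m. N.nrm (?Y m - Z c f)) \<longlonglongrightarrow> 0"
      using I2_tendsto[OF f ap] f s by (simp add: Z_def nrm_\<iota> flip: \<iota>_diff)
    show "\<exists>B. \<forall>m. cmod (\<psi> (?Y m ^ k)) \<le> B" for k
    proof (cases "k = 0")
      case False
      then show ?thesis
        using moments_bounded_of_cumulants[of "\<lambda>m k. \<psi> (?Y m ^ k)" k] bdd
        by (simp add: free_cumulant_def Suc_le_eq)
    qed (auto intro: exI[of _ 1])
  qed (use f s Z_adj in auto)
  then show ?thesis unfolding free_cumulant_def by (rule free_cumulants_tendsto)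
qed

text \<open>For \<open>r \<ge> 2\<close> this is the trace of the \<open>r\<close>th power of the kernel operator of \<open>f\<close>.\<close>

definition \<tau> :: "(real \<times> real \<Rightarrow> real) \<Rightarrow> nat \<Rightarrow> real" where
  "\<tau> f r = Re (free_cumulant \<psi> r (Z 0 f))"

lemma \<tau>_tendsto:
  assumes "f \<in> symmetric_kernels" "step_approx f ts a" "r \<ge> 2"
  shows "(\<lambda>m. trace_moment (length (ts m) - 1) (a m) r) \<longlonglongrightarrow> \<tau> f r"
  using tendsto_Re[OF free_cumulant_Z_tendsto[OF assms(1,2), of r 0]] assms(3)
  by (simp add: \<tau>_def free_cumulant_Z_step[OF step_approxD(1,2)[OF assms(2)]] cong: if_cong)

text \<open>\<open>\<tau>\<close> is defined at \<open>c = 0\<close>. That \<open>A\<close>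
  contributes to order 2 only is inherited from the step kernels in the limit.\<close>

lemma free_cumulant_Z:
  assumes f: "f \<in> symmetric_kernels" and r: "r \<ge> 1"
  shows "free_cumulant \<psi> r (Z c f) =
    complex_of_real (if r = 1 then 0 else \<tau> f r + (if r = 2 then c\<^sup>2 * \<mu>\<^sub>0\<^sup>2 else 0))"
proof -
  obtain ts a where ap: "step_approx f ts a" by (rule ex_step_approx[OF f])
  have "(\<lambda>m. complex_of_real (if r = 1 then 0 else trace_moment (length (ts m) - 1) (a m) r + (if r = 2 then c\<^sup>2 * \<mu>\<^sub>0\<^sup>2 else 0)))
    \<longlonglongrightarrow> complex_of_real (if r = 1 then 0 else \<tau> f r + (if r = 2 then c\<^sup>2 * \<mu>\<^sub>0\<^sup>2 else 0))"
  proof (cases "r = 1")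
    case False
    then show ?thesis using \<tau>_tendsto[OF f ap, of r] r
      by (intro tendsto_of_real) (auto intro!: tendsto_add)
  qed simp
  moreover have "(\<lambda>m. complex_of_real (if r = 1 then 0 else trace_moment (length (ts m) - 1) (a m) r + (if r = 2 then c\<^sup>2 * \<mu>\<^sub>0\<^sup>2 else 0)))
      \<longlonglongrightarrow> free_cumulant \<psi> r (Z c f)"
    using free_cumulant_Z_tendsto[OF f ap, of r c] by (simp only: free_cumulant_Z_step[OF step_approxD(1,2)[OF ap] r])
  ultimately show ?thesis by (rule LIMSEQ_unique[THEN sym])
qed

lemma free_cumulant_I2:
  assumes f: "f \<in> symmetric_kernels"
  shows "free_cumulant \<phi> r (I\<^sub>2 f) = free_cumulant \<psi> r (Z 0 f)"
  using f by (simp add: free_cumulant_def Z_def \<psi>_\<iota> flip: \<iota>_power)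

lemma \<tau>_2: 
  assumes f: "f \<in> symmetric_kernels"
  shows "\<tau> f 2 = (L2_norm_measure half_line2 f)\<^sup>2"
proof -
  obtain ts a where ap: "step_approx f ts a" by (rule ex_step_approx[OF f])
  have "(\<lambda>m. trace_moment (length (ts m) - 1) (a m) 2) \<longlonglongrightarrow> (L2_norm_measure half_line2 f)\<^sup>2"
    unfolding step_trace_2[OF ap] by (intro tendsto_power step_norm_tendsto f ap)
  then show ?thesis using \<tau>_tendsto[OF f ap, of 2] LIMSEQ_unique by force
qed

lemma \<tau>_even_bound:
  assumes f: "f \<in> symmetric_kernels" and s: "s \<ge> 1"
  shows "\<tau> f (2 * s) \<le> \<tau> f 2 ^ s"
proof -
  obtain ts a where ap: "step_approx f ts a" by (rule ex_step_approx[OF f])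
  show ?thesis
  proof (rule LIMSEQ_le)
    show "(\<lambda>m. trace_moment (length (ts m) - 1) (a m) (2 * s)) \<longlonglongrightarrow> \<tau> f (2 * s)"
      using s by (intro \<tau>_tendsto f ap) simp
    show "(\<lambda>m. trace_moment (length (ts m) - 1) (a m) 2 ^ s) \<longlonglongrightarrow> \<tau> f 2 ^ s"
      by (intro tendsto_power \<tau>_tendsto f ap) simp
    show "\<exists>N. \<forall>m\<ge>N. trace_moment (length (ts m) - 1) (a m) (2 * s) \<le> trace_moment (length (ts m) - 1) (a m) 2 ^ s"
      by (intro exI allI impI trace_moment_bound_even s) (rule step_approxD(2)[OF ap])
  qed
qed

text \<open>Both factors are divisible by x, so every product starts at x ^ 2, where
  \<open>\<tau>\<close> is the limit of matrix traces; the matrix inequality survives the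
  limit.\<close>

lemma \<tau>_cauchy_schwarz:
  assumes f: "f \<in> symmetric_kernels"
  shows "(poly_sum (\<tau> f) (pCons 0 p * pCons 0 q))\<^sup>2 \<le>
    poly_sum (\<tau> f) ((pCons 0 p)\<^sup>2) * poly_sum (\<tau> f) ((pCons 0 q)\<^sup>2)"
proof -
  obtain ts a where ap: "step_approx f ts a" by (rule ex_step_approx[OF f])
  let ?t = "\<lambda>m. trace_moment (length (ts m) - 1) (a m)"
  have lim: "(\<lambda>m. poly_sum (?t m) (pCons 0 p * pCons 0 q)) \<longlonglongrightarrow> poly_sum (\<tau> f) (pCons 0 p * pCons 0 q)" for p q
  proof -
    have "pCons 0 p * pCons 0 q = pCons 0 (pCons 0 (p * q))" by simp
    then show ?thesis by (simp only:) (intro poly_sum_tendsto \<tau>_tendsto f ap)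
  qed
  show ?thesis
  proof (rule LIMSEQ_le)
    show "(\<lambda>m. (poly_sum (?t m) (pCons 0 p * pCons 0 q))\<^sup>2) \<longlonglongrightarrow> (poly_sum (\<tau> f) (pCons 0 p * pCons 0 q))\<^sup>2"
      by (intro tendsto_power lim)
    show "(\<lambda>m. poly_sum (?t m) ((pCons 0 p)\<^sup>2) * poly_sum (?t m) ((pCons 0 q)\<^sup>2)) \<longlonglongrightarrow>
        poly_sum (\<tau> f) ((pCons 0 p)\<^sup>2) * poly_sum (\<tau> f) ((pCons 0 q)\<^sup>2)"
      unfolding power2_eq_square by (intro tendsto_mult lim)
    show "\<exists>N. \<forall>m\<ge>N. (poly_sum (?t m) (pCons 0 p * pCons 0 q))\<^sup>2 \<le>
        poly_sum (?t m) ((pCons 0 p)\<^sup>2) * poly_sum (?t m) ((pCons 0 q)\<^sup>2)"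
      by (intro exI allI impI trace_cauchy_schwarz) (rule step_approxD(2)[OF ap])
  qed
qed

end

section \<open>Kernels of finite rank\<close>

lemma L2_inner_sum_left:
  assumes "\<And>p. p \<in> I \<Longrightarrow> E p \<in> square_integrable \<mu>" "h \<in> square_integrable \<mu>"
  shows "(\<integral>x. (\<Sum>p\<in>I. c p * E p x) * h x \<partial>\<mu>) = (\<Sum>p\<in>I. c p * (\<integral>x. E p x * h x \<partial>\<mu>))"
  using L2_inner_sum[of I E \<mu> "{()}" "\<lambda>_. h" c "\<lambda>_. 1"] assms by simp

lemma L2_inner_cong_AE:
  assumes "f \<in> square_integrable \<mu>" "g \<in> square_integrable \<mu>" "h \<in> square_integrable \<mu>" "AE x in \<mu>. f x = g x"
  shows "(\<integral>x. f x * h x \<partial>\<mu>) = (\<integral>x. g x * h x \<partial>\<mu>)"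
proof (rule integral_cong_AE)
  show "AE x in \<mu>. f x * h x = g x * h x" using assms(4) by eventually_elim simp
qed (use assms square_integrableD in \<open>auto intro!: borel_measurable_times\<close>)

definition orthonormal :: "'a measure \<Rightarrow> nat \<Rightarrow> (nat \<Rightarrow> 'a \<Rightarrow> real) \<Rightarrow> bool" where
  "orthonormal \<mu> n e \<longleftrightarrow> (\<forall>k. e k \<in> square_integrable \<mu>) \<and>
     (\<forall>k<n. \<forall>l<n. (\<integral>x. e k x * e l x \<partial>\<mu>) = (if k = l then 1 else 0))"

lemma orthonormalD:
  assumes "orthonormal \<mu> n e"
  shows "e k \<in> square_integrable \<mu>" "k < n \<Longrightarrow> l < n \<Longrightarrow> (\<integral>x. e k x * e l x \<partial>\<mu>) = (if k = l then 1 else 0)"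
  using assms unfolding orthonormal_def by blast+

lemma orthonormal_coefficient:
  assumes e: "orthonormal \<mu> n e" and l: "l < n"
  shows "(\<integral>x. (\<Sum>k<n. c k * e k x) * e l x \<partial>\<mu>) = c l"
  using l by (subst L2_inner_sum_left) (auto simp: orthonormalD[OF e] mult_delta_right sum_delta_lt)

text \<open>Gram-Schmidt modulo null functions: a vector whose residual has norm 0 is dropped,
  otherwise the normalised residual becomes the next member of the family.\<close>

lemma ex_orthonormal:
  assumes "finite B" "B \<subseteq> square_integrable \<mu>"
  shows "\<exists>n e. orthonormal \<mu> n e \<and> (\<forall>b\<in>B. \<exists>c. AE x in \<mu>. b x = (\<Sum>k<n. c k * e k x))"
  using assms
proof (induction B rule: finite_induct)
  case empty
  show ?case by (intro exI[of _ 0] exI[of _ "\<lambda>_ _. 0"]) (auto simp: orthonormal_def square_integrable_zero)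
next
  case (insert b B)
  then obtain n e where e: "orthonormal \<mu> n e"
    and B: "\<And>b. b \<in> B \<Longrightarrow> \<exists>c. AE x in \<mu>. b x = (\<Sum>k<n. c k * e k x)" by auto
  note E = orthonormalD(1)[OF e]
  have b: "b \<in> square_integrable \<mu>" using insert by simp
  define c where "c k = (\<integral>x. b x * e k x \<partial>\<mu>)" for k
  define r where "r x = b x - (\<Sum>k<n. c k * e k x)" for x
  have s: "(\<lambda>x. \<Sum>k<n. c k * e k x) \<in> square_integrable \<mu>"
    by (intro square_integrable_sum square_integrable_scale E)
  have r: "r \<in> square_integrable \<mu>" unfolding r_def[abs_def] using b s by (rule square_integrable_diff)
  show ?case
  proof (cases "L2_norm_measure \<mu> r = 0")
    case True
    then have "AE x in \<mu>. b x = (\<Sum>k<n. c k * e k x)"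
      using L2_norm_eq_0_AE[OF r] by (simp add: r_def)
    then show ?thesis using e B by (intro exI[of _ n] exI[of _ e]) auto
  next
    case False
    let ?N = "L2_norm_measure \<mu> r"
    define e' where "e' = e(n := \<lambda>x. (1 / ?N) * r x)"
    have orth: "(\<integral>x. r x * e l x \<partial>\<mu>) = 0" if "l < n" for l
    proof -
      have "(\<integral>x. r x * e l x \<partial>\<mu>) = (\<integral>x. b x * e l x - (\<Sum>k<n. c k * e k x) * e l x \<partial>\<mu>)"
        by (simp add: r_def left_diff_distrib)
      also have "\<dots> = c l - (\<integral>x. (\<Sum>k<n. c k * e k x) * e l x \<partial>\<mu>)"
        unfolding c_def[of l] by (intro Bochner_Integration.integral_diff square_integrable_mult b s E)
      finally show ?thesis using orthonormal_coefficient[OF e that] by simp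
    qed
    have nn: "(\<integral>x. r x * r x \<partial>\<mu>) = ?N\<^sup>2" using L2_norm_measure_sq(1)[of \<mu> r] by (simp add: power2_eq_square)
    have e': "orthonormal \<mu> (Suc n) e'"
      unfolding orthonormal_def
    proof (intro conjI allI impI)
      show "e' k \<in> square_integrable \<mu>" for k using E square_integrable_scale[OF r, of "1 / ?N"] by (auto simp: e'_def)
      fix k l assume kl: "k < Suc n" "l < Suc n"
      have n1: "(\<integral>x. e' n x * e' n x \<partial>\<mu>) = 1"
        using nn False by (simp add: e'_def power2_eq_square)
      have n2: "(\<integral>x. e' n x * e' l x \<partial>\<mu>) = 0" if "l < n" for l
        using orth[OF that] that by (simp add: e'_def)
      show "(\<integral>x. e' k x * e' l x \<partial>\<mu>) = (if k = l then 1 else 0)"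
      proof -
        consider "k < n" "l < n" | "k = n" "l = n" | "k = n" "l < n" | "k < n" "l = n" using kl by linarith
        then show ?thesis
        proof cases
          case 1
          then show ?thesis using orthonormalD(2)[OF e] by (simp add: e'_def)
        next
          case 4
          then show ?thesis using n2[of k] by (simp add: mult.commute)
        qed (use n1 n2 in auto)
      qed
    qed
    have old: "\<exists>c. AE x in \<mu>. h x = (\<Sum>k<Suc n. c k * e' k x)" if "\<exists>c. AE x in \<mu>. h x = (\<Sum>k<n. c k * e k x)" for h
    proof -
      from that obtain c where "AE x in \<mu>. h x = (\<Sum>k<n. c k * e k x)" by blast
      then show ?thesis by (intro exI[of _ "c(n := 0)"]) (simp add: e'_def)
    qed
    have "b x = (\<Sum>k<Suc n. (c(n := ?N)) k * e' k x)" for x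
      using False by (simp add: e'_def r_def)
    then have "\<exists>c. AE x in \<mu>. b x = (\<Sum>k<Suc n. c k * e' k x)" by (intro exI[of _ "c(n := ?N)"]) simp
    then show ?thesis using e' old B by (intro exI[of _ "Suc n"] exI[of _ e']) auto
  qed
qed

lemma kernel_operator_measurable:
  assumes f: "f \<in> square_integrable half_line2" and g: "g \<in> square_integrable half_line"
  shows "kernel_operator f g \<in> borel_measurable half_line"
proof -
  note [measurable] = square_integrableD(1)[OF f] square_integrableD(1)[OF g]
  show ?thesis unfolding kernel_operator_def by measurable
qed

lemma kernel_operator_inner:
  assumes f: "f \<in> square_integrable half_line2"
    and h: "h \<in> square_integrable half_line" and g: "g \<in> square_integrable half_line"
  shows "(\<integral>x. kernel_operator f g x * h x \<partial>half_line) = (\<integral>z. f z * (case z of (x, y) \<Rightarrow> h x * g y) \<partial>half_line2)"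
proof -
  have "integrable half_line2 (\<lambda>z. f z * (case z of (x, y) \<Rightarrow> h x * g y))"
    using f tensor_square_integrable[OF h g] by (rule square_integrable_mult)
  from half_line2.integral_fst'[OF this]
  have "(\<integral>z. f z * (case z of (x, y) \<Rightarrow> h x * g y) \<partial>half_line2) =
      (\<integral>x. \<integral>y. f (x, y) * (h x * g y) \<partial>half_line \<partial>half_line)" by simp
  also have "(\<lambda>x. \<integral>y. f (x, y) * (h x * g y) \<partial>half_line) = (\<lambda>x. kernel_operator f g x * h x)"
  proof
    fix x
    have "(\<lambda>y. f (x, y) * (h x * g y)) = (\<lambda>y. f (x, y) * g y * h x)" by (simp add: mult_ac)
    then show "(\<integral>y. f (x, y) * (h x * g y) \<partial>half_line) = kernel_operator f g x * h x"
      by (simp add: kernel_operator_def)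
  qed
  finally show ?thesis by simp
qed

lemma symmetric_kernel_inner_commute:
  assumes f: "f \<in> symmetric_kernels"
    and h: "h \<in> square_integrable half_line" and g: "g \<in> square_integrable half_line"
  shows "(\<integral>z. f z * (case z of (x, y) \<Rightarrow> h x * g y) \<partial>half_line2) =
    (\<integral>z. f z * (case z of (x, y) \<Rightarrow> g x * h y) \<partial>half_line2)"
proof -
  let ?sw = "\<lambda>z :: real \<times> real. case z of (x, y) \<Rightarrow> (y, x)"
  note [measurable] = square_integrableD(1)[OF symmetric_kernelsD[OF f]] square_integrableD(1)[OF h] square_integrableD(1)[OF g]
  have [measurable]: "?sw \<in> measurable half_line2 half_line2" by measurable
  have m: "(\<lambda>z. f z * (case z of (x, y) \<Rightarrow> g x * h y)) \<in> borel_measurable half_line2" by measurable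
  have "(\<integral>z. f z * (case z of (x, y) \<Rightarrow> h x * g y) \<partial>half_line2) =
      (\<integral>z. f (?sw z) * (case ?sw z of (x, y) \<Rightarrow> g x * h y) \<partial>half_line2)"
  proof (rule integral_cong_AE)
    show "AE z in half_line2. f z * (case z of (x, y) \<Rightarrow> h x * g y) = f (?sw z) * (case ?sw z of (x, y) \<Rightarrow> g x * h y)"
      using symmetric_kernels_swap[OF f] by eventually_elim (auto simp: case_prod_beta' mult.commute)
  qed measurable
  also have "\<dots> = (\<integral>z. f z * (case z of (x, y) \<Rightarrow> g x * h y) \<partial>half_line2)"
    by (rule integral_swap_half_line2[OF m])
  finally show ?thesis .
qed

text \<open>Orthogonality spreads from rectangles to all square-integrable functions of two
  variables; finally \<open>F\<close> is tested against itself.\<close>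

lemma tensor_orthogonal_imp_null:
  assumes F: "F \<in> square_integrable half_line2"
    and orth: "\<And>u v. u \<in> square_integrable half_line \<Longrightarrow> v \<in> square_integrable half_line \<Longrightarrow>
      (\<integral>z. F z * (case z of (x, y) \<Rightarrow> u x * v y) \<partial>half_line2) = 0"
  shows "L2_norm_measure half_line2 F = 0"
proof -
  have "(\<integral>z. F z * w z \<partial>half_line2) = 0" if "w \<in> square_integrable half_line2" for w
    using that
  proof (induction rule: half_line2_induct)
    case (rectangle s t s' t')
    then show ?case by (intro orth interval_square_integrable)
  next
    case (add f g)
    then show ?case using square_integrable_mult[OF F] by (simp add: distrib_left)
  next
    case (scale c f)
    then show ?case by (simp add: mult.left_commute[of _ c])
  next
    case (lim w)
    let ?N = "L2_norm_measure half_line2 F"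
    have "\<bar>\<integral>z. F z * w z \<partial>half_line2\<bar> \<le> 0 + e" if "e > 0" for e
    proof -
      have "?N \<ge> 0" by (simp add: L2_norm_measure_sq)
      then have "e / (?N + 1) > 0" using that by simp
      then obtain g where g: "g \<in> square_integrable half_line2" "(\<integral>z. F z * g z \<partial>half_line2) = 0"
        "L2_norm_measure half_line2 (\<lambda>x. w x - g x) < e / (?N + 1)" using lim(2) by blast
      have "\<bar>\<integral>z. F z * w z \<partial>half_line2\<bar> = \<bar>\<integral>z. F z * (w z - g z) \<partial>half_line2\<bar>"
        using g(2) square_integrable_mult[OF F] lim(1) g(1) by (simp add: right_diff_distrib)
      also have "\<dots> \<le> ?N * L2_norm_measure half_line2 (\<lambda>x. w x - g x)"
        using F lim(1) g(1) by (intro L2_cauchy_schwarz square_integrable_diff)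
      also have "\<dots> \<le> (?N + 1) * (e / (?N + 1))"
        using g(3) \<open>?N \<ge> 0\<close> by (intro mult_mono) (auto simp: L2_norm_measure_sq)
      finally show ?thesis using \<open>?N \<ge> 0\<close> by simp
    qed
    then show ?case using field_le_epsilon[of "\<bar>\<integral>z. F z * w z \<partial>half_line2\<bar>" 0] by simp
  qed
  from this[OF F] show ?thesis by (simp add: L2_norm_measure_def power2_eq_square)
qed

text \<open>Nothing is diagonalised: \<open>c\<close> is the matrix of the kernel operator in an
  orthonormal family whose span contains its range. The spectral information needed later comes from
  the annihilating polynomial of \<open>c\<close>.\<close>

definition spectral_form :: "(real \<times> real \<Rightarrow> real) \<Rightarrow> nat \<Rightarrow> (nat \<Rightarrow> real \<Rightarrow> real) \<Rightarrow> (nat \<Rightarrow> nat \<Rightarrow> real) \<Rightarrow> bool" where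
  "spectral_form f n e c \<longleftrightarrow> orthonormal half_line n e \<and> (\<forall>k l. c k l = c l k) \<and>
     L2_norm_measure half_line2 (\<lambda>z. f z - (\<Sum>k<n. \<Sum>l<n. c k l * (case z of (x, y) \<Rightarrow> e k x * e l y))) = 0 \<and>
     nonzero_eigenvalues f = mat_eigenvalues n c"

text \<open>The range lies in the span of \<open>e\<close>. By symmetry the operator then depends on
  its argument only through the coordinates along \<open>e\<close>, so \<open>f\<close> and the
  finite kernel have the same integrals against all tensors.\<close>

lemma finite_rank_spectral_form:
  assumes f: "f \<in> symmetric_kernels" and rank: "kernel_rank f < \<infinity>"
  obtains n e c where "spectral_form f n e c"
proof -
  let ?spans = "\<lambda>B. finite B \<and> B \<subseteq> square_integrable half_line \<and> (\<forall>g\<in>square_integrable half_line. \<exists>c.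
      AE x in half_line. kernel_operator f g x = (\<Sum>b\<in>B. c b * b x))"
  \<comment> \<open>An infimum over the empty set is \<infinity>, so finite rank guarantees some
    spanning family.\<close>
  have "\<exists>B. ?spans B"
  proof (rule ccontr)
    assume "\<not> (\<exists>B. ?spans B)"
    then have "Collect ?spans = {}" by (simp only: Collect_empty_eq not_ex not_False_eq_True simp_thms)
    then have "kernel_rank f = \<infinity>" unfolding kernel_rank_def by (simp only: image_empty) (simp add: top_enat_def)
    then show False using rank by simp
  qed
  then obtain B where P: "?spans B" ..
  have B: "finite B" "B \<subseteq> square_integrable half_line"
    "\<And>g. g \<in> square_integrable half_line \<Longrightarrow> \<exists>c. AE x in half_line. kernel_operator f g x = (\<Sum>b\<in>B. c b * b x)"
    by (rule conjunct1[OF P], rule conjunct1[OF conjunct2[OF P]], rule bspec[OF conjunct2[OF conjunct2[OF P]]])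
  obtain n e where e: "orthonormal half_line n e"
    and Be: "\<And>b. b \<in> B \<Longrightarrow> \<exists>c. AE x in half_line. b x = (\<Sum>k<n. c k * e k x)"
    using ex_orthonormal[OF B(1,2)] by blast
  note E = orthonormalD(1)[OF e] and fL = symmetric_kernelsD[OF f]
  have sum_in: "(\<lambda>x. \<Sum>k<n. a k * e k x) \<in> square_integrable half_line" for a
    by (intro square_integrable_sum square_integrable_scale E)
  obtain \<beta> where \<beta>: "\<And>b. b \<in> B \<Longrightarrow> AE x in half_line. b x = (\<Sum>k<n. \<beta> b k * e k x)"
    using Be by metis
  have span: "\<exists>a. AE x in half_line. kernel_operator f g x = (\<Sum>k<n. a k * e k x)"
    if g: "g \<in> square_integrable half_line" for g
  proof -
    obtain d where d: "AE x in half_line. kernel_operator f g x = (\<Sum>b\<in>B. d b * b x)" using B(3)[OF g] by blast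
    have "AE x in half_line. \<forall>b\<in>B. b x = (\<Sum>k<n. \<beta> b k * e k x)" using B(1) \<beta> by (simp add: AE_finite_all)
    then have "AE x in half_line. kernel_operator f g x = (\<Sum>k<n. (\<Sum>b\<in>B. d b * \<beta> b k) * e k x)"
      using d
    proof eventually_elim
      case (elim x)
      have "(\<Sum>b\<in>B. d b * b x) = (\<Sum>b\<in>B. d b * (\<Sum>k<n. \<beta> b k * e k x))"
        by (intro sum.cong refl arg_cong2[where f = times] bspec[OF elim(1)])
      then have "kernel_operator f g x = (\<Sum>b\<in>B. \<Sum>k<n. d b * \<beta> b k * e k x)"
        unfolding elim(2) by (simp only: sum_distrib_left mult.assoc)
      also have "\<dots> = (\<Sum>k<n. (\<Sum>b\<in>B. d b * \<beta> b k) * e k x)"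
        by (subst sum.swap) (simp add: sum_distrib_right)
      finally show ?case .
    qed
    then show ?thesis by (rule exI[of _ "\<lambda>k. \<Sum>b\<in>B. d b * \<beta> b k"])
  qed
  \<comment> \<open>Square integrability of the image is read off from its expansion in the finite
    family.\<close>
  have L2: "kernel_operator f g \<in> square_integrable half_line" if g: "g \<in> square_integrable half_line" for g
  proof -
    obtain a where "AE x in half_line. kernel_operator f g x = (\<Sum>k<n. a k * e k x)" using span[OF g] by blast
    then show ?thesis
      by (intro square_integrable_cong_AE[OF sum_in kernel_operator_measurable[OF fL g]]) auto
  qed
  let ?f = "\<lambda>h g. \<integral>z. f z * (case z of (x, y) \<Rightarrow> h x * g y) \<partial>half_line2"
  have expand: "AE x in half_line. kernel_operator f g x = (\<Sum>k<n. ?f (e k) g * e k x)"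
    if g: "g \<in> square_integrable half_line" for g
  proof -
    obtain a where a: "AE x in half_line. kernel_operator f g x = (\<Sum>k<n. a k * e k x)" using span[OF g] by blast
    have "a k = ?f (e k) g" if "k < n" for k
      unfolding kernel_operator_inner[OF fL E g, symmetric] orthonormal_coefficient[OF e that, symmetric, of a]
      using L2_inner_cong_AE[OF L2[OF g] sum_in E a] by simp
    then have "(\<Sum>k<n. a k * e k x) = (\<Sum>k<n. ?f (e k) g * e k x)" for x by simp
    then show ?thesis using a by simp
  qed
  define c where "c k l = ?f (e k) (e l)" for k l
  have sym: "c k l = c l k" for k l unfolding c_def by (rule symmetric_kernel_inner_commute[OF f E E])
  \<comment> \<open>Symmetry of the kernel lets the expansion of the range act on the second
    argument as well.\<close>
  have form: "?f (e k) g = (\<Sum>l<n. c k l * (\<integral>x. e l x * g x \<partial>half_line))"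
    if g: "g \<in> square_integrable half_line" for k g
  proof -
    have "?f (e k) g = ?f g (e k)" by (rule symmetric_kernel_inner_commute[OF f E g])
    also have "\<dots> = (\<integral>x. (\<Sum>l<n. c l k * e l x) * g x \<partial>half_line)"
      unfolding kernel_operator_inner[OF fL g E, symmetric] c_def
      by (rule L2_inner_cong_AE[OF L2[OF E] sum_in g expand[OF E]])
    also have "\<dots> = (\<Sum>l<n. c k l * (\<integral>x. e l x * g x \<partial>half_line))"
      using E g by (subst L2_inner_sum_left) (auto simp: sym[of k])
    finally show ?thesis .
  qed
  let ?p = "\<lambda>z. \<Sum>k<n. \<Sum>l<n. c k l * (case z of (x, y) \<Rightarrow> e k x * e l y)"
  have pL: "?p \<in> square_integrable half_line2"
    by (intro square_integrable_sum square_integrable_scale tensor_square_integrable E)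
  have "L2_norm_measure half_line2 (\<lambda>z. f z - ?p z) = 0"
  proof (rule tensor_orthogonal_imp_null)
    show "(\<lambda>z. f z - ?p z) \<in> square_integrable half_line2" using fL pL by (rule square_integrable_diff)
    fix u v assume u: "u \<in> square_integrable half_line" and v: "v \<in> square_integrable half_line"
    let ?uv = "\<lambda>z. case z of (x, y) \<Rightarrow> u x * v y"
    note uv = tensor_square_integrable[OF u v]
    have "?f u v = (\<integral>x. (\<Sum>k<n. ?f (e k) v * e k x) * u x \<partial>half_line)"
      unfolding kernel_operator_inner[OF fL u v, symmetric]
      by (rule L2_inner_cong_AE[OF L2[OF v] sum_in u expand[OF v]])
    also have "\<dots> = (\<Sum>k<n. ?f (e k) v * (\<integral>x. e k x * u x \<partial>half_line))"
      using E u by (subst L2_inner_sum_left) auto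
    also have "\<dots> = (\<Sum>k<n. \<Sum>l<n. c k l * ((\<integral>x. e k x * u x \<partial>half_line) * (\<integral>x. e l x * v x \<partial>half_line)))"
      unfolding form[OF v] by (simp add: sum_distrib_left mult_ac)
    also have "\<dots> = (\<Sum>k<n. \<Sum>l<n. c k l * (\<integral>z. (case z of (x, y) \<Rightarrow> e k x * e l y) * ?uv z \<partial>half_line2))"
      using E u v by (simp add: tensor_inner)
    also have "\<dots> = (\<integral>z. ?p z * ?uv z \<partial>half_line2)"
    proof -
      have "(\<integral>z. (\<Sum>i\<in>{..<n} \<times> {..<n}. case_prod c i * (case z of (x, y) \<Rightarrow> e (fst i) x * e (snd i) y)) * ?uv z \<partial>half_line2) =
        (\<Sum>i\<in>{..<n} \<times> {..<n}. case_prod c i * (\<integral>z. (case z of (x, y) \<Rightarrow> e (fst i) x * e (snd i) y) * ?uv z \<partial>half_line2))"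
        by (intro L2_inner_sum_left tensor_square_integrable E uv)
      then show ?thesis by (simp add: sum.cartesian_product case_prod_beta')
    qed
    finally show "(\<integral>z. (f z - ?p z) * ?uv z \<partial>half_line2) = 0"
      using square_integrable_mult[OF fL uv] square_integrable_mult[OF pL uv]
      by (simp add: left_diff_distrib)
  qed
  moreover have "nonzero_eigenvalues f = mat_eigenvalues n c"
  proof (intro equalityI subsetI)
    fix l assume "l \<in> nonzero_eigenvalues f"
    then obtain g where l: "l \<noteq> 0" and g: "g \<in> square_integrable half_line"
      "\<not> (AE x in half_line. g x = 0)" "AE x in half_line. kernel_operator f g x = l * g x"
      unfolding nonzero_eigenvalues_def by blast
    define u where "u k = (\<integral>x. e k x * g x \<partial>half_line)" for k
    have eig: "(\<Sum>j<n. c i j * u j) = l * u i" if "i < n" for i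
    proof -
      have "(\<Sum>j<n. c i j * u j) = (\<integral>x. kernel_operator f g x * e i x \<partial>half_line)"
        unfolding kernel_operator_inner[OF fL E g(1)] form[OF g(1)] u_def ..
      also have "\<dots> = (\<integral>x. (l * g x) * e i x \<partial>half_line)"
        using g by (intro L2_inner_cong_AE L2 E square_integrable_scale)
      finally show ?thesis by (simp add: u_def mult.assoc mult.commute[of "e i _"])
    qed
    have "\<exists>i<n. u i \<noteq> 0"
    proof (rule ccontr)
      assume "\<not> (\<exists>i<n. u i \<noteq> 0)"
      then have "?f (e k) g = 0" for k unfolding form[OF g(1)] by (simp add: u_def)
      then have "AE x in half_line. kernel_operator f g x = 0" using expand[OF g(1)] by simp
      then have "AE x in half_line. g x = 0" using g(3) by eventually_elim (use l in auto)
      then show False using g(2) by contradiction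
    qed
    then show "l \<in> mat_eigenvalues n c" unfolding mat_eigenvalues_def
      by (intro CollectI conjI l exI[of _ u] allI impI eig)
  next
    fix l assume "l \<in> mat_eigenvalues n c"
    then obtain u i where l: "l \<noteq> 0" and i: "i < n" "u i \<noteq> 0"
      and eig: "\<And>i. i < n \<Longrightarrow> (\<Sum>j<n. c i j * u j) = l * u i"
      unfolding mat_eigenvalues_def by blast
    let ?g = "\<lambda>x. \<Sum>k<n. u k * e k x"
    have coeff: "(\<integral>x. e k x * ?g x \<partial>half_line) = u k" if "k < n" for k
      using orthonormal_coefficient[OF e that, of u] by (simp add: mult.commute)
    have "?f (e k) ?g = l * u k" if "k < n" for k
      unfolding form[OF sum_in] eig[OF that, symmetric] using coeff by (intro sum.cong) auto
    then have "(\<Sum>k<n. ?f (e k) ?g * e k x) = l * ?g x" for x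
      by (simp add: sum_distrib_left mult.assoc)
    then have "AE x in half_line. kernel_operator f ?g x = l * ?g x" using expand[OF sum_in, of u] by simp
    moreover have "\<not> (AE x in half_line. ?g x = 0)"
    proof
      assume "AE x in half_line. ?g x = 0"
      then have "(\<integral>x. ?g x * e i x \<partial>half_line) = (\<integral>x. 0 * e i x \<partial>half_line)"
        by (intro L2_inner_cong_AE sum_in E square_integrable_zero)
      then show False using orthonormal_coefficient[OF e i(1), of u] i(2) by simp
    qed
    ultimately show "l \<in> nonzero_eigenvalues f"
      unfolding nonzero_eigenvalues_def by (intro CollectI conjI l bexI[of _ ?g] sum_in)
  qed
  ultimately have "spectral_form f n e c" unfolding spectral_form_def by (intro conjI e allI sym)
  then show ?thesis by (rule that)
qed

section \<open>Approximation of a finite rank kernel by congruent matrices\<close>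

lemma tensor_norm:
  assumes "h \<in> square_integrable half_line" "k \<in> square_integrable half_line"
  shows "L2_norm_measure half_line2 (\<lambda>z. case z of (x, y) \<Rightarrow> h x * k y) =
    L2_norm_measure half_line h * L2_norm_measure half_line k"
  using tensor_inner[OF assms assms] by (simp add: L2_norm_measure_def power2_eq_square real_sqrt_mult)

lemma L2_product_tendsto_0:
  assumes v: "g \<in> square_integrable \<mu>" "\<And>m. v m \<in> square_integrable \<mu>"
    and lim: "(\<lambda>m. L2_norm_measure \<mu> (\<lambda>x. f x - u m x)) \<longlonglongrightarrow> 0" "(\<lambda>m. L2_norm_measure \<mu> (\<lambda>x. g x - v m x)) \<longlonglongrightarrow> 0"
  shows "(\<lambda>m. L2_norm_measure \<mu> (\<lambda>x. f x - u m x) * L2_norm_measure \<mu> (v m) +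
      L2_norm_measure \<mu> f * L2_norm_measure \<mu> (\<lambda>x. g x - v m x)) \<longlonglongrightarrow> 0"
  using tendsto_add[OF tendsto_mult[OF lim(1) L2_norm_diff_tendsto[OF v lim(2)]] tendsto_mult_left[OF lim(2), of "L2_norm_measure \<mu> f"]]
  by simp

lemma L2_inner_tendsto:
  assumes f: "f \<in> square_integrable \<mu>" "\<And>m. u m \<in> square_integrable \<mu>"
    and g: "g \<in> square_integrable \<mu>" "\<And>m. v m \<in> square_integrable \<mu>"
    and lim: "(\<lambda>m. L2_norm_measure \<mu> (\<lambda>x. f x - u m x)) \<longlonglongrightarrow> 0" "(\<lambda>m. L2_norm_measure \<mu> (\<lambda>x. g x - v m x)) \<longlonglongrightarrow> 0"
  shows "(\<lambda>m. \<integral>x. u m x * v m x \<partial>\<mu>) \<longlonglongrightarrow> (\<integral>x. f x * g x \<partial>\<mu>)"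
proof -
  have "norm ((\<integral>x. f x * g x \<partial>\<mu>) - (\<integral>x. u m x * v m x \<partial>\<mu>)) \<le>
      L2_norm_measure \<mu> (\<lambda>x. f x - u m x) * L2_norm_measure \<mu> (v m) +
      L2_norm_measure \<mu> f * L2_norm_measure \<mu> (\<lambda>x. g x - v m x)" for m
  proof -
    have "(\<integral>x. f x * g x \<partial>\<mu>) - (\<integral>x. u m x * v m x \<partial>\<mu>) =
        (\<integral>x. (f x - u m x) * v m x \<partial>\<mu>) + (\<integral>x. f x * (g x - v m x) \<partial>\<mu>)"
      using square_integrable_mult[OF f(1) g(1)] square_integrable_mult[OF f(1) g(2)[of m]]
        square_integrable_mult[OF f(2)[of m] g(2)[of m]]
      by (simp add: left_diff_distrib right_diff_distrib)
    moreover have "\<bar>\<integral>x. (f x - u m x) * v m x \<partial>\<mu>\<bar> \<le> L2_norm_measure \<mu> (\<lambda>x. f x - u m x) * L2_norm_measure \<mu> (v m)"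
      by (intro L2_cauchy_schwarz square_integrable_diff f g)
    moreover have "\<bar>\<integral>x. f x * (g x - v m x) \<partial>\<mu>\<bar> \<le> L2_norm_measure \<mu> f * L2_norm_measure \<mu> (\<lambda>x. g x - v m x)"
      by (intro L2_cauchy_schwarz square_integrable_diff f g)
    ultimately show ?thesis by simp
  qed
  then have "(\<lambda>m. (\<integral>x. f x * g x \<partial>\<mu>) - (\<integral>x. u m x * v m x \<partial>\<mu>)) \<longlonglongrightarrow> 0"
    by (intro Lim_null_comparison[OF always_eventually[OF allI] L2_product_tendsto_0[OF g lim]])
  then have "(\<lambda>m. (\<integral>x. f x * g x \<partial>\<mu>) - ((\<integral>x. f x * g x \<partial>\<mu>) - (\<integral>x. u m x * v m x \<partial>\<mu>))) \<longlonglongrightarrow> (\<integral>x. f x * g x \<partial>\<mu>) - 0"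
    by (intro tendsto_diff tendsto_const)
  then show ?thesis by simp
qed

lemma tensor_tendsto:
  fixes f g :: "real \<Rightarrow> real" and u v :: "nat \<Rightarrow> real \<Rightarrow> real"
  assumes f: "f \<in> square_integrable half_line" "\<And>m. u m \<in> square_integrable half_line"
    and g: "g \<in> square_integrable half_line" "\<And>m. v m \<in> square_integrable half_line"
    and lim: "(\<lambda>m. L2_norm_measure half_line (\<lambda>x. f x - u m x)) \<longlonglongrightarrow> 0"
      "(\<lambda>m. L2_norm_measure half_line (\<lambda>x. g x - v m x)) \<longlonglongrightarrow> 0"
  shows "(\<lambda>m. L2_norm_measure half_line2 (\<lambda>z. (case z of (x, y) \<Rightarrow> f x * g y) - (case z of (x, y) \<Rightarrow> u m x * v m y))) \<longlonglongrightarrow> 0"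
proof -
  have "norm (L2_norm_measure half_line2 (\<lambda>z. (case z of (x, y) \<Rightarrow> f x * g y) - (case z of (x, y) \<Rightarrow> u m x * v m y))) \<le>
      L2_norm_measure half_line (\<lambda>x. f x - u m x) * L2_norm_measure half_line (v m) +
      L2_norm_measure half_line f * L2_norm_measure half_line (\<lambda>x. g x - v m x)" for m
  proof -
    have eq: "(\<lambda>z. (case z of (x, y) \<Rightarrow> f x * g y) - (case z of (x, y) \<Rightarrow> u m x * v m y)) =
        (\<lambda>z. (case z of (x, y) \<Rightarrow> (f x - u m x) * v m y) + (case z of (x, y) \<Rightarrow> f x * (g y - v m y)))"
      by (auto simp: algebra_simps)
    have "L2_norm_measure half_line2 (\<lambda>z. (case z of (x, y) \<Rightarrow> (f x - u m x) * v m y) + (case z of (x, y) \<Rightarrow> f x * (g y - v m y))) \<le>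
        L2_norm_measure half_line2 (\<lambda>z. case z of (x, y) \<Rightarrow> (f x - u m x) * v m y) +
        L2_norm_measure half_line2 (\<lambda>z. case z of (x, y) \<Rightarrow> f x * (g y - v m y))"
      by (intro L2_norm_triangle tensor_square_integrable square_integrable_diff f g)
    also have "\<dots> = L2_norm_measure half_line (\<lambda>x. f x - u m x) * L2_norm_measure half_line (v m) +
        L2_norm_measure half_line f * L2_norm_measure half_line (\<lambda>x. g x - v m x)"
      by (intro arg_cong2[where f = "(+)"] tensor_norm square_integrable_diff f g)
    finally show ?thesis unfolding eq by (simp add: L2_norm_measure_sq)
  qed
  then show ?thesis
    by (intro Lim_null_comparison[OF always_eventually[OF allI] L2_product_tendsto_0[OF g lim]])
qed

lemma common_step_approx:
  fixes e :: "nat \<Rightarrow> real \<Rightarrow> real" and n :: nat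
  assumes "\<And>k. e k \<in> square_integrable half_line"
  obtains ts d where "\<And>m. increments (ts m)"
    "\<And>k. k < n \<Longrightarrow> (\<lambda>m. L2_norm_measure half_line (\<lambda>x. e k x - step_fun (ts m) (d m k) x)) \<longlonglongrightarrow> 0"
proof -
  have "\<exists>p. increments (fst p) \<and> (\<forall>k<n. L2_norm_measure half_line (\<lambda>x. e k x - step_fun (fst p) (snd p k) x) < \<epsilon>)"
    if "\<epsilon> > 0" for \<epsilon> :: real
  proof -
    have "\<exists>T\<^sub>0. finite T\<^sub>0 \<and> T\<^sub>0 \<subseteq> {0..} \<and>
       (\<forall>T. finite T \<longrightarrow> T \<subseteq> {0..} \<longrightarrow> T\<^sub>0 \<subseteq> T \<longrightarrow>
         (\<exists>g\<in>range (step_fun (sorted_list_of_set T)). L2_norm_measure half_line (\<lambda>x. e k x - g x) < \<epsilon>))" for k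
      using step_fun_dense[OF assms[of k]] that unfolding refinable_def by (elim allE) (erule impE)
    from choice[OF allI[OF this]] obtain T\<^sub>0 where T: "\<forall>k. finite (T\<^sub>0 k) \<and> T\<^sub>0 k \<subseteq> {0..} \<and>
       (\<forall>T. finite T \<longrightarrow> T \<subseteq> {0..} \<longrightarrow> T\<^sub>0 k \<subseteq> T \<longrightarrow>
         (\<exists>g\<in>range (step_fun (sorted_list_of_set T)). L2_norm_measure half_line (\<lambda>x. e k x - g x) < \<epsilon>))" ..
    \<comment> \<open>The union of the partitions is fine enough for all functions
      \<open>e k\<close> with \<open>k < n\<close> at once.\<close>
    define T' where "T' = (\<Union>k<n. T\<^sub>0 k)"
    have T': "finite T'" "T' \<subseteq> {0..}" "\<And>k. k < n \<Longrightarrow> T\<^sub>0 k \<subseteq> T'" using T by (auto simp: T'_def)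
    have "\<exists>c. k < n \<longrightarrow> L2_norm_measure half_line (\<lambda>x. e k x - step_fun (sorted_list_of_set T') c x) < \<epsilon>" for k
    proof (cases "k < n")
      case True
      then have "\<exists>g\<in>range (step_fun (sorted_list_of_set T')). L2_norm_measure half_line (\<lambda>x. e k x - g x) < \<epsilon>"
        using T T' by (elim allE[of _ k]) (elim conjE allE[of _ T'], simp)
      then show ?thesis by (elim bexE imageE) (hypsubst, intro exI impI)
    qed simp
    from choice[OF allI[OF this]] obtain c where
      "\<forall>k. k < n \<longrightarrow> L2_norm_measure half_line (\<lambda>x. e k x - step_fun (sorted_list_of_set T') (c k) x) < \<epsilon>" ..
    then show ?thesis using increments_sorted_list[OF T'(1,2)] by (intro exI[of _ "(sorted_list_of_set T', c)"]) simp
  qed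
  then have "\<forall>m. \<exists>p. increments (fst p) \<and>
      (\<forall>k<n. L2_norm_measure half_line (\<lambda>x. e k x - step_fun (fst p) (snd p k) x) < 1 / real (Suc m))"
    by (intro allI) simp
  from choice[OF this] obtain p where p: "\<And>m. increments (fst (p m))"
    "\<And>m k. k < n \<Longrightarrow> L2_norm_measure half_line (\<lambda>x. e k x - step_fun (fst (p m)) (snd (p m) k) x) < 1 / real (Suc m)"
    by blast
  have "(\<lambda>m. L2_norm_measure half_line (\<lambda>x. e k x - step_fun (fst (p m)) (snd (p m) k) x)) \<longlonglongrightarrow> 0" if "k < n" for k
  proof (rule Lim_null_comparison[OF _ LIMSEQ_Suc[OF lim_1_over_n]])
    show "\<forall>\<^sub>F m in sequentially. norm (L2_norm_measure half_line (\<lambda>x. e k x - step_fun (fst (p m)) (snd (p m) k) x))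
        \<le> 1 / real (Suc m)"
      using p(2)[OF that] by (intro always_eventually allI) (simp add: L2_norm_measure_sq less_imp_le)
  qed
  with p(1) show ?thesis by (intro that[of "\<lambda>m. fst (p m)" "\<lambda>m. snd (p m)"])
qed

lemma step_fun_inner:
  assumes ts: "increments ts"
  shows "(\<integral>x. step_fun ts c x * step_fun ts d x \<partial>half_line) = (\<Sum>i<length ts - 1. c i * d i)"
proof -
  have "(\<integral>x. step_fun ts c x * step_fun ts d x \<partial>half_line) =
     (\<Sum>i<length ts - 1. \<Sum>j<length ts - 1. c i * d j * (\<integral>x. incr_fun ts i x * incr_fun ts j x \<partial>half_line))"
    unfolding step_fun_def by (intro L2_inner_sum incr_fun_square_integrable ts) auto
  also have "\<dots> = (\<Sum>i<length ts - 1. \<Sum>j<length ts - 1. if j = i then c i * d j else 0)"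
    by (intro sum.cong refl) (simp add: incr_fun_orthonormal[OF ts])
  also have "\<dots> = (\<Sum>i<length ts - 1. c i * d i)"
    by (intro sum.cong refl) (simp add: sum.delta)
  finally show ?thesis .
qed

text \<open>Replacing the orthonormal functions by step functions turns \<open>c\<close> into the
  congruent matrix in the coordinates of the partition.\<close>

lemma step_kernel_tensor:
  "(\<Sum>k<n. \<Sum>l<n. c k l * (case z of (x, y) \<Rightarrow> step_fun ts (d k) x * step_fun ts (d l) y)) =
    step_kernel ts (mat_mult n (\<lambda>i k. d k i) (mat_mult n c d)) z"
proof -
  obtain x y where z: "z = (x, y)" by (cases z)
  let ?N = "length ts - 1"
  have "(\<Sum>k<n. \<Sum>l<n. c k l * (step_fun ts (d k) x * step_fun ts (d l) y)) =
      (\<Sum>k<n. \<Sum>l<n. \<Sum>i<?N. \<Sum>j<?N. d k i * (c k l * d l j) * (incr_fun ts i x * incr_fun ts j y))"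
    unfolding step_fun_def sum_product by (simp only: sum_distrib_left mult_ac)
  also have "\<dots> = (\<Sum>k<n. \<Sum>i<?N. \<Sum>l<n. \<Sum>j<?N. d k i * (c k l * d l j) * (incr_fun ts i x * incr_fun ts j y))"
    by (intro sum.cong refl sum.swap)
  also have "\<dots> = (\<Sum>i<?N. \<Sum>k<n. \<Sum>l<n. \<Sum>j<?N. d k i * (c k l * d l j) * (incr_fun ts i x * incr_fun ts j y))"
    by (rule sum.swap)
  also have "\<dots> = (\<Sum>i<?N. \<Sum>k<n. \<Sum>j<?N. \<Sum>l<n. d k i * (c k l * d l j) * (incr_fun ts i x * incr_fun ts j y))"
    by (intro sum.cong refl sum.swap)
  also have "\<dots> = (\<Sum>i<?N. \<Sum>j<?N. \<Sum>k<n. \<Sum>l<n. d k i * (c k l * d l j) * (incr_fun ts i x * incr_fun ts j y))"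
    by (intro sum.cong refl sum.swap)
  also have "\<dots> = step_kernel ts (mat_mult n (\<lambda>i k. d k i) (mat_mult n c d)) z"
    by (simp add: step_kernel_def mat_mult_def z sum_distrib_left sum_distrib_right)
  finally show ?thesis by (simp add: z)
qed

lemma spectral_formD:
  assumes sp: "spectral_form f n e c"
  shows "orthonormal half_line n e" "c k l = c l k"
    "L2_norm_measure half_line2 (\<lambda>z. f z - (\<Sum>k<n. \<Sum>l<n. c k l * (case z of (x, y) \<Rightarrow> e k x * e l y))) = 0"
    "nonzero_eigenvalues f = mat_eigenvalues n c"
proof -
  note S = sp[unfolded spectral_form_def]
  show "orthonormal half_line n e" by (rule conjunct1[OF S])
  show "c k l = c l k" by (rule conjunct1[OF conjunct2[OF S], rule_format])
  show "L2_norm_measure half_line2 (\<lambda>z. f z - (\<Sum>k<n. \<Sum>l<n. c k l * (case z of (x, y) \<Rightarrow> e k x * e l y))) = 0"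
    by (rule conjunct1[OF conjunct2[OF conjunct2[OF S]]])
  show "nonzero_eigenvalues f = mat_eigenvalues n c" by (rule conjunct2[OF conjunct2[OF conjunct2[OF S]]])
qed

text \<open>All \<open>e k\<close> are approximated on one common partition, so that the
  approximating kernels are congruent to the fixed matrix \<open>c\<close>. Orthonormality survives
  as convergence of the Gram matrices to the identity.\<close>

lemma spectral_form_step_approx:
  assumes f: "f \<in> symmetric_kernels" and sp: "spectral_form f n e c"
  obtains ts d where "step_approx f ts (\<lambda>m. mat_mult n (\<lambda>i k. d m k i) (mat_mult n c (d m)))"
    "\<And>k l. k < n \<Longrightarrow> l < n \<Longrightarrow>
      (\<lambda>m. mat_mult (length (ts m) - 1) (d m) (\<lambda>i k. d m k i) k l) \<longlonglongrightarrow> (if k = l then 1 else 0)"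
proof -
  note e = spectral_formD(1)[OF sp] and sym = spectral_formD(2)[OF sp] and null = spectral_formD(3)[OF sp]
  note E = orthonormalD(1)[OF e]
  obtain ts d where ts: "\<And>m. increments (ts m)"
    and lim: "\<And>k. k < n \<Longrightarrow> (\<lambda>m. L2_norm_measure half_line (\<lambda>x. e k x - step_fun (ts m) (d m k) x)) \<longlonglongrightarrow> 0"
    by (rule common_step_approx[of e n, OF E], rule that)
  note sf = step_fun_square_integrable[OF ts]
  have gram: "(\<lambda>m. mat_mult (length (ts m) - 1) (d m) (\<lambda>i k. d m k i) k l) \<longlonglongrightarrow> (if k = l then 1 else 0)"
    if "k < n" "l < n" for k l
    using L2_inner_tendsto[OF E sf E sf lim[OF that(1)] lim[OF that(2)]]
    by (simp add: mat_mult_def step_fun_inner[OF ts] orthonormalD(2)[OF e that])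
  let ?a = "\<lambda>m. mat_mult n (\<lambda>i k. d m k i) (mat_mult n c (d m))"
  let ?e = "\<lambda>k l z. case z of (x, y) \<Rightarrow> e k x * e l y"
  let ?s = "\<lambda>m k l z. case z of (x, y) \<Rightarrow> step_fun (ts m) (d m k) x * step_fun (ts m) (d m l) y"
  let ?D = "\<lambda>m k l. L2_norm_measure half_line2 (\<lambda>z. ?e k l z - ?s m k l z)"
  note eL = tensor_square_integrable[OF E E] and sL = tensor_square_integrable[OF sf sf]
  note fL = symmetric_kernelsD[OF f]
  have a_sym: "?a m i j = ?a m j i" for m i j
  proof -
    have "?a m i j = (\<Sum>k<n. \<Sum>l<n. d m k i * (c k l * d m l j))" by (simp add: mat_mult_def sum_distrib_left)
    also have "\<dots> = (\<Sum>l<n. \<Sum>k<n. d m l j * (c l k * d m k i))"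
      by (subst sum.swap) (simp add: sym mult_ac)
    finally show ?thesis by (simp add: mat_mult_def sum_distrib_left)
  qed
  have "norm (L2_norm_measure half_line2 (\<lambda>z. f z - step_kernel (ts m) (?a m) z)) \<le> (\<Sum>k<n. \<Sum>l<n. \<bar>c k l\<bar> * ?D m k l)" for m
  proof -
    let ?p = "\<lambda>z. \<Sum>k<n. \<Sum>l<n. c k l * ?e k l z"
    let ?q = "\<lambda>z. \<Sum>k<n. \<Sum>l<n. c k l * (?e k l z - ?s m k l z)"
    have eq: "(\<lambda>z. f z - step_kernel (ts m) (?a m) z) = (\<lambda>z. (f z - ?p z) + ?q z)"
      unfolding step_kernel_tensor[symmetric] by (simp only: right_diff_distrib sum_subtractf) simp
    have inn: "(\<lambda>z. ?e k l z - ?s m k l z) \<in> square_integrable half_line2" for k l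
      using eL sL by (rule square_integrable_diff)
    have pL: "?p \<in> square_integrable half_line2" by (intro square_integrable_sum square_integrable_scale eL)
    have qL: "?q \<in> square_integrable half_line2" by (intro square_integrable_sum square_integrable_scale inn)
    have "L2_norm_measure half_line2 (\<lambda>z. (f z - ?p z) + ?q z) \<le>
        L2_norm_measure half_line2 (\<lambda>z. f z - ?p z) + L2_norm_measure half_line2 ?q"
      by (intro L2_norm_triangle square_integrable_diff fL pL qL)
    also have "\<dots> = L2_norm_measure half_line2 ?q" using null by simp
    also have "\<dots> \<le> (\<Sum>k<n. L2_norm_measure half_line2 (\<lambda>z. \<Sum>l<n. c k l * (?e k l z - ?s m k l z)))"
      by (intro L2_norm_sum square_integrable_sum square_integrable_scale inn)
    also have "\<dots> \<le> (\<Sum>k<n. \<Sum>l<n. L2_norm_measure half_line2 (\<lambda>z. c k l * (?e k l z - ?s m k l z)))"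
      by (intro sum_mono L2_norm_sum square_integrable_scale inn)
    also have "\<dots> = (\<Sum>k<n. \<Sum>l<n. \<bar>c k l\<bar> * ?D m k l)"
      unfolding L2_norm_scale ..
    finally show ?thesis unfolding eq by (simp add: L2_norm_measure_sq)
  qed
  moreover have "(\<lambda>m. \<Sum>k<n. \<Sum>l<n. \<bar>c k l\<bar> * ?D m k l) \<longlonglongrightarrow> 0"
  proof -
    have "(\<lambda>m. \<Sum>k<n. \<Sum>l<n. \<bar>c k l\<bar> * ?D m k l) \<longlonglongrightarrow> (\<Sum>k<n. \<Sum>l<n. \<bar>c k l\<bar> * 0)"
      by (intro tendsto_sum tendsto_mult tendsto_const tensor_tendsto E sf lim) auto
    then show ?thesis by (simp only: mult_zero_right sum.neutral_const)
  qed
  ultimately have "(\<lambda>m. L2_norm_measure half_line2 (\<lambda>z. f z - step_kernel (ts m) (?a m) z)) \<longlonglongrightarrow> 0"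
    by (rule Lim_null_comparison[OF always_eventually[OF allI]])
  then have "step_approx f ts ?a" unfolding step_approx_def by (intro conjI allI ts a_sym)
  then show ?thesis by (rule that[OF _ gram])
qed

context wigner_setting
begin

text \<open>By cyclicity, the traces along this approximation are those of powers of
  \<open>c\<close> times a Gram matrix, of fixed size \<open>n\<close>; the Gram matrix tends to the
  identity.\<close>

lemma \<tau>_spectral:
  assumes f: "f \<in> symmetric_kernels" and sp: "spectral_form f n e c" and r: "r \<ge> 2"
  shows "\<tau> f r = trace_moment n c r"
proof -
  obtain ts d where ap: "step_approx f ts (\<lambda>m. mat_mult n (\<lambda>i k. d m k i) (mat_mult n c (d m)))"
    and gram: "\<And>k l. k < n \<Longrightarrow> l < n \<Longrightarrow>
      (\<lambda>m. mat_mult (length (ts m) - 1) (d m) (\<lambda>i k. d m k i) k l) \<longlonglongrightarrow> (if k = l then 1 else 0)"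
    by (rule spectral_form_step_approx[OF f sp], rule that)
  have "(\<lambda>m. trace_moment n (mat_mult n c (mat_mult (length (ts m) - 1) (d m) (\<lambda>i k. d m k i))) r) \<longlonglongrightarrow> trace_moment n c r"
    by (rule trace_moment_tendsto[OF gram])
  moreover have "(\<lambda>m. trace_moment n (mat_mult n c (mat_mult (length (ts m) - 1) (d m) (\<lambda>i k. d m k i))) r) \<longlonglongrightarrow> \<tau> f r"
    using \<tau>_tendsto[OF f ap r] r by (subst (asm) trace_moment_congruence) auto
  ultimately show ?thesis by (rule LIMSEQ_unique[THEN sym])
qed

lemma finite_nonzero_eigenvalues:
  assumes "f \<in> symmetric_kernels" "kernel_rank f < \<infinity>"
  shows "finite (nonzero_eigenvalues f)"
  by (rule finite_rank_spectral_form[OF assms]) (simp add: spectral_formD(4) finite_mat_eigenvalues)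

text \<open>One factor x of the monomial completes the product over the eigenvalues to an
  annihilating polynomial. The bound \<open>r \<ge> 2\<close> keeps to orders at which
  \<open>\<tau>\<close> is a trace.\<close>

lemma \<tau>_recurrence:
  assumes f: "f \<in> symmetric_kernels" and rank: "kernel_rank f < \<infinity>" and r: "r \<ge> 2"
  shows "poly_sum (\<tau> f) (monom 1 r * q * (\<Prod>l\<in>nonzero_eigenvalues f. [:- l, 1:])) = 0"
proof -
  obtain n e c where sp: "spectral_form f n e c" by (rule finite_rank_spectral_form[OF f rank])
  note sym = spectral_formD(2)[OF sp] and ev = spectral_formD(4)[OF sp]
  let ?p = "\<Prod>l\<in>mat_eigenvalues n c. [:- l, 1:]"
  have split: "monom 1 r * q * ?p = (monom 1 (r - 1) * q) * ([:0, 1:] * ?p)"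
  proof -
    have "monom 1 r = (monom 1 (r - 1) * [:0, 1:] :: real poly)"
      using r by (cases r) (simp_all add: monom_Suc)
    then show ?thesis by (simp only: mult_ac)
  qed
  have "poly_sum (\<tau> f) (monom 1 r * q * ?p) = poly_sum (trace_moment n c) (monom 1 r * q * ?p)"
    unfolding poly_sum_def
  proof (intro sum.cong refl)
    fix k
    show "coeff (monom 1 r * q * ?p) k * \<tau> f k = coeff (monom 1 r * q * ?p) k * trace_moment n c k"
      using r \<tau>_spectral[OF f sp, of k] by (cases "k \<ge> 2") (auto simp: coeff_monom_mult mult.assoc)
  qed
  also have "\<dots> = mat_trace n (mat_poly n c (monom 1 r * q * ?p))" by (rule poly_sum_trace)
  also have "mat_trace n (mat_poly n c (monom 1 r * q * ?p)) = 0"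
    unfolding mat_trace_def split
  proof (rule sum.neutral, rule ballI)
    fix i assume "i \<in> {..<n}"
    then have i: "i < n" by simp
    show "mat_poly n c (monom 1 (r - 1) * q * ([:0, 1:] * ?p)) i i = 0"
      unfolding mat_poly_mult[OF i i] mat_mult_def
      by (rule sum.neutral, rule ballI) (subst mat_poly_eigenvalues[OF sym _ i], auto)
  qed
  finally show ?thesis unfolding ev .
qed

end

section \<open>The convergence criterion\<close>

text \<open>Dividing by \<open>b a\<close> determines the next term from the \<open>a\<close>
  preceding ones, dividing by \<open>b 0\<close> the previous term from the \<open>a\<close>
  following ones. The second direction can be followed down to \<open>R\<close>, from which on the
  recurrence is assumed.\<close>

lemma recurrence_tendsto_0:
  fixes d :: "nat \<Rightarrow> nat \<Rightarrow> real"
  assumes b: "b 0 \<noteq> 0" "b a \<noteq> 0"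
    and rec: "\<And>r. r \<ge> R \<Longrightarrow> (\<lambda>n. \<Sum>i\<le>a. b i * d n (r + i)) \<longlonglongrightarrow> 0"
    and r0: "r\<^sub>0 \<ge> R" and start: "\<And>r. r \<in> {r\<^sub>0..<r\<^sub>0 + a} \<Longrightarrow> (\<lambda>n. d n r) \<longlonglongrightarrow> 0"
    and r: "r \<ge> R"
  shows "(\<lambda>n. d n r) \<longlonglongrightarrow> 0"
proof -
  have up: "(\<lambda>n. d n r) \<longlonglongrightarrow> 0" if "r \<ge> r\<^sub>0" for r
    using that
  proof (induction r rule: less_induct)
    case (less r)
    show ?case
    proof (cases "r < r\<^sub>0 + a")
      case True
      then show ?thesis using start less.prems by simp
    next
      case False
      let ?q = "r - a"
      have q: "?q \<ge> r\<^sub>0" "r = ?q + a" using False by auto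
      have "(\<lambda>n. ((\<Sum>i\<le>a. b i * d n (?q + i)) - (\<Sum>i<a. b i * d n (?q + i))) / b a) \<longlonglongrightarrow> (0 - (\<Sum>i<a. b i * 0)) / b a"
        using less.IH q r0 b by (intro tendsto_intros rec) auto
      moreover have "((\<Sum>i\<le>a. b i * d n (?q + i)) - (\<Sum>i<a. b i * d n (?q + i))) / b a = d n r" for n
        using b q(2) by (simp add: lessThan_Suc_atMost[symmetric])
      ultimately show ?thesis by simp
    qed
  qed
  show ?thesis
    using r
  proof (induction "r\<^sub>0 - r" arbitrary: r rule: less_induct)
    case less
    show ?case
    proof (cases "r \<ge> r\<^sub>0")
      case True
      then show ?thesis by (rule up)
    next
      case False
      have "(\<lambda>n. d n (r + i)) \<longlonglongrightarrow> 0" if "i \<in> {1..a}" for i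
        using less.hyps[of "r + i"] less.prems False that by auto
      then have "(\<lambda>n. ((\<Sum>i\<le>a. b i * d n (r + i)) - (\<Sum>i\<in>{1..a}. b i * d n (r + i))) / b 0) \<longlonglongrightarrow> (0 - (\<Sum>i\<in>{1..a}. b i * 0)) / b 0"
        using less.prems b by (intro tendsto_intros rec) auto
      moreover have "((\<Sum>i\<le>a. b i * d n (r + i)) - (\<Sum>i\<in>{1..a}. b i * d n (r + i))) / b 0 = d n r" for n
        using b by (simp add: atLeast0AtMost[symmetric] sum.atLeast_Suc_atMost)
      ultimately show ?thesis by simp
    qed
  qed
qed

lemma poly_sum_monom_mult: "poly_sum \<tau> (monom 1 r * p) = (\<Sum>i\<le>degree p. coeff p i * \<tau> (r + i))"
proof (induction r arbitrary: \<tau>)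
  case 0
  then show ?case by (simp add: poly_sum_def)
next
  case (Suc r)
  then show ?case by (simp add: monom_Suc poly_sum_pCons)
qed

lemma monom_mult_pCons: "r \<ge> 1 \<Longrightarrow> monom 1 r * p = pCons 0 (monom 1 (r - 1) * (p :: real poly))"
  by (cases r) (simp_all add: monom_Suc)

lemma linear_factors:
  fixes E :: "real set"
  assumes "finite E"
  shows "degree (\<Prod>l\<in>E. [:- l, 1:]) = card E" "coeff (\<Prod>l\<in>E. [:- l, 1:]) (card E) = 1"
    "0 \<notin> E \<Longrightarrow> coeff (\<Prod>l\<in>E. [:- l, 1:]) 0 \<noteq> 0"
proof -
  show d: "degree (\<Prod>l\<in>E. [:- l, 1:]) = card E"
    by (subst degree_prod_eq_sum_degree) auto
  show "coeff (\<Prod>l\<in>E. [:- l, 1:]) (card E) = 1"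
    using lead_coeff_prod[of "\<lambda>l. [:- l, 1:]" E] by (simp add: d)
  show "coeff (\<Prod>l\<in>E. [:- l, 1:]) 0 \<noteq> 0" if "0 \<notin> E"
    using assms that by (simp add: poly_0_coeff_0[symmetric] poly_prod)
qed

lemma taylor_coeff: "poly ((pderiv ^^ r) Q) 0 / fact r = coeff (Q :: real poly) r"
proof -
  have "coeff ((pderiv ^^ r) Q) k * fact k = fact (k + r) * coeff Q (k + r)" for k
  proof (induction r arbitrary: k)
    case (Suc r)
    have "coeff ((pderiv ^^ Suc r) Q) k * fact k = coeff ((pderiv ^^ r) Q) (Suc k) * fact (Suc k)"
      by (simp add: coeff_pderiv)
    then show ?case using Suc[of "Suc k"] by simp
  qed simp
  from this[of 0] show ?thesis by (simp add: poly_0_coeff_0)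
qed

section \<open>The criterion for traces and for cumulants\<close>

context wigner_setting
begin

lemma \<tau>_square_nonneg:
  assumes f: "f \<in> symmetric_kernels"
  shows "0 \<le> poly_sum (\<tau> f) ((pCons 0 p)\<^sup>2)"
proof -
  obtain ts a where ap: "step_approx f ts a" by (rule ex_step_approx[OF f])
  have "(\<lambda>m. poly_sum (trace_moment (length (ts m) - 1) (a m)) (pCons 0 (pCons 0 (p * p)))) \<longlonglongrightarrow>
      poly_sum (\<tau> f) (pCons 0 (pCons 0 (p * p)))"
    by (intro poly_sum_tendsto \<tau>_tendsto f ap)
  moreover have sq: "pCons 0 (pCons 0 (p * p)) = (pCons 0 p)\<^sup>2" by (simp add: power2_eq_square)
  moreover have "0 \<le> poly_sum (trace_moment (length (ts m) - 1) (a m)) ((pCons 0 p)\<^sup>2)" for m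
    by (subst trace_square) (auto intro: step_approxD(2)[OF ap] frobenius_nonneg)
  ultimately show ?thesis by (intro LIMSEQ_le_const) auto
qed

text \<open>Cauchy-Schwarz pairs x ^ s with the given polynomial. The companion factor, the moment
  of order \<open>2 * s\<close>, is at most the \<open>s\<close>th power of the moment of order 2,
  which converges.\<close>

lemma \<tau>_square_tendsto_0:
  assumes g: "\<And>n. g n \<in> symmetric_kernels" and lim: "(\<lambda>n. \<tau> (g n) 2) \<longlonglongrightarrow> v"
    and sq: "(\<lambda>n. poly_sum (\<tau> (g n)) ((pCons 0 p)\<^sup>2)) \<longlonglongrightarrow> 0" and s: "s \<ge> 1"
  shows "(\<lambda>n. poly_sum (\<tau> (g n)) (monom 1 s * pCons 0 p)) \<longlonglongrightarrow> 0"
proof -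
  have "norm ((poly_sum (\<tau> (g n)) (monom 1 s * pCons 0 p))\<^sup>2) \<le> \<tau> (g n) 2 ^ s * poly_sum (\<tau> (g n)) ((pCons 0 p)\<^sup>2)" for n
  proof -
    have m: "monom 1 s = pCons 0 (monom 1 (s - 1) :: real poly)" using monom_mult_pCons[OF s, of 1] by simp
    have "(monom 1 s)\<^sup>2 = (monom 1 (2 * s) :: real poly)" by (simp add: monom_power mult.commute)
    then have "(poly_sum (\<tau> (g n)) (monom 1 s * pCons 0 p))\<^sup>2 \<le> \<tau> (g n) (2 * s) * poly_sum (\<tau> (g n)) ((pCons 0 p)\<^sup>2)"
      using \<tau>_cauchy_schwarz[OF g[of n], of "monom 1 (s - 1)" p] by (simp only: m[symmetric] poly_sum_monom)
    also have "\<dots> \<le> \<tau> (g n) 2 ^ s * poly_sum (\<tau> (g n)) ((pCons 0 p)\<^sup>2)"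
      by (intro mult_right_mono \<tau>_even_bound \<tau>_square_nonneg g s)
    finally show ?thesis by simp
  qed
  moreover have "(\<lambda>n. \<tau> (g n) 2 ^ s * poly_sum (\<tau> (g n)) ((pCons 0 p)\<^sup>2)) \<longlonglongrightarrow> 0"
    using tendsto_mult[OF tendsto_power[OF lim, of s] sq] by simp
  ultimately have "(\<lambda>n. (poly_sum (\<tau> (g n)) (monom 1 s * pCons 0 p))\<^sup>2) \<longlonglongrightarrow> 0"
    by (rule Lim_null_comparison[OF always_eventually[OF allI]])
  then show ?thesis by simp
qed

lemma \<tau>_criterion:
  assumes f: "f \<in> symmetric_kernels" and rank: "kernel_rank f < \<infinity>"
    and g: "\<And>n. g n \<in> symmetric_kernels"
  defines "Q \<equiv> limit_polynomial \<mu>\<^sub>0 f"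
  assumes a: "(\<lambda>n. \<tau> (g n) 2) \<longlonglongrightarrow> \<tau> f 2 + \<mu>\<^sub>0\<^sup>2"
    and b: "(\<lambda>n. \<Sum>r=3..degree Q. coeff Q r * \<tau> (g n) r) \<longlonglongrightarrow> (\<Sum>r=3..degree Q. coeff Q r * \<tau> f r)"
    and r0: "r\<^sub>0 \<ge> 2 * (1 + of_bool (\<mu>\<^sub>0 \<noteq> 0))"
    and c: "\<And>r. r \<in> {r\<^sub>0..<r\<^sub>0 + card (nonzero_eigenvalues f)} \<Longrightarrow> (\<lambda>n. \<tau> (g n) r) \<longlonglongrightarrow> \<tau> f r"
    and r: "r \<ge> 3"
  shows "(\<lambda>n. \<tau> (g n) r) \<longlonglongrightarrow> \<tau> f r"
proof -
  define m :: nat where "m = 1 + of_bool (\<mu>\<^sub>0 \<noteq> 0)"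
  have m: "1 \<le> m" "m \<le> 2" by (auto simp: m_def)
  let ?E = "nonzero_eigenvalues f"
  let ?p = "\<Prod>l\<in>?E. [:- l, 1:]"
  let ?p' = "monom 1 (m - 1) * ?p"
  have E: "finite ?E" "0 \<notin> ?E"
    using finite_nonzero_eigenvalues[OF f rank] by (auto simp: nonzero_eigenvalues_def)
  have p': "monom 1 m * ?p = pCons 0 ?p'" by (rule monom_mult_pCons[OF m(1)])
  have Q: "Q = monom 1 (2 * m) * ?p\<^sup>2"
    by (simp only: Q_def limit_polynomial_def m_def[symmetric] monom_altdef smult_1_left prod_power_distrib)
  then have Q2: "Q = (pCons 0 ?p')\<^sup>2"
    unfolding p'[symmetric] by (simp only: power_mult_distrib monom_power power_one mult.commute[of m])
  have Qm: "Q = monom 1 (2 * m) * ?p * ?p" unfolding Q by (simp only: power2_eq_square mult.assoc)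
  have Qf: "poly_sum (\<tau> f) Q = 0"
    unfolding Qm by (rule \<tau>_recurrence[OF f rank]) (use m in simp)
  have Qc: "coeff Q k = 0" if "k < 2 * m" for k
    using that unfolding Qm mult.assoc by (simp add: coeff_monom_mult)
  have "degree Q \<ge> 2"
  proof -
    have "pCons 0 ?p' \<noteq> 0" unfolding p'[symmetric] using E by (auto simp: monom_eq_0_iff)
    then show ?thesis unfolding Q2 power2_eq_square by (simp add: degree_mult_eq degree_pCons_eq_if split: if_splits)
  qed
  then have Qsum: "poly_sum \<tau> Q = coeff Q 2 * \<tau> 2 + (\<Sum>r=3..degree Q. coeff Q r * \<tau> r)" for \<tau>
  proof -
    have "poly_sum \<tau> Q = (\<Sum>r=2..degree Q. coeff Q r * \<tau> r)"
      unfolding poly_sum_def using Qc m by (intro sum.mono_neutral_right) (auto simp: not_le)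
    then show ?thesis using \<open>degree Q \<ge> 2\<close> by (simp add: sum.atLeast_Suc_atMost eval_nat_numeral)
  qed
  \<comment> \<open>The sums of hypothesis \<open>b\<close> begin at 3. For nonzero
    \<open>\<mu>\<^sub>0\<close> the coefficient of order 2 is 0, so the surplus
    \<open>\<mu>\<^sub>0\<^sup>2\<close> in the limit of the second moments does no harm.\<close>
  have "(\<lambda>n. coeff Q 2 * \<tau> (g n) 2) \<longlonglongrightarrow> coeff Q 2 * \<tau> f 2"
  proof (cases "\<mu>\<^sub>0 = 0")
    case True
    then show ?thesis using a by (intro tendsto_mult_left) simp
  next
    case False
    then show ?thesis using Qc[of 2] by (simp add: m_def)
  qed
  from tendsto_add[OF this b] have "(\<lambda>n. poly_sum (\<tau> (g n)) Q) \<longlonglongrightarrow> poly_sum (\<tau> f) Q"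
    by (simp only: Qsum)
  then have sq: "(\<lambda>n. poly_sum (\<tau> (g n)) ((pCons 0 ?p')\<^sup>2)) \<longlonglongrightarrow> 0"
    by (simp only: Qf Q2[symmetric])
  \<comment> \<open>The polynomial with vanishing square carries x ^ m, so x ^ k times the product
    over the eigenvalues leaves x ^ (k - m) for Cauchy-Schwarz; the bound on \<open>k\<close> makes
    this exponent at least 1.\<close>
  have rec: "(\<lambda>n. \<Sum>i\<le>card ?E. coeff ?p i * (\<tau> (g n) (k + i) - \<tau> f (k + i))) \<longlonglongrightarrow> 0" if "k \<ge> m + 1" for k
  proof -
    have "(\<lambda>n. poly_sum (\<tau> (g n)) (monom 1 (k - m) * pCons 0 ?p')) \<longlonglongrightarrow> 0"
      by (rule \<tau>_square_tendsto_0[OF g a sq]) (use that in simp)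
    also have "monom 1 (k - m) * pCons 0 ?p' = monom 1 k * ?p"
      unfolding p'[symmetric] using that by (simp add: mult_monom flip: mult.assoc)
    finally have "(\<lambda>n. poly_sum (\<tau> (g n)) (monom 1 k * ?p)) \<longlonglongrightarrow> 0" .
    moreover have "poly_sum (\<tau> f) (monom 1 k * ?p) = 0"
      using \<tau>_recurrence[OF f rank, of k 1] that m by simp
    ultimately show ?thesis
      unfolding poly_sum_monom_mult linear_factors(1)[OF E(1)]
      by (simp add: right_diff_distrib sum_subtractf)
  qed
  \<comment> \<open>The recurrence starts at \<open>m + 1\<close>, which is at most
    \<open>2 * m\<close>, hence at most \<open>r\<^sub>0\<close>, and at most 3. Both the given
    indices and all orders still wanted are therefore in its range.\<close>
  have "(\<lambda>n. \<tau> (g n) r - \<tau> f r) \<longlonglongrightarrow> 0"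
  proof (rule recurrence_tendsto_0[where b = "coeff ?p" and a = "card ?E" and R = "m + 1" and r\<^sub>0 = r\<^sub>0])
    show "coeff ?p 0 \<noteq> 0" "coeff ?p (card ?E) \<noteq> 0" using linear_factors[OF E(1)] E(2) by auto
    show "m + 1 \<le> r\<^sub>0" using r0 m unfolding m_def[symmetric] by linarith
    show "m + 1 \<le> r" using r m by linarith
    show "(\<lambda>n. \<tau> (g n) k - \<tau> f k) \<longlonglongrightarrow> 0" if "k \<in> {r\<^sub>0..<r\<^sub>0 + card ?E}" for k
      using c[OF that] by (rule LIM_zero)
  qed (rule rec)
  then show ?thesis by (rule LIM_zero_cancel)
qed

text \<open>Moments and cumulants are polynomials in each other, so convergence of one sequence is
  that of the other. The first cumulants are 0, and \<open>A\<close> is felt at order 2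
  only.\<close>

lemma law_convergence_iff:
  assumes f: "f \<in> symmetric_kernels" and g: "\<And>n. g n \<in> symmetric_kernels"
  shows "(\<forall>k. (\<lambda>n. \<phi> (I\<^sub>2 (g n) ^ k)) \<longlonglongrightarrow> \<psi> (Z 1 f ^ k)) \<longleftrightarrow>
    (\<lambda>n. \<tau> (g n) 2) \<longlonglongrightarrow> \<tau> f 2 + \<mu>\<^sub>0\<^sup>2 \<and> (\<forall>r\<ge>3. (\<lambda>n. \<tau> (g n) r) \<longlonglongrightarrow> \<tau> f r)"
    (is "?L \<longleftrightarrow> ?R")
proof -
  have cum: "free_cumulant \<phi> r (I\<^sub>2 (g n)) = complex_of_real (if r = 1 then 0 else \<tau> (g n) r)" if "r \<ge> 1" for n r
    using free_cumulant_Z[OF g[of n] that, of 0] by (simp add: free_cumulant_I2[OF g])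
  have "?L \<longleftrightarrow> (\<forall>r\<ge>1. (\<lambda>n. free_cumulant \<phi> r (I\<^sub>2 (g n))) \<longlonglongrightarrow> free_cumulant \<psi> r (Z 1 f))"
    unfolding free_cumulant_def
  proof (intro iffI allI impI)
    fix r assume ?L
    then show "(\<lambda>n. free_cumulant_of_moments (\<lambda>k. \<phi> (I\<^sub>2 (g n) ^ k)) r) \<longlonglongrightarrow> free_cumulant_of_moments (\<lambda>k. \<psi> (Z 1 f ^ k)) r"
      by (intro free_cumulants_tendsto) (erule allE)
  next
    fix k
    assume *: "\<forall>r\<ge>1. (\<lambda>n. free_cumulant_of_moments (\<lambda>k. \<phi> (I\<^sub>2 (g n) ^ k)) r) \<longlonglongrightarrow> free_cumulant_of_moments (\<lambda>k. \<psi> (Z 1 f ^ k)) r"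
    show "(\<lambda>n. \<phi> (I\<^sub>2 (g n) ^ k)) \<longlonglongrightarrow> \<psi> (Z 1 f ^ k)"
    proof (cases "k = 0")
      case False
      then show ?thesis
        using moments_tendsto_of_cumulants[of "\<lambda>n k. \<phi> (I\<^sub>2 (g n) ^ k)" "\<lambda>k. \<psi> (Z 1 f ^ k)" k, OF *[rule_format]]
        by simp
    qed simp
  qed
  also have "\<dots> \<longleftrightarrow> (\<forall>r\<ge>1. (\<lambda>n. if r = 1 then 0 else \<tau> (g n) r) \<longlonglongrightarrow> (if r = 1 then 0 else \<tau> f r + (if r = 2 then \<mu>\<^sub>0\<^sup>2 else 0)))"
    by (intro all_cong) (simp only: cum free_cumulant_Z[OF f] tendsto_of_real_iff power_one mult_1_left)
  also have "\<dots> \<longleftrightarrow> ?R"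
  proof (intro iffI conjI allI impI)
    assume *: "\<forall>r\<ge>1. (\<lambda>n. if r = 1 then 0 else \<tau> (g n) r) \<longlonglongrightarrow> (if r = 1 then 0 else \<tau> f r + (if r = 2 then \<mu>\<^sub>0\<^sup>2 else 0))"
    show "(\<lambda>n. \<tau> (g n) 2) \<longlonglongrightarrow> \<tau> f 2 + \<mu>\<^sub>0\<^sup>2" using *[rule_format, of 2] by simp
    show "(\<lambda>n. \<tau> (g n) r) \<longlonglongrightarrow> \<tau> f r" if "r \<ge> 3" for r using *[rule_format, of r] that by simp
  next
    fix r :: nat assume R: ?R and "r \<ge> 1"
    then consider "r = 1" | "r = 2" | "r \<ge> 3" by linarith
    then show "(\<lambda>n. if r = 1 then 0 else \<tau> (g n) r) \<longlonglongrightarrow> (if r = 1 then 0 else \<tau> f r + (if r = 2 then \<mu>\<^sub>0\<^sup>2 else 0))"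
      by cases (use R in auto)
  qed
  finally show ?thesis .
qed

lemma cumulant_criterion:
  assumes f: "f \<in> symmetric_kernels" and rank: "kernel_rank f < \<infinity>" and g: "\<And>n. g n \<in> symmetric_kernels"
  defines "Q \<equiv> limit_polynomial \<mu>\<^sub>0 f"
  shows "(\<forall>k. (\<lambda>n. \<phi> (I\<^sub>2 (g n) ^ k)) \<longlonglongrightarrow> \<psi> (Z 1 f ^ k)) \<longleftrightarrow>
    (\<lambda>n. free_cumulant \<phi> 2 (I\<^sub>2 (g n))) \<longlonglongrightarrow> free_cumulant \<psi> 2 (Z 1 f) \<and>
    (\<lambda>n. \<Sum>r=3..degree Q. complex_of_real (coeff Q r) * free_cumulant \<phi> r (I\<^sub>2 (g n)))
      \<longlonglongrightarrow> (\<Sum>r=3..degree Q. complex_of_real (coeff Q r) * free_cumulant \<phi> r (I\<^sub>2 f)) \<and>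
    (\<exists>r\<^sub>0\<ge>2 * (1 + of_bool (\<mu>\<^sub>0 \<noteq> 0)). \<forall>r\<in>{r\<^sub>0..<r\<^sub>0 + card (nonzero_eigenvalues f)}.
      (\<lambda>n. free_cumulant \<phi> r (I\<^sub>2 (g n))) \<longlonglongrightarrow> free_cumulant \<phi> r (I\<^sub>2 f))"
proof -
  have cum: "free_cumulant \<phi> r (I\<^sub>2 h) = complex_of_real (\<tau> h r)" if "r \<ge> 2" "h \<in> symmetric_kernels" for r h
    using free_cumulant_Z[OF that(2), of r 0] that by (simp add: free_cumulant_I2)
  have c2: "free_cumulant \<psi> 2 (Z 1 f) = complex_of_real (\<tau> f 2 + \<mu>\<^sub>0\<^sup>2)"
    using free_cumulant_Z[OF f, of 2 1] by simp
  have sum: "(\<Sum>r=3..degree Q. complex_of_real (coeff Q r) * free_cumulant \<phi> r (I\<^sub>2 h)) =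
      complex_of_real (\<Sum>r=3..degree Q. coeff Q r * \<tau> h r)" if "h \<in> symmetric_kernels" for h
    using cum that by (simp add: of_real_sum)
  have A: "(\<lambda>n. free_cumulant \<phi> 2 (I\<^sub>2 (g n))) \<longlonglongrightarrow> free_cumulant \<psi> 2 (Z 1 f) \<longleftrightarrow>
      (\<lambda>n. \<tau> (g n) 2) \<longlonglongrightarrow> \<tau> f 2 + \<mu>\<^sub>0\<^sup>2"
    by (simp only: c2 cum[OF order_refl g] tendsto_of_real_iff)
  have B: "(\<lambda>n. \<Sum>r=3..degree Q. complex_of_real (coeff Q r) * free_cumulant \<phi> r (I\<^sub>2 (g n)))
      \<longlonglongrightarrow> (\<Sum>r=3..degree Q. complex_of_real (coeff Q r) * free_cumulant \<phi> r (I\<^sub>2 f)) \<longleftrightarrow>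
      (\<lambda>n. \<Sum>r=3..degree Q. coeff Q r * \<tau> (g n) r) \<longlonglongrightarrow> (\<Sum>r=3..degree Q. coeff Q r * \<tau> f r)"
    by (simp only: sum[OF g] sum[OF f] tendsto_of_real_iff)
  have C: "(\<lambda>n. free_cumulant \<phi> r (I\<^sub>2 (g n))) \<longlonglongrightarrow> free_cumulant \<phi> r (I\<^sub>2 f) \<longleftrightarrow> (\<lambda>n. \<tau> (g n) r) \<longlonglongrightarrow> \<tau> f r"
    if "r \<ge> 2" for r
    by (simp only: cum[OF that g] cum[OF that f] tendsto_of_real_iff)
  show ?thesis (is "_ \<longleftrightarrow> _ \<and> _ \<and> ?C")
    unfolding A B law_convergence_iff[OF f g]
  proof (intro iffI conjI allI impI; (elim conjE)?)
    assume *: "\<forall>r\<ge>3. (\<lambda>n. \<tau> (g n) r) \<longlonglongrightarrow> \<tau> f r"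
    show "(\<lambda>n. \<Sum>r=3..degree Q. coeff Q r * \<tau> (g n) r) \<longlonglongrightarrow> (\<Sum>r=3..degree Q. coeff Q r * \<tau> f r)"
      by (intro tendsto_sum tendsto_mult tendsto_const *[rule_format]) simp
    \<comment> \<open>The index 4 is admissible for either value of \<open>\<mu>\<^sub>0\<close>,
      and all orders from there on converge.\<close>
    show ?C
      by (intro exI[of _ 4] conjI ballI) (use * C in auto)
  next
    fix r :: nat
    assume a: "(\<lambda>n. \<tau> (g n) 2) \<longlonglongrightarrow> \<tau> f 2 + \<mu>\<^sub>0\<^sup>2"
      and b: "(\<lambda>n. \<Sum>r=3..degree Q. coeff Q r * \<tau> (g n) r) \<longlonglongrightarrow> (\<Sum>r=3..degree Q. coeff Q r * \<tau> f r)"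
      and "?C" and r: "r \<ge> 3"
    then obtain r\<^sub>0 where r0: "r\<^sub>0 \<ge> 2 * (1 + of_bool (\<mu>\<^sub>0 \<noteq> 0))"
      and c: "\<And>r. r \<in> {r\<^sub>0..<r\<^sub>0 + card (nonzero_eigenvalues f)} \<Longrightarrow>
        (\<lambda>n. free_cumulant \<phi> r (I\<^sub>2 (g n))) \<longlonglongrightarrow> free_cumulant \<phi> r (I\<^sub>2 f)" by blast
    show "(\<lambda>n. \<tau> (g n) r) \<longlonglongrightarrow> \<tau> f r"
    proof (rule \<tau>_criterion[OF f rank g a b[unfolded Q_def] r0 _ r])
      fix k assume k: "k \<in> {r\<^sub>0..<r\<^sub>0 + card (nonzero_eigenvalues f)}"
      then have "k \<ge> 2" using r0 by simp
      then show "(\<lambda>n. \<tau> (g n) k) \<longlonglongrightarrow> \<tau> f k" using c[OF k] by (simp only: C)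
    qed
  qed assumption
qed

end

theorem theorem4p3:
  fixes M :: "'h::chilbert_space bop set" and \<phi> :: "'h bop \<Rightarrow> complex"
    and N :: "'k::chilbert_space bop set" and \<psi> :: "'k bop \<Rightarrow> complex"
    and \<iota> :: "'h bop \<Rightarrow> 'k bop"
    and S :: "real \<Rightarrow> 'h bop" and I\<^sub>2 :: "(real \<times> real \<Rightarrow> real) \<Rightarrow> 'h bop"
    and f :: "real \<times> real \<Rightarrow> real" and \<mu>\<^sub>0 :: real and A :: "'k bop"
    and F :: "nat \<Rightarrow> 'h bop" and fs :: "nat \<Rightarrow> real \<times> real \<Rightarrow> real"
    and Q :: "real poly"
  assumes "tracial_W_probability_space M \<phi>"
    and "free_Brownian_motion M \<phi> S"
    and "double_wigner_integral M \<phi> S I\<^sub>2"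
    and "f \<in> symmetric_kernels" and "kernel_rank f < \<infinity>"
    and "enlargement M \<phi> N \<psi> \<iota>"
    and "semicircular N \<psi> (\<mu>\<^sub>0\<^sup>2) A"
    and "freely_independent \<psi> UNIV (\<lambda>b. if b then {A} else \<iota> ` S ` {0..})"
    and "\<bar>\<mu>\<^sub>0\<bar> + L2_norm_measure (half_line \<Otimes>\<^sub>M half_line) f > 0"
    and "Q = limit_polynomial \<mu>\<^sub>0 f"
    and "\<And>n. n \<ge> 1 \<Longrightarrow> fs n \<in> symmetric_kernels"
    and "\<And>n. n \<ge> 1 \<Longrightarrow> F n = I\<^sub>2 (fs n)"
  shows "(converges_in_law \<phi> F \<psi> (A + \<iota> (I\<^sub>2 f)) \<longleftrightarrow>
      (\<lambda>n. free_cumulant \<phi> 2 (F n)) \<longlonglongrightarrow> free_cumulant \<psi> 2 (A + \<iota> (I\<^sub>2 f)) \<and>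
      (\<lambda>n. \<Sum>r=3..degree Q.
             complex_of_real (poly ((pderiv ^^ r) Q) 0 / fact r) * free_cumulant \<phi> r (F n))
        \<longlonglongrightarrow> (\<Sum>r=3..degree Q.
             complex_of_real (poly ((pderiv ^^ r) Q) 0 / fact r) * free_cumulant \<phi> r (I\<^sub>2 f)) \<and>
      (\<exists>r\<^sub>0 \<ge> 2 * (1 + of_bool (\<mu>\<^sub>0 \<noteq> 0)). \<forall>r\<in>{r\<^sub>0..<r\<^sub>0 + card (nonzero_eigenvalues f)}.
        (\<lambda>n. free_cumulant \<phi> r (F n)) \<longlonglongrightarrow> free_cumulant \<phi> r (I\<^sub>2 f))) \<and>
    free_cumulant \<psi> 2 (A + \<iota> (I\<^sub>2 f)) =
      complex_of_real (\<mu>\<^sub>0\<^sup>2 + (L2_norm_measure (half_line \<Otimes>\<^sub>M half_line) f)\<^sup>2)"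
proof -
  have I2: "continuous_linear_L2 M \<phi> (half_line \<Otimes>\<^sub>M half_line) symmetric_kernels I\<^sub>2"
    using assms(3) unfolding double_wigner_integral_def by (rule conjunct1)
  obtain W where W: "wigner_integral M \<phi> S W"
    "\<forall>h\<in>square_integrable half_line. I\<^sub>2 (\<lambda>(x, y). h x * h y) = (W h)\<^sup>2 - (\<integral>t. (h t)\<^sup>2 \<partial>half_line) *\<^sub>R 1"
    using assms(3) unfolding double_wigner_integral_def by (elim conjE exE)
  interpret wigner_setting M \<phi> N \<psi> \<iota> S W I\<^sub>2 \<mu>\<^sub>0 A
  proof unfold_locales
    show "tracial_W_probability_space M \<phi>" by fact
    show "tracial_W_probability_space N \<psi>" using assms(6) unfolding enlargement_def by (rule conjunct1)
    show "I\<^sub>2 (\<lambda>(x, y). h x * h y) = (W h)\<^sup>2 - (\<integral>t. (h t)\<^sup>2 \<partial>half_line) *\<^sub>R 1"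
      if "h \<in> square_integrable half_line" for h using W(2) that by (rule bspec)
  qed (fact assms I2 W)+
  have Z: "A + \<iota> (I\<^sub>2 f) = Z 1 f" by (simp add: Z_def)
  \<comment> \<open>\<open>F\<close> and \<open>fs\<close> are constrained only from index 1 on,
    whereas the criterion takes kernels for all natural indices; shifting by one leaves limits
    unchanged.\<close>
  have seq: "(\<lambda>n. h (F n)) \<longlonglongrightarrow> l \<longleftrightarrow> (\<lambda>n. h (I\<^sub>2 (fs (Suc n)))) \<longlonglongrightarrow> l" for h :: "'h bop \<Rightarrow> complex" and l
    using filterlim_sequentially_Suc[of "\<lambda>n. h (F n)" "nhds l"] assms(12) by simp
  have fs: "fs (Suc n) \<in> symmetric_kernels" for n using assms(11) by simp
  have law: "converges_in_law \<phi> F \<psi> (Z 1 f) \<longleftrightarrow> (\<forall>k. (\<lambda>n. \<phi> (I\<^sub>2 (fs (Suc n)) ^ k)) \<longlonglongrightarrow> \<psi> (Z 1 f ^ k))"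
    unfolding converges_in_law_def by (intro all_cong1 seq)
  have cum: "(\<lambda>n. free_cumulant \<phi> r (F n)) \<longlonglongrightarrow> l \<longleftrightarrow> (\<lambda>n. free_cumulant \<phi> r (I\<^sub>2 (fs (Suc n)))) \<longlonglongrightarrow> l" for r l
    by (rule seq)
  have sum: "(\<lambda>n. \<Sum>r=3..degree Q. complex_of_real (coeff Q r) * free_cumulant \<phi> r (F n)) \<longlonglongrightarrow> l \<longleftrightarrow>
      (\<lambda>n. \<Sum>r=3..degree Q. complex_of_real (coeff Q r) * free_cumulant \<phi> r (I\<^sub>2 (fs (Suc n)))) \<longlonglongrightarrow> l" for l
    by (rule seq)
  have "free_cumulant \<psi> 2 (Z 1 f) = complex_of_real (\<mu>\<^sub>0\<^sup>2 + (L2_norm_measure half_line2 f)\<^sup>2)"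
    using free_cumulant_Z[OF assms(4), of 2 1] by (simp add: \<tau>_2[OF assms(4)])
  with cumulant_criterion[where g = "\<lambda>n. fs (Suc n)", OF assms(4,5) fs] show ?thesis
    unfolding Z taylor_coeff law cum sum unfolding assms(10) by (rule conjI)
qed

end
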